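(* Let $\alpha\in(0,1)$ and $\tau>0$, and let $\varphi$ be the semiflow in $C([-\tau,0];\mathbb R)$ (with the supremum norm) generated by the Suarez–Schopf equation $$\dot x(t)=x(t)-\alpha x(t-\tau)-x^3(t).$$ Let $R>0$ be such that the global attractor $\mathcal A$ of $\varphi$ is contained in the ball of radius $R$ centered at $0$, and put $\Lambda_R=\frac32R^2$. Let $$\widetilde A\phi=(1-\Lambda_R)\phi(0)-\alpha\phi(-\tau)\ \ (\phi\in C([-\tau,0];\mathbb R)),\qquad \widetilde B=-1,\qquad \tau_0=0,$$ and let $A$ and $W(p)$ be the operators associated with these data in the context. Let $\lambda_1(A),\lambda_2(A),\dots$ be the eigenvalues of $A$ (the roots $p\in\mathbb C$ of $1-\Lambda_R-\alpha e^{-\tau p}-p=0$), arranged by nonincreasing real parts and according to their multiplicities. Suppose that there exists $\nu_0\ge0$ such that $$\operatorname{Re}\lambda_1(A)+\operatorname{Re}\lambda_2(A)<-\nu_0\qquad\text{and}\qquad \sup_{\omega\in\mathbb R}\|W(-\nu_0+i\omega)\|_{\mathcal L((\mathbb U^\wedge_2)^{\mathbb C};(\mathbb M^\wedge_2)^{\mathbb C})}<\Lambda_R^{-1}.$$ Then $\varphi$ is globally stable, i.e. every trajectory of $\varphi$ converges to one of the three equilibria $\phi^0\equiv0$, $\phi^+\equiv\sqrt{1-\alpha}$, $\phi^-\equiv-\sqrt{1-\alpha}$.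
   Context: The semiflow is $\varphi^t(\phi_0)=x_t$, $t\ge0$, where $x\colon[-\tau,\infty)\to\mathbb R$ is the classical solution with $x(\theta)=\phi_0(\theta)$ for $\theta\in[-\tau,0]$, and $x_t(\theta)=x(t+\theta)$, $\theta\in[-\tau,0]$. It is known that this semiflow is well defined and dissipative and has a global attractor. Operators associated with data $(\widetilde A,\widetilde B,\tau_0)$, where $\widetilde A\colon C([-\tau,0];\mathbb R)\to\mathbb R$ is bounded linear, $\widetilde B\in\mathbb R$, $\tau_0\in[0,\tau]$ (all spaces complexified). Let $\mu$ be Lebesgue measure on $[-\tau,0]$ plus the unit point mass at $0$, and $\mathbb H=L_2([-\tau,0];\mu;\mathbb C)$. $\mathcal D(A)$ consists of $\phi\in\mathbb H$ such that $\phi|_{(-\tau,0)}$ is the class of some $\psi\in W^{1,2}(-\tau,0;\mathbb C)\subset C([-\tau,0];\mathbb C)$ and $\phi(0)=\psi(0)$; then $(A\phi)(0)=\widetilde A\psi$ and $(A\phi)|_{(-\tau,0)}=\psi'$. $A$ generates an eventually compact $C_0$-semigroup $G$ in $\mathbb H$. Let $\mathcal L^\wedge_2$ be the space of $\Phi\in L_2([-\tau,0]^2;\mu\otimes\mu;\mathbb C)$ with $\Phi(\theta_1,\theta_2)=-\Phi(\theta_2,\theta_1)$, identified with $\mathbb H\wedge\mathbb H$ by $(\phi_1\wedge\phi_2)(\theta_1,\theta_2)=\frac12[\phi_1(\theta_1)\phi_2(\theta_2)-\phi_2(\theta_1)\phi_1(\theta_2)]$. $G^{\wedge2}$ is the $C_0$-semigroup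 in $\mathcal L^\wedge_2$ with $G^{\wedge2}(t)(\phi_1\wedge\phi_2)=G(t)\phi_1\wedge G(t)\phi_2$, and $A^{[\wedge2]}$ is its generator. An element $\Phi\in\mathcal L^\wedge_2$ satisfies $\Phi(0,0)=0$ and is determined by $R_{12}\Phi=\Phi|_{(-\tau,0)^2}$, $R_1\Phi(\theta)=\Phi(\theta,0)$ and $R_2\Phi(\theta)=\Phi(0,\theta)=-R_1\Phi(\theta)$, $\theta\in(-\tau,0)$. Let $$(\mathbb U^\wedge_2)^{\mathbb C}=(\mathbb M^\wedge_2)^{\mathbb C}=\{(\eta^1,\eta^2)\in L_2(-\tau,0;\mathbb C)^2:\ \eta^1=-\eta^2\}$$ with the norm of $L_2(-\tau,0;\mathbb C)^2$. Define $B^\wedge_2(\eta^1,\eta^2)=\Phi\in\mathcal L^\wedge_2$ by $R_{12}\Phi=0$, $R_1\Phi=\widetilde B\eta^2$, $R_2\Phi=\widetilde B\eta^1$. For $\Phi\in\mathcal D(A^{[\wedge2]})$ it is known that $\theta_2\mapsto (R_{12}\Phi)(\cdot,\theta_2)$ and $\theta_1\mapsto (R_{12}\Phi)(\theta_1,\cdot)$ have representatives continuous from $[-\tau,0]$ to $L_2(-\tau,0;\mathbb C)$; using them, define $C^\wedge_2\Phi=(M^1,M^2)$ with $M^2(\theta)=(R_{12}\Phi)(\theta,-\tau_0)$ and $M^1(\theta)=(R_{12}\Phi)(-\tau_0,\theta)$. For $p$ outside the spectrum of $A^{[\wedge2]}$, $W(p)=-C^\wedge_2(A^{[\wedge2]}-pI)^{-1}B^\wedge_2$,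 a bounded operator from $(\mathbb U^\wedge_2)^{\mathbb C}$ to $(\mathbb M^\wedge_2)^{\mathbb C}$. (The spectral bound of $A^{[\wedge 2]}$ is $\operatorname{Re}\lambda_1(A)+\operatorname{Re}\lambda_2(A)$.) *)

theory Defs
  imports "HOL-Complex_Analysis.Complex_Analysis"
begin

section \<open>The semiflow of the Suarez--Schopf equation\<close>

text \<open>Elements of \<open>C([-\<tau>,0])\<close> are extensional functions, i.e. they are \<open>undefined\<close> outside
  \<open>[-\<tau>,0]\<close>; the metric of \<^const>\<open>cfunspace\<close> is the supremum metric.\<close>

definition hist_space :: "real \<Rightarrow> (real \<Rightarrow> real) metric" where
  "hist_space \<tau> = cfunspace (top_of_set {-\<tau>..0}) euclidean_metric"

definition const_hist :: "real \<Rightarrow> real \<Rightarrow> real \<Rightarrow> real" where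
  "const_hist \<tau> c = restrict (\<lambda>_. c) {-\<tau>..0}"

text \<open>The derivative at \<open>t = 0\<close> is the one-sided one.\<close>

definition ss_solution :: "real \<Rightarrow> real \<Rightarrow> (real \<Rightarrow> real) \<Rightarrow> (real \<Rightarrow> real) \<Rightarrow> bool" where
  "ss_solution \<alpha> \<tau> \<phi>\<^sub>0 x \<longleftrightarrow>
     continuous_on {-\<tau>..} x \<and> (\<forall>\<theta>\<in>{-\<tau>..0}. x \<theta> = \<phi>\<^sub>0 \<theta>) \<and>
     (\<forall>t\<ge>0. (x has_real_derivative x t - \<alpha> * x (t - \<tau>) - x t ^ 3) (at t within {0..}))"

text \<open>The solution is unique on \<open>[-\<tau>,\<infinity>)\<close>; only its values there are used, for \<open>t \<ge> 0\<close>.\<close>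

definition ss_semiflow :: "real \<Rightarrow> real \<Rightarrow> real \<Rightarrow> (real \<Rightarrow> real) \<Rightarrow> real \<Rightarrow> real" where
  "ss_semiflow \<alpha> \<tau> t \<phi>\<^sub>0 =
     restrict (\<lambda>\<theta>. (SOME x. ss_solution \<alpha> \<tau> \<phi>\<^sub>0 x) (t + \<theta>)) {-\<tau>..0}"

text \<open>The quantifier form of attraction also forces \<open>\<A> \<noteq> {}\<close> when the space is nonempty.\<close>

definition global_attractor :: "'a metric \<Rightarrow> (real \<Rightarrow> 'a \<Rightarrow> 'a) \<Rightarrow> 'a set \<Rightarrow> bool" where
  "global_attractor m S \<A> \<longleftrightarrow>
     compactin (mtopology_of m) \<A> \<and> (\<forall>t\<ge>0. S t ` \<A> = \<A>) \<and>
     (\<forall>B. Metric_space.mbounded (mspace m) (mdist m) B \<longrightarrow>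
        (\<forall>\<epsilon>>0. \<exists>T. \<forall>t\<ge>T. \<forall>b\<in>B. \<exists>a\<in>\<A>. mdist m (S t b) a < \<epsilon>))"

definition ss_globally_stable :: "real \<Rightarrow> real \<Rightarrow> bool" where
  "ss_globally_stable \<alpha> \<tau> \<longleftrightarrow>
     (\<forall>\<phi>\<^sub>0\<in>mspace (hist_space \<tau>).
        \<exists>e\<in>{const_hist \<tau> 0, const_hist \<tau> (sqrt (1 - \<alpha>)), const_hist \<tau> (- sqrt (1 - \<alpha>))}.
          limitin (mtopology_of (hist_space \<tau>)) (\<lambda>t. ss_semiflow \<alpha> \<tau> t \<phi>\<^sub>0) e at_top)"


section \<open>Square-integrable functions and \<open>C\<^sub>0\<close>-semigroups\<close>

text \<open>Elements of \<open>L\<^sub>2\<close> are represented by functions; equality in \<open>L\<^sub>2\<close> is equality almost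
  everywhere, so all operators below are meant up to \<open>AE\<close>-equality.\<close>

definition L2 :: "'a measure \<Rightarrow> ('a \<Rightarrow> complex) set" where
  "L2 M = {f \<in> borel_measurable M. integrable M (\<lambda>x. (cmod (f x))\<^sup>2)}"

definition L2_norm :: "'a measure \<Rightarrow> ('a \<Rightarrow> complex) \<Rightarrow> real" where
  "L2_norm M f = sqrt (\<integral>x. (cmod (f x))\<^sup>2 \<partial>M)"

text \<open>Here \<open>S\<close> is a closed subspace of \<open>L2 M\<close>. Boundedness of \<open>T t\<close> together with linearity makes
  \<open>T t\<close> respect \<open>AE\<close>-equality.\<close>

definition C0_semigroup ::
  "'a measure \<Rightarrow> ('a \<Rightarrow> complex) set \<Rightarrow> (real \<Rightarrow> ('a \<Rightarrow> complex) \<Rightarrow> 'a \<Rightarrow> complex) \<Rightarrow> bool" where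
  "C0_semigroup M S T \<longleftrightarrow>
     (\<forall>t\<ge>0. \<forall>f\<in>S. T t f \<in> S) \<and>
     (\<forall>t\<ge>0. \<forall>f\<in>S. \<forall>g\<in>S. \<forall>a b. AE x in M. T t (\<lambda>y. a * f y + b * g y) x = a * T t f x + b * T t g x) \<and>
     (\<forall>t\<ge>0. \<exists>K. \<forall>f\<in>S. L2_norm M (T t f) \<le> K * L2_norm M f) \<and>
     (\<forall>f\<in>S. AE x in M. T 0 f x = f x) \<and>
     (\<forall>s\<ge>0. \<forall>t\<ge>0. \<forall>f\<in>S. AE x in M. T (s + t) f x = T s (T t f) x) \<and>
     (\<forall>f\<in>S. ((\<lambda>t. L2_norm M (\<lambda>x. T t f x - f x)) \<longlongrightarrow> 0) (at_right 0))"

text \<open>Unbounded operators are given by their graphs: \<open>semigroup_generator M S T f g\<close> says that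
  \<open>f\<close> is in the domain of the generator of \<open>T\<close> and is mapped to \<open>g\<close>.\<close>

definition semigroup_generator ::
  "'a measure \<Rightarrow> ('a \<Rightarrow> complex) set \<Rightarrow> (real \<Rightarrow> ('a \<Rightarrow> complex) \<Rightarrow> 'a \<Rightarrow> complex)
     \<Rightarrow> ('a \<Rightarrow> complex) \<Rightarrow> ('a \<Rightarrow> complex) \<Rightarrow> bool" where
  "semigroup_generator M S T f g \<longleftrightarrow> f \<in> S \<and> g \<in> S \<and>
     ((\<lambda>h. L2_norm M (\<lambda>x. (T h f x - f x) / complex_of_real h - g x)) \<longlongrightarrow> 0) (at_right 0)"

text \<open>\<open>(\<A> - p I)\<^sup>-\<^sup>1 g\<close>, unspecified when \<open>p\<close> is in the spectrum.\<close>

definition resolvent ::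
  "'a measure \<Rightarrow> (('a \<Rightarrow> complex) \<Rightarrow> ('a \<Rightarrow> complex) \<Rightarrow> bool) \<Rightarrow> complex \<Rightarrow> ('a \<Rightarrow> complex) \<Rightarrow> 'a \<Rightarrow> complex" where
  "resolvent M \<A> p g = (SOME f. \<exists>h. \<A> f h \<and> (AE x in M. h x - p * f x = g x))"


section \<open>The delay operator \<open>A\<close>\<close>

text \<open>\<open>\<mu>\<close>: Lebesgue measure on \<open>[-\<tau>,0]\<close> plus a unit point mass at \<open>0\<close>.\<close>

definition hist_measure :: "real \<Rightarrow> real measure" where
  "hist_measure \<tau> = measure_of {-\<tau>..0} (sets (restrict_space borel {-\<tau>..0}))
     (\<lambda>E. emeasure lborel E + indicator E 0)"

lemma space_hist_measure [simp]: "space (hist_measure \<tau>) = {-\<tau>..0}"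
  and sets_hist_measure [simp]: "sets (hist_measure \<tau>) = sets (restrict_space borel {-\<tau>..0})"
proof -
  have sub: "sets (restrict_space borel {-\<tau>..0}) \<subseteq> Pow {-\<tau>..0::real}"
    by (auto simp: sets_restrict_space)
  show "space (hist_measure \<tau>) = {-\<tau>..0}"
    unfolding hist_measure_def using sub by (rule space_measure_of)
  have "sigma_algebra {-\<tau>..0::real} (sets (restrict_space borel {-\<tau>..0}))"
    using sets.sigma_algebra_axioms[of "restrict_space borel {-\<tau>..0::real}"]
    by (simp add: space_restrict_space)
  then show "sets (hist_measure \<tau>) = sets (restrict_space borel {-\<tau>..0})"
    unfolding hist_measure_def using sub
    by (simp add: sigma_algebra.sigma_sets_eq)
qed

lemma emeasure_hist_measure:
  assumes "E \<in> sets (hist_measure \<tau>)"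
  shows "emeasure (hist_measure \<tau>) E = emeasure lborel E + indicator E 0"
proof (rule emeasure_measure_of[OF hist_measure_def])
  have bor: "E \<in> sets lborel" if "E \<in> sets (hist_measure \<tau>)" for E
    using that by (auto simp: sets_restrict_space)
  show "sets (restrict_space borel {-\<tau>..0}) \<subseteq> Pow {-\<tau>..0}"
    by (auto simp: sets_restrict_space)
  show "positive (sets (hist_measure \<tau>)) (\<lambda>E. emeasure lborel E + indicator E 0)"
    by (simp add: positive_def)
  show "countably_additive (sets (hist_measure \<tau>)) (\<lambda>E. emeasure lborel E + indicator E 0)"
  proof (rule countably_additiveI)
    fix F :: "nat \<Rightarrow> real set"
    assume F: "range F \<subseteq> sets (hist_measure \<tau>)" "disjoint_family F"
    have "(\<Sum>i. emeasure lborel (F i)) = emeasure lborel (\<Union>i. F i)"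
      using F bor by (intro suminf_emeasure) auto
    moreover have "(\<Sum>i. indicator (F i) 0 :: ennreal) = indicator (\<Union>i. F i) 0"
      using F(2) by (rule suminf_indicator)
    ultimately show "(\<Sum>i. emeasure lborel (F i) + indicator (F i) 0)
        = emeasure lborel (\<Union>(range F)) + indicator (\<Union>(range F)) 0"
      by (simp flip: suminf_add)
  qed
  show "E \<in> sets (hist_measure \<tau>)" by fact
qed

lemma finite_measure_hist_measure: "finite_measure (hist_measure \<tau>)"
proof (rule finite_measureI)
  have "emeasure lborel {-\<tau>..0::real} < \<infinity>"
    by (rule emeasure_bounded_finite) simp
  then show "emeasure (hist_measure \<tau>) (space (hist_measure \<tau>)) \<noteq> \<infinity>"
    by (subst emeasure_hist_measure) (auto simp: sets_restrict_space split: split_indicator)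
qed

abbreviation leb_open :: "real \<Rightarrow> real measure" where
  "leb_open \<tau> \<equiv> restrict_space lborel {-\<tau><..<0}"

definition test_function :: "real \<Rightarrow> real \<Rightarrow> (real \<Rightarrow> real) \<Rightarrow> bool" where
  "test_function a b \<zeta> \<longleftrightarrow> (\<forall>n x. ((deriv ^^ n) \<zeta>) field_differentiable (at x)) \<and>
     (\<exists>c d. a < c \<and> d < b \<and> (\<forall>x. x \<notin> {c..d} \<longrightarrow> \<zeta> x = 0))"

text \<open>\<open>\<psi>\<close> is the continuous representative of an element of \<open>W\<^sup>1\<^sup>,\<^sup>2(-\<tau>,0)\<close> with weak derivative
  \<open>\<psi>'\<close>.\<close>

definition sobolev_W12 :: "real \<Rightarrow> (real \<Rightarrow> complex) \<Rightarrow> (real \<Rightarrow> complex) \<Rightarrow> bool" where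
  "sobolev_W12 \<tau> \<psi> \<psi>' \<longleftrightarrow>
     continuous_on {-\<tau>..0} \<psi> \<and> \<psi> \<in> L2 (leb_open \<tau>) \<and> \<psi>' \<in> L2 (leb_open \<tau>) \<and>
     (\<forall>\<zeta>. test_function (-\<tau>) 0 \<zeta> \<longrightarrow>
        (\<integral>\<theta>. \<psi> \<theta> * complex_of_real (deriv \<zeta> \<theta>) \<partial>leb_open \<tau>) =
        - (\<integral>\<theta>. \<psi>' \<theta> * complex_of_real (\<zeta> \<theta>) \<partial>leb_open \<tau>))"

definition delay_operator ::
  "real \<Rightarrow> ((real \<Rightarrow> complex) \<Rightarrow> complex) \<Rightarrow> (real \<Rightarrow> complex) \<Rightarrow> (real \<Rightarrow> complex) \<Rightarrow> bool" where
  "delay_operator \<tau> Atil \<phi> \<xi> \<longleftrightarrow> \<phi> \<in> L2 (hist_measure \<tau>) \<and> \<xi> \<in> L2 (hist_measure \<tau>) \<and>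
     (\<exists>\<psi> \<psi>'. sobolev_W12 \<tau> \<psi> \<psi>' \<and>
        (AE \<theta> in leb_open \<tau>. \<phi> \<theta> = \<psi> \<theta>) \<and> \<phi> 0 = \<psi> 0 \<and>
        \<xi> 0 = Atil \<psi> \<and> (AE \<theta> in leb_open \<tau>. \<xi> \<theta> = \<psi>' \<theta>))"

definition generates_semigroup ::
  "real \<Rightarrow> ((real \<Rightarrow> complex) \<Rightarrow> complex) \<Rightarrow> (real \<Rightarrow> (real \<Rightarrow> complex) \<Rightarrow> real \<Rightarrow> complex) \<Rightarrow> bool" where
  "generates_semigroup \<tau> Atil G \<longleftrightarrow>
     C0_semigroup (hist_measure \<tau>) (L2 (hist_measure \<tau>)) G \<and>
     semigroup_generator (hist_measure \<tau>) (L2 (hist_measure \<tau>)) G = delay_operator \<tau> Atil"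


section \<open>The second compound operator and the transfer operator\<close>

abbreviation hist_measure2 :: "real \<Rightarrow> (real \<times> real) measure" where
  "hist_measure2 \<tau> \<equiv> hist_measure \<tau> \<Otimes>\<^sub>M hist_measure \<tau>"

definition L2_wedge :: "real \<Rightarrow> (real \<times> real \<Rightarrow> complex) set" where
  "L2_wedge \<tau> = {\<Phi> \<in> L2 (hist_measure2 \<tau>).
     AE z in hist_measure2 \<tau>. \<Phi> (fst z, snd z) = - \<Phi> (snd z, fst z)}"

definition wedge :: "(real \<Rightarrow> complex) \<Rightarrow> (real \<Rightarrow> complex) \<Rightarrow> real \<times> real \<Rightarrow> complex" where
  "wedge \<phi>\<^sub>1 \<phi>\<^sub>2 = (\<lambda>(\<theta>\<^sub>1, \<theta>\<^sub>2). (\<phi>\<^sub>1 \<theta>\<^sub>1 * \<phi>\<^sub>2 \<theta>\<^sub>2 - \<phi>\<^sub>2 \<theta>\<^sub>1 * \<phi>\<^sub>1 \<theta>\<^sub>2) / 2)"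

definition wedge_semigroup ::
  "real \<Rightarrow> (real \<Rightarrow> (real \<Rightarrow> complex) \<Rightarrow> real \<Rightarrow> complex)
     \<Rightarrow> (real \<Rightarrow> (real \<times> real \<Rightarrow> complex) \<Rightarrow> real \<times> real \<Rightarrow> complex) \<Rightarrow> bool" where
  "wedge_semigroup \<tau> G G2 \<longleftrightarrow> C0_semigroup (hist_measure2 \<tau>) (L2_wedge \<tau>) G2 \<and>
     (\<forall>t\<ge>0. \<forall>\<phi>\<^sub>1\<in>L2 (hist_measure \<tau>). \<forall>\<phi>\<^sub>2\<in>L2 (hist_measure \<tau>).
        AE z in hist_measure2 \<tau>. G2 t (wedge \<phi>\<^sub>1 \<phi>\<^sub>2) z = wedge (G t \<phi>\<^sub>1) (G t \<phi>\<^sub>2) z)"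

text \<open>The control space and the measurement space coincide, with the same norm.\<close>

definition control_space :: "real \<Rightarrow> ((real \<Rightarrow> complex) \<times> (real \<Rightarrow> complex)) set" where
  "control_space \<tau> = {(\<eta>\<^sub>1, \<eta>\<^sub>2). \<eta>\<^sub>1 \<in> L2 (leb_open \<tau>) \<and> \<eta>\<^sub>2 \<in> L2 (leb_open \<tau>) \<and>
     (AE \<theta> in leb_open \<tau>. \<eta>\<^sub>1 \<theta> = - \<eta>\<^sub>2 \<theta>)}"

definition control_norm :: "real \<Rightarrow> (real \<Rightarrow> complex) \<times> (real \<Rightarrow> complex) \<Rightarrow> real" where
  "control_norm \<tau> \<eta> = sqrt ((L2_norm (leb_open \<tau>) (fst \<eta>))\<^sup>2 + (L2_norm (leb_open \<tau>) (snd \<eta>))\<^sup>2)"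

text \<open>The first branch is the trace \<open>R\<^sub>1 \<Phi> (\<theta>) = \<Phi> (\<theta>, 0)\<close>, the second \<open>R\<^sub>2 \<Phi> (\<theta>) = \<Phi> (0, \<theta>)\<close>;
  note the swap of the components of \<open>\<eta>\<close>.\<close>

definition control_op ::
  "real \<Rightarrow> real \<Rightarrow> (real \<Rightarrow> complex) \<times> (real \<Rightarrow> complex) \<Rightarrow> real \<times> real \<Rightarrow> complex" where
  "control_op \<tau> Btil \<eta> = (\<lambda>(\<theta>\<^sub>1, \<theta>\<^sub>2).
     if \<theta>\<^sub>1 \<in> {-\<tau><..<0} \<and> \<theta>\<^sub>2 = 0 then complex_of_real Btil * snd \<eta> \<theta>\<^sub>1
     else if \<theta>\<^sub>1 = 0 \<and> \<theta>\<^sub>2 \<in> {-\<tau><..<0} then complex_of_real Btil * fst \<eta> \<theta>\<^sub>2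
     else 0)"

text \<open>\<open>V\<close> is the representative, continuous from \<open>[-\<tau>,0]\<close> to \<open>L\<^sub>2(-\<tau>,0)\<close>, of the family of slices
  \<open>s \<mapsto> F s\<close> given for almost every \<open>s\<close>.\<close>

definition continuous_slices ::
  "real \<Rightarrow> (real \<Rightarrow> real \<Rightarrow> complex) \<Rightarrow> (real \<Rightarrow> real \<Rightarrow> complex) \<Rightarrow> bool" where
  "continuous_slices \<tau> F V \<longleftrightarrow> (\<forall>s\<in>{-\<tau>..0}. V s \<in> L2 (leb_open \<tau>)) \<and>
     (\<forall>s\<in>{-\<tau>..0}. ((\<lambda>r. L2_norm (leb_open \<tau>) (\<lambda>\<theta>. V r \<theta> - V s \<theta>)) \<longlongrightarrow> 0) (at s within {-\<tau>..0})) \<and>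
     (AE s in leb_open \<tau>. AE \<theta> in leb_open \<tau>. V s \<theta> = F s \<theta>)"

definition slice :: "real \<Rightarrow> (real \<Rightarrow> real \<Rightarrow> complex) \<Rightarrow> real \<Rightarrow> real \<Rightarrow> complex" where
  "slice \<tau> F = (SOME V. continuous_slices \<tau> F V)"

definition measurement_op ::
  "real \<Rightarrow> real \<Rightarrow> (real \<times> real \<Rightarrow> complex) \<Rightarrow> (real \<Rightarrow> complex) \<times> (real \<Rightarrow> complex)" where
  "measurement_op \<tau> \<tau>\<^sub>0 \<Phi> =
     (slice \<tau> (\<lambda>s \<theta>. \<Phi> (s, \<theta>)) (-\<tau>\<^sub>0), slice \<tau> (\<lambda>s \<theta>. \<Phi> (\<theta>, s)) (-\<tau>\<^sub>0))"

text \<open>\<open>W(p)\<close>; \<open>G2\<close> is the semigroup \<open>G\<^sup>\<and>\<^sup>2\<close>.\<close>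

definition transfer_op ::
  "real \<Rightarrow> real \<Rightarrow> real \<Rightarrow> (real \<Rightarrow> (real \<times> real \<Rightarrow> complex) \<Rightarrow> real \<times> real \<Rightarrow> complex)
     \<Rightarrow> complex \<Rightarrow> (real \<Rightarrow> complex) \<times> (real \<Rightarrow> complex) \<Rightarrow> (real \<Rightarrow> complex) \<times> (real \<Rightarrow> complex)" where
  "transfer_op \<tau> Btil \<tau>\<^sub>0 G2 p \<eta> =
     map_prod uminus uminus (measurement_op \<tau> \<tau>\<^sub>0
       (resolvent (hist_measure2 \<tau>) (semigroup_generator (hist_measure2 \<tau>) (L2_wedge \<tau>) G2) p
         (control_op \<tau> Btil \<eta>)))"

text \<open>The operator norm, as an extended real so that no boundedness is presupposed.\<close>

definition control_opnorm ::
  "real \<Rightarrow> ((real \<Rightarrow> complex) \<times> (real \<Rightarrow> complex) \<Rightarrow> (real \<Rightarrow> complex) \<times> (real \<Rightarrow> complex)) \<Rightarrow> ereal" where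
  "control_opnorm \<tau> W =
     (SUP \<eta>\<in>{\<eta> \<in> control_space \<tau>. control_norm \<tau> \<eta> \<le> 1}. ereal (control_norm \<tau> (W \<eta>)))"


section \<open>Data for the Suarez--Schopf equation\<close>

definition ss_functional :: "real \<Rightarrow> real \<Rightarrow> real \<Rightarrow> (real \<Rightarrow> complex) \<Rightarrow> complex" where
  "ss_functional \<alpha> \<tau> \<Lambda> \<psi> = complex_of_real (1 - \<Lambda>) * \<psi> 0 - complex_of_real \<alpha> * \<psi> (-\<tau>)"

definition ss_char :: "real \<Rightarrow> real \<Rightarrow> real \<Rightarrow> complex \<Rightarrow> complex" where
  "ss_char \<alpha> \<tau> \<Lambda> p =
     complex_of_real (1 - \<Lambda>) - complex_of_real \<alpha> * exp (- complex_of_real \<tau> * p) - p"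

text \<open>\<open>ls\<close> lists all roots of \<open>f\<close> by nonincreasing real part, each as often as its multiplicity.
  The indices start at \<open>0\<close>.\<close>

definition root_enumeration :: "(complex \<Rightarrow> complex) \<Rightarrow> (nat \<Rightarrow> complex) \<Rightarrow> bool" where
  "root_enumeration f ls \<longleftrightarrow> (\<forall>n. f (ls n) = 0) \<and>
     (\<forall>p. f p = 0 \<longrightarrow> finite {n. ls n = p} \<and> int (card {n. ls n = p}) = zorder f p) \<and>
     (\<forall>m n. m \<le> n \<longrightarrow> Re (ls n) \<le> Re (ls m))"

end

theory Submission
  imports Defs
begin

text \<open>The spectral condition and the frequency condition together force \<open>\<alpha> \<tau> < 1\<close>, and for
  \<open>\<alpha> \<tau> < 1\<close> an elementary Lyapunov--Krasovskii functional proves convergence.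

  Suppose \<open>\<alpha> \<tau> \<ge> 1\<close>. The spectral condition then excludes real characteristic roots. On the line
  \<open>Re p = -\<nu>\<^sub>0\<close> one evaluates \<open>W\<close> only at \<open>p = -\<nu>\<^sub>0\<close>: with \<open>\<sigma> = -\<nu>\<^sub>0 / 2\<close> and a suitable frequency
  \<open>w\<close>, put \<open>\<phi>\<^sub>1 = e\<^bsup>\<sigma>\<theta>\<^esup> cos (w \<theta>)\<close> and \<open>\<phi>\<^sub>2 = e\<^bsup>\<sigma>\<theta>\<^esup> sin (w \<theta>) / w\<close>
  (read as its limit if \<open>w = 0\<close>). Then \<open>\<phi>\<^sub>1 \<and> \<phi>\<^sub>2\<close> solves the
  resolvent equation with a right-hand side in the range of the control operator, which gives
  \<open>\<parallel>W(-\<nu>\<^sub>0)\<parallel> \<ge> 1 / c\<close> for some \<open>0 < c \<le> \<Lambda>\<close>, a contradiction. That this solution is the resolvent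
  follows by pairing an eigenfunction of the compound operator with exponentials: the pairing yields
  an entire function that vanishes by Liouville's theorem.

  If \<open>\<alpha> \<tau> < 1\<close>, then \<open>x\<^sup>4 / 4 - (1 - \<alpha>) x\<^sup>2 / 2\<close> plus a delayed quadratic term in \<open>x'\<close> decreases along
  solutions, so \<open>x'\<close> is square integrable and \<open>x\<close> approaches the zeros of \<open>(1 - \<alpha>) x - x\<^sup>3\<close>.\<close>

section \<open>Square-integrable functions\<close>

text \<open>The constant \<open>c\<close> comes from the boundary conditions at \<open>0\<close>.
  With \<open>\<beta> = \<alpha> * exp (- \<tau> * \<sigma>)\<close>, the equation
  \<open>\<beta> * sin (\<tau> * w) = w\<close> makes \<open>\<phi>\<^sub>2\<close> satisfy its
  condition, and \<open>\<phi>\<^sub>1\<close> misses its own by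
  \<open>c = \<sigma> - (1 - \<Lambda>) + \<beta> * cos (\<tau> * w)\<close>. Since
  \<open>x * cos x \<le> sin x\<close>, the cosine term is at most
  \<open>1 / \<tau> \<le> \<alpha> < 1\<close>, so \<open>c < \<Lambda>\<close>. If
  \<open>c \<le> 0\<close>, the curve on which the imaginary part of the characteristic function
  vanishes leads to a conjugate pair of roots with real part at least \<open>\<sigma>\<close>,
  against the spectral condition. The obstacle is that the resolvent is an arbitrary choice of
  solution, so an explicit solution says nothing before the shifted compound operator is known to be
  injective. Its domain is accessible only through wedges of elements of the domain of
  \<open>A\<close>, and these are not known to be dense in the graph norm. Eigenfunctions are
  therefore tested along orbits of the semigroup, where density in \<open>L2\<close> is
  enough.\<close>

lemma L2_measurable [measurable_dest]: "f \<in> L2 M \<Longrightarrow> f \<in> borel_measurable M"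
  and L2_integrable_square: "f \<in> L2 M \<Longrightarrow> integrable M (\<lambda>x. (cmod (f x))\<^sup>2)"
  by (auto simp: L2_def)

lemma L2I_bound:
  assumes "g \<in> borel_measurable M" "f \<in> L2 M" "AE x in M. cmod (g x) \<le> cmod (f x)"
  shows "g \<in> L2 M"
proof -
  have "integrable M (\<lambda>x. (cmod (g x))\<^sup>2)"
    by (rule Bochner_Integration.integrable_bound[OF L2_integrable_square[OF assms(2)]])
       (use assms in \<open>auto elim!: eventually_mono intro!: power_mono\<close>)
  then show ?thesis using assms(1) by (simp add: L2_def)
qed

lemma L2_norm_nonneg [simp]: "L2_norm M f \<ge> 0"
  by (simp add: L2_norm_def)

lemma L2_norm_square: "(L2_norm M f)\<^sup>2 = (\<integral>x. (cmod (f x))\<^sup>2 \<partial>M)"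
  by (simp add: L2_norm_def)

lemma L2_lincomb:
  assumes "f \<in> L2 M" "g \<in> L2 M"
  shows "(\<lambda>x. a * f x + b * g x) \<in> L2 M"
proof -
  have m [measurable]: "f \<in> borel_measurable M" "g \<in> borel_measurable M"
    using assms by (auto simp: L2_def)
  have "(cmod (a * u + b * v))\<^sup>2 \<le> 2 * (cmod a)\<^sup>2 * (cmod u)\<^sup>2 + 2 * (cmod b)\<^sup>2 * (cmod v)\<^sup>2" for u v
  proof -
    have "cmod (a * u + b * v) \<le> cmod a * cmod u + cmod b * cmod v"
      by (metis norm_mult norm_triangle_ineq)
    then have "(cmod (a * u + b * v))\<^sup>2 \<le> (cmod a * cmod u + cmod b * cmod v)\<^sup>2"
      by (intro power_mono) auto
    also have "\<dots> \<le> 2 * (cmod a * cmod u)\<^sup>2 + 2 * (cmod b * cmod v)\<^sup>2"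
      by (smt (verit) power2_sum sum_squares_bound)
    finally show ?thesis by (simp add: power_mult_distrib)
  qed
  note le = this
  have "integrable M (\<lambda>x. (cmod (a * f x + b * g x))\<^sup>2)"
  proof (rule Bochner_Integration.integrable_bound)
    show "integrable M (\<lambda>x. 2 * (cmod a)\<^sup>2 * (cmod (f x))\<^sup>2 + 2 * (cmod b)\<^sup>2 * (cmod (g x))\<^sup>2)"
      by (intro Bochner_Integration.integrable_add integrable_mult_right L2_integrable_square assms)
    show "AE x in M. norm ((cmod (a * f x + b * g x))\<^sup>2)
      \<le> norm (2 * (cmod a)\<^sup>2 * (cmod (f x))\<^sup>2 + 2 * (cmod b)\<^sup>2 * (cmod (g x))\<^sup>2)"
      using order_trans[OF le abs_ge_self] by (intro AE_I2) simp
  qed measurable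
  then show ?thesis by (simp add: L2_def)
qed

lemma L2_add: "f \<in> L2 M \<Longrightarrow> g \<in> L2 M \<Longrightarrow> (\<lambda>x. f x + g x) \<in> L2 M"
  using L2_lincomb[of f M g 1 1] by simp

lemma L2_diff: "f \<in> L2 M \<Longrightarrow> g \<in> L2 M \<Longrightarrow> (\<lambda>x. f x - g x) \<in> L2 M"
  using L2_lincomb[of f M g 1 "-1"] by simp

lemma L2_scale: "f \<in> L2 M \<Longrightarrow> (\<lambda>x. a * f x) \<in> L2 M"
  using L2_lincomb[of f M f a 0] by simp

lemma L2_zero: "(\<lambda>x. 0) \<in> L2 M"
  by (simp add: L2_def)

lemma L2_sum:
  assumes "\<And>i. i \<in> I \<Longrightarrow> f i \<in> L2 M"
  shows "(\<lambda>x. \<Sum>i\<in>I. f i x) \<in> L2 M"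
  using assms
proof (induction I rule: infinite_finite_induct)
  case (insert i I)
  then show ?case using L2_add[of "f i" M "\<lambda>x. \<Sum>i\<in>I. f i x"] by simp
qed (auto simp: L2_zero)

lemma L2_norm_cong_AE:
  assumes "f \<in> borel_measurable M" "g \<in> borel_measurable M" "AE x in M. f x = g x"
  shows "L2_norm M f = L2_norm M g"
  unfolding L2_norm_def using assms
  by (intro arg_cong[where f=sqrt] integral_cong_AE) auto

lemma L2_norm_cong: "(\<And>x. x \<in> space M \<Longrightarrow> f x = g x) \<Longrightarrow> L2_norm M f = L2_norm M g"
  unfolding L2_norm_def by (intro arg_cong[where f=sqrt] Bochner_Integration.integral_cong) auto

lemma L2_norm_eq_0:
  assumes "f \<in> L2 M"
  shows "L2_norm M f = 0 \<longleftrightarrow> (AE x in M. f x = 0)"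
  unfolding L2_norm_def
  using integral_nonneg_eq_0_iff_AE[OF L2_integrable_square[OF assms]] by simp

lemma L2_norm_scale: "L2_norm M (\<lambda>x. a * f x) = cmod a * L2_norm M f"
  by (simp add: L2_norm_def norm_mult power_mult_distrib real_sqrt_mult)

lemma L2_norm_uminus: "L2_norm M (\<lambda>x. - f x) = L2_norm M f"
  by (simp add: L2_norm_def)

lemma L2_norm_minus_commute: "L2_norm M (\<lambda>x. f x - g x) = L2_norm M (\<lambda>x. g x - f x)"
  by (simp add: L2_norm_def norm_minus_commute)

lemma L2_mult_integrable:
  assumes "f \<in> L2 M" "g \<in> L2 M"
  shows "integrable M (\<lambda>x. f x * g x)"
proof (rule Bochner_Integration.integrable_bound[where f="\<lambda>x. (cmod (f x))\<^sup>2 + (cmod (g x))\<^sup>2"])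
  show "integrable M (\<lambda>x. (cmod (f x))\<^sup>2 + (cmod (g x))\<^sup>2)"
    using L2_integrable_square[OF assms(1)] L2_integrable_square[OF assms(2)] by auto
  show "(\<lambda>x. f x * g x) \<in> borel_measurable M"
    using assms by (auto simp: L2_def)
  have "cmod (u * v) \<le> (cmod u)\<^sup>2 + (cmod v)\<^sup>2" for u v
    using sum_squares_bound[of "cmod u" "cmod v"] mult_nonneg_nonneg[OF norm_ge_zero norm_ge_zero, of u v]
    unfolding norm_mult by linarith
  then show "AE x in M. norm (f x * g x) \<le> norm ((cmod (f x))\<^sup>2 + (cmod (g x))\<^sup>2)"
    by simp
qed

lemma L2_Cauchy_Schwarz_abs:
  assumes "f \<in> L2 M" "g \<in> L2 M"
  shows "(\<integral>x. cmod (f x) * cmod (g x) \<partial>M) \<le> L2_norm M f * L2_norm M g"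
proof -
  define A B C where "A = (\<integral>x. (cmod (f x))\<^sup>2 \<partial>M)" and "B = (\<integral>x. (cmod (g x))\<^sup>2 \<partial>M)"
    and "C = (\<integral>x. cmod (f x) * cmod (g x) \<partial>M)"
  have i: "integrable M (\<lambda>x. (cmod (f x))\<^sup>2)" "integrable M (\<lambda>x. (cmod (g x))\<^sup>2)"
     "integrable M (\<lambda>x. cmod (f x) * cmod (g x))"
    using L2_integrable_square[OF assms(1)] L2_integrable_square[OF assms(2)]
      integrable_norm[OF L2_mult_integrable[OF assms]]
    by (auto simp: norm_mult)
  have q: "0 \<le> t\<^sup>2 * A - 2 * t * C + B" for t
  proof -
    have "0 \<le> (\<integral>x. (t * cmod (f x) - cmod (g x))\<^sup>2 \<partial>M)" by simp
    also have "\<dots> = (\<integral>x. t\<^sup>2 * (cmod (f x))\<^sup>2 - 2 * t * (cmod (f x) * cmod (g x)) + (cmod (g x))\<^sup>2 \<partial>M)"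
      by (intro Bochner_Integration.integral_cong) (auto simp: power2_diff power_mult_distrib)
    also have "\<dots> = t\<^sup>2 * A - 2 * t * C + B"
      using i by (simp add: A_def B_def C_def)
    finally show ?thesis .
  qed
  have nn: "A \<ge> 0" "B \<ge> 0" "C \<ge> 0" by (auto simp: A_def B_def C_def)
  have "C\<^sup>2 \<le> A * B"
  proof (cases "A = 0")
    case True
    \<comment> \<open>At this \<open>t\<close> the quadratic reads
      \<open>- (B + 1) + B = - 1\<close>, so \<open>C\<close> cannot be nonzero.\<close>
    then have "C = 0" using q[of "(B + 1) / (2 * C)"] by (cases "C = 0") (auto simp: field_simps)
    then show ?thesis using nn by simp
  next
    case False
    then show ?thesis using q[of "C / A"] nn by (simp add: field_simps power2_eq_square)
  qed
  then have "sqrt (C\<^sup>2) \<le> sqrt (A * B)" by (rule real_sqrt_le_mono)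
  then show ?thesis using nn by (simp add: A_def B_def C_def L2_norm_def real_sqrt_mult)
qed

lemma L2_Cauchy_Schwarz:
  assumes "f \<in> L2 M" "g \<in> L2 M"
  shows "cmod (\<integral>x. f x * g x \<partial>M) \<le> L2_norm M f * L2_norm M g"
proof -
  have "cmod (\<integral>x. f x * g x \<partial>M) \<le> (\<integral>x. cmod (f x) * cmod (g x) \<partial>M)"
    using integral_norm_bound[of M "\<lambda>x. f x * g x"] by (simp add: norm_mult)
  then show ?thesis using L2_Cauchy_Schwarz_abs[OF assms] by linarith
qed

lemma L2_norm_triangle:
  assumes "f \<in> L2 M" "g \<in> L2 M"
  shows "L2_norm M (\<lambda>x. f x + g x) \<le> L2_norm M f + L2_norm M g"
proof -
  have i: "integrable M (\<lambda>x. (cmod (f x))\<^sup>2)" "integrable M (\<lambda>x. (cmod (g x))\<^sup>2)"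
     "integrable M (\<lambda>x. cmod (f x) * cmod (g x))" "integrable M (\<lambda>x. (cmod (f x + g x))\<^sup>2)"
    using L2_integrable_square[OF assms(1)] L2_integrable_square[OF assms(2)]
      integrable_norm[OF L2_mult_integrable[OF assms]] L2_integrable_square[OF L2_add[OF assms]]
    by (auto simp: norm_mult)
  have le: "(cmod (u + v))\<^sup>2 \<le> (cmod u)\<^sup>2 + 2 * (cmod u * cmod v) + (cmod v)\<^sup>2" for u v
    using power_mono[OF norm_triangle_ineq[of u v], of 2] by (simp add: power2_sum)
  have "(L2_norm M (\<lambda>x. f x + g x))\<^sup>2 \<le> (\<integral>x. (cmod (f x))\<^sup>2 + 2 * (cmod (f x) * cmod (g x)) + (cmod (g x))\<^sup>2 \<partial>M)"
    unfolding L2_norm_square using i le by (intro integral_mono) auto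
  also have "\<dots> = (L2_norm M f)\<^sup>2 + 2 * (\<integral>x. cmod (f x) * cmod (g x) \<partial>M) + (L2_norm M g)\<^sup>2"
    using i by (simp add: L2_norm_square)
  also have "\<dots> \<le> (L2_norm M f + L2_norm M g)\<^sup>2"
    using L2_Cauchy_Schwarz_abs[OF assms] by (simp add: power2_sum)
  finally show ?thesis by (rule power2_le_imp_le) simp
qed

lemma L2_norm_triangle_diff:
  assumes "f \<in> L2 M" "g \<in> L2 M"
  shows "L2_norm M (\<lambda>x. f x - g x) \<le> L2_norm M f + L2_norm M g"
  using L2_norm_triangle[OF assms(1) L2_scale[OF assms(2), of "-1"]] L2_norm_scale[of M "-1" g] by simp

lemma L2_norm_triangle_sub:
  assumes "f \<in> L2 M" "g \<in> L2 M"
  shows "L2_norm M f \<le> L2_norm M g + L2_norm M (\<lambda>x. f x - g x)"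
  using L2_norm_triangle[OF assms(2) L2_diff[OF assms]] by simp

lemma L2_norm_diff_triangle:
  assumes "f \<in> L2 M" "g \<in> L2 M" "h \<in> L2 M"
  shows "L2_norm M (\<lambda>x. f x - h x) \<le> L2_norm M (\<lambda>x. f x - g x) + L2_norm M (\<lambda>x. g x - h x)"
  using L2_norm_triangle[OF L2_diff[OF assms(1,2)] L2_diff[OF assms(2,3)]] by simp

lemma L2_norm_triangle_lincomb:
  assumes "f \<in> L2 M" "g \<in> L2 M"
  shows "L2_norm M (\<lambda>x. a * f x + b * g x) \<le> cmod a * L2_norm M f + cmod b * L2_norm M g"
  using L2_norm_triangle[OF L2_scale[OF assms(1), of a] L2_scale[OF assms(2), of b]]
  by (simp add: L2_norm_scale)

lemma L2_bounded:
  assumes "finite_measure M" "f \<in> borel_measurable M" "\<And>x. x \<in> space M \<Longrightarrow> cmod (f x) \<le> B"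
  shows "f \<in> L2 M"
proof -
  interpret finite_measure M by fact
  have "integrable M (\<lambda>x. (cmod (f x))\<^sup>2)"
    by (rule integrable_const_bound[where B="B\<^sup>2"]) (use assms in \<open>auto intro!: power_mono\<close>)
  then show ?thesis using assms by (simp add: L2_def)
qed

lemma L2_dominated_convergence:
  assumes w: "w \<in> L2 M" and f: "f \<in> borel_measurable M" and s: "\<And>n. s n \<in> borel_measurable M"
    and lim: "AE x in M. (\<lambda>n. s n x) \<longlonglongrightarrow> f x"
    and le: "\<And>n. AE x in M. cmod (s n x) \<le> cmod (w x)"
  shows "(\<lambda>n. L2_norm M (\<lambda>x. f x - s n x)) \<longlonglongrightarrow> 0"
proof -
  have bd: "AE x in M. \<forall>n. cmod (s n x) \<le> cmod (w x)" using le by (simp add: AE_all_countable)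
  have fb: "AE x in M. cmod (f x) \<le> cmod (w x)"
    using lim bd
  proof eventually_elim
    case (elim x)
    then have "(\<lambda>n. cmod (s n x)) \<longlonglongrightarrow> cmod (f x)" by (auto intro: tendsto_norm)
    then show ?case by (rule LIMSEQ_le_const2) (use elim in auto)
  qed
  have "(\<lambda>n. \<integral>x. (cmod (f x - s n x))\<^sup>2 \<partial>M) \<longlonglongrightarrow> (\<integral>x. 0 \<partial>M)"
  proof (rule integral_dominated_convergence[where w="\<lambda>x. (2 * cmod (w x))\<^sup>2"])
    show "integrable M (\<lambda>x. (2 * cmod (w x))\<^sup>2)"
      using L2_integrable_square[OF w] by (simp add: power_mult_distrib)
    show "AE x in M. (\<lambda>n. (cmod (f x - s n x))\<^sup>2) \<longlonglongrightarrow> 0"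
      using lim
    proof eventually_elim
      case (elim x)
      then have "(\<lambda>n. (cmod (f x - s n x))\<^sup>2) \<longlonglongrightarrow> (cmod (f x - f x))\<^sup>2" by (intro tendsto_intros)
      then show ?case by simp
    qed
    show "AE x in M. norm ((cmod (f x - s n x))\<^sup>2) \<le> (2 * cmod (w x))\<^sup>2" for n
      using fb bd
    proof eventually_elim
      case (elim x)
      have "cmod (f x - s n x) \<le> 2 * cmod (w x)"
        using norm_triangle_ineq4[of "f x" "s n x"] elim(1) elim(2)[rule_format, of n] by linarith
      then have "(cmod (f x - s n x))\<^sup>2 \<le> (2 * cmod (w x))\<^sup>2" by (intro power_mono) auto
      then show ?case by simp
    qed
  qed (use f s in measurable)
  then have "(\<lambda>n. sqrt (\<integral>x. (cmod (f x - s n x))\<^sup>2 \<partial>M)) \<longlonglongrightarrow> sqrt 0"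
    by (intro tendsto_real_sqrt) simp
  then show ?thesis by (simp add: L2_norm_def)
qed

text \<open>A Dynkin-class argument passes from the intersection-stable generator \<open>E\<close>
  to all measurable sets, linear combinations give simple functions, and norm limits give the rest.
  Closedness is asked for in epsilon form, which also makes \<open>P\<close> insensitive to changes
  on null sets.\<close>

lemma L2_induct [consumes 1, case_names closed lincomb generator]:
  assumes f: "f \<in> L2 M" and fin: "finite_measure M"
    and gen: "sets M = sigma_sets (space M) E" "Int_stable E" "E \<subseteq> Pow (space M)"
    and closed: "\<And>f. f \<in> L2 M \<Longrightarrow> (\<And>e. e > 0 \<Longrightarrow> \<exists>g\<in>L2 M. P g \<and> L2_norm M (\<lambda>x. f x - g x) < e) \<Longrightarrow> P f"
    and lincomb: "\<And>f g a b. f \<in> L2 M \<Longrightarrow> g \<in> L2 M \<Longrightarrow> P f \<Longrightarrow> P g \<Longrightarrow> P (\<lambda>x. a * f x + b * g x)"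
    and space: "P (indicator (space M))" and E: "\<And>A. A \<in> E \<Longrightarrow> P (indicator A)"
  shows "P f"
proof -
  interpret finite_measure M by fact
  have indL2: "(indicator A :: _ \<Rightarrow> complex) \<in> L2 M" if "A \<in> sets M" for A
    using that by (intro L2_bounded[where B=1]) (auto simp: fin indicator_def)
  have close_cong: "P g" if "P f'" "f' \<in> L2 M" "g \<in> L2 M" "\<And>x. x \<in> space M \<Longrightarrow> g x = f' x" for f' g
  proof (rule closed[OF that(3)])
    fix e :: real assume "e > 0"
    moreover have "L2_norm M (\<lambda>x. g x - f' x) = L2_norm M (\<lambda>x. 0)"
      using that(4) by (intro L2_norm_cong) auto
    ultimately show "\<exists>h\<in>L2 M. P h \<and> L2_norm M (\<lambda>x. g x - h x) < e"
      using that by (intro bexI[of _ f']) (auto simp: L2_norm_def)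
  qed
  have closed_seq: "P g" if "g \<in> L2 M" "\<And>n. s n \<in> L2 M" "\<And>n. P (s n)"
    "(\<lambda>n. L2_norm M (\<lambda>x. g x - s n x)) \<longlonglongrightarrow> 0" for g s
  proof (rule closed[OF that(1)])
    fix e :: real assume "e > 0"
    with that(4) have "eventually (\<lambda>n. L2_norm M (\<lambda>x. g x - s n x) < e) sequentially"
      by (auto dest: order_tendstoD(2))
    then obtain n where "L2_norm M (\<lambda>x. g x - s n x) < e"
      by (auto simp: eventually_sequentially)
    then show "\<exists>h\<in>L2 M. P h \<and> L2_norm M (\<lambda>x. g x - h x) < e" using that by blast
  qed
  have P0: "P (\<lambda>x. 0)"
    using lincomb[of "indicator (space M)" "indicator (space M)" 0 0] indL2 space by simp
  have Psum: "P (\<lambda>x. \<Sum>i\<in>I. c i * g i x)"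
    if "finite I" "\<And>i. i \<in> I \<Longrightarrow> g i \<in> L2 M" "\<And>i. i \<in> I \<Longrightarrow> P (g i)" for I :: "'i set" and c g
    using that
  proof (induction I)
    case (insert i I)
    have "P (\<lambda>x. c i * g i x + 1 * (\<Sum>i\<in>I. c i * g i x))"
      using insert by (intro lincomb) (auto intro!: L2_sum L2_scale)
    then show ?case using insert by simp
  qed (simp add: P0)
  have ind: "P (indicator A)" if "A \<in> sigma_sets (space M) E" for A
    using gen(2,3) that
  proof (induction rule: sigma_sets_induct_disjoint)
    case (basic A) then show ?case by (rule E)
  next
    case empty
    have "indicator {} = (\<lambda>x. 0::complex)" by auto
    then show ?case using P0 by simp
  next
    case (compl A)
    then have A: "A \<in> sets M" using gen by simp
    have "P (\<lambda>x. 1 * indicator (space M) x + (-1) * indicator A x)"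
      using A compl space indL2 by (intro lincomb) auto
    then show ?case
    proof (rule close_cong)
      show "(\<lambda>x. 1 * indicator (space M) x + (-1) * indicator A x) \<in> L2 M"
        "indicator (space M - A) \<in> L2 M"
        using A indL2 by (intro L2_lincomb | simp)+
    qed (auto simp: indicator_def)
  next
    case (union A)
    then have A: "\<And>i. A i \<in> sets M" using gen by auto
    have U: "(\<lambda>n. \<Sum>i\<in>{..<n}. 1 * indicator (A i) x :: complex) \<longlonglongrightarrow> indicator (\<Union>i. A i) x" for x
    proof (cases "x \<in> (\<Union>i. A i)")
      case True
      then obtain j where j: "x \<in> A j" by auto
      have "indicator (A i) x = (if i = j then 1 else 0 :: complex)" for i
        using union(1) j by (auto simp: disjoint_family_on_def indicator_def)
      then have "(\<Sum>i\<in>{..<n}. 1 * indicator (A i) x :: complex) = 1" if "n > j" for n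
        using that by simp
      then have "eventually (\<lambda>n. (\<Sum>i\<in>{..<n}. 1 * indicator (A i) x :: complex) = 1) sequentially"
        by (auto simp: eventually_sequentially intro!: exI[of _ "Suc j"])
      then show ?thesis using True by (simp add: tendsto_eventually)
    next
      case False
      then have "indicator (A i) x = (0::complex)" for i by auto
      then show ?thesis using False by simp
    qed
    show ?case
    proof (rule closed_seq)
      show "(indicator (\<Union>i. A i) :: _ \<Rightarrow> complex) \<in> L2 M" using A by (intro indL2) auto
      show "(\<lambda>x. \<Sum>i\<in>{..<n}. 1 * indicator (A i) x) \<in> L2 M" for n
        using A indL2 by (intro L2_sum L2_scale) auto
      show "P (\<lambda>x. \<Sum>i\<in>{..<n}. 1 * indicator (A i) x)" for n
        using union A indL2 by (intro Psum) auto
      have le: "cmod (\<Sum>i\<in>{..<n}. 1 * indicator (A i) x) \<le> cmod 1" for n x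
      proof -
        have "disjoint_family_on A {..<n}" using union(1) by (auto simp: disjoint_family_on_def)
        then have "(\<Sum>i\<in>{..<n}. indicator (A i) x :: complex) = indicator (\<Union>i\<in>{..<n}. A i) x"
          by (simp add: indicator_UN_disjoint)
        then show ?thesis by (simp add: indicator_def)
      qed
      show "(\<lambda>n. L2_norm M (\<lambda>x. indicator (\<Union>i. A i) x - (\<Sum>i\<in>{..<n}. 1 * indicator (A i) x))) \<longlonglongrightarrow> 0"
        by (rule L2_dominated_convergence[where w="\<lambda>_. 1"])
           (use A U le in \<open>auto intro!: L2_bounded[where B=1] fin\<close>)
    qed
  qed
  have simple: "P s" if s: "simple_function M s" "s \<in> L2 M" for s
  proof (rule close_cong)
    have set: "s -` {y} \<inter> space M \<in> sets M" for y
      using s by (auto simp: L2_def intro: measurable_sets)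
    show "P (\<lambda>x. \<Sum>y\<in>s ` space M. y * indicator (s -` {y} \<inter> space M) x)"
      using s set ind indL2 gen by (intro Psum) (auto simp: simple_function_def)
    show "(\<lambda>x. \<Sum>y\<in>s ` space M. y * indicator (s -` {y} \<inter> space M) x) \<in> L2 M"
      using set indL2 by (intro L2_sum L2_scale) auto
    fix x assume "x \<in> space M"
    then have "(\<Sum>y\<in>s ` space M. y * indicator (s -` {y} \<inter> space M) x)
        = (\<Sum>y\<in>s ` space M. if y = s x then y else 0)"
      by (intro sum.cong) (auto simp: indicator_def)
    also have "\<dots> = s x" using s \<open>x \<in> space M\<close> by (simp add: simple_function_def)
    finally show "s x = (\<Sum>y\<in>s ` space M. y * indicator (s -` {y} \<inter> space M) x)" ..
  qed (fact s)
  from borel_measurable_implies_sequence_metric[OF L2_measurable[OF f], of 0]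
  obtain s where s: "\<And>i. simple_function M (s i)" "\<And>x. x \<in> space M \<Longrightarrow> (\<lambda>i. s i x) \<longlonglongrightarrow> f x"
    "\<And>i x. x \<in> space M \<Longrightarrow> dist (s i x) 0 \<le> 2 * dist (f x) 0"
    by blast
  have w: "(\<lambda>x. 2 * f x) \<in> L2 M" using f by (rule L2_scale)
  have sL: "s i \<in> L2 M" for i
    by (rule L2I_bound[OF borel_measurable_simple_function[OF s(1)] w]) (use s in \<open>auto simp: norm_mult\<close>)
  show ?thesis
  proof (rule closed_seq[OF f sL])
    show "P (s n)" for n using s sL by (intro simple) auto
    show "(\<lambda>n. L2_norm M (\<lambda>x. f x - s n x)) \<longlonglongrightarrow> 0"
      using s sL f by (intro L2_dominated_convergence[OF w]) (auto simp: norm_mult L2_measurable)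
  qed
qed

text \<open>The increments are already summable in \<open>L1\<close>, because the measure is finite,
  so the sequence converges almost everywhere. Fatou's lemma then carries the geometric tail bound
  to the pointwise limit.\<close>

lemma L2_geometric_limit:
  assumes fin: "finite_measure M" and f: "\<And>n. f n \<in> L2 M"
    and r: "0 \<le> r" "r < 1" and step: "\<And>n. L2_norm M (\<lambda>x. f (Suc n) x - f n x) \<le> C * r ^ n"
  shows "\<exists>g\<in>L2 M. \<forall>n. L2_norm M (\<lambda>x. g x - f n x) \<le> C * r ^ n / (1 - r)"
proof -
  interpret finite_measure M by fact
  have fm [measurable]: "f n \<in> borel_measurable M" for n using f by (simp add: L2_def)
  have one: "(\<lambda>x. 1) \<in> L2 M" by (rule L2_bounded[where B=1]) (auto simp: fin)
  have d: "(\<lambda>x. f (Suc n) x - f n x) \<in> L2 M" for n by (intro L2_diff f)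
  have int: "integrable M (\<lambda>x. cmod (f (Suc n) x - f n x))" for n
    using integrable_norm[OF L2_mult_integrable[OF d[of n] one]] by simp
  have le: "(\<integral>x. cmod (f (Suc n) x - f n x) \<partial>M) \<le> C * L2_norm M (\<lambda>x. 1) * r ^ n" for n
    using L2_Cauchy_Schwarz_abs[OF d[of n] one] mult_right_mono[OF step[of n] L2_norm_nonneg[of M "\<lambda>x. 1"]]
    by (simp add: mult_ac)
  have sumint: "summable (\<lambda>n. \<integral>x. cmod (f (Suc n) x - f n x) \<partial>M)"
  proof (rule summable_comparison_test'[where N=0])
    show "summable (\<lambda>n. C * L2_norm M (\<lambda>x. 1) * r ^ n)"
      using r by (intro summable_mult summable_geometric) simp
    show "norm (\<integral>x. cmod (f (Suc n) x - f n x) \<partial>M) \<le> C * L2_norm M (\<lambda>x. 1) * r ^ n" for n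
      using le[of n] by (subst real_norm_def, subst abs_of_nonneg) (auto intro: integral_nonneg)
  qed
  have "(\<integral>\<^sup>+x. (\<Sum>n. ennreal (cmod (f (Suc n) x - f n x))) \<partial>M)
      = (\<Sum>n. \<integral>\<^sup>+x. ennreal (cmod (f (Suc n) x - f n x)) \<partial>M)"
    by (rule nn_integral_suminf) auto
  also have "\<dots> = (\<Sum>n. ennreal (\<integral>x. cmod (f (Suc n) x - f n x) \<partial>M))"
    by (intro suminf_cong nn_integral_eq_integral int) auto
  also have "\<dots> < \<infinity>"
    using sumint by (subst suminf_ennreal2) auto
  finally have "AE x in M. (\<Sum>n. ennreal (cmod (f (Suc n) x - f n x))) \<noteq> \<infinity>"
    by (intro nn_integral_PInf_AE) auto
  then have conv: "AE x in M. convergent (\<lambda>n. f n x)"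
  proof eventually_elim
    case (elim x)
    then have "summable (\<lambda>n. cmod (f (Suc n) x - f n x))"
      by (intro summable_suminf_not_top) auto
    then have "summable (\<lambda>n. f (Suc n) x - f n x)" by (rule summable_norm_cancel)
    then have "convergent (\<lambda>n. f n x - f 0 x)"
      by (simp add: summable_iff_convergent sum_lessThan_telescope[of "\<lambda>n. f n x"])
    then show ?case using convergent_diff_const_right_iff[of "\<lambda>n. f n x" "f 0 x"] by auto
  qed
  define g where "g x = lim (\<lambda>n. f n x)" for x
  have gm [measurable]: "g \<in> borel_measurable M" unfolding g_def by measurable
  have gl: "AE x in M. (\<lambda>n. f n x) \<longlonglongrightarrow> g x"
    using conv by eventually_elim (simp add: g_def convergent_LIMSEQ_iff)
  have dist: "L2_norm M (\<lambda>x. f (n + k) x - f n x) \<le> C * r ^ n / (1 - r)" for n k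
  proof -
    have *: "L2_norm M (\<lambda>x. f (n + k) x - f n x) \<le> C * r ^ n * (\<Sum>i<k. r ^ i)"
    proof (induction k)
      case 0 then show ?case by (simp add: L2_norm_def)
    next
      case (Suc k)
      have "L2_norm M (\<lambda>x. f (n + Suc k) x - f n x)
        \<le> L2_norm M (\<lambda>x. f (n + Suc k) x - f (n + k) x) + L2_norm M (\<lambda>x. f (n + k) x - f n x)"
        by (rule L2_norm_diff_triangle[OF f f f])
      also have "\<dots> \<le> C * r ^ (n + k) + C * r ^ n * (\<Sum>i<k. r ^ i)"
        using step[of "n + k"] Suc by simp
      finally show ?case by (simp add: algebra_simps power_add)
    qed
    have C: "C \<ge> 0" using order_trans[OF L2_norm_nonneg step[of 0]] by simp
    have "(\<Sum>i<k. r ^ i) \<le> 1 / (1 - r)"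
      using sum_le_suminf[of "(^) r" "{..<k}"] r suminf_geometric[of r] summable_geometric[of r] by simp
    then have "C * r ^ n * (\<Sum>i<k. r ^ i) \<le> C * r ^ n * (1 / (1 - r))"
      using C r by (intro mult_left_mono) auto
    with * show ?thesis by simp
  qed
  have C: "C * r ^ n / (1 - r) \<ge> 0" for n using order_trans[OF L2_norm_nonneg dist[of n 0]] .
  have nn: "(\<integral>\<^sup>+x. ennreal ((cmod (g x - f n x))\<^sup>2) \<partial>M) \<le> ennreal ((C * r ^ n / (1 - r))\<^sup>2)" for n
  proof -
    have "(\<integral>\<^sup>+x. ennreal ((cmod (g x - f n x))\<^sup>2) \<partial>M)
        = (\<integral>\<^sup>+x. liminf (\<lambda>k. ennreal ((cmod (f (n + k) x - f n x))\<^sup>2)) \<partial>M)"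
    proof (rule nn_integral_cong_AE)
      show "AE x in M. ennreal ((cmod (g x - f n x))\<^sup>2)
        = liminf (\<lambda>k. ennreal ((cmod (f (n + k) x - f n x))\<^sup>2))"
        using gl
      proof eventually_elim
        case (elim x)
        have "(\<lambda>k. f (n + k) x) \<longlonglongrightarrow> g x" using LIMSEQ_ignore_initial_segment[OF elim, of n]
          by (simp add: add.commute)
        then have "(\<lambda>k. ennreal ((cmod (f (n + k) x - f n x))\<^sup>2)) \<longlonglongrightarrow> ennreal ((cmod (g x - f n x))\<^sup>2)"
          by (intro tendsto_intros)
        then show ?case by (intro lim_imp_Liminf[symmetric]) auto
      qed
    qed
    also have "\<dots> \<le> liminf (\<lambda>k. \<integral>\<^sup>+x. ennreal ((cmod (f (n + k) x - f n x))\<^sup>2) \<partial>M)"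
      by (rule nn_integral_liminf) auto
    also have "\<dots> \<le> liminf (\<lambda>k. ennreal ((C * r ^ n / (1 - r))\<^sup>2))"
    proof (rule Liminf_mono, intro always_eventually allI)
      fix k
      have "(\<integral>\<^sup>+x. ennreal ((cmod (f (n + k) x - f n x))\<^sup>2) \<partial>M)
          = ennreal ((L2_norm M (\<lambda>x. f (n + k) x - f n x))\<^sup>2)"
        unfolding L2_norm_square
        by (intro nn_integral_eq_integral L2_integrable_square L2_diff f) auto
      also have "\<dots> \<le> ennreal ((C * r ^ n / (1 - r))\<^sup>2)"
        by (intro ennreal_leI power_mono dist) auto
      finally show "(\<integral>\<^sup>+x. ennreal ((cmod (f (n + k) x - f n x))\<^sup>2) \<partial>M) \<le> ennreal ((C * r ^ n / (1 - r))\<^sup>2)" .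
    qed
    also have "\<dots> = ennreal ((C * r ^ n / (1 - r))\<^sup>2)" by (simp add: Liminf_const)
    finally show ?thesis .
  qed
  have gd: "(\<lambda>x. g x - f n x) \<in> L2 M" for n
  proof -
    have "integrable M (\<lambda>x. (cmod (g x - f n x))\<^sup>2)"
      by (rule integrableI_bounded) (use nn[of n] in \<open>auto simp: le_less_trans[OF _ ennreal_less_top]\<close>)
    then show ?thesis by (simp add: L2_def)
  qed
  show ?thesis
  proof (intro bexI allI)
    show "g \<in> L2 M" using L2_add[OF gd[of 0] f[of 0]] by simp
    fix n
    have "ennreal ((L2_norm M (\<lambda>x. g x - f n x))\<^sup>2) \<le> ennreal ((C * r ^ n / (1 - r))\<^sup>2)"
      using nn[of n] nn_integral_eq_integral[OF L2_integrable_square[OF gd[of n]]]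
      by (simp add: L2_norm_square)
    then have "(L2_norm M (\<lambda>x. g x - f n x))\<^sup>2 \<le> (C * r ^ n / (1 - r))\<^sup>2"
      by (subst (asm) ennreal_le_iff) auto
    then show "L2_norm M (\<lambda>x. g x - f n x) \<le> C * r ^ n / (1 - r)"
      by (rule power2_le_imp_le) (rule C)
  qed
qed

section \<open>Uniform boundedness of C0-semigroups near time zero\<close>

text \<open>Elements are representatives, so closedness under norm approximation includes closedness
  under almost-everywhere equality.\<close>

definition closed_subspace :: "'a measure \<Rightarrow> ('a \<Rightarrow> complex) set \<Rightarrow> bool" where
  "closed_subspace M S \<longleftrightarrow> S \<subseteq> L2 M \<and> (\<lambda>x. 0) \<in> S \<and>
     (\<forall>f\<in>S. \<forall>g\<in>S. \<forall>a b. (\<lambda>x. a * f x + b * g x) \<in> S) \<and>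
     (\<forall>f\<in>L2 M. (\<forall>e>0. \<exists>g\<in>S. L2_norm M (\<lambda>x. f x - g x) < e) \<longrightarrow> f \<in> S)"

lemma closed_subspace_L2: "closed_subspace M (L2 M)"
  by (auto simp: closed_subspace_def L2_zero L2_lincomb)

lemma closed_subspace_diff:
  "closed_subspace M S \<Longrightarrow> f \<in> S \<Longrightarrow> g \<in> S \<Longrightarrow> (\<lambda>x. f x - g x) \<in> S"
  unfolding closed_subspace_def by (drule conjunct2, drule conjunct2, drule conjunct1,
      drule bspec[of _ _ f], assumption, drule bspec[of _ _ g], assumption, drule spec[of _ 1], drule spec[of _ "-1"]) simp

text \<open>The definition of a C0-semigroup bounds each \<open>T t\<close> separately. Without a
  common bound near \<open>0\<close>, the uniform boundedness principle yields a single
  \<open>g\<close> in \<open>S\<close> for which \<open>T (s n) g\<close> is unbounded along times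
  \<open>s n\<close> tending to \<open>0\<close>, against strong continuity. The principle is proved
  directly by a gliding hump.\<close>

lemma C0_semigroup_bounded_near_0:
  assumes fin: "finite_measure M" and S: "closed_subspace M S" and T: "C0_semigroup M S T"
  shows "\<exists>\<delta>>0. \<exists>K\<ge>0. \<forall>s\<in>{0..\<delta>}. \<forall>f\<in>S. L2_norm M (T s f) \<le> K * L2_norm M f"
proof (rule ccontr)
  assume neg: "\<not> ?thesis"
  have SL: "f \<in> L2 M" if "f \<in> S" for f using S that by (auto simp: closed_subspace_def)
  have Sl: "(\<lambda>x. a * f x + b * g x) \<in> S" if "f \<in> S" "g \<in> S" for f g a b
    using S that by (auto simp: closed_subspace_def)
  have TS: "T t f \<in> S" if "t \<ge> 0" "f \<in> S" for t f using T that by (auto simp: C0_semigroup_def)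
  have TL: "L2_norm M (T t (\<lambda>x. a * f x + b * g x)) = L2_norm M (\<lambda>x. a * T t f x + b * T t g x)"
    if "t \<ge> 0" "f \<in> S" "g \<in> S" for t f g a b
    using T that TS[OF that(1)] Sl SL unfolding C0_semigroup_def
    by (intro L2_norm_cong_AE L2_measurable L2_lincomb) auto
  have "\<exists>K. \<forall>f\<in>S. L2_norm M (T t f) \<le> K * L2_norm M f" if "t \<ge> 0" for t
    using T that by (auto simp: C0_semigroup_def)
  then obtain B where B: "\<And>t f. t \<ge> 0 \<Longrightarrow> f \<in> S \<Longrightarrow> L2_norm M (T t f) \<le> B t * L2_norm M f"
    by metis
  \<comment> \<open>Norms beyond \<open>4 ^ n\<close> are set against humps of size
    \<open>1 / 3 ^ n\<close>: the humps form a convergent series, while the products grow at least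
    like \<open>(4 / 3) ^ n\<close>.\<close>
  have "\<exists>s\<in>{0..1 / real (Suc n)}. \<exists>f\<in>S. L2_norm M (T s f) > 4 ^ n * L2_norm M f" for n
    using neg[simplified, rule_format, of "1 / real (Suc n)" "4 ^ n"] by (auto simp: not_le)
  then obtain s where s: "\<And>n. s n \<in> {0..1 / real (Suc n)}"
    and sb: "\<And>n. \<exists>f\<in>S. L2_norm M (T (s n) f) > 4 ^ n * L2_norm M f"
    by metis
  have s0: "s n \<ge> 0" for n using s[of n] by simp
  have slim: "s \<longlonglongrightarrow> 0"
  proof (rule tendsto_sandwich[of "\<lambda>_. 0" s sequentially "\<lambda>n. 1 / real (Suc n)"])
    show "(\<lambda>n. 1 / real (Suc n)) \<longlonglongrightarrow> 0" using LIMSEQ_inverse_real_of_nat by (simp add: inverse_eq_divide)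
  qed (use s in auto)
  define N where "N n = (SUP f\<in>{f\<in>S. L2_norm M f \<le> 1}. L2_norm M (T (s n) f))" for n
  have bdd: "bdd_above ((\<lambda>f. L2_norm M (T (s n) f)) ` {f\<in>S. L2_norm M f \<le> 1})" for n
  proof (rule bdd_aboveI2)
    fix f assume f: "f \<in> {f\<in>S. L2_norm M f \<le> 1}"
    have "L2_norm M (T (s n) f) \<le> B (s n) * L2_norm M f" using B s0 f by auto
    also have "\<dots> \<le> \<bar>B (s n)\<bar> * 1" using f by (intro mult_mono) auto
    finally show "L2_norm M (T (s n) f) \<le> \<bar>B (s n)\<bar>" by simp
  qed
  have scale: "L2_norm M (T (s n) (\<lambda>x. a * f x)) = cmod a * L2_norm M (T (s n) f)" if "f \<in> S" for n a f
    using TL[OF s0 that that, of n a 0] by (simp add: L2_norm_scale)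
  have NB: "L2_norm M (T (s n) f) \<le> N n * L2_norm M f" if f: "f \<in> S" for n f
  proof (cases "L2_norm M f = 0")
    case True
    then show ?thesis using B[OF s0[of n] f] by simp
  next
    case False
    define c where "c = L2_norm M f"
    have c: "c > 0" using False L2_norm_nonneg[of M f] unfolding c_def by linarith
    have "(\<lambda>x. complex_of_real (1 / c) * f x) \<in> S" using Sl[OF f f, of "complex_of_real (1 / c)" 0] by (simp only: mult_zero_left add_0_right)
    moreover have "L2_norm M (\<lambda>x. complex_of_real (1 / c) * f x) = 1"
      using c by (subst L2_norm_scale) (simp add: c_def norm_divide)
    ultimately have "L2_norm M (T (s n) (\<lambda>x. complex_of_real (1 / c) * f x)) \<le> N n"
      unfolding N_def by (intro cSUP_upper bdd) auto
    then show ?thesis using c unfolding scale[OF f] by (simp add: c_def norm_divide field_simps)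
  qed
  have N4: "N n > 4 ^ n" for n
  proof -
    obtain f where f: "f \<in> S" "L2_norm M (T (s n) f) > 4 ^ n * L2_norm M f" using sb by blast
    then have "4 ^ n * L2_norm M f < N n * L2_norm M f" using NB[of f n] by linarith
    then show ?thesis using L2_norm_nonneg[of M f] by (simp add: mult_less_cancel_right)
  qed
  have "\<exists>f\<in>S. L2_norm M f \<le> 1 \<and> L2_norm M (T (s n) f) > 3 / 4 * N n" for n
  proof -
    have "3 / 4 * N n < N n" using N4[of n] less_trans[of 0 "4 ^ n" "N n"] by simp
    moreover have "(\<lambda>x. 0) \<in> {f \<in> S. L2_norm M f \<le> 1}"
      using S by (simp add: closed_subspace_def L2_norm_def)
    ultimately have "\<exists>f\<in>{f \<in> S. L2_norm M f \<le> 1}. 3 / 4 * N n < L2_norm M (T (s n) f)"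
      using \<open>3 / 4 * N n < N n\<close> unfolding N_def[of n]
      by (intro less_cSUP_iff[THEN iffD1] bdd) auto
    then show ?thesis by auto
  qed
  then obtain h where h: "\<And>n. h n \<in> S" "\<And>n. L2_norm M (h n) \<le> 1"
    "\<And>n. L2_norm M (T (s n) (h n)) > 3 / 4 * N n" by metis
  \<comment> \<open>Sokal's gliding hump: one of \<open>T (x + h)\<close> and \<open>T (x - h)\<close> is at least as large as \<open>T h\<close>.\<close>
  have signex: "\<exists>\<epsilon>\<in>{1, -1}. L2_norm M (T (s n) (\<lambda>y. x y + \<epsilon> * (1 / 3 ^ n) * h n y)) \<ge> 3 / 4 * N n / 3 ^ n"
    if x: "x \<in> S" for n x
  proof (rule ccontr)
    let ?c = "1 / 3 ^ n :: complex"
    let ?u = "T (s n) x" and ?v = "T (s n) (h n)"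
    assume "\<not> ?thesis"
    then have lt: "L2_norm M (T (s n) (\<lambda>y. 1 * x y + ?c * h n y)) < 3 / 4 * N n / 3 ^ n"
      "L2_norm M (T (s n) (\<lambda>y. 1 * x y + (- ?c) * h n y)) < 3 / 4 * N n / 3 ^ n" by auto
    have uv: "?u \<in> L2 M" "?v \<in> L2 M" using TS[OF s0] SL x h by auto
    have eq: "(1 * ?u y + ?c * ?v y) - (1 * ?u y + (- ?c) * ?v y) = (2 * ?c) * ?v y" for y
      by (simp add: algebra_simps)
    have "2 * (1 / 3 ^ n) * L2_norm M ?v = L2_norm M (\<lambda>y. (2 * ?c) * ?v y)"
      by (subst L2_norm_scale) (simp add: norm_mult norm_divide norm_power)
    also have "\<dots> \<le> L2_norm M (\<lambda>y. 1 * ?u y + ?c * ?v y) + L2_norm M (\<lambda>y. 1 * ?u y + (- ?c) * ?v y)"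
      unfolding eq[symmetric] by (intro L2_norm_triangle_diff L2_lincomb uv)
    also have "\<dots> < 2 * (3 / 4 * N n / 3 ^ n)"
      using lt unfolding TL[OF s0 x h(1)] by linarith
    finally have "L2_norm M ?v < 3 / 4 * N n" by (simp add: field_simps)
    with h(3)[of n] show False by simp
  qed
  define sg where "sg n x = (SOME \<epsilon>. \<epsilon> \<in> {1, -1} \<and>
     L2_norm M (T (s n) (\<lambda>y. x y + \<epsilon> * (1 / 3 ^ n) * h n y)) \<ge> 3 / 4 * N n / 3 ^ n)" for n x
  have sg: "sg n x \<in> {1, -1}" "L2_norm M (T (s n) (\<lambda>y. x y + sg n x * (1 / 3 ^ n) * h n y)) \<ge> 3 / 4 * N n / 3 ^ n"
    if "x \<in> S" for n x
    using someI_ex[OF signex[OF that, of n, unfolded Bex_def]] unfolding sg_def by auto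
  define x where "x = rec_nat (\<lambda>y. 0) (\<lambda>n x y. x y + sg n x * (1 / 3 ^ n) * h n y)"
  have xSuc: "x (Suc n) = (\<lambda>y. x n y + sg n (x n) * (1 / 3 ^ n) * h n y)" for n
    by (simp add: x_def)
  have xS: "x n \<in> S" for n
  proof (induction n)
    case 0 then show ?case using S by (simp add: x_def closed_subspace_def)
  next
    case (Suc n) then show ?case
      using Sl[OF Suc h(1)[of n], of 1 "sg n (x n) * (1 / 3 ^ n)"] by (simp add: xSuc)
  qed
  have "\<exists>g\<in>L2 M. \<forall>n. L2_norm M (\<lambda>y. g y - x n y) \<le> 1 * (1 / 3) ^ n / (1 - 1 / 3)"
  proof (rule L2_geometric_limit[OF fin])
    fix n
    have "L2_norm M (\<lambda>y. x (Suc n) y - x n y) = cmod (sg n (x n) * (1 / 3 ^ n)) * L2_norm M (h n)"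
      by (subst L2_norm_scale[symmetric]) (simp add: xSuc)
    also have "\<dots> \<le> (1 / 3) ^ n * 1"
      using sg(1)[OF xS, of n n] h(2)[of n] by (intro mult_mono) (auto simp: norm_divide norm_mult norm_power power_divide)
    finally show "L2_norm M (\<lambda>y. x (Suc n) y - x n y) \<le> 1 * (1 / 3) ^ n" by simp
  qed (use xS SL in auto)
  then obtain g where gL: "g \<in> L2 M" and g: "\<And>n. L2_norm M (\<lambda>y. g y - x n y) \<le> 3 / 2 / 3 ^ n"
    by (auto simp: power_divide mult.commute)
  have gS: "g \<in> S"
  proof -
    have "\<exists>f\<in>S. L2_norm M (\<lambda>x. g x - f x) < e" if e: "e > 0" for e
    proof -
      obtain n where "(1 / 3 :: real) ^ n < e / 2"
        using real_arch_pow_inv[of "e / 2" "1 / 3"] e by auto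
      moreover have "3 / 2 / 3 ^ n \<le> 2 * (1 / 3 :: real) ^ n" by (simp add: power_divide field_simps)
      ultimately show ?thesis using g[of n] xS[of n] by (intro bexI[of _ "x n"]) auto
    qed
    then show ?thesis using S gL by (auto simp: closed_subspace_def)
  qed
  \<comment> \<open>The part of the series after step \<open>n\<close> has norm at most
    \<open>1 / 2 / 3 ^ n\<close>, so it cancels at most \<open>N n / 2 / 3 ^ n\<close> of the
    \<open>3 / 4 * N n / 3 ^ n\<close> gained at step \<open>n\<close>. A quarter remains.\<close>
  have big: "L2_norm M (T (s n) g) \<ge> 1 / 4 * (4 / 3) ^ n" for n
  proof -
    have gx: "(\<lambda>y. g y - x (Suc n) y) \<in> S" using closed_subspace_diff[OF S gS xS] .
    have "L2_norm M (T (s n) (\<lambda>y. g y - x (Suc n) y)) = L2_norm M (\<lambda>y. T (s n) g y - T (s n) (x (Suc n)) y)"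
      using TL[OF s0 gS xS, of n 1 "-1"] by simp
    moreover have "L2_norm M (T (s n) (\<lambda>y. g y - x (Suc n) y)) \<le> N n * (3 / 2 / 3 ^ Suc n)"
      by (rule order_trans[OF NB[OF gx] mult_left_mono[OF g]])
        (use less_trans[OF _ N4[of n], of 0] in simp)
    moreover have "L2_norm M (T (s n) (x (Suc n)))
        \<le> L2_norm M (T (s n) g) + L2_norm M (\<lambda>y. T (s n) (x (Suc n)) y - T (s n) g y)"
      using TS[OF s0] gS xS SL by (intro L2_norm_triangle_sub) auto
    moreover have "L2_norm M (T (s n) (x (Suc n))) \<ge> 3 / 4 * N n / 3 ^ n"
      using sg(2)[OF xS, of n n] by (simp add: xSuc)
    ultimately have "L2_norm M (T (s n) g) \<ge> 3 / 4 * N n / 3 ^ n - N n * (3 / 2 / 3 ^ Suc n)"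
      by (simp add: L2_norm_minus_commute[of M "T (s n) (x (Suc n))"])
    also have "3 / 4 * N n / 3 ^ n - N n * (3 / 2 / 3 ^ Suc n) = 1 / 4 * (N n / 3 ^ n)"
      by (simp add: field_simps)
    finally have "L2_norm M (T (s n) g) \<ge> 1 / 4 * (N n / 3 ^ n)" .
    moreover have "(4 / 3) ^ n \<le> N n / 3 ^ n"
      using N4[of n] by (simp add: power_divide divide_right_mono)
    ultimately show ?thesis by linarith
  qed
  have "((\<lambda>t. L2_norm M (\<lambda>x. T t g x - g x)) \<longlongrightarrow> 0) (at_right 0)"
    using T gS by (auto simp: C0_semigroup_def)
  then have "eventually (\<lambda>t. L2_norm M (\<lambda>x. T t g x - g x) < 1) (at_right 0)"
    by (rule order_tendstoD) simp
  then obtain b where b: "b > 0" "\<And>t. t > 0 \<Longrightarrow> t < b \<Longrightarrow> L2_norm M (\<lambda>x. T t g x - g x) < 1"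
    by (auto simp: eventually_at_right_field)
  have T0: "L2_norm M (T 0 g) = L2_norm M g"
    using T gS TS[OF order_refl gS] SL by (intro L2_norm_cong_AE) (auto simp: C0_semigroup_def L2_measurable)
  have "eventually (\<lambda>n. s n < b) sequentially" using slim b(1) by (rule order_tendstoD)
  then have ev: "eventually (\<lambda>n. L2_norm M (T (s n) g) \<le> L2_norm M g + 1) sequentially"
  proof eventually_elim
    case (elim n)
    show ?case
    proof (cases "s n = 0")
      case True then show ?thesis using T0 by simp
    next
      case False
      then have "L2_norm M (\<lambda>x. T (s n) g x - g x) < 1" using b(2)[of "s n"] s0[of n] elim by simp
      then show ?thesis using L2_norm_triangle_sub[of "T (s n) g" M g] TS[OF s0 gS] SL gS by fastforce
    qed
  qed
  obtain m where m: "4 * (L2_norm M g + 1) < (4 / 3 :: real) ^ m"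
    using real_arch_pow[of "4 / 3" "4 * (L2_norm M g + 1)"] by auto
  have "eventually (\<lambda>n. (4 / 3 :: real) ^ n > 4 * (L2_norm M g + 1)) sequentially"
    using eventually_ge_at_top[of m]
  proof eventually_elim
    case (elim n)
    then have "(4 / 3 :: real) ^ m \<le> (4 / 3) ^ n" by (intro power_increasing) auto
    then show ?case using m by linarith
  qed
  with ev have "eventually (\<lambda>n. False) sequentially"
  proof eventually_elim
    case (elim n)
    have "1 / 4 * (4 / 3 :: real) ^ n \<le> L2_norm M g + 1"
      using big[of n] elim(1) by (rule order_trans)
    with elim(2) show ?case by (simp add: field_simps)
  qed
  then show False by simp
qed

section \<open>The measure on the history space and its square\<close>

definition tensor :: "('a \<Rightarrow> complex) \<Rightarrow> ('b \<Rightarrow> complex) \<Rightarrow> 'a \<times> 'b \<Rightarrow> complex" where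
  "tensor f g = (\<lambda>(x, y). f x * g y)"

lemma integral_pair_mult:
  fixes f :: "'a \<Rightarrow> 'c::{real_normed_field, banach, second_countable_topology}"
  assumes "finite_measure M" "finite_measure N" "integrable M f" "integrable N g"
  shows "integrable (M \<Otimes>\<^sub>M N) (\<lambda>(x, y). f x * g y)"
    and "(\<integral>z. (case z of (x, y) \<Rightarrow> f x * g y) \<partial>(M \<Otimes>\<^sub>M N)) = (\<integral>x. f x \<partial>M) * (\<integral>y. g y \<partial>N)"
proof -
  interpret M: finite_measure M by fact
  interpret N: finite_measure N by fact
  interpret pair_sigma_finite M N ..
  have [measurable]: "f \<in> borel_measurable M" "g \<in> borel_measurable N" using assms by auto
  show i: "integrable (M \<Otimes>\<^sub>M N) (\<lambda>(x, y). f x * g y)"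
  proof (rule Fubini_integrable)
    show "integrable M (\<lambda>x. \<integral>y. norm (case (x, y) of (x, y) \<Rightarrow> f x * g y) \<partial>N)"
      using assms by (simp add: norm_mult)
  qed (use assms in auto)
  show "(\<integral>z. (case z of (x, y) \<Rightarrow> f x * g y) \<partial>(M \<Otimes>\<^sub>M N)) = (\<integral>x. f x \<partial>M) * (\<integral>y. g y \<partial>N)"
    using assms by (subst integral_fst'[OF i, symmetric]) simp
qed

lemma L2_tensor:
  assumes "finite_measure M" "finite_measure N" "f \<in> L2 M" "g \<in> L2 N"
  shows "tensor f g \<in> L2 (M \<Otimes>\<^sub>M N)"
    and "L2_norm (M \<Otimes>\<^sub>M N) (tensor f g) = L2_norm M f * L2_norm N g"
proof -
  have [measurable]: "f \<in> borel_measurable M" "g \<in> borel_measurable N"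
    using assms by (auto simp: L2_def)
  have eq: "(cmod (tensor f g z))\<^sup>2 = (case z of (x, y) \<Rightarrow> (cmod (f x))\<^sup>2 * (cmod (g y))\<^sup>2)" for z
    by (cases z) (simp add: tensor_def norm_mult power_mult_distrib)
  note * = integral_pair_mult[OF assms(1,2) L2_integrable_square[OF assms(3)] L2_integrable_square[OF assms(4)]]
  have m: "tensor f g \<in> borel_measurable (M \<Otimes>\<^sub>M N)" unfolding tensor_def by measurable
  show "tensor f g \<in> L2 (M \<Otimes>\<^sub>M N)"
    using m *(1) by (simp add: L2_def eq)
  show "L2_norm (M \<Otimes>\<^sub>M N) (tensor f g) = L2_norm M f * L2_norm N g"
    using *(2) by (simp add: L2_norm_def eq real_sqrt_mult)
qed

lemma integral_tensor_mult:
  assumes "finite_measure M" "finite_measure N" "f \<in> L2 M" "g \<in> L2 N" "h \<in> L2 M" "k \<in> L2 N"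
  shows "(\<integral>z. tensor f g z * tensor h k z \<partial>(M \<Otimes>\<^sub>M N)) = (\<integral>x. f x * h x \<partial>M) * (\<integral>y. g y * k y \<partial>N)"
proof -
  have "(\<integral>z. tensor f g z * tensor h k z \<partial>(M \<Otimes>\<^sub>M N))
      = (\<integral>z. (case z of (x, y) \<Rightarrow> (f x * h x) * (g y * k y)) \<partial>(M \<Otimes>\<^sub>M N))"
    by (intro Bochner_Integration.integral_cong) (auto simp: tensor_def)
  then show ?thesis
    using integral_pair_mult(2)[OF assms(1,2) L2_mult_integrable[OF assms(3,5)] L2_mult_integrable[OF assms(4,6)]]
    by simp
qed

lemma L2_norm_swap:
  assumes "finite_measure M" "f \<in> L2 (M \<Otimes>\<^sub>M M)"
  shows "(\<lambda>z. f (snd z, fst z)) \<in> L2 (M \<Otimes>\<^sub>M M)"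
    and "L2_norm (M \<Otimes>\<^sub>M M) (\<lambda>z. f (snd z, fst z)) = L2_norm (M \<Otimes>\<^sub>M M) f"
proof -
  interpret finite_measure M by fact
  interpret pair_sigma_finite M M ..
  have fm [measurable]: "f \<in> borel_measurable (M \<Otimes>\<^sub>M M)" using assms by (auto simp: L2_def)
  have "(\<lambda>z. f (snd z, fst z)) \<in> borel_measurable (M \<Otimes>\<^sub>M M)" by measurable
  then show "(\<lambda>z. f (snd z, fst z)) \<in> L2 (M \<Otimes>\<^sub>M M)"
    using integrable_product_swap[OF L2_integrable_square[OF assms(2)]]
    by (simp add: L2_def case_prod_beta')
  show "L2_norm (M \<Otimes>\<^sub>M M) (\<lambda>z. f (snd z, fst z)) = L2_norm (M \<Otimes>\<^sub>M M) f"
    using integral_product_swap[of "\<lambda>z. (cmod (f z))\<^sup>2"]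
    by (simp add: L2_norm_def case_prod_beta')
qed

lemma finite_measure_hist2: "finite_measure (hist_measure2 \<tau>)"
  by (intro finite_measure_pair_measure finite_measure_hist_measure)

lemma leb_open_eq_restrict_hist: "leb_open \<tau> = restrict_space (hist_measure \<tau>) {-\<tau><..<0}"
proof (rule measure_eqI)
  show "sets (leb_open \<tau>) = sets (restrict_space (hist_measure \<tau>) {-\<tau><..<0})"
    by (subst sets_restrict_space_cong[OF sets_hist_measure], subst sets_restrict_restrict_space,
        rule trans[OF sets_restrict_space_cong[of lborel borel]])
       (auto simp: intro!: arg_cong[where f="\<lambda>A. sets (restrict_space borel A)"])
  fix A assume A: "A \<in> sets (leb_open \<tau>)"
  then have A': "A \<subseteq> {-\<tau><..<0}" "A \<in> sets borel" by (auto simp: sets_restrict_space_iff)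
  then have "A \<in> sets (hist_measure \<tau>)" by (auto simp: sets_restrict_space image_iff intro!: bexI[of _ A])
  moreover have "{-\<tau><..<0} \<in> sets (restrict_space borel {-\<tau>..0})"
    by (auto simp: sets_restrict_space image_iff intro!: bexI[of _ "{-\<tau><..<0}"])
  ultimately show "emeasure (leb_open \<tau>) A = emeasure (restrict_space (hist_measure \<tau>) {-\<tau><..<0}) A"
    using A' by (subst (1 2) emeasure_restrict_space)
      (auto simp: emeasure_hist_measure Int_absorb2 greaterThanLessThan_subseteq_atLeastAtMost_iff indicator_def)
qed

lemma open_in_sets_hist: "{-\<tau><..<0} \<inter> space (hist_measure \<tau>) \<in> sets (hist_measure \<tau>)"
  by (auto simp: sets_restrict_space image_iff intro!: bexI[of _ "{-\<tau><..<0}"])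

lemma finite_measure_leb_open: "finite_measure (leb_open \<tau>)"
  unfolding leb_open_eq_restrict_hist
  by (rule finite_measure_restrict_space[OF finite_measure_hist_measure])
     (auto simp: sets_restrict_space image_iff intro!: bexI[of _ "{-\<tau><..<0}"])

lemma singleton_in_sets_hist: "a \<in> {-\<tau>..0} \<Longrightarrow> {a} \<in> sets (hist_measure \<tau>)"
  by (auto simp: sets_restrict_space image_iff intro!: bexI[of _ "{a}"])

lemma emeasure_hist_singleton:
  assumes "0 < \<tau>"
  shows "emeasure (hist_measure \<tau>) {0} = 1" "emeasure (hist_measure \<tau>) {-\<tau>} = 0"
  using assms by (simp_all add: emeasure_hist_measure[OF singleton_in_sets_hist])

text \<open>The endpoint \<open>-\<tau>\<close> is null and \<open>0\<close> is an atom of mass one,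
  so an almost-everywhere statement decides what happens at \<open>0\<close> itself. This is how
  boundary values are read off elements of \<open>L2\<close>.\<close>

lemma AE_hist_iff:
  assumes "0 < \<tau>"
  shows "(AE \<theta> in hist_measure \<tau>. P \<theta>) \<longleftrightarrow> (AE \<theta> in leb_open \<tau>. P \<theta>) \<and> P 0"
proof -
  have "AE \<theta> in hist_measure \<tau>. \<theta> \<noteq> -\<tau>"
    by (rule AE_I[of _ _ "{-\<tau>}"]) (use assms emeasure_hist_singleton singleton_in_sets_hist in auto)
  with AE_space have "AE \<theta> in hist_measure \<tau>. P \<theta> \<longleftrightarrow> (\<theta> \<in> {-\<tau><..<0} \<longrightarrow> P \<theta>) \<and> (\<theta> = 0 \<longrightarrow> P \<theta>)"
    by eventually_elim (auto simp: order_less_le)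
  then have "(AE \<theta> in hist_measure \<tau>. P \<theta>) \<longleftrightarrow>
     (AE \<theta> in hist_measure \<tau>. (\<theta> \<in> {-\<tau><..<0} \<longrightarrow> P \<theta>) \<and> (\<theta> = 0 \<longrightarrow> P \<theta>))"
    by (rule eventually_subst)
  also have "\<dots> \<longleftrightarrow> (AE \<theta> in leb_open \<tau>. P \<theta>) \<and> (AE \<theta> in hist_measure \<tau>. \<theta> = 0 \<longrightarrow> P \<theta>)"
    unfolding leb_open_eq_restrict_hist AE_restrict_space_iff[OF open_in_sets_hist] by simp
  also have "(AE \<theta> in hist_measure \<tau>. \<theta> = 0 \<longrightarrow> P \<theta>) \<longleftrightarrow> P 0"
  proof
    assume "AE \<theta> in hist_measure \<tau>. \<theta> = 0 \<longrightarrow> P \<theta>"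
    then obtain N where N: "{\<theta> \<in> space (hist_measure \<tau>). \<not> (\<theta> = 0 \<longrightarrow> P \<theta>)} \<subseteq> N"
      "emeasure (hist_measure \<tau>) N = 0" "N \<in> sets (hist_measure \<tau>)"
      by (rule AE_E)
    have "0 \<notin> N"
      using N(2) emeasure_mono[of "{0}" N "hist_measure \<tau>"] N(3) emeasure_hist_singleton[OF assms] by auto
    with N(1) assms show "P 0" by auto
  qed auto
  finally show ?thesis .
qed

lemma integral_hist:
  fixes f :: "real \<Rightarrow> 'b::{banach, second_countable_topology}"
  assumes "0 < \<tau>" "integrable (hist_measure \<tau>) f"
  shows "integrable (leb_open \<tau>) f" "(\<integral>\<theta>. f \<theta> \<partial>hist_measure \<tau>) = (\<integral>\<theta>. f \<theta> \<partial>leb_open \<tau>) + f 0"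
proof -
  interpret finite_measure "hist_measure \<tau>" by (rule finite_measure_hist_measure)
  have open_sets: "{-\<tau><..<0} \<in> sets (hist_measure \<tau>)"
    by (auto simp: sets_restrict_space image_iff intro!: bexI[of _ "{-\<tau><..<0}"])
  have i1: "integrable (hist_measure \<tau>) (\<lambda>\<theta>. indicator {-\<tau><..<0} \<theta> *\<^sub>R f \<theta>)"
    using integrable_mult_indicator[OF open_sets assms(2)] .
  have [measurable]: "f \<in> borel_measurable (hist_measure \<tau>)" "{-\<tau><..<0} \<in> sets (hist_measure \<tau>)"
    "{0} \<in> sets (hist_measure \<tau>)"
    using assms open_sets singleton_in_sets_hist[of 0 \<tau>] by auto
  show "integrable (leb_open \<tau>) f"
    unfolding leb_open_eq_restrict_hist using i1 by (simp add: integrable_restrict_space[OF open_in_sets_hist])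
  have "(\<integral>\<theta>. f \<theta> \<partial>hist_measure \<tau>) = (\<integral>\<theta>. indicator {-\<tau><..<0} \<theta> *\<^sub>R f \<theta> + indicator {0} \<theta> *\<^sub>R f 0 \<partial>hist_measure \<tau>)"
  proof (rule integral_cong_AE)
    show "AE \<theta> in hist_measure \<tau>. f \<theta> = indicator {-\<tau><..<0} \<theta> *\<^sub>R f \<theta> + indicator {0} \<theta> *\<^sub>R f 0"
      unfolding AE_hist_iff[OF assms(1)] by (auto intro!: AE_I2)
  qed measurable
  also have "\<dots> = (\<integral>\<theta>. indicator {-\<tau><..<0} \<theta> *\<^sub>R f \<theta> \<partial>hist_measure \<tau>) + (\<integral>\<theta>. indicator {0} \<theta> *\<^sub>R f 0 \<partial>hist_measure \<tau>)"
    using integrable_real_indicator[OF \<open>{0} \<in> sets (hist_measure \<tau>)\<close>] assms emeasure_hist_singleton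
    by (intro Bochner_Integration.integral_add i1 integrable_scaleR_left) simp
  also have "(\<integral>\<theta>. indicator {0} \<theta> *\<^sub>R f 0 \<partial>hist_measure \<tau>) = f 0"
    using integrable_real_indicator[OF \<open>{0} \<in> sets (hist_measure \<tau>)\<close>] assms emeasure_hist_singleton
    by (subst integral_scaleR_left) (auto simp: measure_def)
  also have "(\<integral>\<theta>. indicator {-\<tau><..<0} \<theta> *\<^sub>R f \<theta> \<partial>hist_measure \<tau>) = (\<integral>\<theta>. f \<theta> \<partial>leb_open \<tau>)"
    unfolding leb_open_eq_restrict_hist by (simp add: integral_restrict_space[OF open_in_sets_hist])
  finally show "(\<integral>\<theta>. f \<theta> \<partial>hist_measure \<tau>) = (\<integral>\<theta>. f \<theta> \<partial>leb_open \<tau>) + f 0" .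
qed

lemma L2_hist_imp_leb_open:
  assumes "0 < \<tau>" "f \<in> L2 (hist_measure \<tau>)"
  shows "f \<in> L2 (leb_open \<tau>)"
proof -
  have "f \<in> borel_measurable (leb_open \<tau>)"
    using L2_measurable[OF assms(2)] unfolding leb_open_eq_restrict_hist by (rule measurable_restrict_space1)
  then show ?thesis
    using integral_hist(1)[OF assms(1) L2_integrable_square[OF assms(2)]] by (simp add: L2_def)
qed

text \<open>Fubini gives square integrability of almost every section, and the section at the atom
  \<open>0\<close> cannot be exceptional. It is the trace of \<open>d\<close> on the edge where the
  first variable is \<open>0\<close>.\<close>

lemma L2_section_at_0:
  assumes "0 < \<tau>" "d \<in> L2 (hist_measure2 \<tau>)"
  shows "(\<lambda>\<theta>. d (0, \<theta>)) \<in> L2 (hist_measure \<tau>)"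
proof -
  interpret finite_measure "hist_measure \<tau>" by (rule finite_measure_hist_measure)
  interpret pair_sigma_finite "hist_measure \<tau>" "hist_measure \<tau>" ..
  have "0 \<in> space (hist_measure \<tau>)" using assms by simp
  then have "(\<lambda>\<theta>. d (0, \<theta>)) \<in> borel_measurable (hist_measure \<tau>)"
    using L2_measurable[OF assms(2)] by (rule measurable_Pair2[rotated])
  moreover have "AE x in hist_measure \<tau>. integrable (hist_measure \<tau>) (\<lambda>\<theta>. (cmod (d (x, \<theta>)))\<^sup>2)"
    using AE_integrable_fst'[OF L2_integrable_square[OF assms(2)]] .
  ultimately show ?thesis unfolding AE_hist_iff[OF assms(1)] by (simp add: L2_def)
qed

lemma continuous_on_L2_hist:
  assumes "continuous_on {-\<tau>..0} f"
  shows "f \<in> L2 (hist_measure \<tau>)"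
proof -
  have "bounded (f ` {-\<tau>..0})" by (intro compact_imp_bounded compact_continuous_image assms) simp
  then obtain B where "\<And>x. x \<in> {-\<tau>..0} \<Longrightarrow> cmod (f x) \<le> B" unfolding bounded_iff by blast
  moreover have "f \<in> borel_measurable (hist_measure \<tau>)"
    using borel_measurable_continuous_on_restrict[OF assms] by (simp cong: measurable_cong_sets)
  ultimately show ?thesis by (intro L2_bounded[OF finite_measure_hist_measure, of f \<tau> B]) auto
qed

lemma closed_subspace_L2_wedge: "closed_subspace (hist_measure2 \<tau>) (L2_wedge \<tau>)"
proof -
  let ?M = "hist_measure2 \<tau>"
  \<comment> \<open>Antisymmetry is rewritten as the vanishing of the norm of \<open>f\<close> plus
    its swap, a condition that survives norm limits.\<close>
  have mem: "f \<in> L2_wedge \<tau> \<longleftrightarrow> f \<in> L2 ?M \<and> L2_norm ?M (\<lambda>z. f z + f (snd z, fst z)) = 0" for f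
  proof (cases "f \<in> L2 ?M")
    case True
    have s: "(\<lambda>z. f z + f (snd z, fst z)) \<in> L2 ?M"
      by (intro L2_add True L2_norm_swap(1)[OF finite_measure_hist_measure])
    show ?thesis unfolding L2_norm_eq_0[OF s] using True
      by (auto simp: L2_wedge_def add_eq_0_iff2 elim!: eventually_mono)
  qed (simp add: L2_wedge_def)
  show ?thesis
    unfolding closed_subspace_def
  proof (intro conjI ballI allI impI)
    show "L2_wedge \<tau> \<subseteq> L2 ?M" by (auto simp: L2_wedge_def)
    show "(\<lambda>x. 0) \<in> L2_wedge \<tau>" by (simp add: L2_wedge_def L2_zero)
    fix f g a b assume fg: "f \<in> L2_wedge \<tau>" "g \<in> L2_wedge \<tau>"
    then have "AE z in ?M. f z = - f (snd z, fst z)" "AE z in ?M. g z = - g (snd z, fst z)"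
      by (auto simp: L2_wedge_def)
    then have "AE z in ?M. a * f z + b * g z = - (a * f (snd z, fst z) + b * g (snd z, fst z))"
      by eventually_elim simp
    with fg show "(\<lambda>x. a * f x + b * g x) \<in> L2_wedge \<tau>"
      by (auto simp: L2_wedge_def intro!: L2_lincomb)
  next
    fix f assume f: "f \<in> L2 ?M" and ex: "\<forall>e>0. \<exists>g\<in>L2_wedge \<tau>. L2_norm ?M (\<lambda>x. f x - g x) < e"
    have "L2_norm ?M (\<lambda>z. f z + f (snd z, fst z)) \<le> 0"
    proof (rule field_le_epsilon)
      fix e :: real assume "e > 0"
      then obtain g where g: "g \<in> L2_wedge \<tau>" "L2_norm ?M (\<lambda>x. f x - g x) < e / 2"
        using ex[rule_format, of "e / 2"] by auto
      have gL: "g \<in> L2 ?M" using g by (auto simp: L2_wedge_def)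
      note sw = L2_norm_swap[OF finite_measure_hist_measure]
      have d: "(\<lambda>z. f z - g z) \<in> L2 ?M" by (intro L2_diff f gL)
      have sum: "(\<lambda>z. f z + f (snd z, fst z)) \<in> L2 ?M" "(\<lambda>z. g z + g (snd z, fst z)) \<in> L2 ?M"
        by (intro L2_add f gL sw(1))+
      have "L2_norm ?M (\<lambda>z. f z + f (snd z, fst z))
          \<le> L2_norm ?M (\<lambda>z. g z + g (snd z, fst z))
            + L2_norm ?M (\<lambda>z. (f z + f (snd z, fst z)) - (g z + g (snd z, fst z)))"
        by (rule L2_norm_triangle_sub[OF sum])
      also have "L2_norm ?M (\<lambda>z. g z + g (snd z, fst z)) = 0" using g mem by blast
      also have "(\<lambda>z. (f z + f (snd z, fst z)) - (g z + g (snd z, fst z)))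
          = (\<lambda>z. (f z - g z) + (f (snd z, fst z) - g (snd z, fst z)))" by auto
      also have "L2_norm ?M \<dots> \<le> L2_norm ?M (\<lambda>z. f z - g z) + L2_norm ?M (\<lambda>z. f (snd z, fst z) - g (snd z, fst z))"
        by (rule L2_norm_triangle[OF d sw(1)[OF d]])
      also have "L2_norm ?M (\<lambda>z. f (snd z, fst z) - g (snd z, fst z)) = L2_norm ?M (\<lambda>z. f z - g z)"
        by (rule sw(2)[OF d])
      finally show "L2_norm ?M (\<lambda>z. f z + f (snd z, fst z)) \<le> 0 + e" using g(2) by simp
    qed
    then show "f \<in> L2_wedge \<tau>" using f L2_norm_nonneg order_antisym unfolding mem by blast
  qed
qed

lemma wedge_eq_tensor: "wedge f g = (\<lambda>z. 1 / 2 * tensor f g z + (- 1 / 2) * tensor g f z)"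
  by (auto simp: wedge_def tensor_def diff_divide_distrib)

lemma L2_norm_wedge:
  assumes "f \<in> L2 (hist_measure \<tau>)" "g \<in> L2 (hist_measure \<tau>)"
  shows "wedge f g \<in> L2_wedge \<tau>"
    and "L2_norm (hist_measure2 \<tau>) (wedge f g) \<le> L2_norm (hist_measure \<tau>) f * L2_norm (hist_measure \<tau>) g"
proof -
  note t = L2_tensor[OF finite_measure_hist_measure finite_measure_hist_measure]
  have "wedge f g \<in> L2 (hist_measure2 \<tau>)"
    unfolding wedge_eq_tensor by (intro L2_lincomb t assms)
  then show "wedge f g \<in> L2_wedge \<tau>"
    by (auto simp: L2_wedge_def wedge_def case_prod_beta' field_simps intro!: AE_I2)
  have "L2_norm (hist_measure2 \<tau>) (wedge f g)
    \<le> cmod (1 / 2) * L2_norm (hist_measure2 \<tau>) (tensor f g) + cmod (- 1 / 2) * L2_norm (hist_measure2 \<tau>) (tensor g f)"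
    unfolding wedge_eq_tensor by (intro L2_norm_triangle_lincomb t assms)
  also have "\<dots> = L2_norm (hist_measure \<tau>) f * L2_norm (hist_measure \<tau>) g"
    by (simp add: t assms mult.commute)
  finally show "L2_norm (hist_measure2 \<tau>) (wedge f g) \<le> L2_norm (hist_measure \<tau>) f * L2_norm (hist_measure \<tau>) g" .
qed

section \<open>Smooth cut-off functions\<close>

text \<open>The sequence of all derivatives is carried as a witness, which makes closure under
  differences, affine substitutions and antiderivatives immediate.
  \<open>smooth_real_deriv_funpow\<close> converts it to the iterated \<open>deriv\<close> that
  \<open>test_function\<close> asks for.\<close>

definition smooth_real :: "(real \<Rightarrow> real) \<Rightarrow> bool" where
  "smooth_real f \<longleftrightarrow> (\<exists>F. F 0 = f \<and> (\<forall>n x. (F n has_field_derivative F (Suc n) x) (at x)))"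

lemma smooth_realI_closed:
  assumes "f \<in> X" "\<And>g. g \<in> X \<Longrightarrow> \<exists>g'\<in>X. \<forall>x. (g has_field_derivative g' x) (at x)"
  shows "smooth_real f"
proof -
  obtain D where D: "\<And>g. g \<in> X \<Longrightarrow> D g \<in> X" "\<And>g x. g \<in> X \<Longrightarrow> (g has_field_derivative D g x) (at x)"
    using assms(2) by metis
  have "(D ^^ n) f \<in> X" for n by (induction n) (auto simp: assms(1) D(1))
  then show ?thesis unfolding smooth_real_def
    by (intro exI[of _ "\<lambda>n. (D ^^ n) f"]) (auto intro: D(2))
qed

lemma smooth_real_deriv_funpow:
  assumes "smooth_real f"
  shows "((deriv ^^ n) f) field_differentiable (at x)"
proof -
  obtain F where F: "F 0 = f" "\<And>n x. (F n has_field_derivative F (Suc n) x) (at x)"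
    using assms by (auto simp: smooth_real_def)
  have "(deriv ^^ n) f = F n" for n
  proof (induction n)
    case (Suc n)
    have "deriv (F n) = F (Suc n)" using F(2) by (intro ext DERIV_imp_deriv)
    then show ?case using Suc by simp
  qed (simp add: F)
  then show ?thesis using F(2) by (metis field_differentiable_def)
qed

lemma smooth_real_diff:
  assumes "smooth_real f" "smooth_real g"
  shows "smooth_real (\<lambda>x. f x - g x)"
proof -
  obtain F where F: "F 0 = f" "\<And>n x. (F n has_field_derivative F (Suc n) x) (at x)"
    using assms by (auto simp: smooth_real_def)
  obtain G where G: "G 0 = g" "\<And>n x. (G n has_field_derivative G (Suc n) x) (at x)"
    using assms by (auto simp: smooth_real_def)
  show ?thesis unfolding smooth_real_def
    by (intro exI[of _ "\<lambda>n x. F n x - G n x"]) (auto simp: F G intro!: derivative_intros)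
qed

lemma smooth_real_affine:
  assumes "smooth_real f"
  shows "smooth_real (\<lambda>x. f (c * x + d))"
proof -
  obtain F where F: "F 0 = f" "\<And>n x. (F n has_field_derivative F (Suc n) x) (at x)"
    using assms by (auto simp: smooth_real_def)
  have "((\<lambda>x. c ^ n * F n (c * x + d)) has_field_derivative c ^ Suc n * F (Suc n) (c * x + d)) (at x)" for n x
    by (rule derivative_eq_intros DERIV_chain'[where g="F n", OF _ F(2)] | simp)+
  then show ?thesis unfolding smooth_real_def
    by (intro exI[of _ "\<lambda>n x. c ^ n * F n (c * x + d)"]) (auto simp: F)
qed

lemma smooth_real_antiderivative:
  assumes "smooth_real f" "\<And>x. (g has_field_derivative f x) (at x)"
  shows "smooth_real g"
proof -
  obtain F where F: "F 0 = f" "\<And>n x. (F n has_field_derivative F (Suc n) x) (at x)"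
    using assms by (auto simp: smooth_real_def)
  have "((\<lambda>n. case n of 0 \<Rightarrow> g | Suc m \<Rightarrow> F m) n has_field_derivative
     (\<lambda>n. case n of 0 \<Rightarrow> g | Suc m \<Rightarrow> F m) (Suc n) x) (at x)" for n x
    using assms(2) F by (cases n) auto
  then show ?thesis unfolding smooth_real_def
    by (intro exI[of _ "\<lambda>n. case n of 0 \<Rightarrow> g | Suc m \<Rightarrow> F m"]) auto
qed

text \<open>The classical function that is flat at \<open>0\<close>, with a polynomial factor in
  \<open>1 / x\<close> that makes the family stable under differentiation.\<close>

definition flat_exp :: "real poly \<Rightarrow> real \<Rightarrow> real" where
  "flat_exp q x = (if x > 0 then poly q (1 / x) * exp (- (1 / x)) else 0)"

lemma tendsto_poly_times_exp_minus: "((\<lambda>y. poly q y * exp (- y)) \<longlongrightarrow> (0::real)) at_top"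
proof -
  have "((\<lambda>y. \<Sum>i\<le>degree q. coeff q i * (y ^ i / exp y)) \<longlongrightarrow> (\<Sum>i\<le>degree q. coeff q i * 0)) at_top"
    by (intro tendsto_sum tendsto_mult tendsto_const tendsto_power_div_exp_0)
  then show ?thesis
    by (simp add: poly_altdef sum_distrib_left exp_minus divide_inverse mult_ac)
qed

text \<open>For \<open>x > 0\<close> the chain rule produces \<open>(1 / x)^2\<close> times
  \<open>q - pderiv q\<close> at \<open>1 / x\<close>. At \<open>0\<close> the exponential beats
  every polynomial in \<open>1 / x\<close>, so both one-sided quotients tend to
  \<open>0\<close>.\<close>

lemma DERIV_flat_exp:
  "(flat_exp q has_field_derivative flat_exp ([:0, 0, 1:] * (q - pderiv q)) x) (at x)"
proof -
  consider "x > 0" | "x < 0" | "x = 0" by linarith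
  then show ?thesis
  proof cases
    case 1
    have "((\<lambda>x. poly q (1 / x) * exp (- (1 / x))) has_field_derivative
        flat_exp ([:0, 0, 1:] * (q - pderiv q)) x) (at x)"
      using 1 unfolding flat_exp_def
      by (auto intro!: derivative_eq_intros DERIV_chain'[where g="poly q", OF _ poly_DERIV]
          simp: field_simps power2_eq_square)
    moreover have "eventually (\<lambda>y. y > 0) (nhds x)" using eventually_nhds_in_open[of "{0<..}" x] 1 by simp
    then have "eventually (\<lambda>y. flat_exp q y = poly q (1 / y) * exp (- (1 / y))) (nhds x)"
      by eventually_elim (simp add: flat_exp_def)
    ultimately show ?thesis by (subst DERIV_cong_ev[OF refl _ refl])
  next
    case 2
    have "eventually (\<lambda>y. y < 0) (nhds x)" using eventually_nhds_in_open[of "{..<0}" x] 2 by simp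
    then have "eventually (\<lambda>y. flat_exp q y = 0) (nhds x)"
      by eventually_elim (simp add: flat_exp_def)
    then show ?thesis using 2 by (subst DERIV_cong_ev[OF refl _ refl]) (auto simp: flat_exp_def)
  next
    case 3
    have r: "((\<lambda>h. flat_exp q h / h) \<longlongrightarrow> 0) (at_right 0)"
    proof (subst filterlim_at_right_to_top, rule Lim_transform_eventually)
      show "((\<lambda>y. poly ([:0, 1:] * q) y * exp (- y)) \<longlongrightarrow> 0) at_top"
        by (rule tendsto_poly_times_exp_minus)
      show "\<forall>\<^sub>F y in at_top. poly ([:0, 1:] * q) y * exp (- y) = flat_exp q (inverse y) / inverse y"
        using eventually_gt_at_top[of 0]
        by eventually_elim (simp add: flat_exp_def divide_inverse mult_ac)
    qed
    have l: "((\<lambda>h. flat_exp q h / h) \<longlongrightarrow> 0) (at_left 0)"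
    proof (rule Lim_transform_eventually[OF tendsto_const])
      show "\<forall>\<^sub>F h in at_left 0. 0 = flat_exp q h / h"
        by (rule eventually_mono[OF eventually_at_left_real[of "-1" 0]]) (auto simp: flat_exp_def)
    qed
    show ?thesis using filterlim_split_at[OF l r] 3 by (simp add: DERIV_def flat_exp_def)
  qed
qed

inductive_set bumps :: "(real \<Rightarrow> real) set" where
  base: "(\<lambda>x. flat_exp q x * flat_exp r (1 - x)) \<in> bumps"
| add: "f \<in> bumps \<Longrightarrow> g \<in> bumps \<Longrightarrow> (\<lambda>x. f x + g x) \<in> bumps"

lemma smooth_bumps: "f \<in> bumps \<Longrightarrow> smooth_real f"
proof (erule smooth_realI_closed)
  fix g assume "g \<in> bumps"
  then show "\<exists>g'\<in>bumps. \<forall>x. (g has_field_derivative g' x) (at x)"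
  proof induction
    case (base q r)
    define Dq where "Dq = [:0, 0, 1:] * (q - pderiv q)"
    define Dr where "Dr = [:0, 0, 1:] * (r - pderiv r)"
    have neg: "flat_exp (- Dr) x = - flat_exp Dr x" for x by (simp add: flat_exp_def)
    have c: "((\<lambda>x. flat_exp r (1 - x)) has_field_derivative flat_exp Dr (1 - x) * (- 1)) (at x)" for x
      unfolding Dr_def by (rule DERIV_chain'[where g="flat_exp r", OF _ DERIV_flat_exp])
        (auto intro!: derivative_eq_intros)
    have "((\<lambda>x. flat_exp q x * flat_exp r (1 - x)) has_field_derivative
      flat_exp Dq x * flat_exp r (1 - x) + flat_exp q x * flat_exp (- Dr) (1 - x)) (at x)" for x
      using DERIV_mult[OF DERIV_flat_exp c] by (simp add: neg Dq_def mult.commute add.commute)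
    then show ?case by (intro bexI[of _ "\<lambda>x. flat_exp Dq x * flat_exp r (1 - x) + flat_exp q x * flat_exp (- Dr) (1 - x)"])
      (auto intro!: bumps.intros)
  next
    case (add f g)
    then obtain f' g' where "f' \<in> bumps" "g' \<in> bumps" "\<And>x. (f has_field_derivative f' x) (at x)"
      "\<And>x. (g has_field_derivative g' x) (at x)" by blast
    then show ?case by (intro bexI[of _ "\<lambda>x. f' x + g' x"]) (auto intro!: bumps.intros derivative_intros)
  qed
qed

text \<open>A smooth step is the primitive of a bump, divided by its total mass. Rescaled,
  \<open>b\<close> serves as a mollifier and \<open>B\<close> as a smoothed indicator of a
  half-line.\<close>

lemma smooth_step_exists:
  "\<exists>B b :: real \<Rightarrow> real. smooth_real B \<and> (\<forall>x. (B has_field_derivative b x) (at x)) \<and> continuous_on UNIV b \<and>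
     (\<forall>x. b x \<ge> 0) \<and> (\<forall>x\<le>0. B x = 0) \<and> (\<forall>x\<ge>1. B x = 1) \<and> (\<forall>x. x \<notin> {0..1} \<longrightarrow> b x = 0) \<and> (\<forall>x. 0 \<le> B x \<and> B x \<le> 1)"
proof -
  define f where "f x = flat_exp 1 x * flat_exp 1 (1 - x)" for x
  have fb: "f \<in> bumps" unfolding f_def by (rule bumps.base)
  have f_nonneg: "f x \<ge> 0" and f_out: "x \<notin> {0<..<1} \<Longrightarrow> f x = 0" for x
    by (auto simp: f_def flat_exp_def)
  have sf: "smooth_real f" using smooth_bumps[OF fb] .
  then have fc: "continuous_on S f" for S
    unfolding smooth_real_def by (meson DERIV_continuous_on has_field_derivative_at_within)
  define C where "C x = integral {-1..x} f" for x
  have C_le: "C x = 0" if "x \<le> 0" for x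
    unfolding C_def using that f_out by (intro integral_unique has_integral_is_0) auto
  have dC: "(C has_field_derivative f x) (at x)" for x
  proof (cases "x < 0")
    case True
    then have "eventually (\<lambda>y. C y = 0) (nhds x)"
      using eventually_nhds_in_open[of "{..<0}" x] by (auto elim!: eventually_mono simp: C_le)
    then show ?thesis using True f_out[of x] by (subst DERIV_cong_ev[OF refl _ refl]) auto
  next
    case False
    have "(C has_field_derivative f x) (at x within {-1..x+1})"
      unfolding C_def using False by (intro integral_has_real_derivative fc) auto
    moreover have "at x within {-1..x+1} = at x"
      using False by (intro at_within_interior) (auto simp: interior_atLeastAtMost_real)
    ultimately show ?thesis by simp
  qed
  have mono: "C x \<le> C y" if "x \<le> y" for x y
    using that dC f_nonneg by (meson DERIV_nonneg_imp_nondecreasing)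
  \<comment> \<open>Zero mass would make the nondecreasing \<open>C\<close> constant on
    \<open>(0, 1)\<close>, and the bump would vanish at \<open>1 / 2\<close>, where it is a product
    of two exponentials.\<close>
  have pos: "C 1 > 0"
  proof (rule ccontr)
    assume "\<not> C 1 > 0"
    then have "C x = 0" if "x \<in> {0<..<1}" for x using mono[of 0 x] mono[of x 1] C_le[of 0] that by auto
    then have "eventually (\<lambda>x. C x = 0) (nhds (1 / 2))"
      using eventually_nhds_in_open[of "{0<..<1}" "1/2 :: real"] by (auto elim!: eventually_mono)
    from DERIV_cong_ev[OF refl this refl] have "(C has_field_derivative 0) (at (1 / 2))" by simp
    then have "f (1 / 2) = 0" using DERIV_unique dC by blast
    then show False by (simp add: f_def flat_exp_def)
  qed
  have C_ge: "C x = C 1" if "x \<ge> 1" for x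
  proof -
    have "integral {-1..1} f + integral {1..x} f = integral {-1..x} f"
      using that by (intro Henstock_Kurzweil_Integration.integral_combine integrable_continuous_real fc) auto
    moreover have "integral {1..x} f = 0" using f_out by (intro integral_unique has_integral_is_0) auto
    ultimately show ?thesis by (simp add: C_def)
  qed
  define B where "B x = C x / C 1" for x
  define b where "b x = f x / C 1" for x
  have dB: "(B has_field_derivative b x) (at x)" for x
    unfolding B_def b_def by (intro DERIV_cdivide dC)
  have "smooth_real b"
  proof -
    obtain F where F: "F 0 = f" "\<And>n x. (F n has_field_derivative F (Suc n) x) (at x)"
      using sf by (auto simp: smooth_real_def)
    show ?thesis unfolding smooth_real_def b_def
      by (intro exI[of _ "\<lambda>n x. F n x / C 1"]) (auto simp: F intro!: DERIV_cdivide)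
  qed
  then have "smooth_real B" using dB by (rule smooth_real_antiderivative)
  moreover have "continuous_on UNIV b" unfolding b_def by (intro continuous_intros fc) (use pos in auto)
  moreover have "0 \<le> B x \<and> B x \<le> 1" for x
  proof -
    have "C x \<ge> 0" using mono[of "min x 0" x] C_le[of "min x 0"] by simp
    moreover have "C x \<le> C 1" using mono[of x "max x 1"] C_ge[of "max x 1"] by simp
    ultimately show ?thesis using pos by (simp add: B_def)
  qed
  moreover have "b x \<ge> 0" "x \<notin> {0..1} \<Longrightarrow> b x = 0" for x
    using f_nonneg[of x] f_out[of x] pos by (auto simp: b_def)
  moreover have "B x = 0" if "x \<le> 0" for x using C_le[OF that] by (simp add: B_def)
  moreover have "B x = 1" if "x \<ge> 1" for x using C_ge[OF that] pos by (simp add: B_def)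
  ultimately show ?thesis
    using dB by blast
qed

section \<open>Sobolev functions and the delay operator\<close>

lemma DERIV_affine_arg:
  fixes B b :: "real \<Rightarrow> real"
  assumes "\<And>x. (B has_field_derivative b x) (at x)"
  shows "((\<lambda>t. B (r * (t - x))) has_field_derivative r * b (r * (t - x))) (at t)"
proof -
  have "((\<lambda>t. r * (t - x)) has_field_derivative r) (at t)" by (auto intro!: derivative_eq_intros)
  from DERIV_chain'[OF this assms] show ?thesis by (simp add: mult.commute)
qed

text \<open>The functions \<open>r n * b (r n * (t - x))\<close> are probability densities on
  \<open>[x, x + 1 / r n]\<close>, hence an approximate identity at \<open>x\<close>. The condition
  \<open>1 / r n < - x\<close> keeps these intervals inside the history interval.\<close>

lemma mollifier_tendsto:
  fixes \<psi> :: "real \<Rightarrow> complex" and B b :: "real \<Rightarrow> real" and r :: "nat \<Rightarrow> real"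
  assumes x: "-\<tau> < x" "x < 0" and cont: "continuous_on {-\<tau>..0} \<psi>"
    and r: "\<And>n. r n > 0" "\<And>n. 1 / r n < - x" "filterlim r at_top sequentially"
    and B: "\<And>x. (B has_field_derivative b x) (at x)" "continuous_on UNIV b" "\<And>x. b x \<ge> 0"
      "\<And>x. x \<le> 0 \<Longrightarrow> B x = 0" "\<And>x. x \<ge> 1 \<Longrightarrow> B x = 1" "\<And>x. x \<notin> {0..1} \<Longrightarrow> b x = 0"
  shows "integrable (leb_open \<tau>) (\<lambda>t. \<psi> t * complex_of_real (r n * b (r n * (t - x))))"
    and "(\<lambda>n. \<integral>t. \<psi> t * complex_of_real (r n * b (r n * (t - x))) \<partial>leb_open \<tau>) \<longlonglongrightarrow> \<psi> x"
proof -
  define g where "g n t = r n * b (r n * (t - x))" for n t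
  have gnn: "g n t \<ge> 0" for n t using r(1)[of n] B(3) by (simp add: g_def)
  have gout: "g n t = 0" if "t \<notin> {x..x + 1 / r n}" for n t
  proof -
    have "r n * (t - x) \<notin> {0..1}" using that r(1)[of n] by (auto simp: field_simps zero_le_mult_iff)
    then show ?thesis using B(6) by (simp add: g_def)
  qed
  have "has_bochner_integral lborel (\<lambda>t. g n t * indicator {x..x + 1 / r n} t)
     (B (r n * (x + 1 / r n - x)) - B (r n * (x - x)))" for n
  proof (rule has_bochner_integral_FTC_Icc_real)
    show "x \<le> x + 1 / r n" using r(1)[of n] by simp
    show "((\<lambda>t. B (r n * (t - x))) has_field_derivative g n t) (at t)" for t
      unfolding g_def by (rule DERIV_affine_arg[OF B(1)])
    show "isCont (g n) t" for t
      unfolding g_def using continuous_on_compose2[OF B(2), of UNIV "\<lambda>t. r n * (t - x)"]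
      by (auto simp: continuous_on_eq_continuous_at intro!: continuous_intros)
  qed
  note hb0 = this
  have "has_bochner_integral lborel (\<lambda>t. g n t * indicator {x..x + 1 / r n} t) 1" for n
    using hb0[of n] B(4)[of 0] B(5)[of 1] r(1)[of n] by simp
  moreover have "(\<lambda>t. g n t * indicator {x..x + 1 / r n} t) = (\<lambda>t. indicator {-\<tau><..<0} t *\<^sub>R g n t)" for n
    using gout[of _ n] r(2)[of n] x by (auto simp: indicator_def fun_eq_iff)
  ultimately have hb: "has_bochner_integral lborel (\<lambda>t. indicator {-\<tau><..<0} t *\<^sub>R g n t) 1" for n by metis
  have ig: "integrable (leb_open \<tau>) (g n)" "(\<integral>t. g n t \<partial>leb_open \<tau>) = 1" for n
    using hb[of n] by (simp_all add: integrable_restrict_space integral_restrict_space has_bochner_integral_iff)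
  have "bounded (\<psi> ` {-\<tau>..0})" by (intro compact_imp_bounded compact_continuous_image cont) simp
  then obtain C where C: "\<And>t. t \<in> {-\<tau>..0} \<Longrightarrow> cmod (\<psi> t) \<le> C" unfolding bounded_iff by blast
  have \<psi>m: "\<psi> \<in> borel_measurable (leb_open \<tau>)"
    using borel_measurable_continuous_on_restrict[OF continuous_on_subset[OF cont], of "{-\<tau><..<0}"]
    by (auto simp: greaterThanLessThan_subseteq_atLeastAtMost_iff cong: measurable_cong_sets)
  have i\<psi>: "integrable (leb_open \<tau>) (\<lambda>t. \<psi> t * complex_of_real (g n t))" for n
  proof (rule Bochner_Integration.integrable_bound[where f="\<lambda>t. C * g n t"])
    show "(\<lambda>t. \<psi> t * complex_of_real (g n t)) \<in> borel_measurable (leb_open \<tau>)"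
      using \<psi>m borel_measurable_integrable[OF ig(1)[of n]] by measurable
    show "AE t in leb_open \<tau>. norm (\<psi> t * complex_of_real (g n t)) \<le> norm (C * g n t)"
    proof (intro AE_I2)
      fix t assume "t \<in> space (leb_open \<tau>)"
      then have "cmod (\<psi> t) \<le> \<bar>C\<bar>" using C[of t] by auto
      then show "norm (\<psi> t * complex_of_real (g n t)) \<le> norm (C * g n t)"
        by (simp add: norm_mult abs_mult mult_right_mono)
    qed
  qed (intro integrable_mult_right ig)
  then show "integrable (leb_open \<tau>) (\<lambda>t. \<psi> t * complex_of_real (r n * b (r n * (t - x))))"
    by (simp add: g_def)
  have "(\<lambda>n. \<integral>t. \<psi> t * complex_of_real (g n t) \<partial>leb_open \<tau>) \<longlonglongrightarrow> \<psi> x"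
  proof (rule LIMSEQ_I)
    fix e :: real assume e: "e > 0"
    have "continuous (at x within {-\<tau>..0}) \<psi>" using cont x by (auto simp: continuous_on_eq_continuous_within)
    then obtain \<delta> where \<delta>: "\<delta> > 0" "\<And>t. t \<in> {-\<tau>..0} \<Longrightarrow> dist t x < \<delta> \<Longrightarrow> dist (\<psi> t) (\<psi> x) < e / 2"
      unfolding continuous_within_eps_delta using e by (meson half_gt_zero)
    have "eventually (\<lambda>n. r n > 1 / \<delta>) sequentially" using r(3) by (simp add: filterlim_at_top_dense)
    then obtain n0 where n0: "\<And>n. n \<ge> n0 \<Longrightarrow> r n > 1 / \<delta>" by (auto simp: eventually_sequentially)
    show "\<exists>n0. \<forall>n\<ge>n0. norm ((\<integral>t. \<psi> t * complex_of_real (g n t) \<partial>leb_open \<tau>) - \<psi> x) < e"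
    proof (intro exI allI impI)
      fix n assume n: "n \<ge> n0"
      have dn: "1 / r n < \<delta>" using n0[OF n] r(1)[of n] \<delta>(1) by (simp add: field_simps)
      have ig': "integrable (leb_open \<tau>) (\<lambda>t. \<psi> x * complex_of_real (g n t))"
        by (intro integrable_mult_right integrable_of_real ig)
      have "(\<integral>t. \<psi> t * complex_of_real (g n t) \<partial>leb_open \<tau>) - \<psi> x
          = (\<integral>t. \<psi> t * complex_of_real (g n t) \<partial>leb_open \<tau>) - (\<integral>t. \<psi> x * complex_of_real (g n t) \<partial>leb_open \<tau>)"
        using ig(2)[of n] by (simp add: integral_complex_of_real)
      also have "\<dots> = (\<integral>t. \<psi> t * complex_of_real (g n t) - \<psi> x * complex_of_real (g n t) \<partial>leb_open \<tau>)"
        by (rule Bochner_Integration.integral_diff[OF i\<psi> ig', symmetric])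
      also have "norm \<dots> \<le> (\<integral>t. norm (\<psi> t * complex_of_real (g n t) - \<psi> x * complex_of_real (g n t)) \<partial>leb_open \<tau>)"
        by (rule integral_norm_bound)
      also have "\<dots> \<le> (\<integral>t. e / 2 * g n t \<partial>leb_open \<tau>)"
      proof (rule integral_mono)
        show "integrable (leb_open \<tau>) (\<lambda>t. norm (\<psi> t * complex_of_real (g n t) - \<psi> x * complex_of_real (g n t)))"
          by (intro integrable_norm Bochner_Integration.integrable_diff i\<psi> ig')
        show "integrable (leb_open \<tau>) (\<lambda>t. e / 2 * g n t)" by (intro integrable_mult_right ig)
        fix t assume t: "t \<in> space (leb_open \<tau>)"
        show "norm (\<psi> t * complex_of_real (g n t) - \<psi> x * complex_of_real (g n t)) \<le> e / 2 * g n t"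
        proof (cases "t \<in> {x..x + 1 / r n}")
          case True
          then have "dist (\<psi> t) (\<psi> x) < e / 2" using dn t by (intro \<delta>(2)) (auto simp: dist_real_def)
          then have "cmod (\<psi> t - \<psi> x) * g n t \<le> e / 2 * g n t"
            using gnn[of n t] by (intro mult_right_mono) (auto simp: dist_norm)
          then have "norm ((\<psi> t - \<psi> x) * complex_of_real (g n t)) \<le> e / 2 * g n t"
            using gnn[of n t] by (simp add: norm_mult)
          then show ?thesis by (simp add: left_diff_distrib)
        qed (simp add: gout)
      qed
      also have "\<dots> = e / 2" using ig by simp
      finally show "norm ((\<integral>t. \<psi> t * complex_of_real (g n t) \<partial>leb_open \<tau>) - \<psi> x) < e" using e by simp
    qed
  qed
  then show "(\<lambda>n. \<integral>t. \<psi> t * complex_of_real (r n * b (r n * (t - x))) \<partial>leb_open \<tau>) \<longlonglongrightarrow> \<psi> x"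
    by (simp add: g_def)
qed

lemma L2_imp_integrable:
  assumes "finite_measure M" "f \<in> L2 M"
  shows "integrable M f"
  using L2_mult_integrable[OF assms(2) L2_bounded[OF assms(1), of "\<lambda>_. 1" 1]] by simp

text \<open>The weak derivative is tested with a smoothed indicator of \<open>(x, y]\<close>, a
  difference of two steps. The derivative of this test function is a difference of two mollifiers,
  so one side tends to \<open>\<psi> x - \<psi> y\<close> and the other to minus the integral of
  \<open>\<psi>'\<close>.\<close>

lemma sobolev_increment:
  assumes W: "sobolev_W12 \<tau> \<psi> \<psi>'" and xy: "-\<tau> < x" "x < y" "y < 0"
  shows "\<psi> y - \<psi> x = (\<integral>t. indicator {x<..y} t * \<psi>' t \<partial>leb_open \<tau>)"
proof -
  obtain B b :: "real \<Rightarrow> real" where B: "smooth_real B" "\<And>x. (B has_field_derivative b x) (at x)"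
     "continuous_on UNIV b" "\<And>x. b x \<ge> 0" "\<And>x. x \<le> 0 \<Longrightarrow> B x = 0" "\<And>x. x \<ge> 1 \<Longrightarrow> B x = 1"
     "\<And>x. x \<notin> {0..1} \<Longrightarrow> b x = 0" "\<And>x. 0 \<le> B x" "\<And>x. B x \<le> 1"
    using smooth_step_exists by blast
  have cont: "continuous_on {-\<tau>..0} \<psi>" and \<psi>': "\<psi>' \<in> L2 (leb_open \<tau>)"
    using W by (auto simp: sobolev_W12_def)
  \<comment> \<open>The summand \<open>1 / (- y)\<close> keeps the right edge
    \<open>y + 1 / r n\<close> of the support below \<open>0\<close> for every
    \<open>n\<close>.\<close>
  define r where "r n = real n + 1 + 1 / (- y)" for n
  have r0: "r n > 0" for n
  proof -
    have "1 / (- y) > 0" using xy by simp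
    then show ?thesis unfolding r_def by linarith
  qed
  have ry: "1 / r n < - y" for n
  proof -
    have "1 / (- y) < r n" by (simp add: r_def)
    then show ?thesis using xy r0[of n] by (simp add: field_simps)
  qed
  have rlim: "filterlim r at_top sequentially"
    using filterlim_tendsto_add_at_top[OF tendsto_const filterlim_real_sequentially, of "1 + 1 / (- y)"]
    by (simp add: r_def[abs_def] algebra_simps)
  define \<zeta> where "\<zeta> n t = B (r n * (t - x)) - B (r n * (t - y))" for n t
  have d\<zeta>: "deriv (\<zeta> n) t = r n * b (r n * (t - x)) - r n * b (r n * (t - y))" for n t
  proof (rule DERIV_imp_deriv)
    show "(\<zeta> n has_field_derivative r n * b (r n * (t - x)) - r n * b (r n * (t - y))) (at t)"
      unfolding \<zeta>_def by (intro DERIV_diff DERIV_affine_arg B(2))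
  qed
  have test: "test_function (-\<tau>) 0 (\<zeta> n)" for n
    unfolding test_function_def
  proof (intro conjI allI exI impI)
    have "smooth_real (\<lambda>t. B (r n * t + (- r n * x)) - B (r n * t + (- r n * y)))"
      by (intro smooth_real_diff smooth_real_affine B)
    then have "smooth_real (\<zeta> n)" by (simp add: \<zeta>_def[abs_def] right_diff_distrib)
    then show "((deriv ^^ m) (\<zeta> n)) field_differentiable (at t)" for m t
      by (rule smooth_real_deriv_funpow)
    show "-\<tau> < x" by fact
    show "y + 1 / r n < 0" using ry[of n] by simp
    fix t assume "t \<notin> {x..y + 1 / r n}"
    then consider "t < x" | "t > y + 1 / r n" by force
    then show "\<zeta> n t = 0"
    proof cases
      case 1
      then have "r n * (t - x) \<le> 0" "r n * (t - y) \<le> 0"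
        using r0[of n] xy by (auto simp: mult_le_0_iff)
      then show ?thesis by (simp add: \<zeta>_def B)
    next
      case 2
      then have "r n * (t - y) \<ge> 1" using r0[of n] by (simp add: field_simps)
      moreover have "r n * (t - x) \<ge> r n * (t - y)" using r0[of n] xy by (intro mult_left_mono) auto
      ultimately show ?thesis by (simp add: \<zeta>_def B)
    qed
  qed
  note moll = mollifier_tendsto[where B=B and b=b and \<tau>=\<tau> and \<psi>=\<psi> and r=r, OF _ _ cont r0 _ rlim B(2-7)]
  have mx: "1 / r n < - x" for n using ry[of n] xy by simp
  have yy: "-\<tau> < y" "x < 0" using xy by auto
  note mollx = moll[OF xy(1) yy(2) mx] and molly = moll[OF yy(1) xy(3) ry]
  have "(\<lambda>n. (\<integral>t. \<psi> t * complex_of_real (r n * b (r n * (t - x))) \<partial>leb_open \<tau>)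
      - (\<integral>t. \<psi> t * complex_of_real (r n * b (r n * (t - y))) \<partial>leb_open \<tau>)) \<longlonglongrightarrow> \<psi> x - \<psi> y"
    by (intro tendsto_diff mollx molly)
  moreover have "(\<integral>t. \<psi> t * complex_of_real (r n * b (r n * (t - x))) \<partial>leb_open \<tau>)
      - (\<integral>t. \<psi> t * complex_of_real (r n * b (r n * (t - y))) \<partial>leb_open \<tau>)
      = - (\<integral>t. \<psi>' t * complex_of_real (\<zeta> n t) \<partial>leb_open \<tau>)" for n
  proof -
    have "(\<integral>t. \<psi> t * complex_of_real (r n * b (r n * (t - x))) \<partial>leb_open \<tau>)
      - (\<integral>t. \<psi> t * complex_of_real (r n * b (r n * (t - y))) \<partial>leb_open \<tau>)
      = (\<integral>t. \<psi> t * complex_of_real (r n * b (r n * (t - x))) - \<psi> t * complex_of_real (r n * b (r n * (t - y))) \<partial>leb_open \<tau>)"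
      by (intro Bochner_Integration.integral_diff[symmetric] mollx molly)
    also have "\<dots> = (\<integral>t. \<psi> t * complex_of_real (deriv (\<zeta> n) t) \<partial>leb_open \<tau>)"
      by (intro Bochner_Integration.integral_cong) (auto simp: d\<zeta> right_diff_distrib)
    finally show ?thesis using W test[of n] by (simp add: sobolev_W12_def)
  qed
  ultimately have 1: "(\<lambda>n. - (\<integral>t. \<psi>' t * complex_of_real (\<zeta> n t) \<partial>leb_open \<tau>)) \<longlonglongrightarrow> \<psi> x - \<psi> y"
    by simp
  have lims: "(\<lambda>n. B (r n * (t - z))) \<longlonglongrightarrow> indicator {z<..} t" for t z
  proof (cases "t > z")
    case True
    have "eventually (\<lambda>n. r n > 1 / (t - z)) sequentially" using rlim by (simp add: filterlim_at_top_dense)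
    then have "eventually (\<lambda>n. B (r n * (t - z)) = 1) sequentially"
      by eventually_elim (use True in \<open>auto intro!: B simp: field_simps\<close>)
    then show ?thesis using True by (simp add: tendsto_eventually)
  next
    case False
    then have "B (r n * (t - z)) = 0" for n using r0[of n] by (intro B) (auto simp: mult_le_0_iff)
    then show ?thesis using False by simp
  qed
  have "(\<lambda>n. \<integral>t. \<psi>' t * complex_of_real (\<zeta> n t) \<partial>leb_open \<tau>)
      \<longlonglongrightarrow> (\<integral>t. \<psi>' t * complex_of_real (indicator {x<..y} t) \<partial>leb_open \<tau>)"
  proof (rule integral_dominated_convergence[where w="\<lambda>t. cmod (\<psi>' t)"])
    have \<psi>'m: "\<psi>' \<in> borel_measurable (leb_open \<tau>)" using \<psi>' by (simp add: L2_def)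
    have ind: "(indicator {x<..y} :: real \<Rightarrow> real) \<in> borel_measurable (leb_open \<tau>)"
      by (intro measurable_restrict_space1) auto
    show "(\<lambda>t. \<psi>' t * complex_of_real (indicator {x<..y} t)) \<in> borel_measurable (leb_open \<tau>)"
      using \<psi>'m ind by measurable
    have Bc: "continuous_on UNIV B" using B(2) by (meson DERIV_continuous_on has_field_derivative_at_within)
    have "continuous_on UNIV (\<zeta> n)" for n
      unfolding \<zeta>_def by (intro continuous_intros continuous_on_compose2[OF Bc]) auto
    then have "\<zeta> n \<in> borel_measurable (leb_open \<tau>)" for n
      by (intro measurable_restrict_space1) (auto intro: borel_measurable_continuous_onI)
    then show "(\<lambda>t. \<psi>' t * complex_of_real (\<zeta> n t)) \<in> borel_measurable (leb_open \<tau>)" for n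
      using \<psi>'m by measurable
    show "integrable (leb_open \<tau>) (\<lambda>t. cmod (\<psi>' t))"
      by (intro integrable_norm L2_imp_integrable \<psi>' finite_measure_leb_open)
    have "(\<lambda>n. \<zeta> n t) \<longlonglongrightarrow> indicator {x<..} t - indicator {y<..} t" for t
      unfolding \<zeta>_def by (intro tendsto_diff lims)
    moreover have "indicator {x<..} t - indicator {y<..} t = (indicator {x<..y} t :: real)" for t
      using xy by (auto simp: indicator_def)
    ultimately show "AE t in leb_open \<tau>. (\<lambda>n. \<psi>' t * complex_of_real (\<zeta> n t))
      \<longlonglongrightarrow> \<psi>' t * complex_of_real (indicator {x<..y} t)"
      by (intro AE_I2 tendsto_intros) simp
    have "\<bar>\<zeta> n t\<bar> \<le> 1" for n t using B(8,9)[of "r n * (t - x)"] B(8,9)[of "r n * (t - y)"]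
      by (simp add: \<zeta>_def abs_le_iff)
    then show "AE t in leb_open \<tau>. norm (\<psi>' t * complex_of_real (\<zeta> n t)) \<le> cmod (\<psi>' t)" for n
      by (simp add: norm_mult mult_left_le)
  qed
  from tendsto_minus[OF this] 1 have "\<psi> x - \<psi> y = - (\<integral>t. \<psi>' t * complex_of_real (indicator {x<..y} t) \<partial>leb_open \<tau>)"
    using LIMSEQ_unique by blast
  moreover have "complex_of_real (indicator {x<..y} t) = indicator {x<..y} t" for t by (simp add: indicator_def)
  ultimately show ?thesis by (simp add: mult.commute algebra_simps)
qed

lemma tendsto_continuous_within_seq:
  fixes \<psi> :: "real \<Rightarrow> complex"
  assumes "continuous_on {-\<tau>..0} \<psi>" "\<And>n. s n \<in> {-\<tau>..0}" "s \<longlonglongrightarrow> l" "l \<in> {-\<tau>..0}"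
  shows "(\<lambda>n. \<psi> (s n)) \<longlonglongrightarrow> \<psi> l"
  using assms by (intro continuous_on_tendsto_compose[OF assms(1)]) auto

text \<open>Increments between interior points reach the endpoints by continuity of
  \<open>\<psi>\<close> and dominated convergence of the indicators.\<close>

lemma sobolev_FTC:
  assumes W: "sobolev_W12 \<tau> \<psi> \<psi>'" and \<tau>: "0 < \<tau>"
  shows "y \<in> {-\<tau><..<0} \<Longrightarrow> \<psi> y - \<psi> (-\<tau>) = (\<integral>t. indicator {..y} t * \<psi>' t \<partial>leb_open \<tau>)"
    and "\<psi> 0 - \<psi> (-\<tau>) = (\<integral>t. \<psi>' t \<partial>leb_open \<tau>)"
proof -
  have cont: "continuous_on {-\<tau>..0} \<psi>" and \<psi>': "\<psi>' \<in> L2 (leb_open \<tau>)"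
    using W by (auto simp: sobolev_W12_def)
  have \<psi>'m [measurable]: "\<psi>' \<in> borel_measurable (leb_open \<tau>)" using \<psi>' by (simp add: L2_def)
  have ind [measurable]: "(indicator {x<..y} :: real \<Rightarrow> complex) \<in> borel_measurable (leb_open \<tau>)"
    "(indicator {..y} :: real \<Rightarrow> complex) \<in> borel_measurable (leb_open \<tau>)" for x y
    by (intro measurable_restrict_space1; auto)+
  have dom: "(\<lambda>n. \<integral>t. f n t * \<psi>' t \<partial>leb_open \<tau>) \<longlonglongrightarrow> (\<integral>t. g t * \<psi>' t \<partial>leb_open \<tau>)"
    if "\<And>n. f n \<in> borel_measurable (leb_open \<tau>)" "g \<in> borel_measurable (leb_open \<tau>)"
      "\<And>t. t \<in> {-\<tau><..<0} \<Longrightarrow> (\<lambda>n. f n t) \<longlonglongrightarrow> g t" "\<And>n t. cmod (f n t) \<le> 1" for f g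
  proof (rule integral_dominated_convergence[where w="\<lambda>t. cmod (\<psi>' t)"])
    show "integrable (leb_open \<tau>) (\<lambda>t. cmod (\<psi>' t))"
      by (intro integrable_norm L2_imp_integrable \<psi>' finite_measure_leb_open)
    show "AE t in leb_open \<tau>. (\<lambda>n. f n t * \<psi>' t) \<longlonglongrightarrow> g t * \<psi>' t"
      using that(3) by (intro AE_I2 tendsto_intros) auto
    show "AE t in leb_open \<tau>. norm (f n t * \<psi>' t) \<le> cmod (\<psi>' t)" for n
      using that(4) by (intro AE_I2) (simp add: norm_mult mult_left_le_one_le)
  qed (use that in measurable)
  have 1: "\<psi> y - \<psi> (-\<tau>) = (\<integral>t. indicator {..y} t * \<psi>' t \<partial>leb_open \<tau>)" if y: "y \<in> {-\<tau><..<0}" for y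
  proof -
    define x where "x n = -\<tau> + (y + \<tau>) / (real n + 2)" for n
    have xb: "-\<tau> < x n" "x n < y" for n
    proof -
      have "(y + \<tau>) * 1 < (y + \<tau>) * (real n + 2)" using y by (intro mult_strict_left_mono) auto
      then have "(y + \<tau>) / (real n + 2) < y + \<tau>" by (simp add: divide_less_eq)
      moreover have "(y + \<tau>) / (real n + 2) > 0" using y by (intro divide_pos_pos) auto
      ultimately show "-\<tau> < x n" "x n < y" unfolding x_def by linarith+
    qed
    have xl: "x \<longlonglongrightarrow> -\<tau>"
    proof -
      have "(\<lambda>n. (y + \<tau>) * inverse (real (n + 2))) \<longlonglongrightarrow> (y + \<tau>) * 0"
        by (intro tendsto_mult tendsto_const LIMSEQ_ignore_initial_segment[OF lim_inverse_n])
      then have "(\<lambda>n. -\<tau> + (y + \<tau>) * inverse (real (n + 2))) \<longlonglongrightarrow> -\<tau> + 0"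
        by (intro tendsto_add tendsto_const) simp
      then show ?thesis by (simp add: x_def[abs_def] divide_inverse add.commute)
    qed
    have "(\<lambda>n. \<psi> y - \<psi> (x n)) \<longlonglongrightarrow> \<psi> y - \<psi> (-\<tau>)"
      using xb y xl \<tau> by (intro tendsto_diff tendsto_const tendsto_continuous_within_seq[OF cont])
        (auto intro: less_imp_le order_trans[OF less_imp_le less_imp_le])
    moreover have "\<psi> y - \<psi> (x n) = (\<integral>t. indicator {x n<..y} t * \<psi>' t \<partial>leb_open \<tau>)" for n
      using xb y by (intro sobolev_increment[OF W]) auto
    moreover have "(\<lambda>n. \<integral>t. indicator {x n<..y} t * \<psi>' t \<partial>leb_open \<tau>) \<longlonglongrightarrow> (\<integral>t. indicator {..y} t * \<psi>' t \<partial>leb_open \<tau>)"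
    proof (rule dom)
      fix t assume t: "t \<in> {-\<tau><..<0}"
      then have "eventually (\<lambda>n. x n < t) sequentially" using xl by (intro order_tendstoD) auto
      then have "eventually (\<lambda>n. indicator {x n<..y} t = (indicator {..y} t :: complex)) sequentially"
        by eventually_elim (auto simp: indicator_def)
      then show "(\<lambda>n. indicator {x n<..y} t :: complex) \<longlonglongrightarrow> indicator {..y} t" by (rule tendsto_eventually)
    qed (rule ind | simp add: indicator_def)+
    ultimately show ?thesis using LIMSEQ_unique by simp
  qed
  then show "y \<in> {-\<tau><..<0} \<Longrightarrow> \<psi> y - \<psi> (-\<tau>) = (\<integral>t. indicator {..y} t * \<psi>' t \<partial>leb_open \<tau>)" .
  define y where "y n = - \<tau> * inverse (real (n + 2))" for n
  have yb: "y n \<in> {-\<tau><..<0}" for n using \<tau> by (auto simp: y_def field_simps intro!: add_pos_nonneg)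
  have yl: "y \<longlonglongrightarrow> 0"
  proof -
    have "(\<lambda>n. -\<tau> * inverse (real (n + 2))) \<longlonglongrightarrow> -\<tau> * 0"
      by (intro tendsto_mult tendsto_const LIMSEQ_ignore_initial_segment[OF lim_inverse_n])
    then show ?thesis by (simp add: y_def[abs_def])
  qed
  have "(\<lambda>n. \<psi> (y n) - \<psi> (-\<tau>)) \<longlonglongrightarrow> \<psi> 0 - \<psi> (-\<tau>)"
    using yb yl \<tau> by (intro tendsto_diff tendsto_const tendsto_continuous_within_seq[OF cont])
      (auto intro: less_imp_le)
  moreover have "(\<lambda>n. \<integral>t. indicator {..y n} t * \<psi>' t \<partial>leb_open \<tau>) \<longlonglongrightarrow> (\<integral>t. 1 * \<psi>' t \<partial>leb_open \<tau>)"
  proof (rule dom)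
    fix t assume t: "t \<in> {-\<tau><..<0}"
    then have "eventually (\<lambda>n. t < y n) sequentially" using yl by (intro order_tendstoD) auto
    then have "eventually (\<lambda>n. indicator {..y n} t = (1 :: complex)) sequentially"
      by eventually_elim (auto simp: indicator_def)
    then show "(\<lambda>n. indicator {..y n} t :: complex) \<longlonglongrightarrow> 1" by (rule tendsto_eventually)
  qed (rule ind | simp add: indicator_def)+
  ultimately show "\<psi> 0 - \<psi> (-\<tau>) = (\<integral>t. \<psi>' t \<partial>leb_open \<tau>)"
    using 1[OF yb] LIMSEQ_unique by simp
qed

lemma integral_leb_open_FTC:
  fixes \<kappa> \<kappa>' :: "real \<Rightarrow> complex"
  assumes d: "\<And>t. t \<in> {-\<tau>..0} \<Longrightarrow> (\<kappa> has_vector_derivative \<kappa>' t) (at t within {-\<tau>..0})"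
    and c: "continuous_on {-\<tau>..0} \<kappa>'" and t: "t \<in> {-\<tau>..0}"
  shows "(\<integral>s. indicator {t..} s * \<kappa>' s \<partial>leb_open \<tau>) = \<kappa> 0 - \<kappa> t"
proof -
  have "(\<integral>s. indicator {t..} s * \<kappa>' s \<partial>leb_open \<tau>)
      = (\<integral>s. indicator {-\<tau><..<0} s *\<^sub>R (indicator {t..} s * \<kappa>' s) \<partial>lborel)"
    by (rule integral_restrict_space) auto
  also have "\<dots> = (\<integral>s. indicator {t..0} s *\<^sub>R \<kappa>' s \<partial>lborel)"
  proof (rule integral_cong_AE)
    have m: "(\<lambda>s. indicator {-\<tau>..0} s *\<^sub>R \<kappa>' s) \<in> borel_measurable lborel"
      using borel_measurable_continuous_on_indicator[OF _ c] by simp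
    have "(\<lambda>s. indicator {-\<tau><..<0} s *\<^sub>R (indicator {t..} s * \<kappa>' s))
        = (\<lambda>s. indicator {-\<tau><..<0} s *\<^sub>R (indicator {t..} s *\<^sub>R (indicator {-\<tau>..0} s *\<^sub>R \<kappa>' s)))"
      by (auto simp: indicator_def fun_eq_iff)
    also have "\<dots> \<in> borel_measurable lborel" using m by measurable
    finally show "(\<lambda>s. indicator {-\<tau><..<0} s *\<^sub>R (indicator {t..} s * \<kappa>' s)) \<in> borel_measurable lborel" .
    have "(\<lambda>s. indicator {t..0} s *\<^sub>R \<kappa>' s) = (\<lambda>s. indicator {t..0} s *\<^sub>R (indicator {-\<tau>..0} s *\<^sub>R \<kappa>' s))"
      using t by (auto simp: indicator_def fun_eq_iff)
    also have "\<dots> \<in> borel_measurable lborel" using m by measurable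
    finally show "(\<lambda>s. indicator {t..0} s *\<^sub>R \<kappa>' s) \<in> borel_measurable lborel" .
    show "AE s in lborel. indicator {-\<tau><..<0} s *\<^sub>R (indicator {t..} s * \<kappa>' s) = indicator {t..0} s *\<^sub>R \<kappa>' s"
      using AE_lborel_singleton[of "-\<tau>"] AE_lborel_singleton[of "0 :: real"]
      by eventually_elim (use t in \<open>auto simp: indicator_def\<close>)
  qed
  also have "\<dots> = \<kappa> 0 - \<kappa> t"
    using t by (intro integral_FTC_Icc has_vector_derivative_within_subset[OF d] continuous_on_subset[OF c]) auto
  finally show ?thesis .
qed

text \<open>Since \<open>\<psi>\<close> is known only through integrals of its weak derivative, the
  product rule is replaced by Fubini for \<open>\<kappa>' s * \<psi>' t\<close> on the triangle
  \<open>t \<le> s\<close>.\<close>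

lemma sobolev_integration_by_parts:
  fixes \<kappa> \<kappa>' :: "real \<Rightarrow> complex"
  assumes W: "sobolev_W12 \<tau> \<psi> \<psi>'" and \<tau>: "0 < \<tau>"
    and d: "\<And>t. t \<in> {-\<tau>..0} \<Longrightarrow> (\<kappa> has_vector_derivative \<kappa>' t) (at t within {-\<tau>..0})"
    and c: "continuous_on {-\<tau>..0} \<kappa>'"
  shows "(\<integral>t. \<psi>' t * \<kappa> t \<partial>leb_open \<tau>) = \<psi> 0 * \<kappa> 0 - \<psi> (-\<tau>) * \<kappa> (-\<tau>) - (\<integral>t. \<psi> t * \<kappa>' t \<partial>leb_open \<tau>)"
proof -
  let ?L = "leb_open \<tau>"
  interpret finite_measure ?L by (rule finite_measure_leb_open)
  interpret pair_sigma_finite ?L ?L ..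
  have \<psi>L: "\<psi> \<in> L2 ?L" "\<psi>' \<in> L2 ?L" using W by (auto simp: sobolev_W12_def)
  have "continuous_on {-\<tau>..0} \<kappa>"
    unfolding continuous_on_eq_continuous_within using d has_vector_derivative_continuous by blast
  then have \<kappa>L: "\<kappa> \<in> L2 ?L" "\<kappa>' \<in> L2 ?L"
    using c by (auto intro!: L2_hist_imp_leb_open \<tau> continuous_on_L2_hist)
  have [measurable]: "\<psi>' \<in> borel_measurable ?L" "\<kappa>' \<in> borel_measurable ?L" "\<psi> \<in> borel_measurable ?L"
    using \<psi>L \<kappa>L by (auto simp: L2_def)
  have int: "integrable ?L f" if "f \<in> L2 ?L" for f using that by (rule L2_imp_integrable[OF finite_measure_leb_open])
  define H where "H = (\<lambda>(s, t). indicator {t..} s * (\<kappa>' s * \<psi>' t))"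
  have Hm: "H \<in> borel_measurable (?L \<Otimes>\<^sub>M ?L)"
  proof -
    have id [measurable]: "(\<lambda>x. x) \<in> borel_measurable ?L" by (intro measurable_restrict_space1) auto
    have "H = (\<lambda>z. (if snd z \<le> fst z then 1 else 0) * (\<kappa>' (fst z) * \<psi>' (snd z)))"
      by (auto simp: H_def fun_eq_iff indicator_def)
    also have "\<dots> \<in> borel_measurable (?L \<Otimes>\<^sub>M ?L)"
    proof -
      have "(\<lambda>z. fst z :: real) \<in> borel_measurable (?L \<Otimes>\<^sub>M ?L)" "(\<lambda>z. snd z :: real) \<in> borel_measurable (?L \<Otimes>\<^sub>M ?L)"
        using measurable_compose[OF measurable_fst id] measurable_compose[OF measurable_snd id] by auto
      then show ?thesis by measurable
    qed
    finally show ?thesis .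
  qed
  have "integrable (?L \<Otimes>\<^sub>M ?L) (\<lambda>(s, t). \<kappa>' s * \<psi>' t)"
    by (intro integral_pair_mult(1) finite_measure_leb_open int \<kappa>L \<psi>L)
  then have Hi: "integrable (?L \<Otimes>\<^sub>M ?L) H"
    by (rule Bochner_Integration.integrable_bound[OF _ Hm]) (auto simp: H_def indicator_def)
  have "(\<integral>s. (\<integral>t. H (s, t) \<partial>?L) \<partial>?L) = (\<integral>t. (\<integral>s. H (s, t) \<partial>?L) \<partial>?L)"
    using Fubini_integral[of "\<lambda>s t. H (s, t)"] Hi by simp
  also have "(\<integral>s. (\<integral>t. H (s, t) \<partial>?L) \<partial>?L) = (\<integral>s. \<kappa>' s * (\<psi> s - \<psi> (-\<tau>)) \<partial>?L)"
  proof (rule Bochner_Integration.integral_cong[OF refl])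
    fix s assume s: "s \<in> space ?L"
    have "(\<integral>t. H (s, t) \<partial>?L) = (\<integral>t. \<kappa>' s * (indicator {..s} t * \<psi>' t) \<partial>?L)"
      by (intro Bochner_Integration.integral_cong) (auto simp: H_def indicator_def)
    then show "(\<integral>t. H (s, t) \<partial>?L) = \<kappa>' s * (\<psi> s - \<psi> (-\<tau>))"
      using sobolev_FTC(1)[OF W \<tau>, of s] s by simp
  qed
  also have "(\<integral>t. (\<integral>s. H (s, t) \<partial>?L) \<partial>?L) = (\<integral>t. \<psi>' t * (\<kappa> 0 - \<kappa> t) \<partial>?L)"
  proof (rule Bochner_Integration.integral_cong[OF refl])
    fix t assume t: "t \<in> space ?L"
    have "(\<integral>s. H (s, t) \<partial>?L) = (\<integral>s. \<psi>' t * (indicator {t..} s * \<kappa>' s) \<partial>?L)"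
      by (intro Bochner_Integration.integral_cong) (auto simp: H_def indicator_def)
    then show "(\<integral>s. H (s, t) \<partial>?L) = \<psi>' t * (\<kappa> 0 - \<kappa> t)"
      using integral_leb_open_FTC[OF d c, of t] t by simp
  qed
  finally have eq: "(\<integral>s. \<kappa>' s * (\<psi> s - \<psi> (-\<tau>)) \<partial>?L) = (\<integral>t. \<psi>' t * (\<kappa> 0 - \<kappa> t) \<partial>?L)" .
  have 1: "(\<integral>s. \<kappa>' s * (\<psi> s - \<psi> (-\<tau>)) \<partial>?L) = (\<integral>s. \<psi> s * \<kappa>' s \<partial>?L) - (\<integral>s. \<kappa>' s \<partial>?L) * \<psi> (-\<tau>)"
    using Bochner_Integration.integral_diff[OF L2_mult_integrable[OF \<psi>L(1) \<kappa>L(2)] integrable_mult_left[OF int[OF \<kappa>L(2)], of "\<psi> (-\<tau>)"]]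
    by (simp add: algebra_simps)
  have 2: "(\<integral>t. \<psi>' t * (\<kappa> 0 - \<kappa> t) \<partial>?L) = (\<integral>t. \<psi>' t \<partial>?L) * \<kappa> 0 - (\<integral>t. \<psi>' t * \<kappa> t \<partial>?L)"
    using Bochner_Integration.integral_diff[OF integrable_mult_left[OF int[OF \<psi>L(2)], of "\<kappa> 0"] L2_mult_integrable[OF \<psi>L(2) \<kappa>L(1)]]
    by (simp add: algebra_simps)
  have 3: "(\<integral>s. \<kappa>' s \<partial>?L) = \<kappa> 0 - \<kappa> (-\<tau>)"
  proof -
    have "(\<integral>s. \<kappa>' s \<partial>?L) = (\<integral>s. indicator {-\<tau>..} s * \<kappa>' s \<partial>?L)"
      by (intro Bochner_Integration.integral_cong) (auto simp: indicator_def)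
    then show ?thesis using integral_leb_open_FTC[OF d c, of "-\<tau>"] \<tau> by simp
  qed
  have 4: "(\<integral>t. \<psi>' t \<partial>?L) = \<psi> 0 - \<psi> (-\<tau>)" using sobolev_FTC(2)[OF W \<tau>] by simp
  show ?thesis using eq unfolding 1 2 3 4 by (simp add: algebra_simps)
qed

text \<open>Apart from the value at \<open>0\<close>, these are the eigenvectors of the adjoint of the delay operator
  when \<open>l\<close> is a characteristic root.\<close>

definition adj_exp :: "real \<Rightarrow> real \<Rightarrow> complex \<Rightarrow> real \<Rightarrow> complex" where
  "adj_exp \<alpha> \<tau> l \<theta> = (if \<theta> = 0 then 1 else - complex_of_real \<alpha> * exp (- l * complex_of_real (\<theta> + \<tau>)))"

lemma L2_adj_exp: "0 < \<tau> \<Longrightarrow> adj_exp \<alpha> \<tau> l \<in> L2 (hist_measure \<tau>)"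
proof -
  assume \<tau>: "0 < \<tau>"
  have "continuous_on {-\<tau>..0} (\<lambda>\<theta>. - complex_of_real \<alpha> * exp (- l * complex_of_real (\<theta> + \<tau>)))"
    by (intro continuous_intros)
  then have 1: "(\<lambda>\<theta>. - complex_of_real \<alpha> * exp (- l * complex_of_real (\<theta> + \<tau>))) \<in> L2 (hist_measure \<tau>)"
    by (rule continuous_on_L2_hist)
  have s: "{0} \<in> sets (hist_measure \<tau>)" using \<tau> by (intro singleton_in_sets_hist) auto
  have i: "(indicator {0} :: real \<Rightarrow> complex) \<in> L2 (hist_measure \<tau>)"
    using s by (intro L2_bounded[OF finite_measure_hist_measure, of _ _ 1]) (auto simp: indicator_def intro!: borel_measurable_indicator)
  have "adj_exp \<alpha> \<tau> l = (\<lambda>\<theta>. 1 * (- complex_of_real \<alpha> * exp (- l * complex_of_real (\<theta> + \<tau>)))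
     + (1 + complex_of_real \<alpha> * exp (- l * complex_of_real \<tau>)) * indicator {0} \<theta>)"
    by (auto simp: adj_exp_def fun_eq_iff indicator_def)
  then show ?thesis using L2_lincomb[OF 1 i] by metis
qed

text \<open>Integration by parts. The boundary term at \<open>-\<tau>\<close> cancels the delayed
  value in the functional, because the exponential equals \<open>- \<alpha>\<close> there, and the
  boundary term at \<open>0\<close> completes \<open>ss_char\<close>. Thus the formal adjoint sends
  \<open>adj_exp\<close> to \<open>l\<close> times itself plus \<open>ss_char\<close> times
  evaluation at \<open>0\<close>, for every complex \<open>l\<close> and not only for roots.\<close>

lemma delay_operator_pairing:
  assumes D: "delay_operator \<tau> (ss_functional \<alpha> \<tau> \<Lambda>) \<phi> \<xi>" and \<tau>: "0 < \<tau>"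
  shows "(\<integral>\<theta>. \<xi> \<theta> * adj_exp \<alpha> \<tau> l \<theta> \<partial>hist_measure \<tau>)
    = l * (\<integral>\<theta>. \<phi> \<theta> * adj_exp \<alpha> \<tau> l \<theta> \<partial>hist_measure \<tau>) + ss_char \<alpha> \<tau> \<Lambda> l * \<phi> 0"
proof -
  let ?L = "leb_open \<tau>" and ?k = "adj_exp \<alpha> \<tau> l"
  obtain \<psi> \<psi>' where L: "\<phi> \<in> L2 (hist_measure \<tau>)" "\<xi> \<in> L2 (hist_measure \<tau>)" and W: "sobolev_W12 \<tau> \<psi> \<psi>'"
    and ae: "AE \<theta> in ?L. \<phi> \<theta> = \<psi> \<theta>" "\<phi> 0 = \<psi> 0" "\<xi> 0 = ss_functional \<alpha> \<tau> \<Lambda> \<psi>" "AE \<theta> in ?L. \<xi> \<theta> = \<psi>' \<theta>"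
    using D by (auto simp: delay_operator_def)
  define \<kappa> where "\<kappa> t = - complex_of_real \<alpha> * exp (- l * complex_of_real (t + \<tau>))" for t
  have d: "(\<kappa> has_vector_derivative (- l * \<kappa> t)) (at t within {-\<tau>..0})" for t
    unfolding \<kappa>_def
    by (rule has_vector_derivative_real_field[OF has_field_derivative_subset] | auto intro!: derivative_eq_intros)+
  have c: "continuous_on {-\<tau>..0} (\<lambda>t. - l * \<kappa> t)" unfolding \<kappa>_def by (intro continuous_intros)
  have kk: "?k t = \<kappa> t" if "t \<in> space ?L" for t using that by (simp add: adj_exp_def \<kappa>_def)
  have k0: "?k 0 = 1" by (simp add: adj_exp_def)
  have km: "?k \<in> borel_measurable ?L" and \<phi>m: "\<phi> \<in> borel_measurable ?L" "\<xi> \<in> borel_measurable ?L"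
    using L2_adj_exp[OF \<tau>] L L2_hist_imp_leb_open[OF \<tau>] L2_measurable by blast+
  have \<psi>m: "\<psi> \<in> borel_measurable ?L" "\<psi>' \<in> borel_measurable ?L" using W by (auto simp: sobolev_W12_def L2_def)
  have \<kappa>m: "\<kappa> \<in> borel_measurable ?L" using km measurable_cong[of ?L ?k \<kappa>] kk by simp
  have int\<phi>: "(\<integral>\<theta>. \<phi> \<theta> * ?k \<theta> \<partial>hist_measure \<tau>) = (\<integral>\<theta>. \<psi> \<theta> * \<kappa> \<theta> \<partial>?L) + \<psi> 0"
  proof -
    have "(\<integral>\<theta>. \<phi> \<theta> * ?k \<theta> \<partial>?L) = (\<integral>\<theta>. \<psi> \<theta> * \<kappa> \<theta> \<partial>?L)"
    proof (rule integral_cong_AE)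
      show "AE \<theta> in ?L. \<phi> \<theta> * ?k \<theta> = \<psi> \<theta> * \<kappa> \<theta>" using ae(1) AE_space by eventually_elim (simp only: kk)
    qed (use km \<phi>m \<psi>m \<kappa>m in measurable)
    then show ?thesis
      using integral_hist(2)[OF \<tau> L2_mult_integrable[OF L(1) L2_adj_exp[OF \<tau>]]] ae(2) by (simp add: k0)
  qed
  have int\<xi>: "(\<integral>\<theta>. \<xi> \<theta> * ?k \<theta> \<partial>hist_measure \<tau>) = (\<integral>\<theta>. \<psi>' \<theta> * \<kappa> \<theta> \<partial>?L) + ss_functional \<alpha> \<tau> \<Lambda> \<psi>"
  proof -
    have "(\<integral>\<theta>. \<xi> \<theta> * ?k \<theta> \<partial>?L) = (\<integral>\<theta>. \<psi>' \<theta> * \<kappa> \<theta> \<partial>?L)"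
    proof (rule integral_cong_AE)
      show "AE \<theta> in ?L. \<xi> \<theta> * ?k \<theta> = \<psi>' \<theta> * \<kappa> \<theta>" using ae(4) AE_space by eventually_elim (simp only: kk)
    qed (use km \<phi>m \<psi>m \<kappa>m in measurable)
    then show ?thesis
      using integral_hist(2)[OF \<tau> L2_mult_integrable[OF L(2) L2_adj_exp[OF \<tau>]]] ae(3) by (simp add: k0)
  qed
  have ibp: "(\<integral>t. \<psi>' t * \<kappa> t \<partial>?L) = \<psi> 0 * \<kappa> 0 - \<psi> (-\<tau>) * \<kappa> (-\<tau>) - (\<integral>t. \<psi> t * (- l * \<kappa> t) \<partial>?L)"
    by (rule sobolev_integration_by_parts[OF W \<tau> d c])
  have "(\<integral>t. \<psi> t * (- l * \<kappa> t) \<partial>?L) = - l * (\<integral>t. \<psi> t * \<kappa> t \<partial>?L)"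
    by (subst integral_mult_right_zero[symmetric]) (simp add: mult_ac)
  moreover have "\<kappa> (-\<tau>) = - complex_of_real \<alpha>" "\<kappa> 0 = - complex_of_real \<alpha> * exp (- complex_of_real \<tau> * l)"
    by (auto simp: \<kappa>_def mult.commute)
  ultimately show ?thesis
    unfolding int\<phi> int\<xi> ibp ae(2) by (simp add: ss_functional_def ss_char_def algebra_simps)
qed

lemma sobolev_W12_C1:
  fixes \<phi> \<phi>' :: "real \<Rightarrow> complex"
  assumes \<tau>: "0 < \<tau>" and d: "\<And>t. (\<phi> has_vector_derivative \<phi>' t) (at t)" and c: "continuous_on UNIV \<phi>'"
  shows "sobolev_W12 \<tau> \<phi> \<phi>'"
proof -
  have c\<phi>: "continuous_on UNIV \<phi>"
    using d by (auto simp: continuous_on_eq_continuous_within intro: has_vector_derivative_continuous)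
  have L: "f \<in> L2 (leb_open \<tau>)" if "continuous_on UNIV f" for f :: "real \<Rightarrow> complex"
    by (intro L2_hist_imp_leb_open \<tau> continuous_on_L2_hist continuous_on_subset[OF that]) auto
  have "(\<integral>\<theta>. \<phi> \<theta> * complex_of_real (deriv \<zeta> \<theta>) \<partial>leb_open \<tau>) = - (\<integral>\<theta>. \<phi>' \<theta> * complex_of_real (\<zeta> \<theta>) \<partial>leb_open \<tau>)"
    if \<zeta>: "test_function (-\<tau>) 0 \<zeta>" for \<zeta>
  proof -
    have fd: "((deriv ^^ n) \<zeta>) field_differentiable (at x)" for n x
      using \<zeta> by (auto simp: test_function_def)
    have d\<zeta>: "(\<zeta> has_field_derivative deriv \<zeta> x) (at x)" for x
      using fd[of 0 x] by (simp add: field_differentiable_derivI)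
    have c\<zeta>: "continuous_on UNIV \<zeta>" using d\<zeta> by (meson DERIV_continuous_on has_field_derivative_at_within)
    have "(deriv \<zeta> has_field_derivative deriv (deriv \<zeta>) x) (at x)" for x
      using fd[of 1 x] by (simp add: field_differentiable_derivI)
    then have c\<zeta>': "continuous_on UNIV (deriv \<zeta>)"
      by (meson DERIV_continuous_on has_field_derivative_at_within)
    obtain p q where pq: "-\<tau> < p" "q < 0" "\<And>x. x \<notin> {p..q} \<Longrightarrow> \<zeta> x = 0"
      using \<zeta> by (auto simp: test_function_def)
    have z: "\<zeta> 0 = 0" "\<zeta> (-\<tau>) = 0" using pq by auto
    define P where "P t = \<phi> t * complex_of_real (\<zeta> t)" for t
    define P' where "P' t = \<phi> t * complex_of_real (deriv \<zeta> t) + \<phi>' t * complex_of_real (\<zeta> t)" for t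
    have "(P has_vector_derivative P' t) (at t within {-\<tau>..0})" for t
      unfolding P_def P'_def
      using has_vector_derivative_mult[OF d[of t] has_vector_derivative_of_real[OF d\<zeta>[of t]]]
      by (auto intro: has_vector_derivative_at_within)
    moreover have "continuous_on {-\<tau>..0} P'" unfolding P'_def
      by (intro continuous_intros continuous_on_subset[OF c] continuous_on_subset[OF c\<phi>]
          continuous_on_subset[OF c\<zeta>] continuous_on_subset[OF c\<zeta>']) auto
    ultimately have "(\<integral>s. indicator {-\<tau>..} s * P' s \<partial>leb_open \<tau>) = P 0 - P (-\<tau>)"
      using \<tau> by (intro integral_leb_open_FTC) auto
    also have "(\<integral>s. indicator {-\<tau>..} s * P' s \<partial>leb_open \<tau>) = (\<integral>s. P' s \<partial>leb_open \<tau>)"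
      by (intro Bochner_Integration.integral_cong) (auto simp: indicator_def)
    also have "\<dots> = (\<integral>s. \<phi> s * complex_of_real (deriv \<zeta> s) \<partial>leb_open \<tau>) + (\<integral>s. \<phi>' s * complex_of_real (\<zeta> s) \<partial>leb_open \<tau>)"
      unfolding P'_def
      by (intro Bochner_Integration.integral_add L2_mult_integrable L c\<phi> c continuous_intros c\<zeta> c\<zeta>')
    finally show ?thesis using z by (simp add: P_def add_eq_0_iff2)
  qed
  then show ?thesis unfolding sobolev_W12_def
    using c\<phi> c by (auto intro: continuous_on_subset L)
qed

text \<open>The image is the derivative except at the atom \<open>0\<close>, where it is the value
  of the functional; the indicator term writes both as one function.\<close>

lemma delay_operator_C1:
  fixes \<phi> \<phi>' :: "real \<Rightarrow> complex"
  assumes \<tau>: "0 < \<tau>" and d: "\<And>t. (\<phi> has_vector_derivative \<phi>' t) (at t)" and c: "continuous_on UNIV \<phi>'"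
  shows "delay_operator \<tau> At \<phi> (\<lambda>\<theta>. 1 * \<phi>' \<theta> + (At \<phi> - \<phi>' 0) * indicator {0} \<theta>)"
proof -
  have W: "sobolev_W12 \<tau> \<phi> \<phi>'" by (rule sobolev_W12_C1[OF assms])
  have c\<phi>: "continuous_on UNIV \<phi>"
    using d by (auto simp: continuous_on_eq_continuous_within intro: has_vector_derivative_continuous)
  have s: "{0} \<in> sets (hist_measure \<tau>)" using \<tau> by (intro singleton_in_sets_hist) auto
  have i: "(indicator {0} :: real \<Rightarrow> complex) \<in> L2 (hist_measure \<tau>)"
    using s by (intro L2_bounded[OF finite_measure_hist_measure, of _ _ 1]) (auto simp: indicator_def intro!: borel_measurable_indicator)
  have L: "\<phi> \<in> L2 (hist_measure \<tau>)" "\<phi>' \<in> L2 (hist_measure \<tau>)"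
    using c\<phi> c by (auto intro!: continuous_on_L2_hist intro: continuous_on_subset)
  show ?thesis unfolding delay_operator_def
  proof (intro conjI)
    show "\<exists>\<psi> \<psi>'. sobolev_W12 \<tau> \<psi> \<psi>' \<and> (AE \<theta> in leb_open \<tau>. \<phi> \<theta> = \<psi> \<theta>) \<and> \<phi> 0 = \<psi> 0 \<and>
        1 * \<phi>' 0 + (At \<phi> - \<phi>' 0) * indicator {0} 0 = At \<psi> \<and>
        (AE \<theta> in leb_open \<tau>. 1 * \<phi>' \<theta> + (At \<phi> - \<phi>' 0) * indicator {0} \<theta> = \<psi>' \<theta>)"
      by (rule exI[of _ \<phi>], rule exI[of _ \<phi>']) (use W in \<open>auto intro!: AE_I2\<close>)
  qed (intro L L2_lincomb i)+
qed

section \<open>Pairings with \<open>C\<^sub>0\<close>-semigroups\<close>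

text \<open>Instantiated twice below: for \<open>G\<close> on the whole space and for
  \<open>G2\<close> on the antisymmetric functions.\<close>

locale L2_semigroup =
  fixes M :: "'a measure" and S T
  assumes fin: "finite_measure M" and S: "closed_subspace M S" and T: "C0_semigroup M S T"
begin

lemma S_L2: "f \<in> S \<Longrightarrow> f \<in> L2 M"
  using S by (auto simp: closed_subspace_def)

lemma S_lincomb: "f \<in> S \<Longrightarrow> g \<in> S \<Longrightarrow> (\<lambda>x. a * f x + b * g x) \<in> S"
  using S by (auto simp: closed_subspace_def)

lemma T_in: "t \<ge> 0 \<Longrightarrow> f \<in> S \<Longrightarrow> T t f \<in> S"
  using T by (auto simp: C0_semigroup_def)

lemma T_L2: "t \<ge> 0 \<Longrightarrow> f \<in> S \<Longrightarrow> T t f \<in> L2 M"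
  using T_in S_L2 by blast

lemma T_lincomb: "t \<ge> 0 \<Longrightarrow> f \<in> S \<Longrightarrow> g \<in> S \<Longrightarrow> AE x in M. T t (\<lambda>y. a * f y + b * g y) x = a * T t f x + b * T t g x"
  using T by (auto simp: C0_semigroup_def)

lemma T_add: "s \<ge> 0 \<Longrightarrow> t \<ge> 0 \<Longrightarrow> f \<in> S \<Longrightarrow> AE x in M. T (s + t) f x = T s (T t f) x"
  using T by (auto simp: C0_semigroup_def)

lemma T_bounded: "t \<ge> 0 \<Longrightarrow> \<exists>K. \<forall>f\<in>S. L2_norm M (T t f) \<le> K * L2_norm M f"
  using T by (auto simp: C0_semigroup_def)

lemma T_continuous: "f \<in> S \<Longrightarrow> ((\<lambda>t. L2_norm M (\<lambda>x. T t f x - f x)) \<longlongrightarrow> 0) (at_right 0)"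
  using T by (auto simp: C0_semigroup_def)

lemma pairing_cong:
  "f \<in> L2 M \<Longrightarrow> g \<in> L2 M \<Longrightarrow> k \<in> L2 M \<Longrightarrow> AE x in M. f x = g x \<Longrightarrow> (\<integral>x. f x * k x \<partial>M) = (\<integral>x. g x * k x \<partial>M)"
  by (intro integral_cong_AE borel_measurable_times L2_measurable) (auto elim!: eventually_mono)

lemma T_pairing_lincomb:
  assumes "t \<ge> 0" "f \<in> S" "g \<in> S" "k \<in> L2 M"
  shows "(\<integral>x. T t (\<lambda>y. a * f y + b * g y) x * k x \<partial>M) = a * (\<integral>x. T t f x * k x \<partial>M) + b * (\<integral>x. T t g x * k x \<partial>M)"
proof -
  have "(\<integral>x. T t (\<lambda>y. a * f y + b * g y) x * k x \<partial>M) = (\<integral>x. (a * T t f x + b * T t g x) * k x \<partial>M)"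
    by (intro pairing_cong T_L2 S_lincomb L2_lincomb T_lincomb assms)
  also have "\<dots> = (\<integral>x. a * (T t f x * k x) + b * (T t g x * k x) \<partial>M)"
    by (simp add: algebra_simps)
  also have "\<dots> = a * (\<integral>x. T t f x * k x \<partial>M) + b * (\<integral>x. T t g x * k x \<partial>M)"
    using L2_mult_integrable[OF T_L2[OF assms(1,2)] assms(4)] L2_mult_integrable[OF T_L2[OF assms(1,3)] assms(4)]
    by simp
  finally show ?thesis .
qed

text \<open>The defect of the difference quotient against a candidate derivative \<open>g\<close>.
  It is kept as an element of \<open>S\<close>, so that the semigroup can be applied to it.\<close>

definition quot :: "('a \<Rightarrow> complex) \<Rightarrow> ('a \<Rightarrow> complex) \<Rightarrow> real \<Rightarrow> 'a \<Rightarrow> complex" where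
  "quot f g h = (\<lambda>x. (T h f x - f x) / complex_of_real h - g x)"

lemma quot_eq: "quot f g h = (\<lambda>x. 1 * (1 / complex_of_real h * T h f x + (- 1 / complex_of_real h) * f x) + (- 1) * g x)"
  by (auto simp: quot_def fun_eq_iff diff_divide_distrib)

lemma quot_in: "h \<ge> 0 \<Longrightarrow> f \<in> S \<Longrightarrow> g \<in> S \<Longrightarrow> quot f g h \<in> S"
  unfolding quot_eq by (intro S_lincomb T_in)

lemma generator_quot:
  "semigroup_generator M S T f g \<longleftrightarrow> f \<in> S \<and> g \<in> S \<and> ((\<lambda>h. L2_norm M (quot f g h)) \<longlongrightarrow> 0) (at_right 0)"
  by (simp add: semigroup_generator_def quot_def)

lemma T_quot:
  assumes "s \<ge> 0" "h \<ge> 0" "f \<in> S" "g \<in> S"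
  shows "AE x in M. T s (quot f g h) x = (T (s + h) f x - T s f x) / complex_of_real h - T s g x"
proof -
  let ?a = "1 / complex_of_real h" and ?b = "- 1 / complex_of_real h"
  have 1: "AE x in M. T s (\<lambda>x. 1 * (?a * T h f x + ?b * f x) + (- 1) * g x) x
      = 1 * T s (\<lambda>x. ?a * T h f x + ?b * f x) x + (- 1) * T s g x"
    by (intro T_lincomb S_lincomb T_in assms)
  have 2: "AE x in M. T s (\<lambda>x. ?a * T h f x + ?b * f x) x = ?a * T s (T h f) x + ?b * T s f x"
    by (intro T_lincomb T_in assms)
  show ?thesis unfolding quot_eq
    using 1 2 T_add[OF assms(1,2,3)] by eventually_elim (simp add: diff_divide_distrib)
qed

lemma generator_T:
  assumes g: "semigroup_generator M S T f g" and s: "s \<ge> 0"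
  shows "semigroup_generator M S T (T s f) (T s g)"
proof -
  have fg: "f \<in> S" "g \<in> S" and lim: "((\<lambda>h. L2_norm M (quot f g h)) \<longlongrightarrow> 0) (at_right 0)"
    using g by (auto simp: generator_quot)
  obtain K where K: "\<And>f. f \<in> S \<Longrightarrow> L2_norm M (T s f) \<le> K * L2_norm M f" using T_bounded[OF s] by auto
  have "((\<lambda>h. L2_norm M (quot (T s f) (T s g) h)) \<longlongrightarrow> 0) (at_right 0)"
  proof (rule tendsto_sandwich[OF _ _ tendsto_const])
    show "((\<lambda>h. K * L2_norm M (quot f g h)) \<longlongrightarrow> 0) (at_right 0)"
      using tendsto_mult_left[OF lim, of K] by simp
    show "\<forall>\<^sub>F h in at_right 0. L2_norm M (quot (T s f) (T s g) h) \<le> K * L2_norm M (quot f g h)"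
      using eventually_at_right_less[of "0 :: real"]
    proof eventually_elim
      case (elim h)
      then have h: "h \<ge> 0" by simp
      have "AE x in M. quot (T s f) (T s g) h x = T s (quot f g h) x"
        using T_quot[OF s h fg] T_add[OF s h fg(1)] T_add[OF h s fg(1)]
        by eventually_elim (simp add: quot_def add.commute)
      then have "L2_norm M (quot (T s f) (T s g) h) = L2_norm M (T s (quot f g h))"
        by (intro L2_norm_cong_AE L2_measurable S_L2 T_in quot_in s h fg)
      then show ?case using K[OF quot_in[OF h fg]] by simp
    qed
  qed auto
  then show ?thesis using fg s by (simp add: generator_quot T_in)
qed

lemma generator_add:
  assumes "semigroup_generator M S T f g" "semigroup_generator M S T f' g'"
  shows "semigroup_generator M S T (\<lambda>x. a * f x + b * f' x) (\<lambda>x. a * g x + b * g' x)"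
proof -
  have fg: "f \<in> S" "g \<in> S" "f' \<in> S" "g' \<in> S"
    and lim: "((\<lambda>h. L2_norm M (quot f g h)) \<longlongrightarrow> 0) (at_right 0)" "((\<lambda>h. L2_norm M (quot f' g' h)) \<longlongrightarrow> 0) (at_right 0)"
    using assms by (auto simp: generator_quot)
  have "((\<lambda>h. L2_norm M (quot (\<lambda>x. a * f x + b * f' x) (\<lambda>x. a * g x + b * g' x) h)) \<longlongrightarrow> 0) (at_right 0)"
  proof (rule tendsto_sandwich[OF _ _ tendsto_const])
    show "((\<lambda>h. cmod a * L2_norm M (quot f g h) + cmod b * L2_norm M (quot f' g' h)) \<longlongrightarrow> 0) (at_right 0)"
      using tendsto_add[OF tendsto_mult_left[OF lim(1), of "cmod a"] tendsto_mult_left[OF lim(2), of "cmod b"]] by simp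
    show "\<forall>\<^sub>F h in at_right 0. L2_norm M (quot (\<lambda>x. a * f x + b * f' x) (\<lambda>x. a * g x + b * g' x) h)
        \<le> cmod a * L2_norm M (quot f g h) + cmod b * L2_norm M (quot f' g' h)"
      using eventually_at_right_less[of "0 :: real"]
    proof eventually_elim
      case (elim h)
      then have h: "h \<ge> 0" by simp
      have "AE x in M. quot (\<lambda>x. a * f x + b * f' x) (\<lambda>x. a * g x + b * g' x) h x = a * quot f g h x + b * quot f' g' h x"
        using T_lincomb[OF h fg(1,3), of a b] unfolding quot_def
        by eventually_elim (use elim in \<open>simp add: field_simps\<close>)
      then have "L2_norm M (quot (\<lambda>x. a * f x + b * f' x) (\<lambda>x. a * g x + b * g' x) h)
          = L2_norm M (\<lambda>x. a * quot f g h x + b * quot f' g' h x)"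
        by (intro L2_norm_cong_AE L2_measurable L2_lincomb S_L2 quot_in S_lincomb h fg)
      also have "\<dots> \<le> cmod a * L2_norm M (quot f g h) + cmod b * L2_norm M (quot f' g' h)"
        by (intro L2_norm_triangle_lincomb S_L2 quot_in h fg)
      finally show ?case .
    qed
  qed auto
  then show ?thesis using fg by (simp add: generator_quot S_lincomb)
qed

text \<open>The generator is a limit from the right, whereas the derivative here is two-sided in the
  interior. Left increments are treated as right increments from the earlier point, which requires a
  bound on \<open>T s\<close> uniform in \<open>s\<close>.\<close>

lemma pairing_has_vector_derivative:
  assumes g: "semigroup_generator M S T f g" and k: "k \<in> L2 M"
    and K: "K \<ge> 0" "\<And>s f. s \<in> {0..\<delta>} \<Longrightarrow> f \<in> S \<Longrightarrow> L2_norm M (T s f) \<le> K * L2_norm M f"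
    and s: "s \<in> {0..\<delta>}"
  shows "((\<lambda>s. \<integral>x. T s f x * k x \<partial>M) has_vector_derivative (\<integral>x. T s g x * k x \<partial>M)) (at s within {0..\<delta>})"
proof -
  have fg: "f \<in> S" "g \<in> S" and lim: "((\<lambda>h. L2_norm M (quot f g h)) \<longlongrightarrow> 0) (at_right 0)"
    using g by (auto simp: generator_quot)
  define u where "u s = (\<integral>x. T s f x * k x \<partial>M)" for s
  define v where "v s = (\<integral>x. T s g x * k x \<partial>M)" for s
  define q where "q h = L2_norm M (quot f g h)" for h
  define r where "r h = L2_norm M (\<lambda>x. T h g x - g x)" for h
  have qr: "((\<lambda>h. K * (q h + r h) * L2_norm M k) \<longlongrightarrow> 0) (at_right 0)"
  proof -
    have "((\<lambda>h. K * (q h + r h) * L2_norm M k) \<longlongrightarrow> K * (0 + 0) * L2_norm M k) (at_right 0)"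
      unfolding q_def r_def by (intro tendsto_intros lim T_continuous fg)
    then show ?thesis by simp
  qed
  have pair_int: "integrable M (\<lambda>x. T t f' x * k x)" if "t \<ge> 0" "f' \<in> S" for t f'
    using L2_mult_integrable[OF T_L2[OF that] k] .
  have fwd: "cmod (u (s + h) - u s - complex_of_real h * v s) \<le> h * (K * q h * L2_norm M k)"
    if "0 \<le> s" "0 < h" "s \<le> \<delta>" for s h
  proof -
    have h: "h \<ge> 0" "s + h \<ge> 0" using that by auto
    have "(\<integral>x. T s (quot f g h) x * k x \<partial>M) = (\<integral>x. ((T (s + h) f x - T s f x) / complex_of_real h - T s g x) * k x \<partial>M)"
    proof (rule pairing_cong)
      have "(\<lambda>x. (T (s + h) f x - T s f x) / complex_of_real h - T s g x)
        = (\<lambda>x. 1 * (1 / complex_of_real h * T (s + h) f x + (- 1 / complex_of_real h) * T s f x) + (- 1) * T s g x)"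
        by (auto simp: fun_eq_iff diff_divide_distrib)
      also have "\<dots> \<in> L2 M" by (intro L2_lincomb T_L2 h that fg)
      finally show "(\<lambda>x. (T (s + h) f x - T s f x) / complex_of_real h - T s g x) \<in> L2 M" .
    qed (intro T_L2 that quot_in h fg k T_quot)+
    also have "\<dots> = (\<integral>x. (1 / complex_of_real h) * (T (s + h) f x * k x) - (1 / complex_of_real h) * (T s f x * k x) - T s g x * k x \<partial>M)"
      by (intro Bochner_Integration.integral_cong) (auto simp: diff_divide_distrib left_diff_distrib)
    also have "\<dots> = (1 / complex_of_real h) * u (s + h) - (1 / complex_of_real h) * u s - v s"
      using pair_int[OF h(2) fg(1)] pair_int[OF that(1) fg(1)] pair_int[OF that(1) fg(2)]
      by (simp add: u_def v_def)
    finally have eq: "u (s + h) - u s - complex_of_real h * v s = complex_of_real h * (\<integral>x. T s (quot f g h) x * k x \<partial>M)"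
      using that by (simp add: field_simps)
    have "cmod (\<integral>x. T s (quot f g h) x * k x \<partial>M) \<le> L2_norm M (T s (quot f g h)) * L2_norm M k"
      by (intro L2_Cauchy_Schwarz T_L2 quot_in that h fg k)
    also have "\<dots> \<le> K * q h * L2_norm M k"
      unfolding q_def using that by (intro mult_right_mono K quot_in h fg) auto
    finally show ?thesis unfolding eq norm_mult using that by (simp add: mult_left_mono)
  qed
  have vdiff: "cmod (v (s + h) - v s) \<le> K * r h * L2_norm M k" if "0 \<le> s" "0 < h" "s \<le> \<delta>" for s h
  proof -
    have h: "h \<ge> 0" "s + h \<ge> 0" using that by auto
    have S1: "(\<lambda>x. 1 * T h g x + (- 1) * g x) \<in> S" by (intro S_lincomb T_in h fg)
    have "(\<integral>x. T s (T h g) x * k x \<partial>M) = v (s + h)"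
      unfolding v_def using T_add[OF that(1) h(1) fg(2)]
      by (intro pairing_cong T_L2 T_in that h fg k) (auto elim!: eventually_mono)
    then have "v (s + h) - v s = (\<integral>x. T s (\<lambda>x. 1 * T h g x + (- 1) * g x) x * k x \<partial>M)"
      by (subst T_pairing_lincomb) (use that h fg k T_in in \<open>auto simp: v_def\<close>)
    also have "cmod \<dots> \<le> L2_norm M (T s (\<lambda>x. 1 * T h g x + (- 1) * g x)) * L2_norm M k"
      by (intro L2_Cauchy_Schwarz T_L2 S1 that k)
    also have "\<dots> \<le> K * L2_norm M (\<lambda>x. 1 * T h g x + (- 1) * g x) * L2_norm M k"
      using that by (intro mult_right_mono K S1) auto
    finally show ?thesis by (simp add: r_def)
  qed
  have both: "cmod (u t - u s - complex_of_real (t - s) * v s) \<le> \<bar>t - s\<bar> * (K * (q \<bar>t - s\<bar> + r \<bar>t - s\<bar>) * L2_norm M k)"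
    if t: "t \<in> {0..\<delta>}" "t \<noteq> s" for t
  proof (cases "t > s")
    case True
    have "cmod (u t - u s - complex_of_real (t - s) * v s) \<le> \<bar>t - s\<bar> * (K * q \<bar>t - s\<bar> * L2_norm M k)"
      using fwd[of s "t - s"] True s by simp
    also have "\<dots> \<le> \<bar>t - s\<bar> * (K * (q \<bar>t - s\<bar> + r \<bar>t - s\<bar>) * L2_norm M k)"
      by (intro mult_left_mono mult_right_mono K(1)) (auto simp: r_def)
    finally show ?thesis .
  next
    case False
    \<comment> \<open>The increment is expanded from \<open>t\<close>, and \<open>v t\<close> is
      then exchanged for \<open>v s\<close>; the exchange costs the continuity modulus
      \<open>r\<close>.\<close>
    then have h: "0 < s - t" using t by simp
    have "cmod (u t - u s - complex_of_real (t - s) * v s)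
       = cmod ((u s - u t - complex_of_real (s - t) * v t) - complex_of_real (s - t) * (v s - v t))"
      by (subst norm_minus_cancel[symmetric]) (simp add: algebra_simps)
    also have "\<dots> \<le> cmod (u s - u t - complex_of_real (s - t) * v t) + cmod (complex_of_real (s - t) * (v s - v t))"
      by (rule norm_triangle_ineq4)
    also have "\<dots> \<le> (s - t) * (K * q (s - t) * L2_norm M k) + (s - t) * (K * r (s - t) * L2_norm M k)"
    proof (rule add_mono)
      show "cmod (u s - u t - complex_of_real (s - t) * v t) \<le> (s - t) * (K * q (s - t) * L2_norm M k)"
        using fwd[of t "s - t"] h t by simp
      have "cmod (complex_of_real (s - t) * (v s - v t)) = (s - t) * cmod (v s - v t)"
        using h by (simp add: norm_mult del: of_real_diff)
      then show "cmod (complex_of_real (s - t) * (v s - v t)) \<le> (s - t) * (K * r (s - t) * L2_norm M k)"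
        using vdiff[of t "s - t"] h t by (simp add: mult_left_mono)
    qed
    finally show ?thesis using h by (simp add: algebra_simps)
  qed
  have "((\<lambda>t. cmod (u t - u s - (t - s) *\<^sub>R v s) / norm (t - s)) \<longlongrightarrow> 0) (at s within {0..\<delta>})"
  proof (rule tendsto_sandwich[OF _ _ tendsto_const])
    have "filterlim (\<lambda>t. \<bar>t - s\<bar>) (at_right 0) (at s within {0..\<delta>})"
      unfolding filterlim_at
    proof (intro conjI)
      have "((\<lambda>t. \<bar>t - s\<bar>) \<longlongrightarrow> \<bar>s - s\<bar>) (at s within {0..\<delta>})" by (intro tendsto_intros)
      then show "((\<lambda>t. \<bar>t - s\<bar>) \<longlongrightarrow> 0) (at s within {0..\<delta>})" by simp
      show "\<forall>\<^sub>F t in at s within {0..\<delta>}. \<bar>t - s\<bar> \<in> {0<..} \<and> \<bar>t - s\<bar> \<noteq> 0"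
        by (auto simp: eventually_at_filter)
    qed
    from filterlim_compose[OF qr this]
    show "((\<lambda>t. K * (q \<bar>t - s\<bar> + r \<bar>t - s\<bar>) * L2_norm M k) \<longlongrightarrow> 0) (at s within {0..\<delta>})" .
    show "\<forall>\<^sub>F t in at s within {0..\<delta>}. cmod (u t - u s - (t - s) *\<^sub>R v s) / norm (t - s)
        \<le> K * (q \<bar>t - s\<bar> + r \<bar>t - s\<bar>) * L2_norm M k"
      unfolding eventually_at_filter
    proof (intro always_eventually allI impI)
      fix t assume t: "t \<noteq> s" "t \<in> {0..\<delta>}"
      then show "cmod (u t - u s - (t - s) *\<^sub>R v s) / norm (t - s) \<le> K * (q \<bar>t - s\<bar> + r \<bar>t - s\<bar>) * L2_norm M k"
        using both[OF t(2,1)] by (simp add: pos_divide_le_eq mult.commute scaleR_conv_of_real)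
    qed
  qed auto
  then show ?thesis unfolding u_def v_def has_vector_derivative_def
    by (simp add: has_derivative_iff_norm bounded_linear_scaleR_left)
qed

end

section \<open>Density of exponentials and wedge products\<close>

text \<open>Away from \<open>0\<close> this is \<open>- 1 / \<alpha>\<close> times
  \<open>adj_exp\<close> with exponent \<open>n\<close>. In the variable
  \<open>exp (- (\<theta> + \<tau>))\<close> it is the \<open>n\<close>-th power, so polynomial
  approximation applies.\<close>

definition exp_hist :: "real \<Rightarrow> nat \<Rightarrow> real \<Rightarrow> complex" where
  "exp_hist \<tau> n \<theta> = exp (- of_nat n * complex_of_real (\<theta> + \<tau>))"

lemma exp_hist_conv_power: "exp_hist \<tau> n \<theta> = complex_of_real (exp (- (\<theta> + \<tau>)) ^ n)"
proof -
  have "exp_hist \<tau> n \<theta> = exp (complex_of_real (real n * (- (\<theta> + \<tau>))))"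
    by (simp add: exp_hist_def algebra_simps)
  also have "\<dots> = complex_of_real (exp (real n * (- (\<theta> + \<tau>))))" by (rule exp_of_real)
  finally show ?thesis by (simp only: exp_of_nat_mult)
qed

lemma L2_exp_hist: "exp_hist \<tau> n \<in> L2 (hist_measure \<tau>)"
  unfolding exp_hist_def by (intro continuous_on_L2_hist continuous_intros)

lemma L2_indicator:
  assumes "finite_measure M" "A \<in> sets M"
  shows "(indicator A :: _ \<Rightarrow> complex) \<in> L2 M"
proof (rule L2_bounded[OF assms(1)])
  show "(indicator A :: _ \<Rightarrow> complex) \<in> borel_measurable M"
    using assms(2) by (rule borel_measurable_indicator)
  show "cmod (indicator A x) \<le> 1" for x by (simp add: indicator_def)
qed

lemma L2_norm_le_sup:
  assumes "finite_measure M" "f \<in> borel_measurable M" "\<And>x. x \<in> space M \<Longrightarrow> cmod (f x) \<le> e" "e \<ge> 0"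
  shows "L2_norm M f \<le> e * sqrt (measure M (space M))"
proof -
  interpret finite_measure M by fact
  have "(\<integral>x. (cmod (f x))\<^sup>2 \<partial>M) \<le> (\<integral>x. e\<^sup>2 \<partial>M)"
    using assms L2_integrable_square[OF L2_bounded[OF assms(1-3)]]
    by (intro integral_mono) (auto intro!: power_mono)
  then have "L2_norm M f \<le> sqrt (measure M (space M) * e\<^sup>2)" by (simp add: L2_norm_def)
  then show ?thesis using assms(4) by (simp add: real_sqrt_mult mult.commute)
qed

text \<open>Weierstrass approximation in the variable \<open>x = exp (- (\<theta> + \<tau>))\<close>
  reaches continuous functions, and continuous ramps reach indicators. The exponent \<open>0\<close>
  is left out on purpose: sums of two exponents must later differ from a number
  \<open>p \<le> 0\<close>.\<close>

lemma L2_hist_exp_induct [consumes 2, case_names closed lincomb exp]: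
  assumes f: "f \<in> L2 (hist_measure \<tau>)" and \<tau>: "0 < \<tau>"
    and closed: "\<And>f. f \<in> L2 (hist_measure \<tau>) \<Longrightarrow>
       (\<And>e. e > 0 \<Longrightarrow> \<exists>g\<in>L2 (hist_measure \<tau>). P g \<and> L2_norm (hist_measure \<tau>) (\<lambda>x. f x - g x) < e) \<Longrightarrow> P f"
    and lincomb: "\<And>f g a b. f \<in> L2 (hist_measure \<tau>) \<Longrightarrow> g \<in> L2 (hist_measure \<tau>) \<Longrightarrow> P f \<Longrightarrow> P g \<Longrightarrow> P (\<lambda>x. a * f x + b * g x)"
    and exp: "\<And>n. n \<ge> 1 \<Longrightarrow> P (exp_hist \<tau> n)"
  shows "P f"
proof -
  let ?M = "hist_measure \<tau>"
  define c where "c = sqrt (measure ?M (space ?M))"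
  have c0: "c \<ge> 0" by (simp add: c_def)
  have fin: "finite_measure ?M" by (rule finite_measure_hist_measure)
  have uniform: "P f" if fL: "f \<in> L2 ?M"
    and ap: "\<And>e. e > 0 \<Longrightarrow> \<exists>g\<in>L2 ?M. P g \<and> (\<forall>x\<in>{-\<tau>..0}. cmod (f x - g x) \<le> e)" for f
  proof (rule closed[OF fL])
    fix e :: real assume e: "e > 0"
    obtain g where g: "g \<in> L2 ?M" "P g" "\<And>x. x \<in> {-\<tau>..0} \<Longrightarrow> cmod (f x - g x) \<le> e / (2 * (c + 1))"
      using ap[of "e / (2 * (c + 1))"] e c0 by auto
    have "L2_norm ?M (\<lambda>x. f x - g x) \<le> e / (2 * (c + 1)) * c"
      unfolding c_def by (rule L2_norm_le_sup[OF fin]) (use g e c0 L2_diff[OF fL g(1)] in \<open>auto simp: L2_measurable c_def\<close>)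
    also have "\<dots> < e" using e c0 by (simp add: field_simps add_nonneg_pos)
    finally show "\<exists>g\<in>L2 ?M. P g \<and> L2_norm ?M (\<lambda>x. f x - g x) < e" using g by blast
  qed
  have E1: "exp_hist \<tau> 1 \<in> L2 ?M" by (rule L2_exp_hist)
  have poly: "P (\<lambda>x. \<Sum>i\<le>n. complex_of_real (a i) * exp_hist \<tau> (Suc i) x)" for a :: "nat \<Rightarrow> real" and n
  proof (induction n)
    case 0
    show ?case using lincomb[OF E1 E1 exp exp, of "complex_of_real (a 0)" 0] by simp
  next
    case (Suc n)
    have "P (\<lambda>x. 1 * (\<Sum>i\<le>n. complex_of_real (a i) * exp_hist \<tau> (Suc i) x) + complex_of_real (a (Suc n)) * exp_hist \<tau> (Suc (Suc n)) x)"
      by (intro lincomb L2_sum L2_scale L2_exp_hist Suc exp) simp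
    then show ?case by simp
  qed
  have cont_real: "P (\<lambda>x. complex_of_real (f x))" if cf: "continuous_on {-\<tau>..0} f" for f
  proof (rule uniform)
    show "(\<lambda>x. complex_of_real (f x)) \<in> L2 ?M" by (intro continuous_on_L2_hist continuous_intros cf)
    fix e :: real assume e: "e > 0"
    \<comment> \<open>Dividing by \<open>x\<close> makes up for the missing constant term: if the
      polynomial \<open>g\<close> is close to \<open>F\<close>, then \<open>x * g x\<close> has no
      constant term and is close to the original function.\<close>
    define F where "F x = f (- ln x - \<tau>) / x" for x :: real
    have lnb: "- ln x - \<tau> \<in> {-\<tau>..0}" if "x \<in> {exp (-\<tau>)..1}" for x
    proof -
      have "x > 0" using that less_le_trans[OF exp_gt_zero, of "-\<tau>" x] by simp
      moreover have "ln x \<ge> -\<tau>" using that by (intro ln_ge_iff[THEN iffD2] \<open>x > 0\<close>) auto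
      ultimately show ?thesis using that ln_le_zero_iff[of x] by auto
    qed
    have pos: "x > 0" if "x \<in> {exp (-\<tau>)..1}" for x :: real
      using that less_le_trans[OF exp_gt_zero, of "-\<tau>" x] by simp
    have nz: "\<forall>x\<in>{exp (-\<tau>)..1}. x \<noteq> (0::real)" using pos by force
    have "continuous_on {exp (-\<tau>)..1} ln"
      by (rule continuous_on_ln[OF continuous_on_id]) (use pos in force)
    then have "continuous_on {exp (-\<tau>)..1} (\<lambda>x. - ln x - \<tau>)"
      by (intro continuous_on_diff continuous_on_minus continuous_on_const)
    then have "continuous_on {exp (-\<tau>)..1} (\<lambda>x. f (- ln x - \<tau>))"
      by (rule continuous_on_compose2[OF cf]) (use lnb in blast)
    then have "continuous_on {exp (-\<tau>)..1} F" unfolding F_def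
      by (intro continuous_on_divide continuous_on_id nz)
    then obtain g where g: "real_polynomial_function g" "\<And>x. x \<in> {exp (-\<tau>)..1} \<Longrightarrow> \<bar>F x - g x\<bar> < e"
      using Stone_Weierstrass_real_polynomial_function[of "{exp (-\<tau>)..1}" F e] e by auto
    then obtain a n where an: "g = (\<lambda>x. \<Sum>i\<le>n. a i * x ^ i)" using real_polynomial_function_iff_sum[of g] by auto
    show "\<exists>g\<in>L2 ?M. P g \<and> (\<forall>x\<in>{-\<tau>..0}. cmod (complex_of_real (f x) - g x) \<le> e)"
    proof (intro bexI[of _ "\<lambda>x. \<Sum>i\<le>n. complex_of_real (a i) * exp_hist \<tau> (Suc i) x"] conjI poly ballI)
      show "(\<lambda>x. \<Sum>i\<le>n. complex_of_real (a i) * exp_hist \<tau> (Suc i) x) \<in> L2 ?M"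
        by (intro L2_sum L2_scale L2_exp_hist)
      fix \<theta> assume \<theta>: "\<theta> \<in> {-\<tau>..0}"
      define x where "x = exp (- (\<theta> + \<tau>))"
      have x: "x \<in> {exp (-\<tau>)..1}" "x > 0" "- ln x - \<tau> = \<theta>" using \<theta> by (auto simp: x_def)
      have E: "exp_hist \<tau> i \<theta> = complex_of_real (x ^ i)" for i by (simp add: exp_hist_conv_power x_def)
      have "(\<Sum>i\<le>n. complex_of_real (a i) * exp_hist \<tau> (Suc i) \<theta>) = complex_of_real (x * g x)"
        unfolding an E by (simp add: sum_distrib_left mult_ac)
      then have "cmod (complex_of_real (f \<theta>) - (\<Sum>i\<le>n. complex_of_real (a i) * exp_hist \<tau> (Suc i) \<theta>)) = \<bar>f \<theta> - x * g x\<bar>"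
        by (simp only: of_real_diff[symmetric] norm_of_real)
      also have "f \<theta> - x * g x = x * (F x - g x)" using x by (simp add: F_def field_simps)
      also have "\<bar>x * (F x - g x)\<bar> \<le> 1 * e"
        unfolding abs_mult using x g(2)[OF x(1)] by (intro mult_mono) auto
      finally show "cmod (complex_of_real (f \<theta>) - (\<Sum>i\<le>n. complex_of_real (a i) * exp_hist \<tau> (Suc i) \<theta>)) \<le> e" by simp
    qed
  qed
  have closed_seq: "P g" if "g \<in> L2 ?M" "\<And>n. s n \<in> L2 ?M" "\<And>n. P (s n)"
    "(\<lambda>n. L2_norm ?M (\<lambda>x. g x - s n x)) \<longlonglongrightarrow> 0" for g s
  proof (rule closed[OF that(1)])
    fix e :: real assume "e > 0"
    with that(4) have "eventually (\<lambda>n. L2_norm ?M (\<lambda>x. g x - s n x) < e) sequentially"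
      by (auto dest: order_tendstoD(2))
    then obtain n where "L2_norm ?M (\<lambda>x. g x - s n x) < e" by (auto simp: eventually_sequentially)
    then show "\<exists>h\<in>L2 ?M. P h \<and> L2_norm ?M (\<lambda>x. g x - h x) < e" using that by blast
  qed
  let ?E = "(\<inter>) {-\<tau>..0} ` range lessThan :: real set set"
  show ?thesis
  proof (rule L2_induct[OF f fin])
    have "sets (restrict_space borel {-\<tau>..0::real}) = (\<inter>) {-\<tau>..0} ` sigma_sets UNIV (range lessThan)"
      by (simp add: sets_restrict_space borel_Iio)
    also have "\<dots> = sigma_sets {-\<tau>..0} ?E"
    proof (rule sigma_sets_Int)
      have "{-\<tau>..0::real} \<in> sets borel" by simp
      then show "{-\<tau>..0} \<in> sigma_sets UNIV (range lessThan :: real set set)" by (simp add: borel_Iio)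
    qed simp
    finally show "sets ?M = sigma_sets (space ?M) ?E" by simp
    show "Int_stable ?E"
    proof (rule Int_stableI)
      fix A B assume "A \<in> ?E" "B \<in> ?E"
      then obtain a b where "A = {-\<tau>..0} \<inter> {..<a}" "B = {-\<tau>..0} \<inter> {..<b}" by auto
      then have "A \<inter> B = {-\<tau>..0} \<inter> {..<min a b}" by auto
      then show "A \<inter> B \<in> ?E" by auto
    qed
    show "?E \<subseteq> Pow (space ?M)" by auto
    have one: "(\<lambda>x. 1) \<in> L2 ?M" by (rule L2_bounded[OF fin, of _ 1]) auto
    have "P (\<lambda>x. complex_of_real 1)" by (intro cont_real continuous_intros)
    then show "P (indicator (space ?M))"
    proof (rule closed_seq[rotated 2])
      show "(indicator (space ?M) :: real \<Rightarrow> complex) \<in> L2 ?M"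
        by (intro L2_indicator fin sets.top)
      have "L2_norm ?M (\<lambda>x. indicator (space ?M) x - complex_of_real 1) = L2_norm ?M (\<lambda>x. 0)"
        by (rule L2_norm_cong) simp
      then show "(\<lambda>n. L2_norm ?M (\<lambda>x. indicator (space ?M) x - complex_of_real 1)) \<longlonglongrightarrow> 0"
        by (simp add: L2_norm_def)
    qed (simp add: one)
    fix A assume "A \<in> ?E"
    then obtain b where b: "A = {-\<tau>..0} \<inter> {..<b}" by auto
    have As: "A \<in> sets ?M" unfolding b by (auto simp: sets_restrict_space)
    \<comment> \<open>Continuous ramps that increase to the indicator of
      \<open>x < b\<close>.\<close>
    define s where "s n x = max 0 (min 1 (real n * (b - x)))" for n x
    have sc: "continuous_on X (s n)" for X n unfolding s_def by (intro continuous_intros)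
    show "P (indicator A)"
    proof (rule closed_seq)
      show "(indicator A :: real \<Rightarrow> complex) \<in> L2 ?M"
        by (intro L2_indicator fin As)
      show sL: "(\<lambda>x. complex_of_real (s n x)) \<in> L2 ?M" for n by (intro continuous_on_L2_hist continuous_intros sc)
      show "P (\<lambda>x. complex_of_real (s n x))" for n by (intro cont_real sc)
      show "(\<lambda>n. L2_norm ?M (\<lambda>x. indicator A x - complex_of_real (s n x))) \<longlonglongrightarrow> 0"
      proof (rule L2_dominated_convergence[OF one])
        show "(indicator A :: real \<Rightarrow> complex) \<in> borel_measurable ?M" using As by (rule borel_measurable_indicator)
        show "(\<lambda>x. complex_of_real (s n x)) \<in> borel_measurable ?M" for n using sL by (rule L2_measurable)
        show "AE x in ?M. (\<lambda>n. complex_of_real (s n x)) \<longlonglongrightarrow> indicator A x"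
        proof (intro AE_I2)
          fix x assume x: "x \<in> space ?M"
          show "(\<lambda>n. complex_of_real (s n x)) \<longlonglongrightarrow> indicator A x"
          proof (cases "x < b")
            case True
            obtain n0 where n0: "real n0 > 1 / (b - x)" using reals_Archimedean2 by blast
            have "eventually (\<lambda>n. complex_of_real (s n x) = 1) sequentially"
              using eventually_ge_at_top[of n0]
            proof eventually_elim
              case (elim n)
              then have "real n \<ge> 1 / (b - x)" using n0 by linarith
              then have "real n * (b - x) \<ge> 1" using True by (simp add: field_simps)
              then show ?case by (simp add: s_def)
            qed
            then show ?thesis using True x b by (simp add: tendsto_eventually)
          next
            case False
            then have le: "real n * (b - x) \<le> 0" for n by (simp add: mult_nonneg_nonpos)
            have "s n x = 0" for n using le[of n] unfolding s_def by linarith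
            then show ?thesis using False b by simp
          qed
        qed
        show "AE x in ?M. cmod (complex_of_real (s n x)) \<le> cmod 1" for n
          by (intro AE_I2) (simp add: s_def max_def min_def)
      qed
    qed
  qed (fact closed lincomb)+
qed

lemma tensor_lincomb_left: "tensor (\<lambda>x. a * f x + b * g x) h = (\<lambda>z. a * tensor f h z + b * tensor g h z)"
  by (auto simp: tensor_def algebra_simps)

lemma tensor_lincomb_right: "tensor h (\<lambda>x. a * f x + b * g x) = (\<lambda>z. a * tensor h f z + b * tensor h g z)"
  by (auto simp: tensor_def algebra_simps)

lemma tensor_diff_left: "tensor f h z - tensor g h z = tensor (\<lambda>x. f x - g x) h z"
  by (auto simp: tensor_def algebra_simps split: prod.splits)

lemma tensor_diff_right: "tensor h f z - tensor h g z = tensor h (\<lambda>x. f x - g x) z"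
  by (auto simp: tensor_def algebra_simps split: prod.splits)

text \<open>One tensor factor is approximated at a time while the other is held fixed, which works
  because the norm of a tensor is the product of the norms. Indicators of rectangles are tensors and
  generate the rest.\<close>

lemma L2_hist2_exp_induct [consumes 2, case_names closed lincomb exp]:
  assumes f: "f \<in> L2 (hist_measure2 \<tau>)" and \<tau>: "0 < \<tau>"
    and closed: "\<And>f. f \<in> L2 (hist_measure2 \<tau>) \<Longrightarrow>
       (\<And>e. e > 0 \<Longrightarrow> \<exists>g\<in>L2 (hist_measure2 \<tau>). P g \<and> L2_norm (hist_measure2 \<tau>) (\<lambda>x. f x - g x) < e) \<Longrightarrow> P f"
    and lincomb: "\<And>f g a b. f \<in> L2 (hist_measure2 \<tau>) \<Longrightarrow> g \<in> L2 (hist_measure2 \<tau>) \<Longrightarrow> P f \<Longrightarrow> P g \<Longrightarrow> P (\<lambda>x. a * f x + b * g x)"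
    and exp: "\<And>m n. m \<ge> 1 \<Longrightarrow> n \<ge> 1 \<Longrightarrow> P (tensor (exp_hist \<tau> m) (exp_hist \<tau> n))"
  shows "P f"
proof -
  let ?M = "hist_measure \<tau>" and ?M2 = "hist_measure2 \<tau>"
  have fin: "finite_measure ?M" by (rule finite_measure_hist_measure)
  note tens = L2_tensor[OF fin fin]
  have eps: "\<exists>g\<in>L2 ?M. Q g \<and> L2_norm ?M (\<lambda>x. f x - g x) * c < e"
    if "\<And>e. e > 0 \<Longrightarrow> \<exists>g\<in>L2 ?M. Q g \<and> L2_norm ?M (\<lambda>x. f x - g x) < e" "e > 0" "c \<ge> 0" for f Q and e c :: real
  proof -
    have "e / (c + 1) > 0" using that by simp
    from that(1)[OF this]
    obtain g where g: "g \<in> L2 ?M" "Q g" "L2_norm ?M (\<lambda>x. f x - g x) < e / (c + 1)" by blast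
    have "L2_norm ?M (\<lambda>x. f x - g x) * c \<le> L2_norm ?M (\<lambda>x. f x - g x) * (c + 1)"
      by (intro mult_left_mono) auto
    also have "\<dots> < e" using g(3) that by (simp add: pos_less_divide_eq)
    finally show ?thesis using g by blast
  qed
  have 1: "P (tensor f (exp_hist \<tau> n))" if "f \<in> L2 ?M" "n \<ge> 1" for f n
    using that(1) \<tau>
  proof (induction rule: L2_hist_exp_induct)
    case (closed f)
    show ?case
    proof (rule assms(3))
      show "tensor f (exp_hist \<tau> n) \<in> L2 ?M2" by (intro tens closed L2_exp_hist)
      fix e :: real assume "e > 0"
      from eps[OF closed(2) this, of "L2_norm ?M (exp_hist \<tau> n)"]
      obtain g where g: "g \<in> L2 ?M" "P (tensor g (exp_hist \<tau> n))"
        "L2_norm ?M (\<lambda>x. f x - g x) * L2_norm ?M (exp_hist \<tau> n) < e" by auto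
      have d: "(\<lambda>x. f x - g x) \<in> L2 ?M" by (intro L2_diff closed(1) g)
      show "\<exists>g\<in>L2 ?M2. P g \<and> L2_norm ?M2 (\<lambda>x. tensor f (exp_hist \<tau> n) x - g x) < e"
        by (rule bexI[of _ "tensor g (exp_hist \<tau> n)"])
           (use g tens(1)[OF g(1) L2_exp_hist] in \<open>simp_all add: tensor_diff_left tens(2)[OF d L2_exp_hist]\<close>)
    qed
  next
    case (lincomb f g a b)
    then show ?case unfolding tensor_lincomb_left by (intro assms(4) tens L2_exp_hist) auto
  next
    case (exp m)
    then show ?case using assms(5) that by simp
  qed
  have 2: "P (tensor f g)" if "g \<in> L2 ?M" "f \<in> L2 ?M" for f g
    using that(1) \<tau>
  proof (induction rule: L2_hist_exp_induct)
    case (closed h)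
    show ?case
    proof (rule assms(3))
      show "tensor f h \<in> L2 ?M2" by (intro tens closed that)
      fix e :: real assume "e > 0"
      from eps[OF closed(2) this, of "L2_norm ?M f"]
      obtain g where g: "g \<in> L2 ?M" "P (tensor f g)" "L2_norm ?M (\<lambda>x. h x - g x) * L2_norm ?M f < e" by auto
      have d: "(\<lambda>x. h x - g x) \<in> L2 ?M" by (intro L2_diff closed(1) g)
      show "\<exists>g\<in>L2 ?M2. P g \<and> L2_norm ?M2 (\<lambda>x. tensor f h x - g x) < e"
        by (rule bexI[of _ "tensor f g"])
           (use g tens(1)[OF that(2) g(1)] in \<open>simp_all add: tensor_diff_right tens(2)[OF that(2) d] mult.commute\<close>)
    qed
  next
    case (lincomb g h a b)
    then show ?case unfolding tensor_lincomb_right by (intro assms(4) tens that) auto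
  next
    case (exp m)
    then show ?case using 1 that by simp
  qed
  have indL: "(indicator A :: real \<Rightarrow> complex) \<in> L2 ?M" if "A \<in> sets ?M" for A
    using that by (intro L2_indicator fin)
  have 3: "P (indicator (A \<times> B))" if "A \<in> sets ?M" "B \<in> sets ?M" for A B
  proof -
    have "indicator (A \<times> B) = tensor (indicator A) (indicator B)"
      by (auto simp: tensor_def indicator_def fun_eq_iff)
    then show ?thesis using 2[OF indL indL] that by simp
  qed
  show ?thesis
  proof (rule L2_induct[OF f finite_measure_hist2])
    show "sets ?M2 = sigma_sets (space ?M2) {a \<times> b |a b. a \<in> sets ?M \<and> b \<in> sets ?M}"
      by (simp only: sets_pair_measure space_pair_measure)
    show "Int_stable {a \<times> b |a b. a \<in> sets ?M \<and> b \<in> sets ?M}" by (rule Int_stable_pair_measure_generator)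
    show "{a \<times> b |a b. a \<in> sets ?M \<and> b \<in> sets ?M} \<subseteq> Pow (space ?M2)"
      using sets.sets_into_space[of _ ?M] by (auto simp: space_pair_measure simp del: sets_hist_measure)
    show "P (indicator (space ?M2))" unfolding space_pair_measure by (intro 3 sets.top)
    show "P (indicator A)" if "A \<in> {a \<times> b |a b. a \<in> sets ?M \<and> b \<in> sets ?M}" for A using that 3 by auto
  qed (fact closed lincomb)+
qed

section \<open>Eigenfunctions of the second compound of the delay operator\<close>

locale ss_compound =
  fixes \<alpha> \<tau> \<Lambda> :: real and G G2
  assumes \<tau>: "0 < \<tau>"
    and gen: "generates_semigroup \<tau> (ss_functional \<alpha> \<tau> \<Lambda>) G"
    and wed: "wedge_semigroup \<tau> G G2"
begin

abbreviation M where "M \<equiv> hist_measure \<tau>"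
abbreviation M2 where "M2 \<equiv> hist_measure2 \<tau>"
abbreviation D where "D \<equiv> delay_operator \<tau> (ss_functional \<alpha> \<tau> \<Lambda>)"
abbreviation A2 where "A2 \<equiv> semigroup_generator M2 (L2_wedge \<tau>) G2"
abbreviation chr :: "complex \<Rightarrow> complex" where "chr \<equiv> ss_char \<alpha> \<tau> \<Lambda>"
abbreviation k where "k \<equiv> adj_exp \<alpha> \<tau>"
abbreviation \<delta> :: "real \<Rightarrow> complex" where "\<delta> \<equiv> indicator {0}"

sublocale G: L2_semigroup M "L2 M" G
  by (rule L2_semigroup.intro) (rule finite_measure_hist_measure closed_subspace_L2
      gen[unfolded generates_semigroup_def, THEN conjunct1])+

sublocale W: L2_semigroup M2 "L2_wedge \<tau>" G2
  by (rule L2_semigroup.intro) (rule finite_measure_hist2 closed_subspace_L2_wedge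
      wed[unfolded wedge_semigroup_def, THEN conjunct1])+

lemma generator_G: "semigroup_generator M (L2 M) G = D"
  by (rule gen[unfolded generates_semigroup_def, THEN conjunct2])

lemma D_L2: "D \<phi> \<xi> \<Longrightarrow> \<phi> \<in> L2 M" "D \<phi> \<xi> \<Longrightarrow> \<xi> \<in> L2 M"
  by (simp_all add: delay_operator_def)

lemma D_G: "D \<phi> \<xi> \<Longrightarrow> s \<ge> 0 \<Longrightarrow> D (G s \<phi>) (G s \<xi>)"
  by (rule G.generator_T[unfolded generator_G])

lemma G2_wedge:
  "t \<ge> 0 \<Longrightarrow> \<phi>\<^sub>1 \<in> L2 M \<Longrightarrow> \<phi>\<^sub>2 \<in> L2 M \<Longrightarrow> AE z in M2. G2 t (wedge \<phi>\<^sub>1 \<phi>\<^sub>2) z = wedge (G t \<phi>\<^sub>1) (G t \<phi>\<^sub>2) z"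
  using wed unfolding wedge_semigroup_def by blast

lemma wedge_L2: "f \<in> L2 M \<Longrightarrow> g \<in> L2 M \<Longrightarrow> wedge f g \<in> L2 M2"
  by (rule W.S_L2[OF L2_norm_wedge(1)])

text \<open>The Leibniz rule. Convergence in norm follows because the norm of a wedge is at most the
  product of the norms of its factors.\<close>

lemma generator_wedge:
  assumes D1: "D \<phi>\<^sub>1 \<xi>\<^sub>1" and D2: "D \<phi>\<^sub>2 \<xi>\<^sub>2"
  shows "A2 (wedge \<phi>\<^sub>1 \<phi>\<^sub>2) (\<lambda>z. 1 * wedge \<xi>\<^sub>1 \<phi>\<^sub>2 z + 1 * wedge \<phi>\<^sub>1 \<xi>\<^sub>2 z)"
proof -
  note L = D_L2[OF D1] D_L2[OF D2]
  let ?N = "L2_norm M" and ?N2 = "L2_norm M2"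
  let ?q1 = "\<lambda>h. ?N (G.quot \<phi>\<^sub>1 \<xi>\<^sub>1 h)" and ?q2 = "\<lambda>h. ?N (G.quot \<phi>\<^sub>2 \<xi>\<^sub>2 h)"
  let ?c = "\<lambda>h. ?N (\<lambda>x. G h \<phi>\<^sub>2 x - \<phi>\<^sub>2 x)"
  have q1: "(?q1 \<longlongrightarrow> 0) (at_right 0)" and q2: "(?q2 \<longlongrightarrow> 0) (at_right 0)"
    using D1 D2 unfolding generator_G[symmetric] G.generator_quot by auto
  have c: "(?c \<longlongrightarrow> 0) (at_right 0)" by (rule G.T_continuous[OF L(3)])
  let ?f = "wedge \<phi>\<^sub>1 \<phi>\<^sub>2" and ?g = "\<lambda>z. 1 * wedge \<xi>\<^sub>1 \<phi>\<^sub>2 z + 1 * wedge \<phi>\<^sub>1 \<xi>\<^sub>2 z"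
  have fS: "?f \<in> L2_wedge \<tau>" by (intro L2_norm_wedge L)
  have gS: "?g \<in> L2_wedge \<tau>" by (intro W.S_lincomb L2_norm_wedge L)
  have "((\<lambda>h. ?N2 (W.quot ?f ?g h)) \<longlongrightarrow> 0) (at_right 0)"
  proof (rule tendsto_sandwich[OF _ _ tendsto_const])
    have "((\<lambda>h. ?q1 h * (?N \<phi>\<^sub>2 + ?c h) + (?N \<xi>\<^sub>1 * ?c h + ?N \<phi>\<^sub>1 * ?q2 h))
      \<longlongrightarrow> 0 * (?N \<phi>\<^sub>2 + 0) + (?N \<xi>\<^sub>1 * 0 + ?N \<phi>\<^sub>1 * 0)) (at_right 0)"
      by (intro tendsto_intros q1 q2 c)
    then show "((\<lambda>h. ?q1 h * (?N \<phi>\<^sub>2 + ?c h) + (?N \<xi>\<^sub>1 * ?c h + ?N \<phi>\<^sub>1 * ?q2 h)) \<longlongrightarrow> 0) (at_right 0)" by simp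
    show "\<forall>\<^sub>F h in at_right 0. ?N2 (W.quot ?f ?g h) \<le> ?q1 h * (?N \<phi>\<^sub>2 + ?c h) + (?N \<xi>\<^sub>1 * ?c h + ?N \<phi>\<^sub>1 * ?q2 h)"
      using eventually_at_right_less[of "0 :: real"]
    proof eventually_elim
      case (elim h)
      then have h: "h \<ge> 0" by simp
      \<comment> \<open>The usual splitting for a product: the defect of the first factor against
        the moved second factor, then the increment and the defect of the second factor against
        fixed first factors.\<close>
      let ?r = "\<lambda>z. wedge (G.quot \<phi>\<^sub>1 \<xi>\<^sub>1 h) (G h \<phi>\<^sub>2) z + (wedge \<xi>\<^sub>1 (\<lambda>x. G h \<phi>\<^sub>2 x - \<phi>\<^sub>2 x) z + wedge \<phi>\<^sub>1 (G.quot \<phi>\<^sub>2 \<xi>\<^sub>2 h) z)"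
      note Lh = G.quot_in[OF h L(1,2)] G.quot_in[OF h L(3,4)] G.T_L2[OF h L(1)] G.T_L2[OF h L(3)]
         L2_diff[OF G.T_L2[OF h L(3)] L(3)]
      have "AE z in M2. W.quot ?f ?g h z = ?r z"
        using G2_wedge[OF h L(1,3)]
      proof eventually_elim
        case (elim z)
        show ?case unfolding W.quot_def elim
          using \<open>0 < h\<close> by (cases z) (simp add: wedge_def G.quot_def field_simps)
      qed
      then have "?N2 (W.quot ?f ?g h) = ?N2 ?r"
        by (intro L2_norm_cong_AE L2_measurable L2_add wedge_L2 W.S_L2 W.quot_in h fS gS Lh L)
      also have "\<dots> \<le> ?N2 (wedge (G.quot \<phi>\<^sub>1 \<xi>\<^sub>1 h) (G h \<phi>\<^sub>2))
          + ?N2 (\<lambda>z. wedge \<xi>\<^sub>1 (\<lambda>x. G h \<phi>\<^sub>2 x - \<phi>\<^sub>2 x) z + wedge \<phi>\<^sub>1 (G.quot \<phi>\<^sub>2 \<xi>\<^sub>2 h) z)"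
        by (intro L2_norm_triangle L2_add wedge_L2 Lh L)
      also have "\<dots> \<le> ?q1 h * (?N \<phi>\<^sub>2 + ?c h) + (?N \<xi>\<^sub>1 * ?c h + ?N \<phi>\<^sub>1 * ?q2 h)"
      proof (rule add_mono)
        have "?N2 (wedge (G.quot \<phi>\<^sub>1 \<xi>\<^sub>1 h) (G h \<phi>\<^sub>2)) \<le> ?q1 h * ?N (G h \<phi>\<^sub>2)"
          by (intro L2_norm_wedge Lh)
        also have "\<dots> \<le> ?q1 h * (?N \<phi>\<^sub>2 + ?c h)"
          by (intro mult_left_mono L2_norm_triangle_sub Lh L) simp
        finally show "?N2 (wedge (G.quot \<phi>\<^sub>1 \<xi>\<^sub>1 h) (G h \<phi>\<^sub>2)) \<le> ?q1 h * (?N \<phi>\<^sub>2 + ?c h)" .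
        have "?N2 (\<lambda>z. wedge \<xi>\<^sub>1 (\<lambda>x. G h \<phi>\<^sub>2 x - \<phi>\<^sub>2 x) z + wedge \<phi>\<^sub>1 (G.quot \<phi>\<^sub>2 \<xi>\<^sub>2 h) z)
            \<le> ?N2 (wedge \<xi>\<^sub>1 (\<lambda>x. G h \<phi>\<^sub>2 x - \<phi>\<^sub>2 x)) + ?N2 (wedge \<phi>\<^sub>1 (G.quot \<phi>\<^sub>2 \<xi>\<^sub>2 h))"
          by (intro L2_norm_triangle wedge_L2 Lh L)
        also have "\<dots> \<le> ?N \<xi>\<^sub>1 * ?c h + ?N \<phi>\<^sub>1 * ?q2 h"
          by (intro add_mono L2_norm_wedge Lh L)
        finally show "?N2 (\<lambda>z. wedge \<xi>\<^sub>1 (\<lambda>x. G h \<phi>\<^sub>2 x - \<phi>\<^sub>2 x) z + wedge \<phi>\<^sub>1 (G.quot \<phi>\<^sub>2 \<xi>\<^sub>2 h) z)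
            \<le> ?N \<xi>\<^sub>1 * ?c h + ?N \<phi>\<^sub>1 * ?q2 h" .
      qed
      finally show ?case .
    qed
  qed auto
  then show ?thesis using fS gS by (simp add: W.generator_quot)
qed

section \<open>Pairings of the compound semigroup with tensors of adjoint exponentials\<close>

lemma wedge_pairing:
  assumes "f \<in> L2 M" "g \<in> L2 M" "p \<in> L2 M" "q \<in> L2 M"
  shows "(\<integral>z. wedge f g z * tensor p q z \<partial>M2)
    = ((\<integral>x. f x * p x \<partial>M) * (\<integral>x. g x * q x \<partial>M) - (\<integral>x. g x * p x \<partial>M) * (\<integral>x. f x * q x \<partial>M)) / 2"
proof -
  note fin = finite_measure_hist_measure[of \<tau>]
  note t = L2_tensor(1)[OF fin fin]
  have "(\<integral>z. wedge f g z * tensor p q z \<partial>M2)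
      = (\<integral>z. 1 / 2 * (tensor f g z * tensor p q z) - 1 / 2 * (tensor g f z * tensor p q z) \<partial>M2)"
    by (simp add: wedge_eq_tensor algebra_simps)
  also have "\<dots> = 1 / 2 * (\<integral>z. tensor f g z * tensor p q z \<partial>M2) - 1 / 2 * (\<integral>z. tensor g f z * tensor p q z \<partial>M2)"
    using L2_mult_integrable[OF t[OF assms(1,2)] t[OF assms(3,4)]]
      L2_mult_integrable[OF t[OF assms(2,1)] t[OF assms(3,4)]] by simp
  also have "\<dots> = 1 / 2 * ((\<integral>x. f x * p x \<partial>M) * (\<integral>x. g x * q x \<partial>M)) - 1 / 2 * ((\<integral>x. g x * p x \<partial>M) * (\<integral>x. f x * q x \<partial>M))"
    by (simp only: integral_tensor_mult[OF fin fin] assms)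
  finally show ?thesis by (simp add: diff_divide_distrib)
qed

lemma L2_k: "k l \<in> L2 M"
  using L2_adj_exp[OF \<tau>] .

lemma L2_\<delta>: "\<delta> \<in> L2 M"
  using \<tau> by (intro L2_indicator finite_measure_hist_measure singleton_in_sets_hist) auto

lemma integral_\<delta>:
  assumes "f \<in> L2 M"
  shows "(\<integral>x. f x * \<delta> x \<partial>M) = f 0"
proof -
  have "(\<integral>x. f x * \<delta> x \<partial>leb_open \<tau>) = (\<integral>x. 0 \<partial>leb_open \<tau>)"
    by (intro Bochner_Integration.integral_cong) auto
  then show ?thesis using integral_hist(2)[OF \<tau> L2_mult_integrable[OF assms L2_\<delta>]] by simp
qed

lemma L2_tensor_M: "f \<in> L2 M \<Longrightarrow> g \<in> L2 M \<Longrightarrow> tensor f g \<in> L2 M2"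
  by (intro L2_tensor finite_measure_hist_measure)

text \<open>The formal adjoint of the second compound operator applied to
  \<open>tensor (k l) (k m)\<close>: each factor contributes its exponent and an evaluation at
  \<open>0\<close> weighted by \<open>chr\<close>.\<close>

definition adj2 :: "complex \<Rightarrow> complex \<Rightarrow> real \<times> real \<Rightarrow> complex" where
  "adj2 l m = (\<lambda>z. 1 * ((l + m) * tensor (k l) (k m) z + chr l * tensor \<delta> (k m) z) + chr m * tensor (k l) \<delta> z)"

lemma L2_adj2: "adj2 l m \<in> L2 M2"
  unfolding adj2_def by (intro L2_lincomb L2_tensor_M L2_k L2_\<delta>)

lemma pairing_adj2:
  assumes "f \<in> L2 M2"
  shows "(\<integral>z. f z * adj2 l m z \<partial>M2) = (l + m) * (\<integral>z. f z * tensor (k l) (k m) z \<partial>M2)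
    + chr l * (\<integral>z. f z * tensor \<delta> (k m) z \<partial>M2) + chr m * (\<integral>z. f z * tensor (k l) \<delta> z \<partial>M2)"
proof -
  have i: "integrable M2 (\<lambda>z. f z * tensor a b z)" if "a \<in> L2 M" "b \<in> L2 M" for a b
    by (intro L2_mult_integrable assms L2_tensor_M that)
  have "(\<integral>z. f z * adj2 l m z \<partial>M2) = (\<integral>z. (l + m) * (f z * tensor (k l) (k m) z)
      + chr l * (f z * tensor \<delta> (k m) z) + chr m * (f z * tensor (k l) \<delta> z) \<partial>M2)"
    by (simp add: adj2_def algebra_simps)
  then show ?thesis using i[OF L2_k L2_k] i[OF L2_\<delta> L2_k] i[OF L2_k L2_\<delta>] by simp
qed

lemma D_pairing_adj2:
  assumes D1: "D \<phi>\<^sub>1 \<xi>\<^sub>1" and D2: "D \<phi>\<^sub>2 \<xi>\<^sub>2"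
  shows "(\<integral>z. wedge \<xi>\<^sub>1 \<phi>\<^sub>2 z * tensor (k l) (k m) z \<partial>M2) + (\<integral>z. wedge \<phi>\<^sub>1 \<xi>\<^sub>2 z * tensor (k l) (k m) z \<partial>M2)
    = (\<integral>z. wedge \<phi>\<^sub>1 \<phi>\<^sub>2 z * adj2 l m z \<partial>M2)"
proof -
  note L = D_L2[OF D1] D_L2[OF D2]
  note pair = delay_operator_pairing[OF D1 \<tau>] delay_operator_pairing[OF D2 \<tau>]
  show ?thesis
    unfolding pairing_adj2[OF wedge_L2[OF L(1,3)]]
    by (simp add: wedge_pairing L L2_k L2_\<delta> integral_\<delta> pair field_simps)
qed

text \<open>A substitute for a core of the generator: the adjoint identity is demanded along the
  whole orbit on \<open>[0, T]\<close>, with no graph norm involved. The property is linear, holds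
  for wedges of domain elements, and after integration in time its consequences pass to limits in
  \<open>L2\<close>.\<close>

definition good :: "real \<Rightarrow> complex \<Rightarrow> complex \<Rightarrow> (real \<times> real \<Rightarrow> complex) \<Rightarrow> bool" where
  "good T l m f \<longleftrightarrow> f \<in> L2_wedge \<tau> \<and> (\<forall>s\<in>{0..T}. ((\<lambda>s. \<integral>z. G2 s f z * tensor (k l) (k m) z \<partial>M2)
     has_vector_derivative (\<integral>z. G2 s f z * adj2 l m z \<partial>M2)) (at s within {0..T}))"

lemma good_lincomb:
  assumes "good T l m f" "good T l m g"
  shows "good T l m (\<lambda>z. a * f z + b * g z)"
proof -
  have fg: "f \<in> L2_wedge \<tau>" "g \<in> L2_wedge \<tau>" using assms by (auto simp: good_def)
  note eq = W.T_pairing_lincomb[OF _ fg L2_tensor_M[OF L2_k[of l] L2_k[of m]], of _ a b]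
    and eq' = W.T_pairing_lincomb[OF _ fg L2_adj2[of l m], of _ a b]
  show ?thesis unfolding good_def
  proof (intro conjI ballI)
    show "(\<lambda>z. a * f z + b * g z) \<in> L2_wedge \<tau>" by (intro W.S_lincomb fg)
    fix s assume s: "s \<in> {0..T}"
    have "((\<lambda>s. a * (\<integral>z. G2 s f z * tensor (k l) (k m) z \<partial>M2) + b * (\<integral>z. G2 s g z * tensor (k l) (k m) z \<partial>M2))
      has_vector_derivative (a * (\<integral>z. G2 s f z * adj2 l m z \<partial>M2) + b * (\<integral>z. G2 s g z * adj2 l m z \<partial>M2))) (at s within {0..T})"
      using assms s unfolding good_def
      by (intro has_vector_derivative_add bounded_linear.has_vector_derivative[OF bounded_linear_mult_right]) auto
    then show "((\<lambda>s. \<integral>z. G2 s (\<lambda>z. a * f z + b * g z) z * tensor (k l) (k m) z \<partial>M2)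
      has_vector_derivative (\<integral>z. G2 s (\<lambda>z. a * f z + b * g z) z * adj2 l m z \<partial>M2)) (at s within {0..T})"
      unfolding eq'[of s, OF atLeastAtMost_iff[THEN iffD1, OF s, THEN conjunct1]]
      by (rule has_vector_derivative_transform[OF s, rotated]) (simp add: eq)
  qed
qed

text \<open>The semigroup sends a wedge of domain elements to a wedge of domain elements, so the
  adjoint identity of \<open>D_pairing_adj2\<close> is available at every time
  \<open>s\<close>.\<close>

lemma good_wedge:
  assumes D1: "D \<phi>\<^sub>1 \<xi>\<^sub>1" and D2: "D \<phi>\<^sub>2 \<xi>\<^sub>2"
    and K: "K \<ge> 0" "\<And>s f. s \<in> {0..T} \<Longrightarrow> f \<in> L2_wedge \<tau> \<Longrightarrow> L2_norm M2 (G2 s f) \<le> K * L2_norm M2 f"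
  shows "good T l m (wedge \<phi>\<^sub>1 \<phi>\<^sub>2)"
  unfolding good_def
proof (intro conjI ballI)
  note L = D_L2[OF D1] D_L2[OF D2]
  show "wedge \<phi>\<^sub>1 \<phi>\<^sub>2 \<in> L2_wedge \<tau>" by (intro L2_norm_wedge L)
  fix s assume s: "s \<in> {0..T}"
  then have s0: "s \<ge> 0" by simp
  have w: "wedge \<xi>\<^sub>1 \<phi>\<^sub>2 \<in> L2_wedge \<tau>" "wedge \<phi>\<^sub>1 \<xi>\<^sub>2 \<in> L2_wedge \<tau>" by (intro L2_norm_wedge L)+
  note LG = L[THEN G.T_L2[OF s0]]
  have tk: "tensor (k l) (k m) \<in> L2 M2" by (intro L2_tensor_M L2_k)
  have "(\<integral>z. G2 s (\<lambda>z. 1 * wedge \<xi>\<^sub>1 \<phi>\<^sub>2 z + 1 * wedge \<phi>\<^sub>1 \<xi>\<^sub>2 z) z * tensor (k l) (k m) z \<partial>M2)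
     = (\<integral>z. G2 s (wedge \<xi>\<^sub>1 \<phi>\<^sub>2) z * tensor (k l) (k m) z \<partial>M2) + (\<integral>z. G2 s (wedge \<phi>\<^sub>1 \<xi>\<^sub>2) z * tensor (k l) (k m) z \<partial>M2)"
    by (subst W.T_pairing_lincomb[OF s0 w tk]) simp
  also have "(\<integral>z. G2 s (wedge \<xi>\<^sub>1 \<phi>\<^sub>2) z * tensor (k l) (k m) z \<partial>M2) = (\<integral>z. wedge (G s \<xi>\<^sub>1) (G s \<phi>\<^sub>2) z * tensor (k l) (k m) z \<partial>M2)"
    by (intro W.pairing_cong W.T_L2 wedge_L2 G2_wedge w LG L s0 tk)
  also have "(\<integral>z. G2 s (wedge \<phi>\<^sub>1 \<xi>\<^sub>2) z * tensor (k l) (k m) z \<partial>M2) = (\<integral>z. wedge (G s \<phi>\<^sub>1) (G s \<xi>\<^sub>2) z * tensor (k l) (k m) z \<partial>M2)"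
    by (intro W.pairing_cong W.T_L2 wedge_L2 G2_wedge w LG L s0 tk)
  also have "(\<integral>z. wedge (G s \<xi>\<^sub>1) (G s \<phi>\<^sub>2) z * tensor (k l) (k m) z \<partial>M2) + (\<integral>z. wedge (G s \<phi>\<^sub>1) (G s \<xi>\<^sub>2) z * tensor (k l) (k m) z \<partial>M2)
     = (\<integral>z. wedge (G s \<phi>\<^sub>1) (G s \<phi>\<^sub>2) z * adj2 l m z \<partial>M2)"
    by (rule D_pairing_adj2[OF D_G[OF D1 s0] D_G[OF D2 s0]])
  also have "\<dots> = (\<integral>z. G2 s (wedge \<phi>\<^sub>1 \<phi>\<^sub>2) z * adj2 l m z \<partial>M2)"
    using G2_wedge[OF s0 L(1,3)]
    by (intro W.pairing_cong W.T_L2 L2_norm_wedge wedge_L2 LG L s0 L2_adj2) (auto elim: eventually_mono)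
  finally show "((\<lambda>s. \<integral>z. G2 s (wedge \<phi>\<^sub>1 \<phi>\<^sub>2) z * tensor (k l) (k m) z \<partial>M2)
     has_vector_derivative (\<integral>z. G2 s (wedge \<phi>\<^sub>1 \<phi>\<^sub>2) z * adj2 l m z \<partial>M2)) (at s within {0..T})"
    using W.pairing_has_vector_derivative[OF generator_wedge[OF D1 D2] tk K s] by simp
qed

lemma exp_hist_in_D: "\<exists>\<xi>. D (exp_hist \<tau> n) \<xi>"
proof -
  have d: "(exp_hist \<tau> n has_vector_derivative (- of_nat n * exp_hist \<tau> n t)) (at t)" for t
    unfolding exp_hist_def[abs_def]
    by (rule has_vector_derivative_real_field | auto intro!: derivative_eq_intros)+
  have "continuous_on UNIV (\<lambda>t. - of_nat n * exp_hist \<tau> n t)"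
    unfolding exp_hist_def by (intro continuous_intros)
  from delay_operator_C1[OF \<tau> d this] show ?thesis by blast
qed

definition antisym :: "(real \<times> real \<Rightarrow> complex) \<Rightarrow> real \<times> real \<Rightarrow> complex" where
  "antisym f = (\<lambda>z. 1 / 2 * f z + (- 1 / 2) * f (snd z, fst z))"

lemma antisym_L2:
  assumes "f \<in> L2 M2"
  shows "antisym f \<in> L2 M2" "L2_norm M2 (antisym f) \<le> L2_norm M2 f"
proof -
  note sw = L2_norm_swap[OF finite_measure_hist_measure assms]
  show "antisym f \<in> L2 M2" unfolding antisym_def by (intro L2_lincomb assms sw)
  have "L2_norm M2 (antisym f) \<le> cmod (1 / 2) * L2_norm M2 f + cmod (- 1 / 2) * L2_norm M2 (\<lambda>z. f (snd z, fst z))"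
    unfolding antisym_def by (intro L2_norm_triangle_lincomb assms sw)
  then show "L2_norm M2 (antisym f) \<le> L2_norm M2 f" using sw(2) by simp
qed

text \<open>Antisymmetrization is a contraction and maps tensors of exponentials to wedges of domain
  elements, which are good. Density of the tensors therefore passes to the antisymmetric
  space.\<close>

lemma good_dense:
  assumes K: "K \<ge> 0" "\<And>s f. s \<in> {0..T} \<Longrightarrow> f \<in> L2_wedge \<tau> \<Longrightarrow> L2_norm M2 (G2 s f) \<le> K * L2_norm M2 f"
    and d: "d \<in> L2_wedge \<tau>" and e: "e > 0"
  shows "\<exists>f. good T l m f \<and> L2_norm M2 (\<lambda>z. d z - f z) < e"
proof -
  have goodL: "good T l m f \<Longrightarrow> f \<in> L2 M2" for f using W.S_L2 by (auto simp: good_def)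
  have dL: "d \<in> L2 M2" using d W.S_L2 by blast
  have "\<forall>e>0. \<exists>f. good T l m f \<and> L2_norm M2 (\<lambda>z. antisym d z - f z) < e"
    using dL \<tau>
  proof (induction rule: L2_hist2_exp_induct)
    case (closed F)
    show ?case
    proof (intro allI impI)
      fix e :: real assume "e > 0"
      then obtain g where g: "g \<in> L2 M2" "L2_norm M2 (\<lambda>x. F x - g x) < e / 2"
        and gg: "\<And>e. e > 0 \<Longrightarrow> \<exists>f. good T l m f \<and> L2_norm M2 (\<lambda>z. antisym g z - f z) < e"
        using closed(2)[of "e / 2"] by auto
      obtain f where f: "good T l m f" "L2_norm M2 (\<lambda>z. antisym g z - f z) < e / 2"
        using gg[of "e / 2"] \<open>e > 0\<close> by auto
      have "(\<lambda>z. antisym F z - antisym g z) = antisym (\<lambda>z. F z - g z)"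
        by (auto simp: antisym_def fun_eq_iff diff_divide_distrib)
      then have "L2_norm M2 (\<lambda>z. antisym F z - antisym g z) \<le> L2_norm M2 (\<lambda>x. F x - g x)"
        using antisym_L2(2)[OF L2_diff[OF closed(1) g(1)]] by simp
      then have "L2_norm M2 (\<lambda>z. antisym F z - f z) < e"
        using L2_norm_diff_triangle[OF antisym_L2(1)[OF closed(1)] antisym_L2(1)[OF g(1)] goodL[OF f(1)]] f(2) g(2)
        by linarith
      then show "\<exists>f. good T l m f \<and> L2_norm M2 (\<lambda>z. antisym F z - f z) < e" using f(1) by blast
    qed
  next
    case (lincomb F F' a b)
    show ?case
    proof (intro allI impI)
      fix e :: real assume e: "e > 0"
      define e1 where "e1 = e / (cmod a + cmod b + 1)"
      have e1: "e1 > 0" using e by (simp add: e1_def add_nonneg_pos)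
      obtain f f' where f: "good T l m f" "L2_norm M2 (\<lambda>z. antisym F z - f z) < e1"
        and f': "good T l m f'" "L2_norm M2 (\<lambda>z. antisym F' z - f' z) < e1"
        using lincomb(3,4) e1 by meson
      have eq: "antisym (\<lambda>x. a * F x + b * F' x) z - (a * f z + b * f' z)
          = a * (antisym F z - f z) + b * (antisym F' z - f' z)" for z
        by (simp add: antisym_def algebra_simps)
      have "L2_norm M2 (\<lambda>z. antisym (\<lambda>x. a * F x + b * F' x) z - (a * f z + b * f' z))
          \<le> cmod a * L2_norm M2 (\<lambda>z. antisym F z - f z) + cmod b * L2_norm M2 (\<lambda>z. antisym F' z - f' z)"
        unfolding eq by (intro L2_norm_triangle_lincomb L2_diff antisym_L2 lincomb goodL f f')
      also have "\<dots> \<le> cmod a * e1 + cmod b * e1"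
        using f f' by (intro add_mono mult_left_mono) auto
      also have "\<dots> < e"
      proof -
        have "(cmod a + cmod b + 1) * e1 = e" using add_nonneg_pos[of "cmod a + cmod b" 1] by (simp add: e1_def)
        then show ?thesis using e1 by (simp add: algebra_simps)
      qed
      finally show "\<exists>f. good T l m f \<and> L2_norm M2 (\<lambda>z. antisym (\<lambda>x. a * F x + b * F' x) z - f z) < e"
        using good_lincomb[OF f(1) f'(1)] by blast
    qed
  next
    case (exp i j)
    obtain \<xi> \<xi>' where "D (exp_hist \<tau> i) \<xi>" "D (exp_hist \<tau> j) \<xi>'" using exp_hist_in_D by blast
    then have "good T l m (wedge (exp_hist \<tau> i) (exp_hist \<tau> j))" by (rule good_wedge[OF _ _ K])
    moreover have "antisym (tensor (exp_hist \<tau> i) (exp_hist \<tau> j)) = wedge (exp_hist \<tau> i) (exp_hist \<tau> j)"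
      by (auto simp: antisym_def tensor_def wedge_def fun_eq_iff diff_divide_distrib)
    ultimately show ?case by (intro allI impI exI[of _ "wedge (exp_hist \<tau> i) (exp_hist \<tau> j)"]) (simp add: L2_norm_def)
  qed
  then obtain f where f: "good T l m f" "L2_norm M2 (\<lambda>z. antisym d z - f z) < e" using e by blast
  have "AE z in M2. d (fst z, snd z) = - d (snd z, fst z)" using d by (auto simp: L2_wedge_def)
  then have "AE z in M2. d z - f z = antisym d z - f z" by eventually_elim (auto simp: antisym_def)
  then have "L2_norm M2 (\<lambda>z. d z - f z) = L2_norm M2 (\<lambda>z. antisym d z - f z)"
    by (intro L2_norm_cong_AE L2_measurable L2_diff dL goodL[OF f(1)] antisym_L2)
  then show ?thesis using f by auto
qed

end

section \<open>Laplace transforms over a bounded interval and a Liouville argument\<close>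

text \<open>Since \<open>X\<close> takes values in a bounded interval, the transform is entire and
  bounded on each half-plane \<open>c \<le> Re l\<close>. Differentiability comes from the
  second-order Taylor remainder of the exponential.\<close>

lemma laplace_transform_entire:
  fixes v :: "'a \<Rightarrow> complex" and X :: "'a \<Rightarrow> real"
  assumes v: "integrable N v" and X: "X \<in> borel_measurable N" "\<And>x. x \<in> space N \<Longrightarrow> 0 \<le> X x \<and> X x \<le> \<tau>"
  shows "(\<lambda>l. \<integral>x. v x * exp (- l * complex_of_real (X x)) \<partial>N) holomorphic_on UNIV"
    and "c \<le> Re l \<Longrightarrow> cmod (\<integral>x. v x * exp (- l * complex_of_real (X x)) \<partial>N) \<le> (\<integral>x. cmod (v x) \<partial>N) * exp (\<bar>c\<bar> * \<tau>)"
proof -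
  have [measurable]: "v \<in> borel_measurable N" "X \<in> borel_measurable N" using assms by auto
  have bnd: "cmod (exp (- l * complex_of_real (X x))) \<le> exp (\<bar>c\<bar> * \<tau>)" if "c \<le> Re l" "x \<in> space N" for c l x
  proof -
    have x: "0 \<le> X x" "X x \<le> \<tau>" using X(2)[OF that(2)] by auto
    have "- (Re l * X x) \<le> - (c * X x)" using that x by (simp add: mult_right_mono)
    also have "\<dots> \<le> \<bar>c\<bar> * X x" using x by (metis abs_ge_minus_self minus_mult_left mult_right_mono)
    also have "\<dots> \<le> \<bar>c\<bar> * \<tau>" using x by (intro mult_left_mono) auto
    finally show ?thesis by (simp add: norm_exp_eq_Re)
  qed
  have iv: "integrable N (\<lambda>x. cmod (v x))" using v by (rule integrable_norm)
  have int: "integrable N (\<lambda>x. v x * exp (- l * complex_of_real (X x)))" for l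
  proof (rule Bochner_Integration.integrable_bound[where f="\<lambda>x. exp (\<bar>Re l\<bar> * \<tau>) * cmod (v x)"])
    show "AE x in N. norm (v x * exp (- l * complex_of_real (X x))) \<le> norm (exp (\<bar>Re l\<bar> * \<tau>) * cmod (v x))"
    proof (intro AE_I2)
      fix x assume "x \<in> space N"
      then have "cmod (v x) * cmod (exp (- l * complex_of_real (X x))) \<le> cmod (v x) * exp (\<bar>Re l\<bar> * \<tau>)"
        using bnd[OF order_refl] by (intro mult_left_mono) auto
      then show "norm (v x * exp (- l * complex_of_real (X x))) \<le> norm (exp (\<bar>Re l\<bar> * \<tau>) * cmod (v x))"
        unfolding norm_mult by (simp add: mult.commute)
    qed
  qed (use iv in auto)
  show "cmod (\<integral>x. v x * exp (- l * complex_of_real (X x)) \<partial>N) \<le> (\<integral>x. cmod (v x) \<partial>N) * exp (\<bar>c\<bar> * \<tau>)" if "c \<le> Re l"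
  proof -
    have "cmod (\<integral>x. v x * exp (- l * complex_of_real (X x)) \<partial>N) \<le> (\<integral>x. cmod (v x * exp (- l * complex_of_real (X x))) \<partial>N)"
      by (rule integral_norm_bound)
    also have "\<dots> \<le> (\<integral>x. cmod (v x) * exp (\<bar>c\<bar> * \<tau>) \<partial>N)"
      using bnd[OF that] integrable_norm[OF int[of l]] iv
      by (intro integral_mono) (auto simp: norm_mult intro!: mult_left_mono)
    finally show ?thesis by simp
  qed
  have "(\<lambda>l. \<integral>x. v x * exp (- l * complex_of_real (X x)) \<partial>N) field_differentiable (at l)" for l
  proof -
    define L where "L l = (\<integral>x. v x * exp (- l * complex_of_real (X x)) \<partial>N)" for l
    define L1 where "L1 = (\<integral>x. v x * exp (- l * complex_of_real (X x)) * (- complex_of_real (X x)) \<partial>N)"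
    \<comment> \<open>The remainder estimate is
      \<open>|exp z - 1 - z| \<le> exp |Re z| * |z|^2\<close>, used with
      \<open>z = - h * X x\<close>, where \<open>|z| \<le> \<tau>\<close> as long as
      \<open>cmod h \<le> 1\<close>.\<close>
    define B where "B = (\<integral>x. cmod (v x) \<partial>N) * (exp (\<bar>Re l\<bar> * \<tau>) * (exp \<tau> * \<tau>\<^sup>2))"
    have i1: "integrable N (\<lambda>x. v x * exp (- l * complex_of_real (X x)) * (- complex_of_real (X x)))"
    proof (rule Bochner_Integration.integrable_bound[where f="\<lambda>x. \<tau> * cmod (v x * exp (- l * complex_of_real (X x)))"])
      show "AE x in N. norm (v x * exp (- l * complex_of_real (X x)) * (- complex_of_real (X x)))
         \<le> norm (\<tau> * cmod (v x * exp (- l * complex_of_real (X x))))"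
      proof (intro AE_I2)
        fix x assume "x \<in> space N"
        then have "\<bar>X x\<bar> \<le> \<bar>\<tau>\<bar>" using X(2) by force
        then show "norm (v x * exp (- l * complex_of_real (X x)) * (- complex_of_real (X x)))
         \<le> norm (\<tau> * cmod (v x * exp (- l * complex_of_real (X x))))"
          by (simp add: norm_mult abs_mult mult.commute mult_right_mono)
      qed
    qed (use int[of l] in \<open>auto intro!: integrable_norm\<close>)
    have est: "cmod (L (l + h) - L l - h * L1) \<le> B * (cmod h)\<^sup>2" if h: "cmod h \<le> 1" for h :: complex
    proof -
      have "L (l + h) - L l - h * L1 = (\<integral>x. v x * exp (- (l + h) * complex_of_real (X x)) - v x * exp (- l * complex_of_real (X x))
          - h * (v x * exp (- l * complex_of_real (X x)) * (- complex_of_real (X x))) \<partial>N)"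
        unfolding L_def L1_def using int[of "l + h"] int[of l] i1 by simp
      also have "\<dots> = (\<integral>x. v x * exp (- l * complex_of_real (X x))
          * (exp (- h * complex_of_real (X x)) - (1 + (- h * complex_of_real (X x)))) \<partial>N)"
        by (intro Bochner_Integration.integral_cong) (auto simp: algebra_simps exp_add[symmetric])
      also have "cmod \<dots> \<le> (\<integral>x. cmod (v x) * (exp (\<bar>Re l\<bar> * \<tau>) * (exp \<tau> * \<tau>\<^sup>2 * (cmod h)\<^sup>2)) \<partial>N)"
      proof (rule order_trans[OF integral_norm_bound integral_mono'])
        show "integrable N (\<lambda>x. cmod (v x) * (exp (\<bar>Re l\<bar> * \<tau>) * (exp \<tau> * \<tau>\<^sup>2 * (cmod h)\<^sup>2)))"
          by (intro integrable_mult_left iv)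
        fix x assume x: "x \<in> space N"
        have xb: "0 \<le> X x" "X x \<le> \<tau>" using X(2)[OF x] by auto
        have nz: "cmod (- h * complex_of_real (X x)) \<le> cmod h * \<tau>" using xb by (simp add: norm_mult mult_left_mono)
        have "cmod (exp (- h * complex_of_real (X x)) - (1 + (- h * complex_of_real (X x))))
            \<le> exp \<bar>Re (- h * complex_of_real (X x))\<bar> * cmod (- h * complex_of_real (X x)) ^ Suc 1 / fact 1"
          using Taylor_exp[of "- h * complex_of_real (X x)" 1] by simp
        also have "\<dots> \<le> exp \<tau> * (cmod h * \<tau>) ^ 2"
        proof -
          have "\<bar>Re (- h * complex_of_real (X x))\<bar> \<le> cmod h * \<tau>" using nz abs_Re_le_cmod order_trans by blast
          also have "\<dots> \<le> 1 * \<tau>" using h xb by (intro mult_right_mono) auto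
          finally have "exp \<bar>Re (- h * complex_of_real (X x))\<bar> \<le> exp \<tau>" by simp
          moreover have "cmod (- h * complex_of_real (X x)) ^ 2 \<le> (cmod h * \<tau>) ^ 2" by (intro power_mono nz) simp
          ultimately show ?thesis by (simp add: numeral_2_eq_2 mult_mono)
        qed
        finally have t: "cmod (exp (- h * complex_of_real (X x)) - (1 + (- h * complex_of_real (X x)))) \<le> exp \<tau> * \<tau>\<^sup>2 * (cmod h)\<^sup>2"
          by (simp add: power_mult_distrib mult_ac)
        show "cmod (v x * exp (- l * complex_of_real (X x)) * (exp (- h * complex_of_real (X x)) - (1 + (- h * complex_of_real (X x)))))
            \<le> cmod (v x) * (exp (\<bar>Re l\<bar> * \<tau>) * (exp \<tau> * \<tau>\<^sup>2 * (cmod h)\<^sup>2))"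
          unfolding norm_mult mult.assoc using bnd[OF order_refl x, of l] t
          by (intro mult_left_mono mult_mono) (auto simp: mult.assoc)
      qed auto
      also have "\<dots> = B * (cmod h)\<^sup>2" by (simp add: B_def mult_ac)
      finally show ?thesis .
    qed
    have "(L has_field_derivative L1) (at l)"
      unfolding DERIV_def LIM_eq
    proof (intro allI impI)
      fix r :: real assume r: "r > 0"
      have B: "B \<ge> 0" using est[of 1] order_trans[OF norm_ge_zero, of "L (l + 1) - L l - 1 * L1" B] by simp
      show "\<exists>s>0. \<forall>h. h \<noteq> 0 \<and> norm (h - 0) < s \<longrightarrow> norm ((L (l + h) - L l) / h - L1) < r"
      proof (intro exI[of _ "min 1 (r / (B + 1))"] conjI allI impI)
        show "0 < min 1 (r / (B + 1))" using r B by simp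
        fix h :: complex assume h: "h \<noteq> 0 \<and> norm (h - 0) < min 1 (r / (B + 1))"
        have "(L (l + h) - L l) / h - L1 = (L (l + h) - L l - h * L1) / h" using h by (simp add: field_simps)
        then have "norm ((L (l + h) - L l) / h - L1) = cmod (L (l + h) - L l - h * L1) / cmod h" by (simp add: norm_divide)
        also have "\<dots> \<le> B * (cmod h)\<^sup>2 / cmod h" using est[of h] h by (intro divide_right_mono) auto
        also have "\<dots> = B * cmod h" using h by (simp add: power2_eq_square)
        also have "\<dots> \<le> (B + 1) * cmod h" by (intro mult_right_mono) auto
        also have "\<dots> < r" using h B by (simp add: pos_less_divide_eq mult.commute)
        finally show "norm ((L (l + h) - L l) / h - L1) < r" .
      qed
    qed
    then show ?thesis unfolding L_def field_differentiable_def by blast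
  qed
  then show "(\<lambda>l. \<integral>x. v x * exp (- l * complex_of_real (X x)) \<partial>N) holomorphic_on UNIV"
    by (simp add: holomorphic_on_def field_differentiable_at_within)
qed

text \<open>The symmetry \<open>e l * \<chi> (p - l) = \<chi> l * e (p - l)\<close> lets the quotient \<open>e / \<chi>\<close> be continued
  across every zero of \<open>\<chi>\<close>, and carries its decay from the right half-plane to the left one.\<close>

lemma symmetric_quotient_zero:
  fixes e f :: "complex \<Rightarrow> complex" and p :: real
  assumes e: "e holomorphic_on UNIV" and f: "f holomorphic_on UNIV"
    and sym: "\<And>z::complex. e z * f (complex_of_real p - z) = f z * e (complex_of_real p - z)"
    and nz: "\<And>z::complex. f z \<noteq> 0 \<or> f (complex_of_real p - z) \<noteq> 0"
    and eb: "\<And>z. Re z \<ge> p / 2 \<Longrightarrow> cmod (e z) \<le> C"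
    and fb: "\<And>z. Re z \<ge> p / 2 \<Longrightarrow> cmod z - c \<le> cmod (f z)"
  shows "e z = 0"
proof -
  \<comment> \<open>By \<open>nz\<close> one of the two denominators is always nonzero, and by
    \<open>sym\<close> the quotients agree where both are, so \<open>Q\<close> is entire.\<close>
  define Q :: "complex \<Rightarrow> complex" where "Q z = (if f z \<noteq> 0 then e z / f z else e (complex_of_real p - z) / f (complex_of_real p - z))" for z
  have Q1: "Q z = e z / f z" if "f z \<noteq> 0" for z using that by (simp add: Q_def)
  have Q2: "Q z = e (complex_of_real p - z) / f (complex_of_real p - z)" if "f (complex_of_real p - z) \<noteq> 0" for z
    using that sym[of z] by (auto simp: Q_def field_simps)
  have cf: "continuous_on UNIV f" using f by (rule holomorphic_on_imp_continuous_on)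
  have U1: "open {z. f z \<noteq> 0}"
    using open_vimage[OF _ cf, of "- {0}"] by (simp add: vimage_def open_Compl)
  have U2: "open {z. f (complex_of_real p - z) \<noteq> 0}"
    using open_vimage[OF _ continuous_on_compose2[OF cf, of UNIV "\<lambda>z. complex_of_real p - z"], of "- {0}"]
    by (simp add: vimage_def open_Compl continuous_intros)
  have h: "g holomorphic_on UNIV \<Longrightarrow> (\<lambda>z. g (complex_of_real p - z)) holomorphic_on A" for g A
    using holomorphic_on_compose_gen[of "\<lambda>z. complex_of_real p - z" A g UNIV] by (simp add: o_def holomorphic_intros)
  have "(\<lambda>z. e z / f z) holomorphic_on {z. f z \<noteq> 0}"
    by (intro holomorphic_intros holomorphic_on_subset[OF e] holomorphic_on_subset[OF f]) auto
  then have H1: "Q holomorphic_on {z. f z \<noteq> 0}" by (rule holomorphic_transform) (simp add: Q1)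
  have "(\<lambda>z. e (complex_of_real p - z) / f (complex_of_real p - z)) holomorphic_on {z. f (complex_of_real p - z) \<noteq> 0}"
    by (intro holomorphic_intros h e f) auto
  then have H2: "Q holomorphic_on {z. f (complex_of_real p - z) \<noteq> 0}" by (rule holomorphic_transform) (simp add: Q2)
  have "{z. f z \<noteq> 0} \<union> {z. f (complex_of_real p - z) \<noteq> 0} = UNIV" using nz by auto
  then have H: "Q holomorphic_on UNIV" using holomorphic_on_Un[OF H1 H2 U1 U2] by simp
  \<comment> \<open>Enlarged by \<open>|p|\<close> so that the same lower bound serves
    \<open>z\<close> and its reflection \<open>p - z\<close>.\<close>
  define c' where "c' = \<bar>c\<bar> + \<bar>p\<bar>"
  have C0: "C \<ge> 0" using order_trans[OF norm_ge_zero eb[of "complex_of_real (p / 2)"]] by simp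
  have Qb: "cmod (Q z) \<le> C / (cmod z - c')" if "cmod z > c'" for z
  proof (cases "Re z \<ge> p / 2")
    case True
    have "cmod (f z) \<ge> cmod z - c'" using fb[OF True] by (simp add: c'_def)
    moreover from this that have "f z \<noteq> 0" by auto
    ultimately show ?thesis using eb[OF True] that C0 by (simp add: Q1 norm_divide frac_le)
  next
    case False
    then have r: "Re (complex_of_real p - z) \<ge> p / 2" by simp
    have "cmod z \<le> cmod (complex_of_real p - z) + \<bar>p\<bar>" using norm_triangle_ineq4[of "complex_of_real p" "complex_of_real p - z"] by simp
    then have "cmod (f (complex_of_real p - z)) \<ge> cmod z - c'" using fb[OF r] by (simp add: c'_def)
    moreover from this that have "f (complex_of_real p - z) \<noteq> 0" by auto
    ultimately show ?thesis using eb[OF r] that C0 by (simp add: Q2 norm_divide frac_le)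
  qed
  have "(Q \<longlongrightarrow> 0) at_infinity"
  proof (rule tendsto_norm_zero_cancel, rule tendsto_sandwich[OF _ _ tendsto_const])
    have "filterlim (\<lambda>z::complex. - c' + cmod z) at_top at_infinity"
      by (rule filterlim_tendsto_add_at_top[OF tendsto_const filterlim_norm_at_top])
    then have "((\<lambda>z::complex. C / (- c' + cmod z)) \<longlongrightarrow> 0) at_infinity"
      by (rule real_tendsto_divide_at_top[OF tendsto_const])
    then show "((\<lambda>z::complex. C / (cmod z - c')) \<longlongrightarrow> 0) at_infinity" by simp
    show "\<forall>\<^sub>F z in at_infinity. cmod (Q z) \<le> C / (cmod z - c')"
      unfolding eventually_at_infinity using Qb by (intro exI[of _ "c' + 1"]) auto
  qed auto
  then have Q0: "Q z = 0" for z using Liouville_weak[OF H] by blast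
  show ?thesis using Q0[of z] Q0[of "complex_of_real p - z"] nz[of z] sym[of z] Q1[of z] Q2[of z] by (auto simp: divide_eq_0_iff)
qed

section \<open>Injectivity of the shifted compound operator\<close>

context ss_compound
begin

text \<open>Good functions are only known to be dense in \<open>L2\<close>, so the adjoint identity
  cannot be carried to \<open>d\<close> through the graph norm. Instead a good \<open>f\<close> near
  \<open>d\<close> is followed over a short time \<open>t\<close>: integration replaces derivatives
  by increments, which depend continuously on \<open>f\<close> in \<open>L2\<close>. Letting
  \<open>f\<close> tend to \<open>d\<close>, and then letting the tolerance that governs
  \<open>t\<close> shrink, leaves the identity for \<open>d\<close> itself.\<close>

lemma weak_eigen_equation:
  assumes d: "A2 d h" and h: "AE z in M2. h z = p * d z"
  shows "(\<integral>z. d z * adj2 l m z \<partial>M2) = p * (\<integral>z. d z * tensor (k l) (k m) z \<partial>M2)"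
proof -
  let ?N = "L2_norm M2" and ?t = "tensor (k l) (k m)" and ?a = "adj2 l m"
  have dW: "d \<in> L2_wedge \<tau>" "h \<in> L2_wedge \<tau>" using d by (auto simp: semigroup_generator_def)
  note L = W.S_L2[OF dW(1)] W.S_L2[OF dW(2)]
  have tL: "?t \<in> L2 M2" by (intro L2_tensor_M L2_k)
  note aL = L2_adj2[of l m]
  obtain T K where T: "T > 0" and K: "K \<ge> 0" "\<And>s f. s \<in> {0..T} \<Longrightarrow> f \<in> L2_wedge \<tau> \<Longrightarrow> ?N (G2 s f) \<le> K * ?N f"
    using C0_semigroup_bounded_near_0[OF W.fin W.S W.T] by blast
  \<comment> \<open>The defect of the claimed identity along the orbit of \<open>d\<close>. It is
    continuous from the right at \<open>0\<close>, and the goal is that its initial value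
    \<open>q0\<close> vanishes.\<close>
  define q where "q s = (\<integral>z. G2 s d z * ?a z \<partial>M2) - p * (\<integral>z. G2 s d z * ?t z \<partial>M2)" for s
  define q0 where "q0 = (\<integral>z. d z * ?a z \<partial>M2) - p * (\<integral>z. d z * ?t z \<partial>M2)"
  \<comment> \<open>\<open>h\<close> is \<open>p\<close> times \<open>d\<close> only almost
    everywhere; the norm bound on \<open>G2 s\<close> carries this equality through the
    semigroup.\<close>
  have hp: "(\<integral>z. G2 s h z * ?t z \<partial>M2) = p * (\<integral>z. G2 s d z * ?t z \<partial>M2)" if s: "s \<in> {0..T}" for s
  proof -
    have s0: "s \<ge> 0" using s by simp
    let ?r = "\<lambda>z. 1 * h z + (- p) * d z"
    have rW: "?r \<in> L2_wedge \<tau>" by (intro W.S_lincomb dW)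
    have "AE z in M2. ?r z = 0" using h by eventually_elim simp
    then have "?N ?r = 0" using L2_norm_eq_0[OF W.S_L2[OF rW]] by simp
    then have "?N (G2 s ?r) = 0" using K(2)[OF s rW] by (intro antisym) auto
    then have "cmod (\<integral>z. G2 s ?r z * ?t z \<partial>M2) \<le> 0"
      using L2_Cauchy_Schwarz[OF W.T_L2[OF s0 rW] tL] by simp
    then have "1 * (\<integral>z. G2 s h z * ?t z \<partial>M2) + (- p) * (\<integral>z. G2 s d z * ?t z \<partial>M2) = 0"
      unfolding W.T_pairing_lincomb[OF s0 dW(2,1) tL] by simp
    then show ?thesis by simp
  qed
  have q_diff: "cmod (q s - q0) \<le> ?N (\<lambda>z. G2 s d z - d z) * (?N ?a + cmod p * ?N ?t)" if "s \<ge> 0" for s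
  proof -
    note Ld = W.T_L2[OF that dW(1)]
    have diff: "(\<integral>z. G2 s d z * w z \<partial>M2) - (\<integral>z. d z * w z \<partial>M2) = (\<integral>z. (G2 s d z - d z) * w z \<partial>M2)"
      if "w \<in> L2 M2" for w
      using Bochner_Integration.integral_diff[OF L2_mult_integrable[OF Ld that] L2_mult_integrable[OF L(1) that]]
      by (simp add: left_diff_distrib)
    have eq: "q s - q0 = (\<integral>z. (G2 s d z - d z) * ?a z \<partial>M2) - p * (\<integral>z. (G2 s d z - d z) * ?t z \<partial>M2)"
      unfolding diff[OF aL, symmetric] diff[OF tL, symmetric] q_def q0_def by (simp add: algebra_simps)
    have "cmod (q s - q0) \<le> cmod (\<integral>z. (G2 s d z - d z) * ?a z \<partial>M2) + cmod (p * (\<integral>z. (G2 s d z - d z) * ?t z \<partial>M2))"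
      unfolding eq by (rule norm_triangle_ineq4)
    also have "\<dots> \<le> ?N (\<lambda>z. G2 s d z - d z) * ?N ?a + cmod p * (?N (\<lambda>z. G2 s d z - d z) * ?N ?t)"
      unfolding norm_mult by (intro add_mono mult_left_mono L2_Cauchy_Schwarz L2_diff Ld L aL tL) simp
    finally show ?thesis by (simp add: algebra_simps)
  qed
  have q_lim: "((\<lambda>s. cmod (q s - q0)) \<longlongrightarrow> 0) (at_right 0)"
  proof (rule tendsto_sandwich[OF _ _ tendsto_const])
    show "((\<lambda>s. ?N (\<lambda>z. G2 s d z - d z) * (?N ?a + cmod p * ?N ?t)) \<longlongrightarrow> 0) (at_right 0)"
      using tendsto_mult_right[OF W.T_continuous[OF dW(1)]] by simp
    show "\<forall>\<^sub>F s in at_right 0. cmod (q s - q0) \<le> ?N (\<lambda>z. G2 s d z - d z) * (?N ?a + cmod p * ?N ?t)"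
      using eventually_at_right_less[of "0::real"] by eventually_elim (rule q_diff, simp)
  qed auto
  have T0d: "AE z in M2. G2 0 d z = d z" using W.T dW(1) by (auto simp: C0_semigroup_def)
  have q_0: "q 0 = q0"
  proof -
    have "?N (\<lambda>z. G2 0 d z - d z) = 0"
      by (subst L2_norm_eq_0) (use T0d L2_diff[OF W.T_L2[OF order_refl dW(1)] L(1)] in \<open>auto elim: eventually_mono\<close>)
    then show ?thesis using q_diff[of 0] by simp
  qed
  have "cmod q0 \<le> 0 + \<epsilon>" if \<epsilon>: "\<epsilon> > 0" for \<epsilon>
  proof -
    have "eventually (\<lambda>s. cmod (q s - q0) < \<epsilon>) (at_right 0)" using q_lim \<epsilon> by (rule order_tendstoD)
    then obtain b where b: "b > 0" "\<And>s. 0 < s \<Longrightarrow> s < b \<Longrightarrow> cmod (q s - q0) < \<epsilon>"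
      by (auto simp: eventually_at_right_field)
    define t where "t = min T (b / 2)"
    have t: "0 < t" "t \<le> T" "t < b" using T b(1) by (auto simp: t_def)
    have qt: "cmod (q s - q0) \<le> \<epsilon>" if "s \<in> {0..t}" for s
      using b(2)[of s] q_0 that t \<epsilon> by (cases "s = 0") auto
    have bound: "t * cmod q0 \<le> t * \<epsilon> + \<eta> * (t * K * ?N ?a + 2 * K * ?N ?t)" if \<eta>: "\<eta> > 0" for \<eta>
    proof -
      obtain f where f: "good T l m f" "?N (\<lambda>z. d z - f z) < \<eta>" using good_dense[OF K dW(1) \<eta>] by blast
      have fW: "f \<in> L2_wedge \<tau>" using f by (simp add: good_def)
      let ?g = "\<lambda>z. 1 * f z + (- 1) * d z"
      have gW: "?g \<in> L2_wedge \<tau>" by (intro W.S_lincomb fW dW)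
      have gN: "?N ?g < \<eta>" using f(2) by (simp add: L2_norm_minus_commute[of M2 f])
      have gb: "cmod ((\<integral>z. G2 s f z * w z \<partial>M2) - (\<integral>z. G2 s d z * w z \<partial>M2)) \<le> K * \<eta> * ?N w"
        if s: "s \<in> {0..T}" and w: "w \<in> L2 M2" for s w
      proof -
        have s0: "s \<ge> 0" using s by simp
        have "(\<integral>z. G2 s f z * w z \<partial>M2) - (\<integral>z. G2 s d z * w z \<partial>M2) = (\<integral>z. G2 s ?g z * w z \<partial>M2)"
          by (subst W.T_pairing_lincomb[OF s0 fW dW(1) w]) simp
        also have "cmod \<dots> \<le> ?N (G2 s ?g) * ?N w" by (intro L2_Cauchy_Schwarz W.T_L2 s0 gW w)
        also have "\<dots> \<le> K * \<eta> * ?N w"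
          using order_trans[OF K(2)[OF s gW] mult_left_mono[OF less_imp_le[OF gN] K(1)]] by (intro mult_right_mono) auto
        finally show ?thesis .
      qed
      \<comment> \<open>Subtracting \<open>s\<close> times \<open>q0\<close> leaves a function whose
        derivative is an error of order \<open>\<eta>\<close> plus \<open>q s - q0\<close>. The mean
        value inequality on \<open>[0, t]\<close> then bounds \<open>t * cmod q0\<close> by errors
        alone.\<close>
      define F where "F s = (\<integral>z. G2 s f z * ?t z \<partial>M2) - (\<integral>z. G2 s d z * ?t z \<partial>M2) - s *\<^sub>R q0" for s
      define F' where "F' s = (\<integral>z. G2 s f z * ?a z \<partial>M2) - p * (\<integral>z. G2 s d z * ?t z \<partial>M2) - 1 *\<^sub>R q0" for s
      have dF: "(F has_vector_derivative F' s) (at s within {0..t})" if s: "s \<in> {0..t}" for s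
      proof -
        have sT: "s \<in> {0..T}" using s t by auto
        have "((\<lambda>s. \<integral>z. G2 s f z * ?t z \<partial>M2) has_vector_derivative (\<integral>z. G2 s f z * ?a z \<partial>M2)) (at s within {0..T})"
          using f(1) sT by (auto simp: good_def)
        moreover have "((\<lambda>s. \<integral>z. G2 s d z * ?t z \<partial>M2) has_vector_derivative p * (\<integral>z. G2 s d z * ?t z \<partial>M2)) (at s within {0..T})"
          using W.pairing_has_vector_derivative[OF d tL K sT] hp[OF sT] by simp
        ultimately have "(F has_vector_derivative F' s) (at s within {0..T})"
          unfolding F_def[abs_def] F'_def by (auto intro!: derivative_eq_intros)
        then show ?thesis by (rule has_vector_derivative_within_subset) (use t in auto)
      qed
      have "norm (F t - F 0) \<le> (K * \<eta> * ?N ?a + \<epsilon>) * norm (t - 0)"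
      proof (rule differentiable_bound[where S="{0..t}" and f'="\<lambda>s h. h *\<^sub>R F' s"])
        show "(F has_derivative (\<lambda>h. h *\<^sub>R F' s)) (at s within {0..t})" if "s \<in> {0..t}" for s
          using dF[OF that] by (simp add: has_vector_derivative_def)
        show "onorm (\<lambda>h. h *\<^sub>R F' s) \<le> K * \<eta> * ?N ?a + \<epsilon>" if s: "s \<in> {0..t}" for s
        proof (rule onorm_le)
          fix h :: real
          have sT: "s \<in> {0..T}" using s t by auto
          have "F' s = ((\<integral>z. G2 s f z * ?a z \<partial>M2) - (\<integral>z. G2 s d z * ?a z \<partial>M2)) + (q s - q0)"
            by (simp add: F'_def q_def)
          then have "cmod (F' s) \<le> K * \<eta> * ?N ?a + \<epsilon>"
            using norm_triangle_mono[OF gb[OF sT aL] qt[OF s]] by simp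
          then show "norm (h *\<^sub>R F' s) \<le> (K * \<eta> * ?N ?a + \<epsilon>) * norm h"
            unfolding norm_scaleR by (simp add: mult_left_mono mult.commute[of _ "\<bar>h\<bar>"])
        qed
      qed (use t in auto)
      note mvt = this
      have eq: "t *\<^sub>R q0 = ((\<integral>z. G2 t f z * ?t z \<partial>M2) - (\<integral>z. G2 t d z * ?t z \<partial>M2))
          - (((\<integral>z. G2 0 f z * ?t z \<partial>M2) - (\<integral>z. G2 0 d z * ?t z \<partial>M2)) + (F t - F 0))"
        by (simp add: F_def)
      have n1: "norm (t *\<^sub>R q0) \<le> cmod ((\<integral>z. G2 t f z * ?t z \<partial>M2) - (\<integral>z. G2 t d z * ?t z \<partial>M2))
          + cmod (((\<integral>z. G2 0 f z * ?t z \<partial>M2) - (\<integral>z. G2 0 d z * ?t z \<partial>M2)) + (F t - F 0))"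
        unfolding eq by (rule norm_triangle_ineq4)
      have n2: "cmod ((\<integral>z. G2 t f z * ?t z \<partial>M2) - (\<integral>z. G2 t d z * ?t z \<partial>M2)) \<le> K * \<eta> * ?N ?t"
        using t by (intro gb tL) auto
      have n3: "cmod (((\<integral>z. G2 0 f z * ?t z \<partial>M2) - (\<integral>z. G2 0 d z * ?t z \<partial>M2)) + (F t - F 0))
          \<le> K * \<eta> * ?N ?t + (K * \<eta> * ?N ?a + \<epsilon>) * norm (t - 0)"
        using t by (intro norm_triangle_mono gb tL mvt) auto
      have "t * cmod q0 \<le> K * \<eta> * ?N ?t + (K * \<eta> * ?N ?t + (K * \<eta> * ?N ?a + \<epsilon>) * norm (t - 0))"
        using order_trans[OF n1 add_mono[OF n2 n3]] t by simp
      then show ?thesis using t by (simp add: algebra_simps)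
    qed
    have "t * cmod q0 \<le> t * \<epsilon> + 0"
    proof (rule tendsto_lowerbound)
      have "((\<lambda>\<eta>. t * \<epsilon> + \<eta> * (t * K * ?N ?a + 2 * K * ?N ?t)) \<longlongrightarrow> t * \<epsilon> + 0 * (t * K * ?N ?a + 2 * K * ?N ?t)) (at_right 0)"
        by (intro tendsto_intros)
      then show "((\<lambda>\<eta>. t * \<epsilon> + \<eta> * (t * K * ?N ?a + 2 * K * ?N ?t)) \<longlongrightarrow> t * \<epsilon> + 0) (at_right 0)" by simp
      show "\<forall>\<^sub>F \<eta> in at_right 0. t * cmod q0 \<le> t * \<epsilon> + \<eta> * (t * K * ?N ?a + 2 * K * ?N ?t)"
        using eventually_at_right_less[of "0::real"] by eventually_elim (rule bound)
    qed simp
    then show ?thesis using t(1) by simp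
  qed
  then have "cmod q0 \<le> 0" by (rule field_le_epsilon)
  then show ?thesis by (simp add: q0_def)
qed

lemma pairing_swap:
  assumes d: "d \<in> L2_wedge \<tau>" and f: "f \<in> L2 M" and g: "g \<in> L2 M"
  shows "(\<integral>z. d z * tensor f g z \<partial>M2) = - (\<integral>z. d z * tensor g f z \<partial>M2)"
proof -
  interpret finite_measure M by (rule finite_measure_hist_measure)
  interpret pair_sigma_finite M M ..
  have dL: "d \<in> L2 M2" using W.S_L2[OF d] .
  have ae: "AE z in M2. d (fst z, snd z) = - d (snd z, fst z)" using d by (auto simp: L2_wedge_def)
  have m: "(\<lambda>z. d z * tensor g f z) \<in> borel_measurable M2"
    using L2_mult_integrable[OF dL L2_tensor_M[OF g f]] by auto
  have m': "(\<lambda>z. d z * tensor f g z) \<in> borel_measurable M2"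
    using L2_mult_integrable[OF dL L2_tensor_M[OF f g]] by auto
  have sw: "(\<lambda>z. d (snd z, fst z)) \<in> L2 M2" by (rule L2_norm_swap(1)[OF finite_measure_hist_measure dL])
  have "(\<integral>z. d z * tensor f g z \<partial>M2) = (\<integral>z. - (d (snd z, fst z) * tensor f g z) \<partial>M2)"
  proof (rule integral_cong_AE[OF m'])
    show "(\<lambda>z. - (d (snd z, fst z) * tensor f g z)) \<in> borel_measurable M2"
      using borel_measurable_integrable[OF L2_mult_integrable[OF sw L2_tensor_M[OF f g]]] by measurable
    show "AE z in M2. d z * tensor f g z = - (d (snd z, fst z) * tensor f g z)"
      using ae by eventually_elim simp
  qed
  also have "\<dots> = - (\<integral>z. d (snd z, fst z) * tensor f g z \<partial>M2)" by simp
  also have "(\<integral>z. d (snd z, fst z) * tensor f g z \<partial>M2) = (\<integral>z. (case z of (x, y) \<Rightarrow> d (y, x) * tensor g f (y, x)) \<partial>M2)"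
    by (intro Bochner_Integration.integral_cong) (auto simp: tensor_def)
  also have "\<dots> = (\<integral>z. d z * tensor g f z \<partial>M2)" using integral_product_swap[OF m] .
  finally show ?thesis .
qed

text \<open>By density \<open>d\<close> annihilates all of \<open>L2\<close>. The pairing is
  bilinear, without conjugation, so this is applied to the conjugate of \<open>d\<close>.\<close>

lemma L2_orthogonal_exp_zero:
  assumes d: "d \<in> L2 M2"
    and o: "\<And>m n. m \<ge> 1 \<Longrightarrow> n \<ge> 1 \<Longrightarrow> (\<integral>z. d z * tensor (exp_hist \<tau> m) (exp_hist \<tau> n) z \<partial>M2) = 0"
  shows "AE z in M2. d z = 0"
proof -
  have all: "(\<integral>z. d z * f z \<partial>M2) = 0" if "f \<in> L2 M2" for f
    using that \<tau>
  proof (induction rule: L2_hist2_exp_induct)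
    case (closed f)
    have "cmod (\<integral>z. d z * f z \<partial>M2) \<le> 0 + e" if e: "e > 0" for e
    proof -
      have "e / (L2_norm M2 d + 1) > 0" using e by (simp add: add_nonneg_pos)
      then obtain g where g: "g \<in> L2 M2" "(\<integral>z. d z * g z \<partial>M2) = 0" "L2_norm M2 (\<lambda>x. f x - g x) < e / (L2_norm M2 d + 1)"
        using closed(2) by blast
      have "(\<integral>z. d z * f z \<partial>M2) = (\<integral>z. d z * f z \<partial>M2) - (\<integral>z. d z * g z \<partial>M2)" using g by simp
      also have "\<dots> = (\<integral>z. d z * (f z - g z) \<partial>M2)"
        using Bochner_Integration.integral_diff[OF L2_mult_integrable[OF d closed(1)] L2_mult_integrable[OF d g(1)]]
        by (simp add: right_diff_distrib)
      also have "cmod \<dots> \<le> L2_norm M2 d * L2_norm M2 (\<lambda>x. f x - g x)"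
        by (intro L2_Cauchy_Schwarz d L2_diff closed g)
      also have "\<dots> \<le> (L2_norm M2 d + 1) * L2_norm M2 (\<lambda>x. f x - g x)" by (intro mult_right_mono) auto
      also have "\<dots> \<le> e" using g(3) by (simp add: pos_less_divide_eq add_nonneg_pos mult.commute less_imp_le)
      finally show ?thesis by simp
    qed
    then have "cmod (\<integral>z. d z * f z \<partial>M2) \<le> 0" by (rule field_le_epsilon)
    then show ?case by simp
  next
    case (lincomb f g a b)
    have "(\<integral>z. d z * (a * f z + b * g z) \<partial>M2) = (\<integral>z. a * (d z * f z) + b * (d z * g z) \<partial>M2)"
      by (simp add: algebra_simps)
    also have "\<dots> = a * (\<integral>z. d z * f z \<partial>M2) + b * (\<integral>z. d z * g z \<partial>M2)"
      using L2_mult_integrable[OF d lincomb(1)] L2_mult_integrable[OF d lincomb(2)] by simp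
    finally show ?case using lincomb by simp
  qed (rule o)
  have "(\<lambda>z. cnj (d z)) \<in> L2 M2"
  proof (rule L2I_bound[OF _ d])
    have "cnj \<in> borel_measurable borel" by (intro borel_measurable_continuous_onI continuous_intros)
    then show "(\<lambda>z. cnj (d z)) \<in> borel_measurable M2" by (rule measurable_compose[OF L2_measurable[OF d]])
  qed simp
  then have "(\<integral>z. d z * cnj (d z) \<partial>M2) = 0" by (rule all)
  moreover have "complex_of_real (\<integral>z. (cmod (d z))\<^sup>2 \<partial>M2) = (\<integral>z. d z * cnj (d z) \<partial>M2)"
    unfolding integral_complex_of_real[symmetric]
    by (intro Bochner_Integration.integral_cong) (simp_all only: complex_norm_square)
  ultimately have "complex_of_real (\<integral>z. (cmod (d z))\<^sup>2 \<partial>M2) = 0" by simp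
  then have "L2_norm M2 d = 0" by (simp add: L2_norm_def)
  then show ?thesis using L2_norm_eq_0[OF d] by simp
qed

end

context ss_compound
begin

text \<open>Pairing \<open>d\<close> with two adjoint exponentials gives
  \<open>(l + m - p) * F l m + chr l * e m - chr m * e l = 0\<close>, where \<open>e\<close> pairs
  \<open>d\<close> with evaluation at \<open>0\<close> and one exponential. On
  \<open>l + m = p\<close> this is the symmetry that \<open>symmetric_quotient_zero\<close>
  requires, so \<open>e\<close> vanishes. Then \<open>F\<close> vanishes off
  \<open>l + m = p\<close>, and the positive integer exponents, whose sums exceed
  \<open>p \<le> 0\<close>, determine \<open>d\<close>.\<close>

lemma eigenfunction_zero:
  fixes p :: real
  assumes \<alpha>: "0 < \<alpha>" and p: "p \<le> 0"
    and nz: "\<And>z. chr z \<noteq> 0 \<or> chr (complex_of_real p - z) \<noteq> 0"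
    and d: "A2 d h" and h: "AE z in M2. h z = complex_of_real p * d z"
  shows "AE z in M2. d z = 0"
proof -
  have dW: "d \<in> L2_wedge \<tau>" using d by (auto simp: semigroup_generator_def)
  note dL = W.S_L2[OF dW]
  define v where "v \<theta> = d (0, \<theta>)" for \<theta>
  have vL: "v \<in> L2 M" using L2_section_at_0[OF \<tau> dL] by (simp add: v_def[abs_def])
  have vl: "integrable (leb_open \<tau>) v"
    by (intro L2_imp_integrable finite_measure_leb_open L2_hist_imp_leb_open \<tau> vL)
  define F where "F l m = (\<integral>z. d z * tensor (k l) (k m) z \<partial>M2)" for l m
  define e where "e m = (\<integral>z. d z * tensor \<delta> (k m) z \<partial>M2)" for m
  have weak: "(l + m - complex_of_real p) * F l m + chr l * e m - chr m * e l = 0" for l m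
  proof -
    have "(l + m) * F l m + chr l * e m + chr m * (\<integral>z. d z * tensor (k l) \<delta> z \<partial>M2) = complex_of_real p * F l m"
      using weak_eigen_equation[OF d h, of l m] unfolding pairing_adj2[OF dL] by (simp add: F_def e_def)
    moreover have "(\<integral>z. d z * tensor (k l) \<delta> z \<partial>M2) = - e l"
      unfolding e_def by (rule pairing_swap[OF dW L2_k L2_\<delta>])
    ultimately show ?thesis by (simp add: algebra_simps)
  qed
  interpret finite_measure M by (rule finite_measure_hist_measure)
  interpret pair_sigma_finite M M ..
  \<comment> \<open>\<open>e\<close> is a constant minus a multiple of the Laplace transform of the
    trace of \<open>d\<close>, with \<open>\<theta> + \<tau>\<close> in \<open>[0, \<tau>]\<close>.
    Hence it is entire, and bounded for \<open>Re z \<ge> p / 2\<close>.\<close>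
  have e_eq: "e m = v 0 - complex_of_real \<alpha> * (\<integral>\<theta>. v \<theta> * exp (- m * complex_of_real (\<theta> + \<tau>)) \<partial>leb_open \<tau>)" for m
  proof -
    have i: "integrable M2 (\<lambda>z. d z * tensor \<delta> (k m) z)" by (intro L2_mult_integrable dL L2_tensor_M L2_k L2_\<delta>)
    have i': "integrable M (\<lambda>x. \<integral>y. d (x, y) * tensor \<delta> (k m) (x, y) \<partial>M)" using integrable_fst'[OF i] .
    have "e m = (\<integral>x. \<integral>y. d (x, y) * tensor \<delta> (k m) (x, y) \<partial>M \<partial>M)" unfolding e_def using integral_fst'[OF i] by simp
    also have "\<dots> = (\<integral>x. \<integral>y. d (x, y) * tensor \<delta> (k m) (x, y) \<partial>M \<partial>leb_open \<tau>) + (\<integral>y. v y * k m y \<partial>M)"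
      using integral_hist(2)[OF \<tau> i'] by (simp add: tensor_def v_def)
    also have "(\<integral>x. \<integral>y. d (x, y) * tensor \<delta> (k m) (x, y) \<partial>M \<partial>leb_open \<tau>) = (\<integral>x. 0 \<partial>leb_open \<tau>)"
      by (intro Bochner_Integration.integral_cong) (auto simp: tensor_def)
    also have "(\<integral>y. v y * k m y \<partial>M) = (\<integral>y. v y * k m y \<partial>leb_open \<tau>) + v 0"
      using integral_hist(2)[OF \<tau> L2_mult_integrable[OF vL L2_k]] by (simp add: adj_exp_def)
    also have "(\<integral>y. v y * k m y \<partial>leb_open \<tau>) = (\<integral>\<theta>. - complex_of_real \<alpha> * (v \<theta> * exp (- m * complex_of_real (\<theta> + \<tau>))) \<partial>leb_open \<tau>)"
      by (intro Bochner_Integration.integral_cong) (auto simp: adj_exp_def)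
    finally show ?thesis by simp
  qed
  have Xm: "(\<lambda>\<theta>. \<theta> + \<tau>) \<in> borel_measurable (leb_open \<tau>)" by (intro measurable_restrict_space1) simp
  note lap = laplace_transform_entire[OF vl Xm, of \<tau>]
  define c where "c = \<bar>1 - \<Lambda>\<bar> + \<alpha> * exp (- \<tau> * (p / 2))"
  have e0: "e z = 0" for z
  proof (rule symmetric_quotient_zero[where e=e and f=chr and p=p and c=c])
    show "e holomorphic_on UNIV" unfolding e_eq[abs_def] by (intro holomorphic_intros lap) auto
    show "chr holomorphic_on UNIV" unfolding ss_char_def[abs_def] by (intro holomorphic_intros)
    show "e z * chr (complex_of_real p - z) = chr z * e (complex_of_real p - z)" for z
      using weak[of z "complex_of_real p - z"] by (simp add: algebra_simps)
    show "chr z \<noteq> 0 \<or> chr (complex_of_real p - z) \<noteq> 0" for z by (rule nz)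
    show "cmod (e z) \<le> cmod (v 0) + \<alpha> * ((\<integral>x. cmod (v x) \<partial>leb_open \<tau>) * exp (\<bar>p / 2\<bar> * \<tau>))" if "Re z \<ge> p / 2" for z
    proof -
      have "cmod (e z) \<le> cmod (v 0) + cmod (complex_of_real \<alpha> * (\<integral>\<theta>. v \<theta> * exp (- z * complex_of_real (\<theta> + \<tau>)) \<partial>leb_open \<tau>))"
        unfolding e_eq by (rule norm_triangle_ineq4)
      also have "cmod (complex_of_real \<alpha> * (\<integral>\<theta>. v \<theta> * exp (- z * complex_of_real (\<theta> + \<tau>)) \<partial>leb_open \<tau>))
          \<le> \<alpha> * ((\<integral>x. cmod (v x) \<partial>leb_open \<tau>) * exp (\<bar>p / 2\<bar> * \<tau>))"
        unfolding norm_mult using \<alpha> lap(2)[OF _ that] by (auto intro!: mult_left_mono)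
      finally show ?thesis by simp
    qed
    show "cmod z - c \<le> cmod (chr z)" if "Re z \<ge> p / 2" for z
    proof -
      have "cmod z \<le> cmod (chr z) + (cmod (complex_of_real (1 - \<Lambda>)) + cmod (complex_of_real \<alpha> * exp (- complex_of_real \<tau> * z)))"
      proof -
        have "z = complex_of_real (1 - \<Lambda>) - complex_of_real \<alpha> * exp (- complex_of_real \<tau> * z) - chr z"
          by (simp add: ss_char_def)
        then have "cmod z \<le> cmod (complex_of_real (1 - \<Lambda>) - complex_of_real \<alpha> * exp (- complex_of_real \<tau> * z)) + cmod (chr z)"
          by (metis norm_triangle_ineq4)
        then show ?thesis
          using norm_triangle_ineq4[of "complex_of_real (1 - \<Lambda>)" "complex_of_real \<alpha> * exp (- complex_of_real \<tau> * z)"] by linarith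
      qed
      moreover have "cmod (complex_of_real (1 - \<Lambda>)) = \<bar>1 - \<Lambda>\<bar>" by (rule norm_of_real)
      moreover have "cmod (complex_of_real \<alpha> * exp (- complex_of_real \<tau> * z)) \<le> \<alpha> * exp (- \<tau> * (p / 2))"
        using \<alpha> \<tau> that by (simp add: norm_mult norm_exp_eq_Re mult_left_mono)
      ultimately show ?thesis by (simp add: c_def)
    qed
  qed
  have F0: "F l m = 0" if "l + m \<noteq> complex_of_real p" for l m
    using weak[of l m] e0 that by simp
  show ?thesis
  proof (rule L2_orthogonal_exp_zero[OF dL])
    fix i j :: nat assume ij: "i \<ge> 1" "j \<ge> 1"
    \<comment> \<open>Corrects the value at the atom: \<open>k\<close> equals \<open>1\<close> at
      \<open>0\<close>, where the exponential equals \<open>exp (- n * \<tau>)\<close>.\<close>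
    define \<kappa> where "\<kappa> n = exp (- of_nat n * complex_of_real \<tau>) + 1 / complex_of_real \<alpha>" for n
    have ex: "exp_hist \<tau> n = (\<lambda>\<theta>. (- 1 / complex_of_real \<alpha>) * k (of_nat n) \<theta> + \<kappa> n * \<delta> \<theta>)" for n
      using \<alpha> by (auto simp: exp_hist_def adj_exp_def fun_eq_iff indicator_def \<kappa>_def)
    let ?P = "\<lambda>f g. \<integral>z. d z * tensor f g z \<partial>M2"
    have lin1: "?P (\<lambda>x. a * f x + b * g x) u = a * ?P f u + b * ?P g u"
      if "f \<in> L2 M" "g \<in> L2 M" "u \<in> L2 M" for a b f g u
    proof -
      have "?P (\<lambda>x. a * f x + b * g x) u = (\<integral>z. a * (d z * tensor f u z) + b * (d z * tensor g u z) \<partial>M2)"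
        unfolding tensor_lincomb_left by (simp add: algebra_simps)
      then show ?thesis
        using L2_mult_integrable[OF dL L2_tensor_M[OF that(1,3)]] L2_mult_integrable[OF dL L2_tensor_M[OF that(2,3)]] by simp
    qed
    have lin2: "?P u (\<lambda>x. a * f x + b * g x) = a * ?P u f + b * ?P u g"
      if "f \<in> L2 M" "g \<in> L2 M" "u \<in> L2 M" for a b f g u
    proof -
      have "?P u (\<lambda>x. a * f x + b * g x) = (\<integral>z. a * (d z * tensor u f z) + b * (d z * tensor u g z) \<partial>M2)"
        unfolding tensor_lincomb_right by (simp add: algebra_simps)
      then show ?thesis
        using L2_mult_integrable[OF dL L2_tensor_M[OF that(3,1)]] L2_mult_integrable[OF dL L2_tensor_M[OF that(3,2)]] by simp
    qed
    have "complex_of_nat i + of_nat j \<noteq> complex_of_real p"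
    proof
      assume "complex_of_nat i + of_nat j = complex_of_real p"
      then have "real i + real j = p" by (metis Re_complex_of_real of_nat_add of_real_of_nat_eq)
      then show False using p ij by simp
    qed
    then have 1: "?P (k (of_nat i)) (k (of_nat j)) = 0" using F0 by (simp add: F_def)
    have 2: "?P \<delta> (k (of_nat j)) = 0" using e0 by (simp add: e_def)
    have 3: "?P (k (of_nat i)) \<delta> = 0" using pairing_swap[OF dW L2_k L2_\<delta>] e0 by (simp add: e_def)
    \<comment> \<open>Antisymmetry at the corner: this pairing is its own negative.\<close>
    have 4: "?P \<delta> \<delta> = 0" using pairing_swap[OF dW L2_\<delta> L2_\<delta>] by simp
    show "?P (exp_hist \<tau> i) (exp_hist \<tau> j) = 0"
      unfolding ex
      by (simp only: lin1[OF L2_k L2_\<delta> L2_lincomb[OF L2_k L2_\<delta>]] lin2[OF L2_k L2_\<delta> L2_k] lin2[OF L2_k L2_\<delta> L2_\<delta>] 1 2 3 4)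
        simp
  qed
qed

end

section \<open>A lower bound for the norm of the transfer operator\<close>

lemma AE_leb_open_exists:
  assumes "AE s in leb_open \<tau>. P s" "-\<tau> \<le> a" "a < b" "b \<le> 0"
  shows "\<exists>s. a < s \<and> s < b \<and> P s"
proof (rule ccontr)
  assume neg: "\<not> ?thesis"
  have "AE s in lborel. s \<in> {-\<tau><..<0} \<longrightarrow> P s"
    using assms(1) by (subst (asm) AE_restrict_space_iff) auto
  then have "AE s in lborel. s \<notin> {a<..<b}"
    by eventually_elim (use neg assms in auto)
  then have "{a<..<b} \<in> null_sets lborel" by (subst AE_iff_null_sets) auto
  then have "emeasure lborel {a<..<b} = 0" by auto
  then show False using assms by simp
qed

text \<open>\<open>slice\<close> is an arbitrary continuous representative, so its value at
  \<open>0\<close> must be shown independent of the choice. Two representatives agree for almost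
  every \<open>s\<close>, hence at some \<open>s\<close> arbitrarily close to \<open>0\<close>, and
  both are continuous in norm there.\<close>

lemma slice_eq:
  assumes U: "continuous_slices \<tau> F U" and \<tau>: "0 < \<tau>"
  shows "AE \<theta> in leb_open \<tau>. slice \<tau> F 0 \<theta> = U 0 \<theta>" "slice \<tau> F 0 \<in> L2 (leb_open \<tau>)"
proof -
  define V where "V = slice \<tau> F"
  have V: "continuous_slices \<tau> F V" unfolding V_def slice_def using someI[of "continuous_slices \<tau> F", OF U] by simp
  let ?N = "L2_norm (leb_open \<tau>)"
  have z: "0 \<in> {-\<tau>..0}" using \<tau> by simp
  have L: "V s \<in> L2 (leb_open \<tau>)" "U s \<in> L2 (leb_open \<tau>)" if "s \<in> {-\<tau>..0}" for s
    using U V that by (auto simp: continuous_slices_def)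
  then show "slice \<tau> F 0 \<in> L2 (leb_open \<tau>)" using z by (simp add: V_def)
  have same: "AE s in leb_open \<tau>. AE \<theta> in leb_open \<tau>. V s \<theta> = U s \<theta>"
  proof -
    have "AE s in leb_open \<tau>. AE \<theta> in leb_open \<tau>. V s \<theta> = F s \<theta>" "AE s in leb_open \<tau>. AE \<theta> in leb_open \<tau>. U s \<theta> = F s \<theta>"
      using U V by (auto simp: continuous_slices_def)
    then show ?thesis
    proof eventually_elim
      case (elim s)
      then show ?case by eventually_elim simp
    qed
  qed
  have "?N (\<lambda>\<theta>. V 0 \<theta> - U 0 \<theta>) \<le> 0 + e" if e: "e > 0" for e
  proof -
    have "((\<lambda>r. ?N (\<lambda>\<theta>. V r \<theta> - V 0 \<theta>) + ?N (\<lambda>\<theta>. U r \<theta> - U 0 \<theta>)) \<longlongrightarrow> 0 + 0) (at 0 within {-\<tau>..0})"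
      using U V z by (intro tendsto_add) (auto simp: continuous_slices_def)
    then have "eventually (\<lambda>r. ?N (\<lambda>\<theta>. V r \<theta> - V 0 \<theta>) + ?N (\<lambda>\<theta>. U r \<theta> - U 0 \<theta>) < e) (at 0 within {-\<tau>..0})"
      using e by (auto dest: order_tendstoD(2))
    then obtain \<delta> where \<delta>: "\<delta> > 0" "\<And>r. r \<in> {-\<tau>..0} \<Longrightarrow> r \<noteq> 0 \<Longrightarrow> dist r 0 < \<delta> \<Longrightarrow>
        ?N (\<lambda>\<theta>. V r \<theta> - V 0 \<theta>) + ?N (\<lambda>\<theta>. U r \<theta> - U 0 \<theta>) < e"
      by (auto simp: eventually_at)
    obtain s where s: "max (-\<tau>) (-\<delta>) < s" "s < 0" "AE \<theta> in leb_open \<tau>. V s \<theta> = U s \<theta>"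
      using AE_leb_open_exists[OF same, of "max (-\<tau>) (-\<delta>)" 0] \<tau> \<delta>(1) by auto
    have sm: "s \<in> {-\<tau>..0}" using s by auto
    note L0 = L[OF z] and Ls = L[OF sm]
    have "?N (\<lambda>\<theta>. V s \<theta> - U s \<theta>) = 0"
      using s(3) L2_norm_eq_0[OF L2_diff[OF Ls]] by simp
    moreover have "?N (\<lambda>\<theta>. V 0 \<theta> - U 0 \<theta>) \<le> ?N (\<lambda>\<theta>. V 0 \<theta> - V s \<theta>) + ?N (\<lambda>\<theta>. V s \<theta> - U 0 \<theta>)"
      by (rule L2_norm_diff_triangle[OF L0(1) Ls(1) L0(2)])
    moreover have "?N (\<lambda>\<theta>. V s \<theta> - U 0 \<theta>) \<le> ?N (\<lambda>\<theta>. V s \<theta> - U s \<theta>) + ?N (\<lambda>\<theta>. U s \<theta> - U 0 \<theta>)"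
      by (rule L2_norm_diff_triangle[OF Ls(1) Ls(2) L0(2)])
    moreover have "?N (\<lambda>\<theta>. V s \<theta> - V 0 \<theta>) + ?N (\<lambda>\<theta>. U s \<theta> - U 0 \<theta>) < e"
      using s by (intro \<delta>(2) sm) (auto simp: dist_real_def)
    ultimately show ?thesis using L2_norm_minus_commute[of "leb_open \<tau>" "V 0" "V s"] by simp
  qed
  then have "?N (\<lambda>\<theta>. V 0 \<theta> - U 0 \<theta>) \<le> 0" by (rule field_le_epsilon)
  then have "?N (\<lambda>\<theta>. V 0 \<theta> - U 0 \<theta>) = 0" using L2_norm_nonneg[of "leb_open \<tau>"] by (intro antisym) auto
  then show "AE \<theta> in leb_open \<tau>. slice \<tau> F 0 \<theta> = U 0 \<theta>"
    using L2_norm_eq_0[OF L2_diff[OF L[OF z]]] by (simp add: V_def)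
qed

text \<open>The slices of a wedge move in the span of two fixed functions, so continuity in
  \<open>L2\<close> reduces to continuity of the two scalar coefficients.\<close>

lemma continuous_slices_wedge:
  assumes F: "AE s in leb_open \<tau>. AE \<theta> in leb_open \<tau>. a s * f \<theta> + b s * g \<theta> = F s \<theta>"
    and c: "continuous_on {-\<tau>..0} a" "continuous_on {-\<tau>..0} b"
    and L: "f \<in> L2 (leb_open \<tau>)" "g \<in> L2 (leb_open \<tau>)"
  shows "continuous_slices \<tau> F (\<lambda>s \<theta>. a s * f \<theta> + b s * g \<theta>)"
  unfolding continuous_slices_def
proof (intro conjI ballI)
  let ?N = "L2_norm (leb_open \<tau>)"
  show "(\<lambda>\<theta>. a s * f \<theta> + b s * g \<theta>) \<in> L2 (leb_open \<tau>)" for s by (intro L2_lincomb L)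
  fix s assume s: "s \<in> {-\<tau>..0}"
  show "((\<lambda>r. ?N (\<lambda>\<theta>. a r * f \<theta> + b r * g \<theta> - (a s * f \<theta> + b s * g \<theta>))) \<longlongrightarrow> 0) (at s within {-\<tau>..0})"
  proof (rule tendsto_sandwich[OF _ _ tendsto_const])
    have "((\<lambda>r. cmod (a r - a s) * ?N f + cmod (b r - b s) * ?N g) \<longlongrightarrow> cmod (a s - a s) * ?N f + cmod (b s - b s) * ?N g) (at s within {-\<tau>..0})"
      using c s by (intro tendsto_intros) (auto simp: continuous_on_def)
    then show "((\<lambda>r. cmod (a r - a s) * ?N f + cmod (b r - b s) * ?N g) \<longlongrightarrow> 0) (at s within {-\<tau>..0})" by simp
    show "\<forall>\<^sub>F r in at s within {-\<tau>..0}. ?N (\<lambda>\<theta>. a r * f \<theta> + b r * g \<theta> - (a s * f \<theta> + b s * g \<theta>))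
      \<le> cmod (a r - a s) * ?N f + cmod (b r - b s) * ?N g"
    proof (intro always_eventually allI)
      fix r
      have "(\<lambda>\<theta>. a r * f \<theta> + b r * g \<theta> - (a s * f \<theta> + b s * g \<theta>)) = (\<lambda>\<theta>. (a r - a s) * f \<theta> + (b r - b s) * g \<theta>)"
        by (auto simp: algebra_simps)
      then show "?N (\<lambda>\<theta>. a r * f \<theta> + b r * g \<theta> - (a s * f \<theta> + b s * g \<theta>)) \<le> cmod (a r - a s) * ?N f + cmod (b r - b s) * ?N g"
        using L2_norm_triangle_lincomb[OF L] by simp
    qed
  qed auto
qed (fact F)

context ss_compound
begin

lemma AE_M2_sections:
  assumes "AE z in M2. f z = g z" "f \<in> L2 M2" "g \<in> L2 M2"
  shows "AE s in leb_open \<tau>. AE \<theta> in leb_open \<tau>. f (s, \<theta>) = g (s, \<theta>)"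
    and "AE s in leb_open \<tau>. AE \<theta> in leb_open \<tau>. f (\<theta>, s) = g (\<theta>, s)"
proof -
  interpret finite_measure M by (rule finite_measure_hist_measure)
  interpret pair_sigma_finite M M ..
  have sec: "AE s in leb_open \<tau>. AE \<theta> in leb_open \<tau>. P (s, \<theta>)" if "AE z in M2. P z" for P
  proof -
    have "AE x in M. AE y in M. P (x, y)" using AE_pair[OF that] .
    then have "AE x in leb_open \<tau>. AE y in M. P (x, y)" using AE_hist_iff[OF \<tau>] by blast
    then show ?thesis by eventually_elim (use AE_hist_iff[OF \<tau>] in blast)
  qed
  show "AE s in leb_open \<tau>. AE \<theta> in leb_open \<tau>. f (s, \<theta>) = g (s, \<theta>)" using sec[OF assms(1)] .
  have d: "(\<lambda>z. f z - g z) \<in> L2 M2" by (intro L2_diff assms)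
  note sw = L2_norm_swap[OF finite_measure_hist_measure d]
  have "L2_norm M2 (\<lambda>z. f z - g z) = 0" using assms(1) L2_norm_eq_0[OF d] by simp
  then have "AE z in M2. f (snd z, fst z) - g (snd z, fst z) = 0" using sw L2_norm_eq_0[OF sw(1)] by simp
  then show "AE s in leb_open \<tau>. AE \<theta> in leb_open \<tau>. f (\<theta>, s) = g (\<theta>, s)"
    using sec[of "\<lambda>z. f (snd z, fst z) - g (snd z, fst z) = 0"] by simp
qed

text \<open>The image of the control operator vanishes where a coordinate equals
  \<open>-\<tau>\<close>, since controls live on the open interval, whereas
  \<open>wedge \<delta> \<phi>\<^sub>2\<close> need not. This null set is discarded before the two
  are compared.\<close>

lemma AE_M2_off_corner: "AE z in M2. fst z \<noteq> -\<tau> \<and> snd z \<noteq> -\<tau> \<and> z \<in> space M2"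
proof -
  interpret finite_measure M by (rule finite_measure_hist_measure)
  interpret pair_sigma_finite M M ..
  have ae: "AE x in M. x \<noteq> -\<tau>" unfolding AE_hist_iff[OF \<tau>] using \<tau> by (auto intro!: AE_I2)
  have "(\<lambda>x. x) \<in> borel_measurable (restrict_space borel {-\<tau>..0})"
    by (intro measurable_restrict_space1) simp
  then have id [measurable]: "(\<lambda>x. x) \<in> borel_measurable M" by (simp cong: measurable_cong_sets)
  have "AE z in M2. fst z \<noteq> -\<tau> \<and> snd z \<noteq> -\<tau>"
  proof (rule AE_pair_measure)
    have "(\<lambda>z. fst z) \<in> borel_measurable M2" "(\<lambda>z. snd z) \<in> borel_measurable M2"
      using measurable_compose[OF measurable_fst id] measurable_compose[OF measurable_snd id] by auto
    then show "{x \<in> space M2. fst x \<noteq> -\<tau> \<and> snd x \<noteq> -\<tau>} \<in> sets M2" by measurable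
    show "AE x in M. AE y in M. fst (x, y) \<noteq> -\<tau> \<and> snd (x, y) \<noteq> -\<tau>"
      using ae by eventually_elim (use ae in simp)
  qed
  then show ?thesis using AE_space by eventually_elim simp
qed

text \<open>The hypotheses say that \<open>A f\<^sub>1 = \<sigma> f\<^sub>1 + \<kappa> f\<^sub>2 - c \<delta>\<close> and \<open>A f\<^sub>2 = f\<^sub>1 + \<sigma> f\<^sub>2\<close>, so the second compound
  operator minus \<open>2 \<sigma>\<close> maps \<open>f\<^sub>1 \<and> f\<^sub>2\<close> to \<open>- c \<delta> \<and> f\<^sub>2\<close>, whereas the slice of \<open>f\<^sub>1 \<and> f\<^sub>2\<close> at \<open>0\<close> is
  \<open>f\<^sub>2 / 2\<close>.\<close>

lemma transfer_opnorm_ge: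
  fixes f\<^sub>1 f\<^sub>2 :: "real \<Rightarrow> real" and c \<sigma> \<kappa> :: real
  assumes \<alpha>: "0 < \<alpha>" and \<sigma>: "\<sigma> \<le> 0" and c: "c \<noteq> 0"
    and nz: "\<And>z. chr z \<noteq> 0 \<or> chr (complex_of_real (2 * \<sigma>) - z) \<noteq> 0"
    and f1: "\<And>t. (f\<^sub>1 has_real_derivative \<sigma> * f\<^sub>1 t + \<kappa> * f\<^sub>2 t) (at t)"
    and f2: "\<And>t. (f\<^sub>2 has_real_derivative f\<^sub>1 t + \<sigma> * f\<^sub>2 t) (at t)"
    and init: "f\<^sub>1 0 = 1" "f\<^sub>2 0 = 0"
    and bc: "\<alpha> * f\<^sub>2 (-\<tau>) = - 1" "1 - \<Lambda> - \<alpha> * f\<^sub>1 (-\<tau>) = \<sigma> - c"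
  shows "ereal (inverse \<bar>c\<bar>) \<le> control_opnorm \<tau> (transfer_op \<tau> (-1) 0 G2 (Complex (2 * \<sigma>) 0))"
proof -
  let ?L = "leb_open \<tau>" and ?NL = "L2_norm (leb_open \<tau>)"
  define \<phi>\<^sub>1 \<phi>\<^sub>2 where "\<phi>\<^sub>1 = (\<lambda>t. complex_of_real (f\<^sub>1 t))" and "\<phi>\<^sub>2 = (\<lambda>t. complex_of_real (f\<^sub>2 t))"
  have cf: "continuous_on X f\<^sub>1" "continuous_on X f\<^sub>2" for X
    by (rule DERIV_continuous_on[OF has_field_derivative_at_within], rule f1 f2)+
  have c\<phi>: "continuous_on X \<phi>\<^sub>1" "continuous_on X \<phi>\<^sub>2" for X
    unfolding \<phi>\<^sub>1_def \<phi>\<^sub>2_def by (intro continuous_intros cf)+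
  have \<phi>L: "\<phi>\<^sub>1 \<in> L2 M" "\<phi>\<^sub>2 \<in> L2 M" by (intro continuous_on_L2_hist c\<phi>)+
  have \<phi>l: "\<phi>\<^sub>1 \<in> L2 ?L" "\<phi>\<^sub>2 \<in> L2 ?L" by (intro L2_hist_imp_leb_open \<tau> \<phi>L)+
  have d1: "(\<phi>\<^sub>1 has_vector_derivative complex_of_real (\<sigma> * f\<^sub>1 t + \<kappa> * f\<^sub>2 t)) (at t)" for t
    unfolding \<phi>\<^sub>1_def by (rule has_vector_derivative_of_real[OF f1])
  have d2: "(\<phi>\<^sub>2 has_vector_derivative complex_of_real (f\<^sub>1 t + \<sigma> * f\<^sub>2 t)) (at t)" for t
    unfolding \<phi>\<^sub>2_def by (rule has_vector_derivative_of_real[OF f2])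
  define \<xi>\<^sub>1 \<xi>\<^sub>2 where "\<xi>\<^sub>1 = (\<lambda>t. complex_of_real \<sigma> * \<phi>\<^sub>1 t + complex_of_real \<kappa> * \<phi>\<^sub>2 t - complex_of_real c * \<delta> t)"
    and "\<xi>\<^sub>2 = (\<lambda>t. \<phi>\<^sub>1 t + complex_of_real \<sigma> * \<phi>\<^sub>2 t)"
  have At: "ss_functional \<alpha> \<tau> \<Lambda> \<phi>\<^sub>1 = complex_of_real (\<sigma> - c)" "ss_functional \<alpha> \<tau> \<Lambda> \<phi>\<^sub>2 = 1"
  proof -
    have "ss_functional \<alpha> \<tau> \<Lambda> \<phi>\<^sub>1 = complex_of_real (1 - \<Lambda> - \<alpha> * f\<^sub>1 (-\<tau>))"
      by (simp add: ss_functional_def \<phi>\<^sub>1_def init)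
    then show "ss_functional \<alpha> \<tau> \<Lambda> \<phi>\<^sub>1 = complex_of_real (\<sigma> - c)" by (simp only: bc)
    have "ss_functional \<alpha> \<tau> \<Lambda> \<phi>\<^sub>2 = - complex_of_real (\<alpha> * f\<^sub>2 (-\<tau>))"
      by (simp add: ss_functional_def \<phi>\<^sub>2_def init)
    then show "ss_functional \<alpha> \<tau> \<Lambda> \<phi>\<^sub>2 = 1" by (simp only: bc) simp
  qed
  have "D \<phi>\<^sub>1 (\<lambda>\<theta>. 1 * complex_of_real (\<sigma> * f\<^sub>1 \<theta> + \<kappa> * f\<^sub>2 \<theta>)
     + (ss_functional \<alpha> \<tau> \<Lambda> \<phi>\<^sub>1 - complex_of_real (\<sigma> * f\<^sub>1 0 + \<kappa> * f\<^sub>2 0)) * \<delta> \<theta>)"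
    by (rule delay_operator_C1[OF \<tau> d1]) (intro continuous_intros cf)
  then have D1: "D \<phi>\<^sub>1 \<xi>\<^sub>1" unfolding At init by (simp add: \<xi>\<^sub>1_def \<phi>\<^sub>1_def \<phi>\<^sub>2_def)
  have "D \<phi>\<^sub>2 (\<lambda>\<theta>. 1 * complex_of_real (f\<^sub>1 \<theta> + \<sigma> * f\<^sub>2 \<theta>)
     + (ss_functional \<alpha> \<tau> \<Lambda> \<phi>\<^sub>2 - complex_of_real (f\<^sub>1 0 + \<sigma> * f\<^sub>2 0)) * \<delta> \<theta>)"
    by (rule delay_operator_C1[OF \<tau> d2]) (intro continuous_intros cf)
  then have D2: "D \<phi>\<^sub>2 \<xi>\<^sub>2" unfolding At init by (simp add: \<xi>\<^sub>2_def \<phi>\<^sub>1_def \<phi>\<^sub>2_def)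
  define \<Phi> where "\<Phi> = wedge \<phi>\<^sub>1 \<phi>\<^sub>2"
  have A\<Phi>: "A2 \<Phi> (\<lambda>z. 1 * wedge \<xi>\<^sub>1 \<phi>\<^sub>2 z + 1 * wedge \<phi>\<^sub>1 \<xi>\<^sub>2 z)"
    unfolding \<Phi>_def by (rule generator_wedge[OF D1 D2])
  \<comment> \<open>Only the trace \<open>2 * \<sigma>\<close> of the linear system for the pair
    survives; the off-diagonal terms produce wedges of a function with itself.\<close>
  have A\<Phi>_eq: "1 * wedge \<xi>\<^sub>1 \<phi>\<^sub>2 z + 1 * wedge \<phi>\<^sub>1 \<xi>\<^sub>2 z - complex_of_real (2 * \<sigma>) * \<Phi> z = - complex_of_real c * wedge \<delta> \<phi>\<^sub>2 z" for z
    by (cases z) (simp add: \<Phi>_def wedge_def \<xi>\<^sub>1_def \<xi>\<^sub>2_def field_simps)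
  \<comment> \<open>The boundary condition forces
    \<open>f\<^sub>2 (-\<tau>) = - 1 / \<alpha>\<close>, so \<open>f\<^sub>2\<close> is negative on
    an interval next to \<open>-\<tau>\<close>.\<close>
  have pos: "?NL \<phi>\<^sub>2 > 0"
  proof (rule ccontr)
    assume "\<not> ?thesis"
    then have "?NL \<phi>\<^sub>2 = 0" using L2_norm_nonneg[of ?L \<phi>\<^sub>2] by linarith
    then have ae: "AE t in ?L. \<phi>\<^sub>2 t = 0" using L2_norm_eq_0[OF \<phi>l(2)] by simp
    have "f\<^sub>2 (-\<tau>) < 0" using bc(1) \<alpha> by (smt (verit) zero_le_mult_iff)
    moreover have "(f\<^sub>2 \<longlongrightarrow> f\<^sub>2 (-\<tau>)) (at_right (-\<tau>))" using cf(2)[of UNIV]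
      by (auto simp: continuous_on_def intro: filterlim_mono at_le)
    ultimately have "eventually (\<lambda>t. f\<^sub>2 t < 0) (at_right (-\<tau>))" by (auto dest: order_tendstoD(2))
    then obtain b where b: "b > -\<tau>" "\<And>t. -\<tau> < t \<Longrightarrow> t < b \<Longrightarrow> f\<^sub>2 t < 0" by (auto simp: eventually_at_right_field)
    obtain s where "-\<tau> < s" "s < min b 0" "\<phi>\<^sub>2 s = 0"
      using AE_leb_open_exists[OF ae, of "-\<tau>" "min b 0"] b(1) \<tau> by auto
    then show False using b(2)[of s] by (simp add: \<phi>\<^sub>2_def)
  qed
  define n where "n = ?NL (\<lambda>\<theta>. \<phi>\<^sub>2 \<theta> / 2)"
  have n: "n = ?NL \<phi>\<^sub>2 / 2" using L2_norm_scale[of ?L "1 / 2" \<phi>\<^sub>2] by (simp add: n_def)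
  \<comment> \<open>Normalizes the control to norm one; its two components have equal norm, whence
    the factor \<open>sqrt 2\<close>.\<close>
  define s where "s = 1 / (sqrt 2 * \<bar>c\<bar> * n)"
  have s0: "s > 0" using pos c by (simp add: s_def n)
  \<comment> \<open>The signs undo both \<open>Btil = - 1\<close> and the swap of components in the
    control operator, so that the image of \<open>\<eta>\<close> is \<open>s\<close> times
    \<open>- c * wedge \<delta> \<phi>\<^sub>2\<close>.\<close>
  define \<eta> where "\<eta> = ((\<lambda>\<theta>. complex_of_real (s * c) * (\<phi>\<^sub>2 \<theta> / 2)), (\<lambda>\<theta>. complex_of_real (- s * c) * (\<phi>\<^sub>2 \<theta> / 2)))"
  have cn: "control_norm \<tau> (\<lambda>\<theta>. a * (\<phi>\<^sub>2 \<theta> / 2), \<lambda>\<theta>. b * (\<phi>\<^sub>2 \<theta> / 2)) = sqrt ((cmod a * n)\<^sup>2 + (cmod b * n)\<^sup>2)" for a b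
    using L2_norm_scale[of ?L a "\<lambda>\<theta>. \<phi>\<^sub>2 \<theta> / 2"] L2_norm_scale[of ?L b "\<lambda>\<theta>. \<phi>\<^sub>2 \<theta> / 2"] by (simp add: control_norm_def n_def)
  have h2: "(\<lambda>\<theta>. \<phi>\<^sub>2 \<theta> / 2) \<in> L2 ?L" using L2_scale[OF \<phi>l(2), of "1 / 2"] by simp
  have \<eta>S: "\<eta> \<in> control_space \<tau>"
    unfolding control_space_def \<eta>_def using L2_scale[OF h2] by (simp only: mem_Collect_eq prod.case) simp
  have sq2: "sqrt ((x * n)\<^sup>2 + (x * n)\<^sup>2) = sqrt 2 * \<bar>x\<bar> * n" for x
  proof -
    have "(x * n)\<^sup>2 + (x * n)\<^sup>2 = 2 * (x * n)\<^sup>2" by simp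
    then show ?thesis using pos n by (simp add: real_sqrt_mult abs_mult)
  qed
  have \<eta>n: "control_norm \<tau> \<eta> = 1"
  proof -
    have "control_norm \<tau> \<eta> = sqrt ((\<bar>s * c\<bar> * n)\<^sup>2 + (\<bar>s * c\<bar> * n)\<^sup>2)"
      unfolding \<eta>_def cn norm_of_real by simp
    also have "\<dots> = sqrt 2 * \<bar>s\<bar> * \<bar>c\<bar> * n" unfolding sq2 by (simp add: abs_mult)
    also have "\<dots> = 1" using s0 c pos by (simp add: s_def n)
    finally show ?thesis .
  qed
  define p where "p = Complex (2 * \<sigma>) 0"
  have p: "p = complex_of_real (2 * \<sigma>)" by (simp add: p_def complex_eq_iff)
  define f where "f = resolvent M2 A2 p (control_op \<tau> (-1) \<eta>)"
  let ?s\<Phi> = "\<lambda>z. complex_of_real s * \<Phi> z + 0 * \<Phi> z"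
  have sol: "\<exists>h. A2 ?s\<Phi> h \<and> (AE z in M2. h z - p * ?s\<Phi> z = control_op \<tau> (-1) \<eta> z)"
  proof (intro exI conjI)
    show "A2 ?s\<Phi> (\<lambda>z. complex_of_real s * (1 * wedge \<xi>\<^sub>1 \<phi>\<^sub>2 z + 1 * wedge \<phi>\<^sub>1 \<xi>\<^sub>2 z) + 0 * (1 * wedge \<xi>\<^sub>1 \<phi>\<^sub>2 z + 1 * wedge \<phi>\<^sub>1 \<xi>\<^sub>2 z))"
      by (rule W.generator_add[OF A\<Phi> A\<Phi>])
    show "AE z in M2. complex_of_real s * (1 * wedge \<xi>\<^sub>1 \<phi>\<^sub>2 z + 1 * wedge \<phi>\<^sub>1 \<xi>\<^sub>2 z) + 0 * (1 * wedge \<xi>\<^sub>1 \<phi>\<^sub>2 z + 1 * wedge \<phi>\<^sub>1 \<xi>\<^sub>2 z)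
        - p * ?s\<Phi> z = control_op \<tau> (-1) \<eta> z"
      using AE_M2_off_corner
    proof eventually_elim
      case (elim z)
      obtain x y where z: "z = (x, y)" by (cases z)
      have xy: "-\<tau> < x" "x \<le> 0" "-\<tau> < y" "y \<le> 0" using elim by (auto simp: z space_pair_measure order_less_le)
      have "complex_of_real s * (1 * wedge \<xi>\<^sub>1 \<phi>\<^sub>2 z + 1 * wedge \<phi>\<^sub>1 \<xi>\<^sub>2 z) + 0 * (1 * wedge \<xi>\<^sub>1 \<phi>\<^sub>2 z + 1 * wedge \<phi>\<^sub>1 \<xi>\<^sub>2 z)
        - p * ?s\<Phi> z = complex_of_real s * (1 * wedge \<xi>\<^sub>1 \<phi>\<^sub>2 z + 1 * wedge \<phi>\<^sub>1 \<xi>\<^sub>2 z - complex_of_real (2 * \<sigma>) * \<Phi> z)"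
        unfolding p by (simp add: algebra_simps)
      also have "\<dots> = complex_of_real s * (- complex_of_real c * wedge \<delta> \<phi>\<^sub>2 z)" by (simp only: A\<Phi>_eq)
      also have "\<dots> = control_op \<tau> (-1) \<eta> z"
        using xy by (auto simp: z wedge_def control_op_def \<eta>_def indicator_def \<phi>\<^sub>2_def init)
      finally show ?case .
    qed
  qed
  have fsol: "\<exists>h. A2 f h \<and> (AE z in M2. h z - p * f z = control_op \<tau> (-1) \<eta> z)"
    unfolding f_def resolvent_def
    by (rule someI[where P="\<lambda>f. \<exists>h. A2 f h \<and> (AE z in M2. h z - p * f z = control_op \<tau> (-1) \<eta> z)", OF sol])
  obtain h1 where h1: "A2 ?s\<Phi> h1" "AE z in M2. h1 z - p * ?s\<Phi> z = control_op \<tau> (-1) \<eta> z" using sol by blast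
  obtain h2' where h2': "A2 f h2'" "AE z in M2. h2' z - p * f z = control_op \<tau> (-1) \<eta> z" using fsol by blast
  \<comment> \<open>The chosen solution and the explicit one differ by an element of the kernel of
    \<open>A2 - p\<close>, which is trivial.\<close>
  have "AE z in M2. 1 * f z + (- 1) * ?s\<Phi> z = 0"
  proof (rule eigenfunction_zero[OF \<alpha> _ nz])
    show "A2 (\<lambda>z. 1 * f z + (- 1) * ?s\<Phi> z) (\<lambda>z. 1 * h2' z + (- 1) * h1 z)" by (rule W.generator_add[OF h2'(1) h1(1)])
    show "AE z in M2. 1 * h2' z + (- 1) * h1 z = complex_of_real (2 * \<sigma>) * (1 * f z + (- 1) * ?s\<Phi> z)"
      using h1(2) h2'(2)
    proof eventually_elim
      case (elim z)
      then show ?case unfolding p[symmetric] by (simp add: algebra_simps)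
    qed
  qed (use \<sigma> in simp)
  then have fe: "AE z in M2. f z = complex_of_real s * \<Phi> z" by eventually_elim simp
  have fL: "f \<in> L2 M2" using h2'(1) W.S_L2 by (auto simp: semigroup_generator_def)
  have sL: "(\<lambda>z. complex_of_real s * \<Phi> z) \<in> L2 M2" unfolding \<Phi>_def by (intro L2_scale wedge_L2 \<phi>L)
  note sec = AE_M2_sections[OF fe fL sL]
  \<comment> \<open>At \<open>x = 0\<close> only the coefficient of \<open>\<phi>\<^sub>2\<close>
    survives, by the initial values \<open>f\<^sub>1 0 = 1\<close> and
    \<open>f\<^sub>2 0 = 0\<close>.\<close>
  have cs1: "continuous_slices \<tau> (\<lambda>x \<theta>. f (x, \<theta>)) (\<lambda>x \<theta>. complex_of_real s * \<phi>\<^sub>1 x / 2 * \<phi>\<^sub>2 \<theta> + - (complex_of_real s * \<phi>\<^sub>2 x / 2) * \<phi>\<^sub>1 \<theta>)"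
  proof (rule continuous_slices_wedge)
    show "AE x in ?L. AE \<theta> in ?L. complex_of_real s * \<phi>\<^sub>1 x / 2 * \<phi>\<^sub>2 \<theta> + - (complex_of_real s * \<phi>\<^sub>2 x / 2) * \<phi>\<^sub>1 \<theta> = f (x, \<theta>)"
      using sec(1) by eventually_elim (auto elim!: eventually_mono simp: \<Phi>_def wedge_def field_simps)
  qed (intro continuous_intros c\<phi> \<phi>l | simp)+
  have cs2: "continuous_slices \<tau> (\<lambda>x \<theta>. f (\<theta>, x)) (\<lambda>x \<theta>. - (complex_of_real s * \<phi>\<^sub>1 x / 2) * \<phi>\<^sub>2 \<theta> + complex_of_real s * \<phi>\<^sub>2 x / 2 * \<phi>\<^sub>1 \<theta>)"
  proof (rule continuous_slices_wedge)
    show "AE x in ?L. AE \<theta> in ?L. - (complex_of_real s * \<phi>\<^sub>1 x / 2) * \<phi>\<^sub>2 \<theta> + complex_of_real s * \<phi>\<^sub>2 x / 2 * \<phi>\<^sub>1 \<theta> = f (\<theta>, x)"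
      using sec(2) by eventually_elim (auto elim!: eventually_mono simp: \<Phi>_def wedge_def field_simps)
  qed (intro continuous_intros c\<phi> \<phi>l | simp)+
  note sl1 = slice_eq[OF cs1 \<tau>] and sl2 = slice_eq[OF cs2 \<tau>]
  define V1 V2 where "V1 = slice \<tau> (\<lambda>x \<theta>. f (x, \<theta>)) 0" and "V2 = slice \<tau> (\<lambda>x \<theta>. f (\<theta>, x)) 0"
  have V1n: "?NL (\<lambda>\<theta>. - V1 \<theta>) = s * n"
  proof -
    have "AE \<theta> in ?L. V1 \<theta> = complex_of_real s * (\<phi>\<^sub>2 \<theta> / 2)"
      using sl1(1) by eventually_elim (simp add: V1_def \<phi>\<^sub>1_def \<phi>\<^sub>2_def init)
    then have "?NL V1 = ?NL (\<lambda>\<theta>. complex_of_real s * (\<phi>\<^sub>2 \<theta> / 2))"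
      using sl1(2) by (intro L2_norm_cong_AE L2_measurable L2_scale h2) (simp_all add: V1_def)
    then show ?thesis using s0 unfolding L2_norm_scale by (simp add: L2_norm_uminus n_def)
  qed
  have V2n: "?NL (\<lambda>\<theta>. - V2 \<theta>) = s * n"
  proof -
    have "AE \<theta> in ?L. V2 \<theta> = complex_of_real (- s) * (\<phi>\<^sub>2 \<theta> / 2)"
      using sl2(1) by eventually_elim (simp add: V2_def \<phi>\<^sub>1_def \<phi>\<^sub>2_def init)
    then have "?NL V2 = ?NL (\<lambda>\<theta>. complex_of_real (- s) * (\<phi>\<^sub>2 \<theta> / 2))"
      using sl2(2) by (intro L2_norm_cong_AE L2_measurable L2_scale h2) (simp_all add: V2_def)
    then show ?thesis using s0 unfolding L2_norm_scale by (simp add: L2_norm_uminus n_def)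
  qed
  have W: "transfer_op \<tau> (-1) 0 G2 p \<eta> = (\<lambda>\<theta>. - V1 \<theta>, \<lambda>\<theta>. - V2 \<theta>)"
    by (simp add: transfer_op_def measurement_op_def f_def[symmetric] V1_def V2_def fun_Compl_def)
  have "control_norm \<tau> (transfer_op \<tau> (-1) 0 G2 p \<eta>) = inverse \<bar>c\<bar>"
  proof -
    have "control_norm \<tau> (transfer_op \<tau> (-1) 0 G2 p \<eta>) = sqrt ((s * n)\<^sup>2 + (s * n)\<^sup>2)"
      unfolding W control_norm_def by (simp add: V1n V2n)
    also have "\<dots> = sqrt 2 * \<bar>s\<bar> * n" by (rule sq2)
    also have "\<dots> = inverse \<bar>c\<bar>" using s0 c pos by (simp add: s_def n field_simps)
    finally show ?thesis .
  qed
  then have "ereal (inverse \<bar>c\<bar>) = ereal (control_norm \<tau> (transfer_op \<tau> (-1) 0 G2 p \<eta>))" by simp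
  also have "\<dots> \<le> control_opnorm \<tau> (transfer_op \<tau> (-1) 0 G2 p)"
    unfolding control_opnorm_def by (rule SUP_upper) (simp add: \<eta>S \<eta>n)
  finally show ?thesis by (simp add: p_def)
qed

end

section \<open>The characteristic roots\<close>

lemma deriv_ss_char:
  "deriv (ss_char \<alpha> \<tau> \<Lambda>) = (\<lambda>p. complex_of_real (\<alpha> * \<tau>) * exp (- complex_of_real \<tau> * p) - 1)"
  unfolding ss_char_def[abs_def]
  by (intro ext DERIV_imp_deriv) (auto intro!: derivative_eq_intros)

text \<open>The second derivative is a nonzero constant times an exponential and never vanishes, so
  no root has multiplicity above two.\<close>

lemma zorder_ss_char:
  assumes "0 < \<alpha>" "0 < \<tau>" "ss_char \<alpha> \<tau> \<Lambda> z = 0"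
  shows "zorder (ss_char \<alpha> \<tau> \<Lambda>) z = (if deriv (ss_char \<alpha> \<tau> \<Lambda>) z = 0 then 2 else 1)"
proof -
  let ?f = "ss_char \<alpha> \<tau> \<Lambda>"
  have hol: "?f holomorphic_on UNIV" unfolding ss_char_def[abs_def] by (intro holomorphic_intros)
  have d2: "deriv (deriv ?f) w = - complex_of_real (\<alpha> * \<tau> * \<tau>) * exp (- complex_of_real \<tau> * w)" for w
    unfolding deriv_ss_char by (intro DERIV_imp_deriv) (auto intro!: derivative_eq_intros)
  show ?thesis
  proof (cases "deriv ?f z = 0")
    case True
    have "zorder ?f z = 2"
    proof (rule zorder_zero_eqI[OF hol open_UNIV UNIV_I])
      fix i assume "i < nat 2"
      then have "i = 0 \<or> i = 1" by auto
      then show "(deriv ^^ i) ?f z = 0" using assms(3) True by auto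
    next
      show "(deriv ^^ nat 2) ?f z \<noteq> 0" using assms d2[of z] by (simp add: numeral_2_eq_2)
    qed simp
    then show ?thesis using True by simp
  next
    case False
    have "zorder ?f z = 1"
      by (rule zorder_zero_eqI[OF hol open_UNIV UNIV_I]) (use assms False in auto)
    then show ?thesis using False by simp
  qed
qed

lemma root_enumeration_two_roots:
  assumes e: "root_enumeration f ls" and "m \<noteq> n"
  shows "Re (ls m) + Re (ls n) \<le> Re (ls 0) + Re (ls 1)"
proof -
  have mono: "Re (ls j) \<le> Re (ls i)" if "i \<le> j" for i j using e that by (auto simp: root_enumeration_def)
  show ?thesis
  proof (cases "m < n")
    case True then show ?thesis using mono[of 0 m] mono[of 1 n] by simp
  next
    case False then show ?thesis using mono[of 0 n] mono[of 1 m] assms(2) by simp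
  qed
qed

text \<open>Every root occurs in the enumeration because its order is positive. The spectral
  condition enters the argument only through this bound and its counterpart for double
  roots.\<close>

lemma ss_char_distinct_roots:
  assumes "0 < \<alpha>" "0 < \<tau>" and e: "root_enumeration (ss_char \<alpha> \<tau> \<Lambda>) ls"
    and r: "ss_char \<alpha> \<tau> \<Lambda> z = 0" "ss_char \<alpha> \<tau> \<Lambda> w = 0" "z \<noteq> w"
  shows "Re z + Re w \<le> Re (ls 0) + Re (ls 1)"
proof -
  have ex: "\<exists>n. ls n = u" if "ss_char \<alpha> \<tau> \<Lambda> u = 0" for u
  proof -
    have "int (card {n. ls n = u}) = zorder (ss_char \<alpha> \<tau> \<Lambda>) u" using e that by (auto simp: root_enumeration_def)
    then have "card {n. ls n = u} > 0" using zorder_ss_char[OF assms(1,2) that] by (auto split: if_splits)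
    then show ?thesis by (auto simp: card_gt_0_iff)
  qed
  obtain m n where "ls m = z" "ls n = w" using ex r by meson
  then show ?thesis using root_enumeration_two_roots[OF e, of m n] r(3) by auto
qed

lemma ss_char_double_root:
  assumes "0 < \<alpha>" "0 < \<tau>" and e: "root_enumeration (ss_char \<alpha> \<tau> \<Lambda>) ls"
    and r: "ss_char \<alpha> \<tau> \<Lambda> z = 0" "deriv (ss_char \<alpha> \<tau> \<Lambda>) z = 0"
  shows "2 * Re z \<le> Re (ls 0) + Re (ls 1)"
proof -
  have "int (card {n. ls n = z}) = 2" and fin: "finite {n. ls n = z}"
    using e r zorder_ss_char[OF assms(1,2) r(1)] by (auto simp: root_enumeration_def)
  then have "card {n. ls n = z} = 2" by simp
  then obtain m n where mn: "{n. ls n = z} = {m, n}" "m \<noteq> n" by (auto simp: card_2_iff)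
  then have "ls m = z" "ls n = z" by blast+
  then show ?thesis using root_enumeration_two_roots[OF e mn(2)] by simp
qed

section \<open>Inequalities and real roots for the characteristic equation\<close>

lemma x_cos_le_sin:
  assumes "0 \<le> x" "x \<le> pi"
  shows "x * cos x \<le> sin x"
proof -
  have "(\<lambda>x. sin x - x * cos x) 0 \<le> (\<lambda>x. sin x - x * cos x) x"
  proof (rule DERIV_nonneg_imp_nondecreasing[OF assms(1)])
    fix t assume t: "0 \<le> t" "t \<le> x"
    have "((\<lambda>x. sin x - x * cos x) has_real_derivative t * sin t) (at t)"
      by (auto intro!: derivative_eq_intros)
    then show "\<exists>y. ((\<lambda>x. sin x - x * cos x) has_real_derivative y) (at t) \<and> y \<ge> 0"
      using t assms sin_ge_zero[of t] by (intro exI[of _ "t * sin t"]) auto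
  qed
  then show ?thesis by simp
qed

text \<open>The sign of the derivative is that of \<open>x * cos x - sin x\<close> at
  \<open>x = \<tau> * t\<close>. The monotonicity will show that real parts do not drop when the
  frequency is lowered along a curve of candidate roots.\<close>

lemma sinc_antimono:
  fixes \<tau> :: real
  assumes "0 < \<tau>" "0 < x" "x \<le> y" "\<tau> * y \<le> pi"
  shows "sin (\<tau> * y) / y \<le> sin (\<tau> * x) / x"
proof (rule DERIV_nonpos_imp_nonincreasing[OF assms(3)])
  fix t assume t: "x \<le> t" "t \<le> y"
  then have t0: "t > 0" using assms by simp
  have "\<tau> * t \<le> \<tau> * y" using t assms by (intro mult_left_mono) auto
  then have "\<tau> * t \<le> pi" using assms(4) by linarith
  then have le: "\<tau> * t * cos (\<tau> * t) \<le> sin (\<tau> * t)" using t0 assms by (intro x_cos_le_sin) auto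
  have "((\<lambda>t. sin (\<tau> * t) / t) has_real_derivative (\<tau> * cos (\<tau> * t) * t - sin (\<tau> * t)) / (t * t)) (at t)"
    using t0 by (auto intro!: derivative_eq_intros)
  moreover have "(\<tau> * cos (\<tau> * t) * t - sin (\<tau> * t)) / (t * t) \<le> 0"
    using le t0 by (intro divide_nonpos_pos) (auto simp: algebra_simps)
  ultimately show "\<exists>y. ((\<lambda>t. sin (\<tau> * t) / t) has_real_derivative y) (at t) \<and> y \<le> 0" by blast
qed

text \<open>This is \<open>sinh x \<ge> x\<close>. It compares the values of the convex function
  \<open>- ss_char\<close> at two real points equally far from its minimum.\<close>

lemma exp_diff_ge:
  assumes "0 \<le> (x::real)"
  shows "2 * x \<le> exp x - exp (- x)"
proof -
  have "(\<lambda>x. exp x - exp (- x) - 2 * x) 0 \<le> (\<lambda>x. exp x - exp (- x) - 2 * x) x"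
  proof (rule DERIV_nonneg_imp_nondecreasing[OF assms])
    fix t :: real
    have "((\<lambda>x. exp x - exp (- x) - 2 * x) has_real_derivative exp t + exp (- t) - 2) (at t)"
      by (auto intro!: derivative_eq_intros)
    moreover have "exp t + exp (- t) \<ge> 2" using exp_ge_add_one_self[of t] exp_ge_add_one_self[of "- t"] by linarith
    ultimately show "\<exists>y. ((\<lambda>x. exp x - exp (- x) - 2 * x) has_real_derivative y) (at t) \<and> y \<ge> 0"
      by (intro exI[of _ "exp t + exp (- t) - 2"]) auto
  qed
  then show ?thesis by simp
qed

lemma ss_char_of_real: "ss_char \<alpha> \<tau> \<Lambda> (complex_of_real x) = - complex_of_real (x - (1 - \<Lambda>) + \<alpha> * exp (- \<tau> * x))"
  by (simp add: ss_char_def exp_of_real[symmetric])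

text \<open>If \<open>\<alpha> \<tau> \<ge> 1\<close>, then the convex function \<open>- \<chi>\<close> has its minimum at \<open>ln (\<alpha> \<tau>) / \<tau> \<ge> 0\<close>, and it
  grows faster to the left than to the right, so real roots come in pairs with nonnegative sum.\<close>

lemma ss_char_real_positive:
  assumes \<alpha>: "0 < \<alpha>" and \<tau>: "0 < \<tau>" and e: "root_enumeration (ss_char \<alpha> \<tau> \<Lambda>) ls"
    and neg: "Re (ls 0) + Re (ls 1) < 0" and ge: "\<alpha> * \<tau> \<ge> 1"
  shows "x - (1 - \<Lambda>) + \<alpha> * exp (- \<tau> * x) > 0"
proof -
  define f where "f x = x - (1 - \<Lambda>) + \<alpha> * exp (- \<tau> * x)" for x
  define q where "q = ln (\<alpha> * \<tau>) / \<tau>"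
  have q0: "q \<ge> 0" using ge \<tau> by (simp add: q_def)
  have eq: "\<alpha> * exp (- \<tau> * (q + s)) = exp (- \<tau> * s) / \<tau>" for s
  proof -
    have "\<tau> * q = ln (\<alpha> * \<tau>)" using \<tau> by (simp add: q_def)
    then have "exp (\<tau> * q) = \<alpha> * \<tau>" using \<alpha> \<tau> by simp
    then have "exp (- \<tau> * q) = 1 / (\<alpha> * \<tau>)" by (simp add: exp_minus divide_inverse)
    moreover have "exp (- \<tau> * (q + s)) = exp (- \<tau> * q) * exp (- \<tau> * s)"
      by (simp add: exp_add[symmetric] algebra_simps)
    ultimately show ?thesis using \<alpha> \<tau> by simp
  qed
  have fq: "f (q + s) = q + s - (1 - \<Lambda>) + exp (- \<tau> * s) / \<tau>" for s unfolding f_def eq ..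
  have root: "ss_char \<alpha> \<tau> \<Lambda> (complex_of_real x) = 0 \<longleftrightarrow> f x = 0" for x
    unfolding ss_char_of_real f_def by (simp only: neg_equal_0_iff_equal of_real_eq_0_iff)
  have cont: "isCont f x" for x unfolding f_def by (intro continuous_intros)
  have "f q > 0"
  proof (rule ccontr)
    assume "\<not> f q > 0"
    then consider "f q = 0" | "f q < 0" by linarith
    then show False
    proof cases
      case 1
      have "deriv (ss_char \<alpha> \<tau> \<Lambda>) (complex_of_real q) = complex_of_real (\<tau> * (\<alpha> * exp (- \<tau> * (q + 0))) - 1)"
        unfolding deriv_ss_char by (simp add: exp_of_real[symmetric])
      also have "\<dots> = 0" unfolding eq using \<tau> by simp
      finally show False using ss_char_double_root[OF \<alpha> \<tau> e, of "complex_of_real q"] 1 root[of q] q0 neg by simp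
    next
      case 2
      \<comment> \<open>Beyond \<open>1 - \<Lambda>\<close> the linear part alone is
        positive.\<close>
      define b where "b = max q (1 - \<Lambda>) + 1"
      have "f b > 0" using \<alpha> unfolding f_def b_def by (intro add_pos_pos) auto
      moreover have "q \<le> b" by (simp add: b_def)
      ultimately obtain r where r: "q \<le> r" "f r = 0"
        using IVT[of f q 0 b] 2 cont \<open>q \<le> b\<close> by auto
      then have rq: "r > q" using 2 by (cases "r = q") auto
      define s where "s = r - q"
      have s: "s > 0" using rq by (simp add: s_def)
      \<comment> \<open>The reflection of the right root in \<open>q\<close> has a nonnegative
        value, so a left root lies between it and \<open>q\<close>, and the two roots add up to at
        least \<open>2 * q\<close>.\<close>
      have "f (q + - s) \<ge> 0"
      proof -
        have "f (q + - s) - f (q + s) = (exp (\<tau> * s) - exp (- (\<tau> * s))) / \<tau> - 2 * s"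
          unfolding fq by (simp add: diff_divide_distrib)
        moreover have "2 * s \<le> (exp (\<tau> * s) - exp (- (\<tau> * s))) / \<tau>"
          using exp_diff_ge[of "\<tau> * s"] s \<tau> by (simp add: pos_le_divide_eq mult_ac)
        moreover have "f (q + s) = 0" using r by (simp add: s_def)
        ultimately show ?thesis by simp
      qed
      then obtain r' where r': "q + - s \<le> r'" "r' \<le> q" "f r' = 0"
        using IVT2[of f q 0 "q + - s"] 2 cont s by auto
      have "complex_of_real r \<noteq> complex_of_real r'" using r' rq by auto
      then show False
        using ss_char_distinct_roots[OF \<alpha> \<tau> e, of "complex_of_real r" "complex_of_real r'"] root r r' neg q0
        by (simp add: s_def)
    qed
  qed
  also have "f q \<le> f x"
  proof -
    have "f q = q - (1 - \<Lambda>) + 1 / \<tau>" using fq[of 0] by simp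
    moreover have "f x = x - (1 - \<Lambda>) + exp (- \<tau> * (x - q)) / \<tau>" using fq[of "x - q"] by simp
    moreover have "(1 + - \<tau> * (x - q)) / \<tau> \<le> exp (- \<tau> * (x - q)) / \<tau>"
      using \<tau> by (intro divide_right_mono exp_ge_add_one_self) auto
    moreover have "(1 + - \<tau> * (x - q)) / \<tau> = 1 / \<tau> - (x - q)" using \<tau> by (simp add: field_simps)
    ultimately show ?thesis by linarith
  qed
  finally show ?thesis by (simp add: f_def)
qed

text \<open>\<open>\<beta> * sin (\<tau> * w) - w\<close> starts at \<open>0\<close> with slope
  \<open>\<beta> * \<tau> - 1\<close> and is negative at \<open>pi / \<tau>\<close>, so a positive
  slope forces a zero in between. In the borderline case of slope zero the frequency degenerates to
  \<open>w = 0\<close>.\<close>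

lemma sinc_solution:
  assumes \<beta>: "0 < \<beta>" and \<tau>: "0 < \<tau>" and ge: "\<beta> * \<tau> \<ge> (1::real)"
  shows "\<beta> * \<tau> = 1 \<or> (\<exists>w>0. \<tau> * w < pi \<and> \<beta> * sin (\<tau> * w) = w)"
proof (cases "\<beta> * \<tau> = 1")
  case False
  define g where "g w = \<beta> * sin (\<tau> * w) - w" for w
  have "(g has_real_derivative \<beta> * \<tau> - 1) (at 0)"
    unfolding g_def by (auto intro!: derivative_eq_intros)
  moreover have "\<beta> * \<tau> - 1 > 0" using False ge by simp
  ultimately obtain d where d: "d > 0" "\<And>h. 0 < h \<Longrightarrow> h < d \<Longrightarrow> g 0 < g (0 + h)"
    using DERIV_pos_inc_right[of g "\<beta> * \<tau> - 1" 0] by auto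
  define w1 where "w1 = min (d / 2) (pi / (2 * \<tau>))"
  have w1: "0 < w1" "w1 < d" "w1 < pi / \<tau>" using d(1) \<tau> pi_gt_zero by (auto simp: w1_def min_less_iff_disj field_simps)
  have "g w1 > 0" using d(2)[of w1] w1 by (simp add: g_def)
  moreover have "g (pi / \<tau>) < 0" using \<tau> by (simp add: g_def)
  moreover have "isCont g x" for x unfolding g_def by (intro continuous_intros)
  ultimately obtain w where w: "w1 \<le> w" "w \<le> pi / \<tau>" "g w = 0"
    using IVT2[of g "pi / \<tau>" 0 w1] w1 by auto
  then have "w < pi / \<tau>" using \<open>g (pi / \<tau>) < 0\<close> by (cases "w = pi / \<tau>") auto
  then show ?thesis using w w1 \<tau> by (intro disjI2 exI[of _ w]) (auto simp: g_def field_simps)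
qed simp

lemma ss_char_complex_root:
  assumes "\<alpha> * exp (- \<tau> * s) * sin (\<tau> * w) = w" "s - (1 - \<Lambda>) + \<alpha> * exp (- \<tau> * s) * cos (\<tau> * w) = 0"
  shows "ss_char \<alpha> \<tau> \<Lambda> (Complex s w) = 0" "ss_char \<alpha> \<tau> \<Lambda> (Complex s (- w)) = 0"
  using assms by (simp_all add: ss_char_def complex_eq_iff Re_exp Im_exp algebra_simps)

section \<open>Exclusion of large delay by the spectral and frequency conditions\<close>

context ss_compound
begin

lemma frequency_condition_imp_small_delay:
  fixes ls :: "nat \<Rightarrow> complex"
  assumes \<alpha>: "0 < \<alpha>" "\<alpha> < 1" and \<Lambda>: "0 < \<Lambda>"
    and e: "root_enumeration chr ls" and \<nu>: "0 \<le> \<nu>" and sum: "Re (ls 0) + Re (ls 1) < - \<nu>"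
    and freq: "(SUP \<omega>::real. control_opnorm \<tau> (transfer_op \<tau> (-1) 0 G2 (Complex (- \<nu>) \<omega>))) < ereal (inverse \<Lambda>)"
  shows "\<alpha> * \<tau> < 1"
proof (rule ccontr)
  assume "\<not> \<alpha> * \<tau> < 1"
  then have ge: "\<alpha> * \<tau> \<ge> 1" by simp
  have neg: "Re (ls 0) + Re (ls 1) < 0" using sum \<nu> by simp
  note pos = ss_char_real_positive[OF \<alpha>(1) \<tau> e neg ge]
  have no_real: "chr (complex_of_real x) \<noteq> 0" for x
    using pos[of x] unfolding ss_char_of_real by (simp only: neg_equal_0_iff_equal of_real_eq_0_iff)
  \<comment> \<open>Half of \<open>- \<nu>\<close>, since the compound operator adds the exponents
    of the two test functions.\<close>
  define \<sigma> where "\<sigma> = - \<nu> / 2"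
  define \<beta> where "\<beta> = \<alpha> * exp (- \<tau> * \<sigma>)"
  have \<sigma>: "\<sigma> \<le> 0" "2 * \<sigma> = - \<nu>" using \<nu> by (auto simp: \<sigma>_def)
  \<comment> \<open>Two distinct roots with sum \<open>- \<nu>\<close> contradict the spectral
    condition, and they can coincide only at the real point \<open>\<sigma>\<close>, where there is
    no root.\<close>
  have nz: "chr z \<noteq> 0 \<or> chr (complex_of_real (2 * \<sigma>) - z) \<noteq> 0" for z
  proof (rule ccontr)
    assume "\<not> ?thesis"
    then have r: "chr z = 0" "chr (complex_of_real (2 * \<sigma>) - z) = 0" by auto
    show False
    proof (cases "z = complex_of_real (2 * \<sigma>) - z")
      case True
      then have "z = complex_of_real \<sigma>" by (simp add: complex_eq_iff)
      then show ?thesis using r no_real by simp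
    next
      case False
      then show ?thesis using ss_char_distinct_roots[OF \<alpha>(1) \<tau> e r] sum \<sigma> by simp
    qed
  qed
  have \<beta>: "\<beta> \<ge> \<alpha>" "\<beta> > 0"
  proof -
    have "exp (- \<tau> * \<sigma>) \<ge> 1" using \<sigma> \<tau> by (simp add: mult_nonneg_nonpos)
    then show "\<beta> \<ge> \<alpha>" using \<alpha> by (simp add: \<beta>_def)
    then show "\<beta> > 0" using \<alpha> by simp
  qed
  have \<beta>\<tau>: "\<beta> * \<tau> \<ge> 1" using order_trans[OF ge mult_right_mono[OF \<beta>(1), of \<tau>]] \<tau> by simp
  have i\<tau>: "1 / \<tau> < 1" using ge \<alpha> \<tau> by (smt (verit) divide_less_eq_1 mult_le_cancel_right1 mult_less_cancel_right1)
  \<comment> \<open>The frequency condition read backwards: a test pair that meets the boundary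
    conditions with some \<open>c > 0\<close> must have \<open>c > \<Lambda>\<close>.\<close>
  have bound: "c > \<Lambda>" if "c \<noteq> 0" "(f\<^sub>1 :: real \<Rightarrow> real) 0 = 1" "f\<^sub>2 0 = 0" "c > 0"
    "\<And>t. (f\<^sub>1 has_real_derivative \<sigma> * f\<^sub>1 t + \<kappa> * f\<^sub>2 t) (at t)"
    "\<And>t. (f\<^sub>2 has_real_derivative f\<^sub>1 t + \<sigma> * f\<^sub>2 t) (at t)"
    "\<alpha> * f\<^sub>2 (-\<tau>) = - 1" "1 - \<Lambda> - \<alpha> * f\<^sub>1 (-\<tau>) = \<sigma> - c" for f\<^sub>1 f\<^sub>2 \<kappa> c
  proof -
    have "ereal (inverse \<bar>c\<bar>) \<le> control_opnorm \<tau> (transfer_op \<tau> (-1) 0 G2 (Complex (2 * \<sigma>) 0))"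
      by (rule transfer_opnorm_ge[where f\<^sub>1=f\<^sub>1 and f\<^sub>2=f\<^sub>2 and \<kappa>=\<kappa>]) (fact \<alpha> \<sigma> nz that)+
    also have "\<dots> \<le> (SUP \<omega>::real. control_opnorm \<tau> (transfer_op \<tau> (-1) 0 G2 (Complex (- \<nu>) \<omega>)))"
      unfolding \<sigma>(2) by (rule SUP_upper) simp
    also have "\<dots> < ereal (inverse \<Lambda>)" by (rule freq)
    finally have "inverse c < inverse \<Lambda>" using that by simp
    then show ?thesis using \<Lambda> that by (simp add: inverse_less_iff_less)
  qed
  from sinc_solution[OF \<beta>(2) \<tau> \<beta>\<tau>] show False
  proof
    assume b1: "\<beta> * \<tau> = 1"
    then have b: "\<beta> = 1 / \<tau>" using \<tau> by (simp add: field_simps)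
    \<comment> \<open>In the degenerate case \<open>c\<close> is \<open>- chr\<close> at the real
      point \<open>\<sigma>\<close>, hence positive, while \<open>\<beta> = 1 / \<tau> < 1\<close>
      keeps it below \<open>\<Lambda>\<close>.\<close>
    define c where "c = \<sigma> - (1 - \<Lambda>) + \<beta>"
    have c0: "c > 0" using pos[of \<sigma>] by (simp add: c_def \<beta>_def)
    have "c > \<Lambda>"
    proof (rule bound[where f\<^sub>1="\<lambda>t. exp (\<sigma> * t)" and f\<^sub>2="\<lambda>t. t * exp (\<sigma> * t)" and \<kappa>=0])
      show "((\<lambda>t. exp (\<sigma> * t)) has_real_derivative \<sigma> * exp (\<sigma> * t) + 0 * (t * exp (\<sigma> * t))) (at t)" for t
        by (auto intro!: derivative_eq_intros)
      show "((\<lambda>t. t * exp (\<sigma> * t)) has_real_derivative exp (\<sigma> * t) + \<sigma> * (t * exp (\<sigma> * t))) (at t)" for t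
        by (auto intro!: derivative_eq_intros)
      show "\<alpha> * (- \<tau> * exp (\<sigma> * - \<tau>)) = - 1" using b1 by (simp add: \<beta>_def mult_ac)
      show "1 - \<Lambda> - \<alpha> * exp (\<sigma> * - \<tau>) = \<sigma> - c" by (simp add: c_def \<beta>_def mult_ac)
    qed (use c0 in auto)
    then show False using \<sigma> i\<tau> b by (simp add: c_def)
  next
    assume "\<exists>w>0. \<tau> * w < pi \<and> \<beta> * sin (\<tau> * w) = w"
    then obtain w where w: "w > 0" "\<tau> * w < pi" "\<beta> * sin (\<tau> * w) = w" by blast
    have sinw: "sin (\<tau> * v) > 0" if "0 < v" "v \<le> w" for v
    proof -
      have "\<tau> * v \<le> \<tau> * w" using that \<tau> by (intro mult_left_mono) auto
      then have "\<tau> * v < pi" using w(2) by linarith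
      then show ?thesis using that \<tau> by (intro sin_gt_zero) auto
    qed
    define c where "c = \<sigma> - (1 - \<Lambda>) + \<beta> * cos (\<tau> * w)"
    show False
    proof (cases "c > 0")
      case True
      have "c > \<Lambda>"
      proof (rule bound[where f\<^sub>1="\<lambda>t. exp (\<sigma> * t) * cos (w * t)" and f\<^sub>2="\<lambda>t. exp (\<sigma> * t) * (sin (w * t) / w)" and \<kappa>="- w\<^sup>2"])
        show "((\<lambda>t. exp (\<sigma> * t) * cos (w * t)) has_real_derivative
          \<sigma> * (exp (\<sigma> * t) * cos (w * t)) + (- w\<^sup>2) * (exp (\<sigma> * t) * (sin (w * t) / w))) (at t)" for t
          using w(1) by (auto intro!: derivative_eq_intros simp: power2_eq_square)
        show "((\<lambda>t. exp (\<sigma> * t) * (sin (w * t) / w)) has_real_derivative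
          exp (\<sigma> * t) * cos (w * t) + \<sigma> * (exp (\<sigma> * t) * (sin (w * t) / w))) (at t)" for t
          using w(1) by (auto intro!: derivative_eq_intros simp: field_simps)
        show "\<alpha> * (exp (\<sigma> * - \<tau>) * (sin (w * - \<tau>) / w)) = - 1"
          using w by (simp add: \<beta>_def mult_ac)
        show "1 - \<Lambda> - \<alpha> * (exp (\<sigma> * - \<tau>) * cos (w * - \<tau>)) = \<sigma> - c"
          by (simp add: c_def \<beta>_def mult_ac)
      qed (use True in auto)
      \<comment> \<open>Together with \<open>1 / \<tau> < 1\<close> and
        \<open>\<sigma> \<le> 0\<close> this gives \<open>c < \<Lambda>\<close>, contradicting the
        bound just obtained.\<close>
      moreover have "\<beta> * cos (\<tau> * w) \<le> 1 / \<tau>"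
      proof -
        have "\<tau> * w * cos (\<tau> * w) \<le> sin (\<tau> * w)" using w \<tau> by (intro x_cos_le_sin) auto
        then have "\<beta> * (\<tau> * w * cos (\<tau> * w)) \<le> \<beta> * sin (\<tau> * w)" using \<beta> by (intro mult_left_mono) auto
        then have "w * (\<tau> * (\<beta> * cos (\<tau> * w))) \<le> w * 1" using w(3) by (simp add: mult_ac)
        then have "\<tau> * (\<beta> * cos (\<tau> * w)) \<le> 1" using w(1) by (rule mult_left_le_imp_le)
        then show ?thesis using \<tau> by (simp add: pos_le_divide_eq mult_ac)
      qed
      ultimately show False using \<sigma> i\<tau> by (simp add: c_def)
    next
      case False
      \<comment> \<open>Solves \<open>\<alpha> * exp (- \<tau> * s) * sin (\<tau> * v) = v\<close>
        for \<open>s\<close>, that is, the vanishing of the imaginary part of \<open>chr\<close> at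
        \<open>Complex s v\<close>. Minus the real part of \<open>chr\<close> on this curve is
        \<open>C v\<close>.\<close>
      define s where "s v = ln (\<alpha> * (sin (\<tau> * v) / v)) / \<tau>" for v
      define C where "C v = s v - (1 - \<Lambda>) + v * cos (\<tau> * v) / sin (\<tau> * v)" for v
      have es: "\<alpha> * exp (- \<tau> * s v) = v / sin (\<tau> * v)" if "0 < v" "v \<le> w" for v
      proof -
        have "\<alpha> * (sin (\<tau> * v) / v) > 0" using sinw[OF that] that \<alpha> by simp
        then have "exp (\<tau> * s v) = \<alpha> * (sin (\<tau> * v) / v)" using \<tau> by (simp add: s_def)
        then show ?thesis using sinw[OF that] that \<alpha> by (simp add: exp_minus)
      qed
      \<comment> \<open>The curve passes through \<open>Complex \<sigma> w\<close>, the point at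
        which \<open>c\<close> was computed, so \<open>C w\<close> equals \<open>c\<close> and is
        not positive.\<close>
      have sw: "s w = \<sigma>"
      proof -
        have "\<beta> = w / sin (\<tau> * w)" using w sinw[of w] by (simp add: field_simps)
        then have "\<alpha> * exp (- \<tau> * s w) = \<alpha> * exp (- \<tau> * \<sigma>)" using es[of w] w(1) unfolding \<beta>_def by simp
        then have "exp (- \<tau> * s w) = exp (- \<tau> * \<sigma>)" using \<alpha> by simp
        then show ?thesis using \<tau> by simp
      qed
      have Cw: "C w \<le> 0"
      proof -
        have "\<beta> = w / sin (\<tau> * w)" using w sinw[of w] by (simp add: field_simps)
        then show ?thesis using False by (simp add: C_def sw c_def)
      qed
      have lim: "((\<lambda>v. sin (\<tau> * v) / v) \<longlongrightarrow> \<tau>) (at_right 0)"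
      proof -
        have "((\<lambda>v. sin (\<tau> * v)) has_real_derivative \<tau>) (at 0)" by (auto intro!: derivative_eq_intros)
        then have "((\<lambda>v. sin (\<tau> * v) / v) \<longlongrightarrow> \<tau>) (at 0)" by (simp add: DERIV_def)
        then show ?thesis by (rule filterlim_mono[OF _ order_refl at_le]) simp
      qed
      \<comment> \<open>As \<open>v\<close> tends to \<open>0\<close> the curve runs into the real
        axis at \<open>ln (\<alpha> * \<tau>) / \<tau>\<close>, and \<open>C\<close> tends to the
        value of \<open>- chr\<close> there, which is positive by \<open>pos\<close>. The quotient
        \<open>v / sin (\<tau> * v)\<close> is written as a reciprocal to make the limit
        visible.\<close>
      have "((\<lambda>v. ln (\<alpha> * (sin (\<tau> * v) / v)) / \<tau> - (1 - \<Lambda>) + cos (\<tau> * v) / (sin (\<tau> * v) / v))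
          \<longlongrightarrow> ln (\<alpha> * \<tau>) / \<tau> - (1 - \<Lambda>) + cos (\<tau> * 0) / \<tau>) (at_right 0)"
        using \<alpha> \<tau> by (intro tendsto_intros lim) auto
      moreover have "0 < ln (\<alpha> * \<tau>) / \<tau> - (1 - \<Lambda>) + cos (\<tau> * 0) / \<tau>"
      proof -
        have "- \<tau> * (ln (\<alpha> * \<tau>) / \<tau>) = - ln (\<alpha> * \<tau>)" using \<tau> by simp
        then have "exp (- \<tau> * (ln (\<alpha> * \<tau>) / \<tau>)) = 1 / (\<alpha> * \<tau>)"
          using \<alpha> \<tau> by (simp only: exp_minus) (simp add: divide_inverse)
        then show ?thesis using pos[of "ln (\<alpha> * \<tau>) / \<tau>"] \<alpha> by simp
      qed
      ultimately have "eventually (\<lambda>v. 0 < ln (\<alpha> * (sin (\<tau> * v) / v)) / \<tau> - (1 - \<Lambda>) + cos (\<tau> * v) / (sin (\<tau> * v) / v)) (at_right 0)"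
        by (rule order_tendstoD)
      then obtain b where b: "b > 0" "\<And>v. 0 < v \<Longrightarrow> v < b \<Longrightarrow>
          0 < ln (\<alpha> * (sin (\<tau> * v) / v)) / \<tau> - (1 - \<Lambda>) + cos (\<tau> * v) / (sin (\<tau> * v) / v)"
        by (auto simp: eventually_at_right_field)
      define v1 where "v1 = min w (b / 2)"
      have v1: "0 < v1" "v1 \<le> w" "v1 < b" using w b(1) by (auto simp: v1_def)
      have "C v1 > 0" using b(2)[OF v1(1,3)] by (simp add: C_def s_def mult.commute)
      moreover have "\<forall>x. v1 \<le> x \<and> x \<le> w \<longrightarrow> isCont C x"
      proof (intro allI impI)
        fix x assume x: "v1 \<le> x \<and> x \<le> w"
        then have "x > 0" "sin (\<tau> * x) > 0" using v1 sinw[of x] by auto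
        then show "isCont C x" unfolding C_def s_def using \<alpha> \<tau>
          by (intro continuous_intros) (auto simp: less_imp_neq[symmetric])
      qed
      ultimately obtain v where v: "v1 \<le> v" "v \<le> w" "C v = 0"
        using IVT2[of C w 0 v1] Cw v1 by auto
      have v0: "v > 0" using v v1 by simp
      have r: "chr (Complex (s v) v) = 0" "chr (Complex (s v) (- v)) = 0"
        by (rule ss_char_complex_root; use es[OF v0 v(2)] sinw[OF v0 v(2)] v(3) in \<open>simp add: C_def\<close>)+
      have "2 * s v \<le> Re (ls 0) + Re (ls 1)"
        using ss_char_distinct_roots[OF \<alpha>(1) \<tau> e r] v0 by simp
      \<comment> \<open>Since \<open>v \<le> w\<close>, the conjugate pair found at frequency
        \<open>v\<close> has real part at least \<open>\<sigma>\<close>, hence sum of real parts at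
        least \<open>- \<nu>\<close>.\<close>
      moreover have "s w \<le> s v"
      proof -
        have "sin (\<tau> * w) / w \<le> sin (\<tau> * v) / v" using v0 v w \<tau> by (intro sinc_antimono) auto
        then have "\<alpha> * (sin (\<tau> * w) / w) \<le> \<alpha> * (sin (\<tau> * v) / v)" using \<alpha> by (intro mult_left_mono) auto
        moreover have "\<alpha> * (sin (\<tau> * w) / w) > 0" using sinw[of w] w \<alpha> by simp
        ultimately show ?thesis unfolding s_def using \<tau> by (intro divide_right_mono ln_mono) auto
      qed
      ultimately show False using sum \<sigma>(2) by (simp add: sw)
    qed
  qed
qed

end

section \<open>Solutions of the Suarez--Schopf equation\<close>

lemma integral_from_0_has_derivative:
  fixes g :: "real \<Rightarrow> real"
  assumes "continuous_on {0..} g" "0 \<le> t"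
  shows "((\<lambda>u. integral {0..u} g) has_real_derivative g t) (at t within {0..})"
proof -
  have "((\<lambda>u. integral {0..u} g) has_real_derivative g t) (at t within {0..t + 1})"
    using assms by (intro integral_has_real_derivative continuous_on_subset[OF assms(1)]) auto
  moreover have "at t within {0..t + 1} = at t within {0..}"
    by (rule at_within_nhd[of t "{..<t + 1}"]) auto
  ultimately show ?thesis by simp
qed

text \<open>Picard iteration on the whole half-line at once. The initial function is extended by
  freezing its end values, so that the unknown can range over the bounded continuous functions on
  the real line.\<close>

lemma delay_ode_exists:
  fixes F \<phi> :: "real \<Rightarrow> real" and \<alpha> \<tau> L :: real
  assumes \<tau>: "0 < \<tau>" and \<alpha>: "0 \<le> \<alpha>" and \<phi>: "continuous_on {-\<tau>..0} \<phi>"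
    and L: "0 \<le> L" "\<And>u v. \<bar>F u - F v\<bar> \<le> L * \<bar>u - v\<bar>"
  shows "\<exists>x. continuous_on UNIV x \<and> (\<forall>\<theta>\<in>{-\<tau>..0}. x \<theta> = \<phi> \<theta>) \<and>
    (\<forall>t\<ge>0. (x has_real_derivative F (x t) - \<alpha> * x (t - \<tau>)) (at t within {0..}))"
proof -
  \<comment> \<open>Large enough that \<open>2 * (L + \<alpha>) / \<gamma> \<le> 1 / 2\<close>,
    which is the contraction factor.\<close>
  define \<gamma> where "\<gamma> = 4 * (L + \<alpha> + 1)"
  have \<gamma>: "\<gamma> > 0" using L \<alpha> by (simp add: \<gamma>_def)
  define h where "h s = \<phi> (max (min s 0) (-\<tau>))" for s
  have hc: "continuous_on UNIV h"
    unfolding h_def by (intro continuous_on_compose2[OF \<phi>] continuous_intros) (use \<tau> in auto)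
  have "bounded (\<phi> ` {-\<tau>..0})" by (intro compact_imp_bounded compact_continuous_image \<phi>) simp
  then obtain H where H: "\<And>s. s \<in> {-\<tau>..0} \<Longrightarrow> \<bar>\<phi> s\<bar> \<le> H" unfolding bounded_iff by force
  have hH: "\<bar>h s\<bar> \<le> H" for s unfolding h_def using \<tau> by (intro H) auto
  have Fc: "continuous_on X F" for X
  proof (rule continuous_on_iff[THEN iffD2], intro ballI allI impI)
    fix u e :: real assume "e > 0"
    show "\<exists>d>0. \<forall>v\<in>X. dist v u < d \<longrightarrow> dist (F v) (F u) < e"
    proof (intro exI[of _ "e / (L + 1)"] conjI ballI impI)
      show "e / (L + 1) > 0" using \<open>e > 0\<close> L by simp
      fix v assume "dist v u < e / (L + 1)"
      then have "(L + 1) * \<bar>v - u\<bar> < e" using L by (simp add: dist_real_def pos_less_divide_eq mult.commute)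
      moreover have "\<bar>F v - F u\<bar> \<le> (L + 1) * \<bar>v - u\<bar>" using L(2)[of v u] by (simp add: algebra_simps)
      ultimately show "dist (F v) (F u) < e" by (simp add: dist_real_def)
    qed
  qed
  \<comment> \<open>The solution is sought as \<open>exp (\<gamma> * t) * y t\<close> up to initial values: with this weight the Picard
    map is a contraction for the supremum norm of \<open>y\<close>.\<close>
  define E where "E y s = h s + (exp (\<gamma> * max s 0) * y (max s 0) - y 0)" for y :: "real \<Rightarrow> real" and s
  define g where "g y s = F (E y s) - \<alpha> * E y (s - \<tau>)" for y :: "real \<Rightarrow> real" and s
  define Pf where "Pf y t = exp (- \<gamma> * max t 0) * integral {0..max t 0} (g y)" for y :: "real \<Rightarrow> real" and t
  have Ec: "continuous_on UNIV (E y)" if "continuous_on UNIV y" for y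
    unfolding E_def by (intro continuous_intros hc continuous_on_compose2[OF that]) auto
  have gc: "continuous_on X (g y)" if "continuous_on UNIV y" for y X
    unfolding g_def
    by (rule continuous_on_subset[of UNIV])
       (intro continuous_intros continuous_on_compose2[OF Fc Ec[OF that]] continuous_on_compose2[OF Ec[OF that]], auto)
  have int_bound: "\<bar>integral {0..t} f\<bar> \<le> K * exp (\<gamma> * t) / \<gamma>"
    if f: "continuous_on {0..t} f" and le: "\<And>s. 0 \<le> s \<Longrightarrow> s \<le> t \<Longrightarrow> \<bar>f s\<bar> \<le> K * exp (\<gamma> * s)" and "t \<ge> 0" "K \<ge> 0" for f t K
  proof -
    have I: "((\<lambda>s. K * exp (\<gamma> * s)) has_integral (K * exp (\<gamma> * t) / \<gamma> - K * exp (\<gamma> * 0) / \<gamma>)) {0..t}"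
      using that(3) \<gamma> by (intro fundamental_theorem_of_calculus)
        (auto intro!: derivative_eq_intros simp flip: has_real_derivative_iff_has_vector_derivative)
    have "norm (integral {0..t} f) \<le> integral {0..t} (\<lambda>s. K * exp (\<gamma> * s))"
      using le by (intro integral_norm_bound_integral integrable_continuous_real f continuous_intros) auto
    also have "\<dots> = K * exp (\<gamma> * t) / \<gamma> - K / \<gamma>" using integral_unique[OF I] by simp
    also have "\<dots> \<le> K * exp (\<gamma> * t) / \<gamma>" using that(4) \<gamma> by simp
    finally show ?thesis by simp
  qed
  have Pf_bcont: "Pf y \<in> bcontfun" if y: "y \<in> bcontfun" for y
  proof -
    have yc: "continuous_on UNIV y" using y by (simp add: bcontfun_def)
    have "bounded (range y)" using y by (simp add: bcontfun_def)
    then obtain B where B: "\<And>s. \<bar>y s\<bar> \<le> B" unfolding bounded_iff by auto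
    have B0: "B \<ge> 0" using order_trans[OF abs_ge_zero B[of 0]] .
    have H0: "H \<ge> 0" using order_trans[OF abs_ge_zero hH[of 0]] .
    define K where "K = \<bar>F 0\<bar> + (L + \<alpha>) * (H + 2 * B)"
    have K0: "K \<ge> 0" using L \<alpha> B0 H0 by (simp add: K_def)
    have EB: "\<bar>E y s\<bar> \<le> (H + 2 * B) * exp (\<gamma> * r)" if "max s 0 \<le> r" for s r
    proof -
      have e1: "exp (\<gamma> * r) \<ge> 1" using that \<gamma> by simp
      have "exp (\<gamma> * max s 0) * \<bar>y (max s 0)\<bar> \<le> exp (\<gamma> * r) * B"
        using that \<gamma> B by (intro mult_mono) auto
      moreover have "\<bar>E y s\<bar> \<le> \<bar>h s\<bar> + (exp (\<gamma> * max s 0) * \<bar>y (max s 0)\<bar> + \<bar>y 0\<bar>)"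
        unfolding E_def by (rule order_trans[OF abs_triangle_ineq add_left_mono[OF order_trans[OF abs_triangle_ineq4]]])
          (simp add: abs_mult)
      moreover have "H \<le> H * exp (\<gamma> * r)" "B \<le> B * exp (\<gamma> * r)"
        using mult_left_mono[OF e1 H0] mult_left_mono[OF e1 B0] by auto
      ultimately show ?thesis using hH[of s] B[of 0] by (simp add: algebra_simps)
    qed
    have gB: "\<bar>g y s\<bar> \<le> K * exp (\<gamma> * s)" if "s \<ge> 0" for s
    proof -
      have e1: "exp (\<gamma> * s) \<ge> 1" using that \<gamma> by simp
      have "\<bar>F (E y s)\<bar> \<le> \<bar>F 0\<bar> + L * \<bar>E y s\<bar>" using L(2)[of "E y s" 0] by simp
      moreover have "L * \<bar>E y s\<bar> \<le> L * ((H + 2 * B) * exp (\<gamma> * s))" using that by (intro mult_left_mono EB L) auto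
      moreover have "\<bar>\<alpha> * E y (s - \<tau>)\<bar> \<le> \<alpha> * ((H + 2 * B) * exp (\<gamma> * s))"
        unfolding abs_mult using that \<tau> \<alpha> by (intro mult_mono EB) auto
      moreover have "\<bar>F 0\<bar> \<le> \<bar>F 0\<bar> * exp (\<gamma> * s)" using mult_left_mono[OF e1, of "\<bar>F 0\<bar>"] by simp
      moreover have "\<bar>g y s\<bar> \<le> \<bar>F (E y s)\<bar> + \<bar>\<alpha> * E y (s - \<tau>)\<bar>" unfolding g_def by (rule abs_triangle_ineq4)
      ultimately show ?thesis unfolding K_def by (simp add: algebra_simps)
    qed
    show ?thesis
    proof (rule bcontfun_normI)
      have "continuous_on {0..} (\<lambda>u. integral {0..u} (g y))"
        using integral_from_0_has_derivative[OF gc[OF yc]] by (intro DERIV_continuous_on) auto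
      then have "continuous_on UNIV (\<lambda>t. integral {0..max t 0} (g y))"
        by (rule continuous_on_compose2) (auto intro!: continuous_intros)
      then show "continuous_on UNIV (Pf y)" unfolding Pf_def by (intro continuous_intros)
      show "norm (Pf y t) \<le> K / \<gamma>" for t
      proof -
        have "\<bar>integral {0..max t 0} (g y)\<bar> \<le> K * exp (\<gamma> * max t 0) / \<gamma>"
          using gB K0 by (intro int_bound gc yc) auto
        then have "exp (- \<gamma> * max t 0) * \<bar>integral {0..max t 0} (g y)\<bar> \<le> exp (- \<gamma> * max t 0) * (K * exp (\<gamma> * max t 0) / \<gamma>)"
          by (intro mult_left_mono) auto
        also have "\<dots> = K / \<gamma>" by (simp add: exp_minus)
        finally show ?thesis by (simp add: Pf_def abs_mult)
      qed
    qed
  qed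
  define P where "P y = Bcontfun (Pf (apply_bcontfun y))" for y :: "real \<Rightarrow>\<^sub>C real"
  have P_app: "apply_bcontfun (P y) = Pf (apply_bcontfun y)" for y
    unfolding P_def by (rule Bcontfun_inverse[OF Pf_bcont]) (rule apply_bcontfun)
  have yc: "continuous_on UNIV (apply_bcontfun y)" for y :: "real \<Rightarrow>\<^sub>C real" by simp
  have "dist (P y) (P z) \<le> 1 / 2 * dist y z" for y z
  proof (rule dist_bound)
    fix t
    define D where "D = dist y z"
    have D: "\<bar>apply_bcontfun y s - apply_bcontfun z s\<bar> \<le> D" for s
      using dist_bounded[of y s z] by (simp add: D_def dist_real_def)
    have D0: "D \<ge> 0" by (simp add: D_def)
    have ED: "\<bar>E y s - E z s\<bar> \<le> 2 * D * exp (\<gamma> * r)" if "max s 0 \<le> r" for s r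
    proof -
      have e1: "exp (\<gamma> * r) \<ge> 1" using that \<gamma> by simp
      have "exp (\<gamma> * max s 0) * \<bar>y (max s 0) - z (max s 0)\<bar> \<le> exp (\<gamma> * r) * D"
        using that \<gamma> D by (intro mult_mono) auto
      moreover have "E y s - E z s = exp (\<gamma> * max s 0) * (y (max s 0) - z (max s 0)) - (y 0 - z 0)"
        by (simp add: E_def algebra_simps)
      then have "\<bar>E y s - E z s\<bar> \<le> exp (\<gamma> * max s 0) * \<bar>y (max s 0) - z (max s 0)\<bar> + \<bar>y 0 - z 0\<bar>"
        using abs_triangle_ineq4[of "exp (\<gamma> * max s 0) * (y (max s 0) - z (max s 0))" "y 0 - z 0"] by (simp add: abs_mult)
      moreover have "D \<le> D * exp (\<gamma> * r)" using mult_left_mono[OF e1 D0] by simp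
      ultimately show ?thesis using D[of 0] by (simp add: algebra_simps)
    qed
    define K where "K = (L + \<alpha>) * (2 * D)"
    have K0: "K \<ge> 0" using L \<alpha> D0 by (simp add: K_def)
    have gD: "\<bar>g y s - g z s\<bar> \<le> K * exp (\<gamma> * s)" if "s \<ge> 0" for s
    proof -
      have "\<bar>F (E y s) - F (E z s)\<bar> \<le> L * (2 * D * exp (\<gamma> * s))"
        using that by (intro order_trans[OF L(2)] mult_left_mono ED L) auto
      moreover have "\<bar>\<alpha> * (E y (s - \<tau>) - E z (s - \<tau>))\<bar> \<le> \<alpha> * (2 * D * exp (\<gamma> * s))"
        unfolding abs_mult using that \<tau> \<alpha> by (intro mult_mono ED) auto
      moreover have "g y s - g z s = (F (E y s) - F (E z s)) - \<alpha> * (E y (s - \<tau>) - E z (s - \<tau>))"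
        by (simp add: g_def algebra_simps)
      ultimately show ?thesis
        using abs_triangle_ineq4[of "F (E y s) - F (E z s)" "\<alpha> * (E y (s - \<tau>) - E z (s - \<tau>))"]
        by (simp add: K_def algebra_simps)
    qed
    have "Pf y t - Pf z t = exp (- \<gamma> * max t 0) * integral {0..max t 0} (\<lambda>s. g y s - g z s)"
      unfolding Pf_def by (subst Henstock_Kurzweil_Integration.integral_diff)
        (auto intro!: integrable_continuous_real gc simp: right_diff_distrib)
    then have "\<bar>Pf y t - Pf z t\<bar> = exp (- \<gamma> * max t 0) * \<bar>integral {0..max t 0} (\<lambda>s. g y s - g z s)\<bar>"
      by (simp add: abs_mult)
    also have "\<dots> \<le> exp (- \<gamma> * max t 0) * (K * exp (\<gamma> * max t 0) / \<gamma>)"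
      using gD K0 by (intro mult_left_mono int_bound continuous_intros gc yc) auto
    also have "\<dots> = K / \<gamma>" by (simp add: exp_minus)
    also have "\<dots> \<le> 1 / 2 * D"
    proof -
      have "K \<le> 1 / 2 * D * \<gamma>" using D0 by (simp add: K_def \<gamma>_def algebra_simps)
      then show ?thesis using \<gamma> by (simp add: pos_divide_le_eq)
    qed
    finally show "dist (P y t) (P z t) \<le> 1 / 2 * dist y z" by (simp add: P_app dist_real_def D_def)
  qed
  then obtain y where "P y = y" using banach_fix_type[of "1 / 2" P] by auto
  then have fixp: "y t = Pf y t" for t using P_app[of y] by metis
  have y0: "y 0 = 0" using fixp[of 0] by (simp add: Pf_def)
  define x where "x = E y"
  have xt: "x t = \<phi> 0 + integral {0..t} (g y)" if "t \<ge> 0" for t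
    using that fixp[of t] y0 \<tau> by (simp add: x_def E_def h_def Pf_def exp_minus)
  show ?thesis
  proof (intro exI conjI ballI allI impI)
    show "continuous_on UNIV x" unfolding x_def by (intro Ec yc)
    show "x \<theta> = \<phi> \<theta>" if "\<theta> \<in> {-\<tau>..0}" for \<theta>
      using that y0 \<tau> by (auto simp: x_def E_def h_def max_def min_def intro: arg_cong[where f = \<phi>])
    fix t :: real assume t: "t \<ge> 0"
    have "((\<lambda>t. \<phi> 0 + integral {0..t} (g y)) has_real_derivative 0 + g y t) (at t within {0..})"
      by (intro DERIV_add DERIV_const integral_from_0_has_derivative gc yc t)
    then have "(x has_real_derivative 0 + g y t) (at t within {0..})"
      by (rule has_field_derivative_transform_within[OF _ zero_less_one]) (use t xt in auto)
    then show "(x has_real_derivative F (x t) - \<alpha> * x (t - \<tau>)) (at t within {0..})"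
      by (simp add: g_def x_def)
  qed
qed

text \<open>At the first time at which \<open>|x|\<close> reaches a level \<open>N'\<close> slightly
  above \<open>N\<close>, the delayed value is at most \<open>N'\<close> in size, and
  \<open>N'^3 > (1 + \<alpha>) * N'\<close> makes the derivative point inward. Then
  \<open>|x|\<close> would have been larger just before.\<close>

lemma delay_ode_bounded:
  fixes F x :: "real \<Rightarrow> real"
  assumes \<tau>: "0 < \<tau>" and \<alpha>: "0 \<le> \<alpha>" and c: "continuous_on {-\<tau>..} x"
    and h: "\<And>\<theta>. \<theta> \<in> {-\<tau>..0} \<Longrightarrow> \<bar>x \<theta>\<bar> \<le> N" and N: "N\<^sup>2 \<ge> 1 + \<alpha>" "N > 0"
    and d: "\<And>t. t \<ge> 0 \<Longrightarrow> (x has_real_derivative F (x t) - \<alpha> * x (t - \<tau>)) (at t within {0..})"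
    and F: "\<And>v. \<bar>v\<bar> \<le> N + 1 \<Longrightarrow> F v = v - v ^ 3"
    and t: "t \<ge> -\<tau>"
  shows "\<bar>x t\<bar> \<le> N"
proof (rule ccontr)
  assume "\<not> \<bar>x t\<bar> \<le> N"
  then have big: "\<bar>x t\<bar> > N" by simp
  then have t0: "t > 0" using h[of t] t by force
  \<comment> \<open>Capped at \<open>N + 1\<close>, the range in which \<open>F\<close> is known to
    agree with the cubic.\<close>
  define N' where "N' = min ((N + \<bar>x t\<bar>) / 2) (N + 1)"
  have N': "N < N'" "N' \<le> \<bar>x t\<bar>" "N' \<le> N + 1" using big by (auto simp: N'_def min_def)
  define S where "S = {s \<in> {0..t}. N' \<le> \<bar>x s\<bar>}"
  have cS: "continuous_on {0..t} (\<lambda>s. \<bar>x s\<bar>)"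
    using \<tau> by (intro continuous_intros continuous_on_subset[OF c]) auto
  have "closed S" unfolding S_def using continuous_closed_preimage[OF cS, of "{N'..}"]
    by (simp add: vimage_def Int_def conj_commute)
  moreover have "bounded S" by (rule bounded_subset[of "{0..t}"]) (auto simp: S_def)
  ultimately have "compact S" by (simp add: compact_eq_bounded_closed)
  moreover have "t \<in> S" using N' t0 by (simp add: S_def)
  ultimately obtain s where s: "s \<in> S" "\<And>r. r \<in> S \<Longrightarrow> s \<le> r" using compact_attains_inf[of S] by blast
  have s0: "s > 0"
  proof (rule ccontr)
    assume "\<not> s > 0"
    then have "s = 0" using s(1) by (simp add: S_def)
    then show False using s(1) h[of 0] N' \<tau> by (simp add: S_def)
  qed
  have st: "s \<le> t" "\<bar>x s\<bar> \<ge> N'" using s(1) by (auto simp: S_def)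
  have before: "\<bar>x r\<bar> < N'" if "-\<tau> \<le> r" "r < s" for r
  proof (cases "r \<ge> 0")
    case True
    then show ?thesis using s(2)[of r] that st by (force simp: S_def)
  next
    case False
    then show ?thesis using h[of r] that N' by force
  qed
  have xs: "\<bar>x s\<bar> = N'"
  proof (rule ccontr)
    assume "\<bar>x s\<bar> \<noteq> N'"
    then have gt: "\<bar>x s\<bar> > N'" using st by simp
    have "continuous_on {0..s} (\<lambda>s. \<bar>x s\<bar>)" using continuous_on_subset[OF cS, of "{0..s}"] st by simp
    then obtain r where r: "0 \<le> r" "r \<le> s" "\<bar>x r\<bar> = N'"
      using IVT'[of "\<lambda>s. \<bar>x s\<bar>" 0 N' s] h[of 0] N' gt s0 \<tau> by fastforce
    then have "r = s" using s(2)[of r] st by (auto simp: S_def)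
    then show False using r gt by simp
  qed
  have N'sq: "N'\<^sup>2 > 1 + \<alpha>"
  proof -
    have "N\<^sup>2 < N'\<^sup>2" using N N' by (intro power_strict_mono) auto
    then show ?thesis using N by simp
  qed
  have del: "\<bar>x (s - \<tau>)\<bar> \<le> N'" using before[of "s - \<tau>"] s0 \<tau> by simp
  have N'pos: "N' > 0" using N' N by simp
  have cube: "N' - N' ^ 3 + \<alpha> * N' < 0"
  proof -
    have "N' - N' ^ 3 + \<alpha> * N' = N' * (1 + \<alpha> - N'\<^sup>2)" by (simp add: algebra_simps power2_eq_square power3_eq_cube)
    also have "\<dots> < 0" using N'sq N'pos by (intro mult_pos_neg) auto
    finally show ?thesis .
  qed
  have Fs: "F (x s) = x s - x s ^ 3" using xs N' by (intro F) simp
  have al: "\<bar>\<alpha> * x (s - \<tau>)\<bar> \<le> \<alpha> * N'" unfolding abs_mult using del \<alpha> by (simp add: mult_left_mono)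
  note ds = d[of s, OF less_imp_le[OF s0], unfolded Fs]
  show False
  proof (cases "x s \<ge> 0")
    case True
    then have x: "x s = N'" using xs by simp
    have "x s - x s ^ 3 - \<alpha> * x (s - \<tau>) < 0" unfolding x using cube al by linarith
    from has_real_derivative_neg_dec_left[OF ds this]
    obtain e where e: "e > 0" "\<And>h. 0 < h \<Longrightarrow> s - h \<in> {0..} \<Longrightarrow> h < e \<Longrightarrow> x s < x (s - h)" by auto
    define k where "k = min s (e / 2)"
    have "x s < x (s - k)" using e(1) s0 by (intro e(2)) (auto simp: k_def)
    moreover have "\<bar>x (s - k)\<bar> < N'" using e(1) s0 \<tau> by (intro before) (auto simp: k_def)
    ultimately show False using x by simp
  next
    case False
    then have x: "x s = - N'" using xs by simp
    have "x s - x s ^ 3 - \<alpha> * x (s - \<tau>) > 0" unfolding x using cube al by simp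
    from has_real_derivative_pos_inc_left[OF ds this]
    obtain e where e: "e > 0" "\<And>h. 0 < h \<Longrightarrow> s - h \<in> {0..} \<Longrightarrow> h < e \<Longrightarrow> x (s - h) < x s" by auto
    define k where "k = min s (e / 2)"
    have "x (s - k) < x s" using e(1) s0 by (intro e(2)) (auto simp: k_def)
    moreover have "\<bar>x (s - k)\<bar> < N'" using e(1) s0 \<tau> by (intro before) (auto simp: k_def)
    ultimately show False using x by simp
  qed
qed

lemma ss_bound_exists:
  fixes \<phi> :: "real \<Rightarrow> real"
  assumes "continuous_on {-\<tau>..0} \<phi>" "0 \<le> \<alpha>"
  shows "\<exists>N>0. N\<^sup>2 \<ge> 1 + \<alpha> \<and> (\<forall>\<theta>\<in>{-\<tau>..0}. \<bar>\<phi> \<theta>\<bar> \<le> N)"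
proof -
  have "bounded (\<phi> ` {-\<tau>..0})" by (intro compact_imp_bounded compact_continuous_image assms) simp
  then obtain H where H: "\<And>s. s \<in> {-\<tau>..0} \<Longrightarrow> \<bar>\<phi> s\<bar> \<le> H" unfolding bounded_iff by force
  define N where "N = max H (1 + \<alpha>)"
  have "N \<ge> 1 + \<alpha>" by (simp add: N_def)
  moreover have "(1 + \<alpha>) * 1 \<le> N * N" using assms \<open>N \<ge> 1 + \<alpha>\<close> by (intro mult_mono) auto
  ultimately show ?thesis using assms H by (intro exI[of _ N]) (force simp: N_def power2_eq_square le_max_iff_disj)
qed

lemma cubic_difference_le:
  fixes a b :: real
  assumes "\<bar>a\<bar> \<le> N" "\<bar>b\<bar> \<le> N"
  shows "\<bar>a ^ 3 - b ^ 3\<bar> \<le> 3 * N\<^sup>2 * \<bar>a - b\<bar>"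
proof -
  have N0: "N \<ge> 0" using assms by linarith
  have "\<bar>a * b\<bar> \<le> N * N" unfolding abs_mult using assms N0 by (intro mult_mono) auto
  moreover have "a\<^sup>2 \<le> N\<^sup>2" "b\<^sup>2 \<le> N\<^sup>2"
    using power_mono[OF assms(1) abs_ge_zero, of 2] power_mono[OF assms(2) abs_ge_zero, of 2] by simp_all
  ultimately have "\<bar>a\<^sup>2 + a * b + b\<^sup>2\<bar> \<le> 3 * N\<^sup>2"
    using abs_triangle_ineq[of "a\<^sup>2 + a * b" "b\<^sup>2"] abs_triangle_ineq[of "a\<^sup>2" "a * b"]
    by (simp add: power2_eq_square)
  then have "\<bar>a\<^sup>2 + a * b + b\<^sup>2\<bar> * \<bar>a - b\<bar> \<le> 3 * N\<^sup>2 * \<bar>a - b\<bar>" by (rule mult_right_mono) simp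
  moreover have "a ^ 3 - b ^ 3 = (a\<^sup>2 + a * b + b\<^sup>2) * (a - b)"
    by (simp add: algebra_simps power2_eq_square power3_eq_cube)
  ultimately show ?thesis by (simp only: abs_mult)
qed

lemma ss_solution_exists:
  assumes \<tau>: "0 < \<tau>" and \<alpha>: "0 \<le> \<alpha>" and \<phi>: "continuous_on {-\<tau>..0} \<phi>"
  shows "\<exists>x. ss_solution \<alpha> \<tau> \<phi> x"
proof -
  obtain N where N: "N > 0" "N\<^sup>2 \<ge> 1 + \<alpha>" "\<And>\<theta>. \<theta> \<in> {-\<tau>..0} \<Longrightarrow> \<bar>\<phi> \<theta>\<bar> \<le> N"
    using ss_bound_exists[OF \<phi> \<alpha>] by blast
  \<comment> \<open>Truncating the cubic makes it globally Lipschitz; the a priori bound \<open>N\<close> removes the truncation.\<close>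
  define C where "C v = max (- (N + 1)) (min (N + 1) v)" for v :: real
  define F where "F v = v - C v ^ 3" for v
  have Cb: "\<bar>C v\<bar> \<le> N + 1" for v using N(1) by (auto simp: C_def)
  have Cl: "\<bar>C u - C v\<bar> \<le> \<bar>u - v\<bar>" for u v by (auto simp: C_def max_def min_def)
  define L where "L = 1 + 3 * (N + 1)\<^sup>2"
  have FL: "\<bar>F u - F v\<bar> \<le> L * \<bar>u - v\<bar>" for u v
  proof -
    have "\<bar>C u ^ 3 - C v ^ 3\<bar> \<le> 3 * (N + 1)\<^sup>2 * \<bar>C u - C v\<bar>" by (intro cubic_difference_le Cb)
    also have "\<dots> \<le> 3 * (N + 1)\<^sup>2 * \<bar>u - v\<bar>" using Cl[of u v] by (intro mult_left_mono) auto
    finally have "\<bar>C u ^ 3 - C v ^ 3\<bar> \<le> 3 * (N + 1)\<^sup>2 * \<bar>u - v\<bar>" .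
    then show ?thesis unfolding F_def L_def
      using abs_triangle_ineq4[of "u - v" "C u ^ 3 - C v ^ 3"] by (simp add: algebra_simps)
  qed
  have L0: "L \<ge> 0" by (simp add: L_def)
  obtain x where x: "continuous_on UNIV x" "\<And>\<theta>. \<theta> \<in> {-\<tau>..0} \<Longrightarrow> x \<theta> = \<phi> \<theta>"
    "\<And>t. t \<ge> 0 \<Longrightarrow> (x has_real_derivative F (x t) - \<alpha> * x (t - \<tau>)) (at t within {0..})"
    using delay_ode_exists[OF \<tau> \<alpha> \<phi> L0 FL] by blast
  have FN: "F v = v - v ^ 3" if "\<bar>v\<bar> \<le> N + 1" for v using that by (auto simp: F_def C_def max_def min_def)
  have xc: "continuous_on {-\<tau>..} x" using x(1) continuous_on_subset by blast
  have b: "\<bar>x t\<bar> \<le> N" if "t \<ge> -\<tau>" for t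
    by (rule delay_ode_bounded[OF \<tau> \<alpha> xc _ N(2,1) x(3) FN that]) (use x(2) N(3) in auto)
  show ?thesis unfolding ss_solution_def
  proof (intro exI conjI ballI allI impI)
    show "continuous_on {-\<tau>..} x" by fact
    show "x \<theta> = \<phi> \<theta>" if "\<theta> \<in> {-\<tau>..0}" for \<theta> using x(2) that by blast
    fix t :: real assume t: "t \<ge> 0"
    have "F (x t) - \<alpha> * x (t - \<tau>) = x t - \<alpha> * x (t - \<tau>) - x t ^ 3"
      using FN[of "x t"] b[of t] t \<tau> by simp
    then show "(x has_real_derivative x t - \<alpha> * x (t - \<tau>) - x t ^ 3) (at t within {0..})"
      using DERIV_cong[OF x(3)[OF t]] by blast
  qed
qed

lemma ss_solution_bounded:
  assumes "0 < \<tau>" "0 \<le> \<alpha>" "ss_solution \<alpha> \<tau> \<phi> x"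
  shows "\<exists>N>0. \<forall>t\<ge>-\<tau>. \<bar>x t\<bar> \<le> N"
proof -
  have c: "continuous_on {-\<tau>..} x" using assms by (simp add: ss_solution_def)
  then have "continuous_on {-\<tau>..0} x" by (rule continuous_on_subset) auto
  then obtain N where N: "N > 0" "N\<^sup>2 \<ge> 1 + \<alpha>" "\<And>\<theta>. \<theta> \<in> {-\<tau>..0} \<Longrightarrow> \<bar>x \<theta>\<bar> \<le> N"
    using ss_bound_exists[of \<tau> x \<alpha>] assms by blast
  have "(x has_real_derivative (x t - x t ^ 3) - \<alpha> * x (t - \<tau>)) (at t within {0..})" if "t \<ge> 0" for t
    using assms that by (simp add: ss_solution_def algebra_simps)
  then have "\<bar>x t\<bar> \<le> N" if "t \<ge> -\<tau>" for t
    by (intro delay_ode_bounded[OF assms(1,2) c N(3,2,1) _ _ that, of "\<lambda>v. v - v ^ 3"]) auto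
  then show ?thesis using N(1) by blast
qed

section \<open>Convergence of solutions for small delay\<close>

text \<open>Cauchy-Schwarz for the integral of \<open>v\<close>, with \<open>Q\<close> as primitive
  of \<open>v^2\<close>. With \<open>l\<close> the mean slope,
  \<open>Q u - 2 * l * x u + l^2 * u\<close> has derivative \<open>(v u - l)^2\<close>; its
  monotonicity is the claim.\<close>

lemma square_increment_le:
  fixes x v Q :: "real \<Rightarrow> real"
  assumes x: "\<And>t. t \<ge> 0 \<Longrightarrow> (x has_real_derivative v t) (at t within {0..})"
    and Q: "\<And>t. t \<ge> 0 \<Longrightarrow> (Q has_real_derivative (v t)\<^sup>2) (at t within {0..})"
    and st: "0 \<le> s" "s \<le> t"
  shows "(x t - x s)\<^sup>2 \<le> (t - s) * (Q t - Q s)"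
proof (cases "s = t")
  case False
  define l where "l = (x t - x s) / (t - s)"
  have l: "l * (t - s) = x t - x s" using False by (simp add: l_def)
  have "Q s - 2 * l * x s + l\<^sup>2 * s \<le> Q t - 2 * l * x t + l\<^sup>2 * t"
  proof (rule DERIV_nonneg_imp_increasing_open[OF st(2), of "\<lambda>u. Q u - 2 * l * x u + l\<^sup>2 * u"])
    fix u assume u: "s < u" "u < t"
    have "at u within {0..} = at u" using u st by (intro at_within_interior) simp
    moreover have "((\<lambda>u. Q u - 2 * l * x u + l\<^sup>2 * u) has_real_derivative (v u)\<^sup>2 - 2 * l * v u + l\<^sup>2) (at u within {0..})"
      using u st by (auto intro!: derivative_eq_intros Q x)
    moreover have "(v u)\<^sup>2 - 2 * l * v u + l\<^sup>2 = (v u - l)\<^sup>2" by (simp add: power2_eq_square algebra_simps)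
    ultimately show "\<exists>y. ((\<lambda>u. Q u - 2 * l * x u + l\<^sup>2 * u) has_real_derivative y) (at u) \<and> y \<ge> 0"
      by (metis zero_le_power2)
  next
    have "continuous_on {0..} x" "continuous_on {0..} Q" 
      using DERIV_continuous_on[of "{0..}" x v] DERIV_continuous_on[of "{0..}" Q "\<lambda>t. (v t)\<^sup>2"] x Q by auto
    then have "continuous_on {s..t} x" "continuous_on {s..t} Q" using st by (auto elim!: continuous_on_subset)
    then show "continuous_on {s..t} (\<lambda>u. Q u - 2 * l * x u + l\<^sup>2 * u)" by (intro continuous_intros)
  qed
  then have "2 * l * (l * (t - s)) - l\<^sup>2 * (t - s) \<le> Q t - Q s"
    unfolding l by (simp add: algebra_simps)
  then have "l\<^sup>2 * (t - s) \<le> Q t - Q s" by (simp add: power2_eq_square algebra_simps)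
  then have "(t - s) * (l\<^sup>2 * (t - s)) \<le> (t - s) * (Q t - Q s)" using st by (intro mult_left_mono) auto
  moreover have "(t - s) * (l\<^sup>2 * (t - s)) = (l * (t - s))\<^sup>2" by (simp add: power2_eq_square)
  ultimately show ?thesis unfolding l by simp
qed simp

text \<open>For \<open>t \<ge> \<tau>\<close> the functional \<open>U\<close> equals
  \<open>P (x t) + (1 - \<alpha> * \<tau>) * Q t\<close> plus \<open>\<alpha> / 2\<close> times
  \<open>\<tau> * Q t - (R t - R (t - \<tau>))\<close>. The last difference is the integral of
  \<open>Q t - Q s\<close> over the delay window and hence nonnegative, so an upper bound on
  \<open>U\<close> bounds \<open>Q\<close> because \<open>\<alpha> * \<tau> < 1\<close>.\<close>

lemma small_delay_energy_bounded:
  fixes x v Q :: "real \<Rightarrow> real"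
  assumes \<alpha>: "0 < \<alpha>" "\<alpha> < 1" and \<tau>: "0 < \<tau>" and small: "\<alpha> * \<tau> < 1"
    and x: "\<And>t. t \<ge> 0 \<Longrightarrow> (x has_real_derivative v t) (at t within {0..})"
    and v: "\<And>t. t \<ge> \<tau> \<Longrightarrow> v t = x t - \<alpha> * x (t - \<tau>) - x t ^ 3"
    and Q: "\<And>t. t \<ge> 0 \<Longrightarrow> (Q has_real_derivative (v t)\<^sup>2) (at t within {0..})"
    and R: "\<And>t. t \<ge> 0 \<Longrightarrow> (R has_real_derivative Q t) (at t within {0..})"
  shows "\<exists>M. \<forall>t\<ge>0. Q t \<le> M"
proof -
  have cont: "continuous_on {0..} x" "continuous_on {0..} Q" "continuous_on {0..} R"
    using DERIV_continuous_on[of "{0..}" x v]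
      DERIV_continuous_on[of "{0..}" Q "\<lambda>t. (v t)\<^sup>2"] DERIV_continuous_on[of "{0..}" R Q] x Q R by auto
  have at: "at t within {0..} = at t" if "t > 0" for t :: real
    using that by (intro at_within_interior) simp
  have Qmono: "Q s \<le> Q t" if "0 \<le> s" "s \<le> t" for s t
  proof (rule DERIV_nonneg_imp_increasing_open[OF that(2)])
    show "\<exists>y. (Q has_real_derivative y) (at u) \<and> y \<ge> 0" if "s < u" "u < t" for u
      using Q[of u] at[of u] that \<open>0 \<le> s\<close> by force
    show "continuous_on {s..t} Q" using cont(2) by (rule continuous_on_subset) (use that in auto)
  qed
  have Rincr: "R t - R (t - \<tau>) \<le> \<tau> * Q t" if "t \<ge> \<tau>" for t
  proof -
    have "R (t - \<tau>) - Q t * (t - \<tau>) \<ge> R t - Q t * t"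
    proof (rule DERIV_nonpos_imp_decreasing_open[of _ _ "\<lambda>u. R u - Q t * u"])
      show "t - \<tau> \<le> t" using \<tau> by simp
      show "\<exists>y. ((\<lambda>u. R u - Q t * u) has_real_derivative y) (at u) \<and> y \<le> 0" if u: "t - \<tau> < u" "u < t" for u
      proof (intro exI conjI)
        have u0: "u > 0" using u \<open>t \<ge> \<tau>\<close> by simp
        then have "(R has_real_derivative Q u) (at u)" using R[of u] at[of u] by simp
        then show "((\<lambda>u. R u - Q t * u) has_real_derivative Q u - Q t) (at u)"
          by (auto intro!: derivative_eq_intros)
        show "Q u - Q t \<le> 0" using Qmono[of u t] u u0 by simp
      qed
      have "continuous_on {t - \<tau>..t} R" using cont(3) by (rule continuous_on_subset) (use that in auto)
      then show "continuous_on {t - \<tau>..t} (\<lambda>u. R u - Q t * u)" by (intro continuous_intros)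
    qed
    then show ?thesis by (simp add: algebra_simps)
  qed
  define P where "P y = y ^ 4 / 4 - (1 - \<alpha>) * y\<^sup>2 / 2" for y :: real
  \<comment> \<open>The delayed term has derivative \<open>- \<alpha> / 2 * (Q t - Q (t - \<tau>))\<close>, which absorbs
    \<open>\<alpha> * (x t - x (t - \<tau>)) * v t\<close> by the Cauchy--Schwarz inequality.\<close>
  define U where "U t = P (x t) + (1 - \<alpha> * \<tau> / 2) * Q t - \<alpha> / 2 * (R t - R (t - \<tau>))" for t
  have Ule: "U t \<le> U \<tau>" if "t \<ge> \<tau>" for t
  proof (rule DERIV_nonpos_imp_decreasing_open[OF that])
    fix u assume u: "\<tau> < u" "u < t"
    have u0: "u > 0" "u - \<tau> > 0" using u \<tau> by auto
    define D where "D = x u - x (u - \<tau>)"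
    define q where "q = Q u - Q (u - \<tau>)"
    have vu: "v u = (1 - \<alpha>) * x u - x u ^ 3 + \<alpha> * D" using v[of u] u by (simp add: D_def algebra_simps)
    have xd: "(x has_real_derivative v u) (at u)" using x[of u] at[of u] u0 by simp
    have Qd: "(Q has_real_derivative (v u)\<^sup>2) (at u)" using Q[of u] at[of u] u0 by simp
    have Rd: "(R has_real_derivative Q u) (at u)" using R[of u] at[of u] u0 by simp
    have "(R has_real_derivative Q (u - \<tau>)) (at (u - \<tau>))" using R[of "u - \<tau>"] at[of "u - \<tau>"] u0 by simp
    then have Rd': "((\<lambda>u. R (u - \<tau>)) has_real_derivative Q (u - \<tau>)) (at u)"
      using DERIV_shift[of R "Q (u - \<tau>)" u "-\<tau>"] by simp
    have "(U has_real_derivative (x u ^ 3 - (1 - \<alpha>) * x u) * v u + (1 - \<alpha> * \<tau> / 2) * (v u)\<^sup>2 - \<alpha> / 2 * q) (at u)"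
      unfolding U_def P_def q_def
      by (rule derivative_eq_intros xd Qd Rd Rd' refl | simp add: field_simps power2_eq_square power3_eq_cube)+
    moreover have "(x u ^ 3 - (1 - \<alpha>) * x u) * v u + (1 - \<alpha> * \<tau> / 2) * (v u)\<^sup>2 - \<alpha> / 2 * q \<le> 0"
    proof -
      \<comment> \<open>The gradient of \<open>P\<close> is minus the undelayed part of
        \<open>v\<close>. What remains is \<open>\<alpha> * D * v\<close> against
        \<open>\<alpha> / 2 * (q + \<tau> * v^2)\<close>.\<close>
      have e: "x u ^ 3 - (1 - \<alpha>) * x u = \<alpha> * D - v u" using vu by simp
      have "D\<^sup>2 \<le> \<tau> * q" using square_increment_le[OF x Q, of "u - \<tau>" u] u0 \<tau> by (simp add: D_def q_def)
      moreover have "0 \<le> (D - \<tau> * v u)\<^sup>2" by simp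
      ultimately have "\<tau> * (2 * D * v u) \<le> \<tau> * (q + \<tau> * (v u)\<^sup>2)"
        by (simp add: power2_eq_square algebra_simps)
      then have "2 * D * v u \<le> q + \<tau> * (v u)\<^sup>2" using \<tau> by simp
      then have "\<alpha> / 2 * (2 * D * v u) \<le> \<alpha> / 2 * (q + \<tau> * (v u)\<^sup>2)" using \<alpha> by (intro mult_left_mono) auto
      then show ?thesis unfolding e by (simp add: power2_eq_square algebra_simps)
    qed
    ultimately show "\<exists>y. (U has_real_derivative y) (at u) \<and> y \<le> 0" by blast
  next
    have "continuous_on {\<tau>..t} x" "continuous_on {\<tau>..t} Q" "continuous_on {\<tau>..t} R"
      using \<tau> by (auto intro: cont[THEN continuous_on_subset])
    moreover have "continuous_on {\<tau>..t} (\<lambda>u. R (u - \<tau>))"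
      by (rule continuous_on_compose2[OF cont(3)]) (auto intro!: continuous_intros)
    ultimately show "continuous_on {\<tau>..t} U" unfolding U_def P_def by (intro continuous_intros) auto
  qed
  have P: "P y \<ge> - 1" for y
  proof -
    have "P y = (y\<^sup>2 - (1 - \<alpha>))\<^sup>2 / 4 - (1 - \<alpha>)\<^sup>2 / 4"
      by (simp add: P_def power2_eq_square power4_eq_xxxx field_simps)
    moreover have "(1 - \<alpha>)\<^sup>2 \<le> 1" using \<alpha> by (simp add: power_le_one)
    ultimately show ?thesis using zero_le_power2[of "y\<^sup>2 - (1 - \<alpha>)"] by linarith
  qed
  have "Q t \<le> (U \<tau> + 1) / (1 - \<alpha> * \<tau>)" if "t \<ge> \<tau>" for t
  proof -
    have "\<alpha> / 2 * (R t - R (t - \<tau>)) \<le> \<alpha> / 2 * (\<tau> * Q t)" using Rincr[OF that] \<alpha> by (intro mult_left_mono) auto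
    then have "(1 - \<alpha> * \<tau>) * Q t \<le> U t - P (x t)" unfolding U_def by (simp add: algebra_simps)
    then have "(1 - \<alpha> * \<tau>) * Q t \<le> U \<tau> + 1" using Ule[OF that] P[of "x t"] by linarith
    then show ?thesis using small by (simp add: pos_le_divide_eq mult.commute)
  qed
  then have "Q t \<le> (U \<tau> + 1) / (1 - \<alpha> * \<tau>)" if "t \<ge> 0" for t
    using Qmono[of t "max t \<tau>"] that by (meson max.cobounded1 max.cobounded2 order_trans)
  then show ?thesis by blast
qed

text \<open>\<open>Q\<close> is nondecreasing and bounded, so beyond some time it grows by at most
  \<open>e^2 / L\<close>. Cauchy-Schwarz turns this into increments of \<open>x\<close> of size at
  most \<open>e\<close> on windows of length \<open>L\<close>.\<close>

lemma bounded_energy_increments: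
  fixes x v Q :: "real \<Rightarrow> real"
  assumes x: "\<And>t. t \<ge> 0 \<Longrightarrow> (x has_real_derivative v t) (at t within {0..})"
    and Q: "\<And>t. t \<ge> 0 \<Longrightarrow> (Q has_real_derivative (v t)\<^sup>2) (at t within {0..})"
    and M: "\<And>t. t \<ge> 0 \<Longrightarrow> Q t \<le> M" and "0 < e" "0 < L"
  shows "\<exists>T\<ge>0. \<forall>s\<ge>T. \<forall>t\<in>{s..s + L}. \<bar>x t - x s\<bar> \<le> e"
proof -
  define S where "S = (SUP t\<in>{0..}. Q t)"
  have bdd: "bdd_above (Q ` {0..})" using M by (intro bdd_aboveI2[of _ _ M]) simp
  have "S - e\<^sup>2 / L < S" using assms by simp
  then obtain T where T: "T \<ge> 0" "S - e\<^sup>2 / L < Q T"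
    unfolding S_def using less_cSUP_iff[OF _ bdd] by auto
  have "\<bar>x t - x s\<bar> \<le> e" if "s \<ge> T" "t \<in> {s..s + L}" for s t
  proof -
    have "0 \<le> (s - T) * (Q s - Q T)" using square_increment_le[OF x Q T(1) that(1)] zero_le_power2 order_trans by blast
    then have "Q T \<le> Q s" using that(1) by (cases "s = T") (auto simp: zero_le_mult_iff)
    moreover have "Q t \<le> S" unfolding S_def using that T by (intro cSUP_upper bdd) auto
    ultimately have q: "Q t - Q s \<le> e\<^sup>2 / L" using T(2) by linarith
    have "(x t - x s)\<^sup>2 \<le> (t - s) * (Q t - Q s)" using that T(1) by (intro square_increment_le[OF x Q]) auto
    also have "\<dots> \<le> (t - s) * (e\<^sup>2 / L)" using q that by (intro mult_left_mono) auto
    also have "\<dots> \<le> L * (e\<^sup>2 / L)" using that assms by (intro mult_right_mono) auto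
    also have "\<dots> = e\<^sup>2" using assms by simp
    finally show ?thesis using \<open>0 < e\<close> by (simp add: abs_le_square_iff[symmetric])
  qed
  then show ?thesis using T(1) by blast
qed

text \<open>Eventually \<open>x\<close> lies within \<open>r / 2\<close> of one of the three roots
  and so avoids \<open>r / 2\<close> and \<open>- (r / 2)\<close>. The image of a half-line is an
  interval, hence \<open>x\<close> remains in one of the three regions and near one and the same
  root.\<close>

lemma tendsto_cubic_root:
  fixes x :: "real \<Rightarrow> real"
  assumes x: "continuous_on {0..} x" and r: "0 < r"
    and lim: "((\<lambda>t. x t * (x t - r) * (x t + r)) \<longlongrightarrow> 0) at_top"
  shows "\<exists>z\<in>{0, r, -r}. (x \<longlongrightarrow> z) at_top"
proof -
  have near: "\<forall>\<^sub>F t in at_top. \<bar>x t\<bar> < e \<or> \<bar>x t - r\<bar> < e \<or> \<bar>x t + r\<bar> < e" if "e > 0" for e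
  proof -
    have "\<forall>\<^sub>F t in at_top. \<bar>x t * (x t - r) * (x t + r)\<bar> < e * e * e"
      using tendstoD[OF lim, of "e * e * e"] that by simp
    then show ?thesis
    proof (rule eventually_mono)
      fix t assume *: "\<bar>x t * (x t - r) * (x t + r)\<bar> < e * e * e"
      show "\<bar>x t\<bar> < e \<or> \<bar>x t - r\<bar> < e \<or> \<bar>x t + r\<bar> < e"
      proof (rule ccontr)
        assume "\<not> ?thesis"
        then have "e * e * e \<le> \<bar>x t\<bar> * \<bar>x t - r\<bar> * \<bar>x t + r\<bar>" using that by (intro mult_mono) auto
        then show False using * by (simp add: abs_mult)
      qed
    qed
  qed
  obtain T0 where T0: "\<And>t. t \<ge> T0 \<Longrightarrow> \<bar>x t\<bar> < r / 2 \<or> \<bar>x t - r\<bar> < r / 2 \<or> \<bar>x t + r\<bar> < r / 2"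
    using near[of "r / 2"] r by (auto simp: eventually_at_top_linorder)
  define T where "T = max T0 0"
  have "connected (x ` {T..})"
    by (intro connected_continuous_image continuous_on_subset[OF x]) (auto simp: T_def)
  then have int: "is_interval (x ` {T..})" by (simp add: is_interval_connected_1)
  have out: "x t \<noteq> r / 2 \<and> x t \<noteq> - (r / 2)" if "t \<ge> T" for t
    using T0[of t] that r by (auto simp: T_def abs_if split: if_splits)
  have sep: "x t < c" if "c \<in> {r / 2, - (r / 2)}" "x T < c" "t \<ge> T" for t c
  proof (rule ccontr)
    assume "\<not> x t < c"
    then have "c \<in> x ` {T..}" using that int[unfolded is_interval_1, rule_format, of "x T" "x t" c] by auto
    then show False using out that by auto
  qed
  have sep': "x t > c" if "c \<in> {r / 2, - (r / 2)}" "x T > c" "t \<ge> T" for t c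
  proof (rule ccontr)
    assume "\<not> x t > c"
    then have "c \<in> x ` {T..}" using that int[unfolded is_interval_1, rule_format, of "x t" "x T" c] by auto
    then show False using out that by auto
  qed
  have conv: "(x \<longlongrightarrow> z) at_top"
    if z: "\<And>t e. t \<ge> T \<Longrightarrow> 0 < e \<Longrightarrow> e \<le> r / 2 \<Longrightarrow> \<bar>x t\<bar> < e \<or> \<bar>x t - r\<bar> < e \<or> \<bar>x t + r\<bar> < e \<Longrightarrow> \<bar>x t - z\<bar> < e" for z
  proof (rule tendstoI)
    fix e :: real assume e: "e > 0"
    then have m: "0 < min e (r / 2)" using r by simp
    show "\<forall>\<^sub>F t in at_top. dist (x t) z < e"
      using near[OF m] eventually_ge_at_top[of T]
    proof eventually_elim
      case (elim t)
      then have "\<bar>x t - z\<bar> < min e (r / 2)" using m by (intro z) auto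
      then show ?case by (simp add: dist_real_def)
    qed
  qed
  consider "x T < - (r / 2)" | "- (r / 2) < x T" "x T < r / 2" | "r / 2 < x T"
    using out[of T] by fastforce
  then show ?thesis
  proof cases
    case 1
    have "(x \<longlongrightarrow> -r) at_top"
      by (rule conv) (use sep[of "- (r / 2)"] 1 r in \<open>fastforce simp: abs_if split: if_splits\<close>)
    then show ?thesis by blast
  next
    case 2
    have "(x \<longlongrightarrow> 0) at_top"
      by (rule conv) (use sep[of "r / 2"] sep'[of "- (r / 2)"] 2 r in \<open>fastforce simp: abs_if split: if_splits\<close>)
    then show ?thesis by blast
  next
    case 3
    have "(x \<longlongrightarrow> r) at_top"
      by (rule conv) (use sep'[of "r / 2"] 3 r in \<open>fastforce simp: abs_if split: if_splits\<close>)
    then show ?thesis by blast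
  qed
qed

text \<open>Square integrability alone gives no pointwise decay of \<open>v\<close>, but the
  increments of \<open>x\<close> over windows of fixed length vanish. The mean value theorem
  supplies a time near \<open>t\<close> at which \<open>v\<close> is such an increment; the delay
  term and the way back to \<open>t\<close> are controlled by increments as well.\<close>

lemma small_delay_convergence:
  assumes \<alpha>: "0 < \<alpha>" "\<alpha> < 1" and \<tau>: "0 < \<tau>" and small: "\<alpha> * \<tau> < 1"
    and sol: "ss_solution \<alpha> \<tau> \<phi> x"
  shows "\<exists>z\<in>{0, sqrt (1 - \<alpha>), - sqrt (1 - \<alpha>)}. (x \<longlongrightarrow> z) at_top"
proof -
  define v where "v t = x t - \<alpha> * x (t - \<tau>) - x t ^ 3" for t
  define Q where "Q t = integral {0..t} (\<lambda>s. (v s)\<^sup>2)" for t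
  define R where "R t = integral {0..t} Q" for t
  have xc: "continuous_on {-\<tau>..} x" using sol by (simp add: ss_solution_def)
  have x: "(x has_real_derivative v t) (at t within {0..})" if "t \<ge> 0" for t
    using sol that by (simp add: ss_solution_def v_def)
  have "continuous_on {0..} (\<lambda>t. x (t - \<tau>))"
    by (rule continuous_on_compose2[OF xc]) (auto intro!: continuous_intros)
  moreover have xc0: "continuous_on {0..} x" using xc by (rule continuous_on_subset) (use \<tau> in auto)
  ultimately have vc: "continuous_on {0..} v" unfolding v_def by (intro continuous_intros)
  have Q: "(Q has_real_derivative (v t)\<^sup>2) (at t within {0..})" if "t \<ge> 0" for t
    unfolding Q_def using vc that by (intro integral_from_0_has_derivative continuous_intros)
  have "continuous_on {0..} Q" using DERIV_continuous_on[of "{0..}" Q "\<lambda>t. (v t)\<^sup>2"] Q by auto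
  then have R: "(R has_real_derivative Q t) (at t within {0..})" if "t \<ge> 0" for t
    unfolding R_def using that by (intro integral_from_0_has_derivative)
  obtain M where M: "\<And>t. t \<ge> 0 \<Longrightarrow> Q t \<le> M"
    using small_delay_energy_bounded[OF \<alpha> \<tau> small x v_def Q R] by blast
  obtain N where N: "N > 0" "\<And>t. t \<ge> -\<tau> \<Longrightarrow> \<bar>x t\<bar> \<le> N"
    using ss_solution_bounded[OF \<tau> _ sol] \<alpha> by auto
  define q where "q y = (1 - \<alpha>) * y - y ^ 3" for y :: real
  define K where "K = 1 + 3 * N\<^sup>2"
  have K: "\<bar>q a - q b\<bar> \<le> K * \<bar>a - b\<bar>" if "\<bar>a\<bar> \<le> N" "\<bar>b\<bar> \<le> N" for a b
  proof -
    have "q a - q b = (1 - \<alpha>) * (a - b) - (a ^ 3 - b ^ 3)" by (simp add: q_def algebra_simps)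
    then have "\<bar>q a - q b\<bar> \<le> (1 - \<alpha>) * \<bar>a - b\<bar> + \<bar>a ^ 3 - b ^ 3\<bar>"
      using abs_triangle_ineq4[of "(1 - \<alpha>) * (a - b)" "a ^ 3 - b ^ 3"] \<alpha> by (simp add: abs_mult)
    moreover have "(1 - \<alpha>) * \<bar>a - b\<bar> \<le> 1 * \<bar>a - b\<bar>" using \<alpha> by (intro mult_right_mono) auto
    ultimately show ?thesis using cubic_difference_le[OF that] by (simp add: K_def algebra_simps)
  qed
  have "((\<lambda>t. q (x t)) \<longlongrightarrow> 0) at_top"
  proof (rule tendstoI)
    fix e :: real assume e: "e > 0"
    \<comment> \<open>Of the \<open>K + 3\<close> shares, \<open>K\<close> pay for moving from
      \<open>\<xi>\<close> to \<open>t\<close>, one for \<open>v \<xi>\<close> and one for the delay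
      term; the last makes the inequality strict.\<close>
    define d where "d = e / (K + 3)"
    have K0: "K \<ge> 0" by (simp add: K_def)
    have d: "d > 0" "(K + 3) * d = e" using e K0 by (auto simp: d_def)
    obtain T where T: "T \<ge> 0" "\<And>s t. s \<ge> T \<Longrightarrow> t \<in> {s..s + (\<tau> + 1)} \<Longrightarrow> \<bar>x t - x s\<bar> \<le> d"
      using bounded_energy_increments[OF x Q M d(1), of "\<tau> + 1"] \<tau> by auto
    have "\<bar>q (x t)\<bar> < e" if t: "t \<ge> T + \<tau>" for t
    proof -
      have t0: "t \<ge> 0" using t T \<tau> by simp
      have "\<exists>\<xi>>t. \<xi> < t + 1 \<and> x (t + 1) - x t = (t + 1 - t) * v \<xi>"
      proof (rule MVT2)
        fix s assume s: "t \<le> s" "s \<le> t + 1"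
        show "(x has_real_derivative v s) (at s)"
          using x[of s] at_within_interior[of s "{0..}"] s t T \<tau> by simp
      qed simp
      then obtain \<xi> where \<xi>: "t < \<xi>" "\<xi> < t + 1" "v \<xi> = x (t + 1) - x t" by auto
      have "\<bar>v \<xi>\<bar> \<le> d" unfolding \<xi>(3) using t \<tau> by (intro T(2)) auto
      moreover have "\<bar>x \<xi> - x (\<xi> - \<tau>)\<bar> \<le> d" using t \<xi> \<tau> by (intro T(2)) auto
      then have "\<bar>\<alpha> * (x \<xi> - x (\<xi> - \<tau>))\<bar> \<le> 1 * d" unfolding abs_mult using \<alpha> by (intro mult_mono) auto
      moreover have "v \<xi> = q (x \<xi>) + \<alpha> * (x \<xi> - x (\<xi> - \<tau>))" by (simp add: v_def q_def algebra_simps)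
      moreover have "\<bar>q (x \<xi>) - q (x t)\<bar> \<le> K * d"
      proof -
        have "\<bar>x \<xi> - x t\<bar> \<le> d" using t \<xi> \<tau> by (intro T(2)) auto
        then have "K * \<bar>x \<xi> - x t\<bar> \<le> K * d" using K0 by (intro mult_left_mono) auto
        then show ?thesis using K[of "x \<xi>" "x t"] N(2)[of \<xi>] N(2)[of t] \<xi> t0 \<tau> by simp
      qed
      ultimately have "\<bar>q (x t)\<bar> \<le> K * d + 2 * d" by linarith
      also have "\<dots> < e" unfolding d(2)[symmetric] using d(1) by (simp add: algebra_simps)
      finally show ?thesis .
    qed
    then show "\<forall>\<^sub>F t in at_top. dist (q (x t)) 0 < e"
      by (auto simp: eventually_at_top_linorder)
  qed
  moreover have "x t * (x t - sqrt (1 - \<alpha>)) * (x t + sqrt (1 - \<alpha>)) = - q (x t)" for t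
  proof -
    have "x t * (x t - sqrt (1 - \<alpha>)) * (x t + sqrt (1 - \<alpha>)) = x t * ((x t)\<^sup>2 - (sqrt (1 - \<alpha>))\<^sup>2)"
      by (simp add: algebra_simps power2_eq_square)
    then show ?thesis using \<alpha> by (simp add: q_def algebra_simps power2_eq_square power3_eq_cube)
  qed
  ultimately have "((\<lambda>t. x t * (x t - sqrt (1 - \<alpha>)) * (x t + sqrt (1 - \<alpha>))) \<longlongrightarrow> 0) at_top"
    using tendsto_minus[of "\<lambda>t. q (x t)" 0 at_top] by simp
  then show ?thesis using xc0 \<alpha> by (intro tendsto_cubic_root) auto
qed

text \<open>Membership in the function space includes boundedness of the image, which comes from
  compactness of the history interval.\<close>

lemma restrict_mem_hist_space:
  assumes "continuous_on {-\<tau>..0} f"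
  shows "restrict f {-\<tau>..0} \<in> mspace (hist_space \<tau>)"
proof -
  have c: "continuous_on {-\<tau>..0} (restrict f {-\<tau>..0})"
    using assms by (subst continuous_on_cong[OF refl, of _ _ f]) auto
  have "compact (restrict f {-\<tau>..0} ` {-\<tau>..0})" by (intro compact_continuous_image c) simp
  then have "Metric_space.mbounded UNIV dist (restrict f {-\<tau>..0} ` {-\<tau>..0})"
    using Metric_space.compactin_imp_mbounded[OF Metric_space_mspace_mdist, of euclidean_metric]
    by (simp add: mtopology_of_def[symmetric])
  then show ?thesis using c unfolding hist_space_def by auto
qed

text \<open>\<open>ss_semiflow\<close> follows a chosen solution, so convergence is asked of every
  solution. Convergence of \<open>x\<close> at infinity is uniform on windows of length
  \<open>\<tau>\<close>, which is convergence of the segments in the supremum metric.\<close>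

lemma ss_semiflow_limitin:
  assumes \<tau>: "0 < \<tau>" and sol: "\<exists>x. ss_solution \<alpha> \<tau> \<phi> x"
    and lim: "\<And>x. ss_solution \<alpha> \<tau> \<phi> x \<Longrightarrow> \<exists>z\<in>Z. (x \<longlongrightarrow> z) at_top"
  shows "\<exists>z\<in>Z. limitin (mtopology_of (hist_space \<tau>)) (\<lambda>t. ss_semiflow \<alpha> \<tau> t \<phi>) (const_hist \<tau> z) at_top"
proof -
  define x where "x = (SOME x. ss_solution \<alpha> \<tau> \<phi> x)"
  have x: "ss_solution \<alpha> \<tau> \<phi> x" unfolding x_def using sol by (rule someI_ex)
  then obtain z where z: "z \<in> Z" "(x \<longlongrightarrow> z) at_top" using lim by blast
  have sf: "ss_semiflow \<alpha> \<tau> t \<phi> = restrict (\<lambda>\<theta>. x (t + \<theta>)) {-\<tau>..0}" for t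
    by (simp add: ss_semiflow_def x_def)
  have mem: "ss_semiflow \<alpha> \<tau> t \<phi> \<in> mspace (hist_space \<tau>)" if "t \<ge> 0" for t
  proof -
    have "continuous_on {-\<tau>..} x" using x by (simp add: ss_solution_def)
    then have "continuous_on {-\<tau>..0} (\<lambda>\<theta>. x (t + \<theta>))"
      by (rule continuous_on_compose2) (use that in \<open>auto intro!: continuous_intros\<close>)
    then show ?thesis unfolding sf by (rule restrict_mem_hist_space)
  qed
  have memc: "const_hist \<tau> z \<in> mspace (hist_space \<tau>)"
    unfolding const_hist_def by (intro restrict_mem_hist_space continuous_intros)
  have "\<forall>\<^sub>F t in at_top. ss_semiflow \<alpha> \<tau> t \<phi> \<in> mspace (hist_space \<tau>) \<and>
      mdist (hist_space \<tau>) (ss_semiflow \<alpha> \<tau> t \<phi>) (const_hist \<tau> z) < e" if e: "e > 0" for e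
  proof -
    \<comment> \<open>Half of \<open>e\<close>, because the supremum turns a strict pointwise bound
      into a weak one.\<close>
    obtain T where T: "\<And>t. t \<ge> T \<Longrightarrow> \<bar>x t - z\<bar> < e / 2"
      using tendstoD[OF z(2), of "e / 2"] e by (auto simp: eventually_at_top_linorder dist_real_def)
    have "mdist (hist_space \<tau>) (ss_semiflow \<alpha> \<tau> t \<phi>) (const_hist \<tau> z) \<le> e / 2" if "t \<ge> T + \<tau>" for t
      unfolding hist_space_def
    proof (rule mdist_cfunspace_le)
      fix \<theta> assume "\<theta> \<in> topspace (top_of_set {-\<tau>..0})"
      then show "mdist euclidean_metric (ss_semiflow \<alpha> \<tau> t \<phi> \<theta>) (const_hist \<tau> z \<theta>) \<le> e / 2"
        using T[of "t + \<theta>"] that by (simp add: sf const_hist_def dist_real_def)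
    qed (use e in simp)
    then show ?thesis
      using e mem by (intro eventually_at_top_linorderI[of "max 0 (T + \<tau>)"]) (fastforce intro: le_less_trans)
  qed
  then show ?thesis
    using z(1) memc unfolding mtopology_of_def
    by (auto simp: Metric_space.limitin_metric[OF Metric_space_mspace_mdist])
qed

lemma small_delay_globally_stable:
  assumes \<alpha>: "0 < \<alpha>" "\<alpha> < 1" and \<tau>: "0 < \<tau>" and small: "\<alpha> * \<tau> < 1"
  shows "ss_globally_stable \<alpha> \<tau>"
  unfolding ss_globally_stable_def
proof
  fix \<phi> assume "\<phi> \<in> mspace (hist_space \<tau>)"
  then have "continuous_on {-\<tau>..0} \<phi>" by (simp add: hist_space_def)
  then have "\<exists>x. ss_solution \<alpha> \<tau> \<phi> x" using \<alpha> \<tau> by (intro ss_solution_exists) auto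
  then have "\<exists>z\<in>{0, sqrt (1 - \<alpha>), - sqrt (1 - \<alpha>)}.
      limitin (mtopology_of (hist_space \<tau>)) (\<lambda>t. ss_semiflow \<alpha> \<tau> t \<phi>) (const_hist \<tau> z) at_top"
    by (rule ss_semiflow_limitin[OF \<tau>]) (rule small_delay_convergence[OF \<alpha> \<tau> small])
  then show "\<exists>e\<in>{const_hist \<tau> 0, const_hist \<tau> (sqrt (1 - \<alpha>)), const_hist \<tau> (- sqrt (1 - \<alpha>))}.
      limitin (mtopology_of (hist_space \<tau>)) (\<lambda>t. ss_semiflow \<alpha> \<tau> t \<phi>) e at_top" by blast
qed

theorem proposition5p1:
  fixes \<alpha> \<tau> R \<Lambda> \<nu>\<^sub>0 :: real
    and \<A> :: "(real \<Rightarrow> real) set"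
    and ls :: "nat \<Rightarrow> complex"
    and G :: "real \<Rightarrow> (real \<Rightarrow> complex) \<Rightarrow> real \<Rightarrow> complex"
    and G2 :: "real \<Rightarrow> (real \<times> real \<Rightarrow> complex) \<Rightarrow> real \<times> real \<Rightarrow> complex"
  assumes "0 < \<alpha>" and "\<alpha> < 1" and "0 < \<tau>"
    and "global_attractor (hist_space \<tau>) (ss_semiflow \<alpha> \<tau>) \<A>"
    and "0 < R" and "\<A> \<subseteq> mcball_of (hist_space \<tau>) (const_hist \<tau> 0) R"
    and "\<Lambda> = 3 / 2 * R\<^sup>2"
    and "generates_semigroup \<tau> (ss_functional \<alpha> \<tau> \<Lambda>) G"
    and "wedge_semigroup \<tau> G G2"
    and "root_enumeration (ss_char \<alpha> \<tau> \<Lambda>) ls"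
    and "0 \<le> \<nu>\<^sub>0"
    and "Re (ls 0) + Re (ls 1) < - \<nu>\<^sub>0"
    and "(SUP \<omega>::real. control_opnorm \<tau> (transfer_op \<tau> (-1) 0 G2 (Complex (- \<nu>\<^sub>0) \<omega>))) < ereal (inverse \<Lambda>)"
  shows "ss_globally_stable \<alpha> \<tau>"
proof -
  interpret ss_compound \<alpha> \<tau> \<Lambda> G G2 by unfold_locales fact+
  have "0 < \<Lambda>" unfolding assms(7) using assms(5) by simp
  then have "\<alpha> * \<tau> < 1"
    by (rule frequency_condition_imp_small_delay[OF assms(1,2) _ assms(10-13)])
  then show ?thesis by (rule small_delay_globally_stable[OF assms(1-3)])
qed

end
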